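(* Let $d\ge1$ and $\Omega=(0,2\pi)^d$. Suppose that $g\in\tilde X_{\sigma,s_0}$ for some $\sigma\ge0$, $s_0>2d$, and $$\int_{(0,2\pi)^{d+1}}g(x,t)\,dx\,dt=0 .$$ Let $s_1\in(1+d,\,1+s_0/2)$. There exist positive constants $\delta,C$ with the following properties. For every $\gamma\in(0,1)$ there exists a Cantor set $\mathcal A_\gamma\subset(0,+\infty)\times(0,\delta\gamma)$ of parameters such that for every $(\omega,\mu)\in\mathcal A_\gamma$ there exists a classical solution $u(\omega,\mu)\in\tilde X_{\sigma,s_1}$ of $$\omega^2u_{tt}-\Delta u=\mu\Big(\Delta u\int_\Omega|\nabla u|^2\,dx+g(x,t)\Big),\qquad u(x,t)=u(x+2\pi m,t)\quad\forall m\in\mathbb Z^d,\ x\in\mathbb R^d,\ t\in\mathbb R,$$ $2\pi$-periodic in $t$, satisfying $$\int_{(0,2\pi)^{d+1}}u(\omega,\mu)(x,t)\,dx\,dt=0 .$$ This solution satisfies $$\|u(\omega,\mu)\|_{\sigma,s_1}\le\frac\mu\gamma\Big(1+\frac1{\omega^2}\Big)C,\qquad \|u(\omega,\mu)_{tt}\|_{\sigma,s_1-2}\le\frac{\mu}{\gamma\omega^2}\,C,$$ and it is unique in the ball $\{u\in\tilde X_{\sigma,s_1}:\int_{(0,2\pi)^{d+1}}u\,dx\,dt=0,\ \|u\|_{\sigma,s_1}<1\}$ (that is, every solution in this set coincides with $u(\omega,\mu)$). The set $\mathcal A_\gamma$ satisfies the following Lebesgue measure property: for every $0<\bar\omega_1<\bar\omega_2<\infty$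 there exists a constant $\bar C$ independent of $\gamma$ such that, for $\mathcal R_\gamma:=(\bar\omega_1,\bar\omega_2)\times(0,\delta\gamma)$, $$\frac{|\mathcal R_\gamma\cap\mathcal A_\gamma|}{|\mathcal R_\gamma|}>1-\bar C\,\gamma .$$
   Context: $\mathbb T:=\mathbb R/2\pi\mathbb Z$. For $\sigma,s\ge0$, $\tilde X_{\sigma,s}$ is the space of real-valued functions $$u(x,t)=\sum_{m\in\mathbb Z^d}u_m(t)e^{im\cdot x},\qquad u_m\in H^1(\mathbb T,\mathbb C),\quad u_{-m}=\overline{u_m},$$ with $$\|u\|_{\sigma,s}^2:=\|u_0\|_{H^1}^2+\sum_{m\ne0}\|u_m\|_{H^1}^2|m|^{2s}e^{2\sigma|m|}<\infty .$$ Derivatives of elements of $\tilde X_{\sigma,s}$ are a priori distributional. A classical solution in $\tilde X_{\sigma,s_1}$ means a solution $u\in\tilde X_{\sigma,s_1}$ with $u_{tt}\in\tilde X_{\sigma,s_1-2}$ (so $u$ has regularity $H^3\subset C^2$ in time), the equation holding in $\tilde X_{\sigma,s_1-2}$. The term "Cantor set" is used informally, for a Lebesgue measurable set of parameters obtained by removing countably many resonance zones; no specific topological property is asserted. $|\cdot|$ is two-dimensional Lebesgue measure. *)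

theory Defs
  imports "HOL-Analysis.Analysis"
begin

section \<open>The Sobolev space $H^1$ of the circle\<close>

text \<open>Elements of $H^1$ are given by their absolutely continuous, $2\pi$-periodic representative;
  the weak derivative is unique only up to null sets, and the norm does not depend on the choice.\<close>

definition periodic2pi :: "(real \<Rightarrow> complex) \<Rightarrow> bool" where
  "periodic2pi v \<longleftrightarrow> (\<forall>t. v (t + 2 * pi) = v t)"

definition H1_deriv :: "(real \<Rightarrow> complex) \<Rightarrow> (real \<Rightarrow> complex) \<Rightarrow> bool" where
  "H1_deriv v w \<longleftrightarrow>
     w \<in> borel_measurable borel \<and> periodic2pi w \<and>
     set_integrable lborel {0<..<2 * pi} (\<lambda>t. (norm (w t))\<^sup>2) \<and>
     (\<forall>a b. a \<le> b \<longrightarrow> v b - v a = (LINT \<tau>:{a..b}|lborel. w \<tau>))"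

definition H1 :: "(real \<Rightarrow> complex) set" where
  "H1 = {v. periodic2pi v \<and> (\<exists>w. H1_deriv v w)}"

definition H1_norm :: "(real \<Rightarrow> complex) \<Rightarrow> real" where
  "H1_norm v = sqrt ((LINT t:{0<..<2 * pi}|lborel. (norm (v t))\<^sup>2) +
                     (LINT t:{0<..<2 * pi}|lborel. (norm ((SOME w. H1_deriv v w) t))\<^sup>2))"


section \<open>Fourier series in space and the spaces $\tilde X_{\sigma,s}$\<close>

definition rvec :: "int^'d \<Rightarrow> real^'d" where
  "rvec m = (\<chi> j. real_of_int (m $ j))"

definition Omega :: "(real^'d) set" where
  "Omega = box 0 (\<chi> j. 2 * pi)"

definition char_fun :: "int^'d \<Rightarrow> real^'d \<Rightarrow> complex" where
  "char_fun m x = exp (\<i> * of_real (rvec m \<bullet> x))"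

text \<open>The coefficient $u_m(t)$. For real-valued $u$ the relation
  $u_{-m} = \overline{u_m}$ holds automatically.\<close>

definition coeff_fun :: "(real^'d \<Rightarrow> real \<Rightarrow> real) \<Rightarrow> int^'d \<Rightarrow> real \<Rightarrow> complex" where
  "coeff_fun u m t =
     (LINT x:Omega|lborel. of_real (u x t) * cnj (char_fun m x)) / of_real ((2 * pi) ^ CARD('d))"

definition weight :: "real \<Rightarrow> real \<Rightarrow> int^'d \<Rightarrow> real" where
  "weight \<sigma> s m =
     (if m = 0 then 1 else norm (rvec m) powr (2 * s) * exp (2 * \<sigma> * norm (rvec m)))"

text \<open>The identity $u(x,t) = \sum_m u_m(t) e^{i m\cdot x}$ is required for every $t$ in the sense of
  $L^2(\Omega)$-convergence, which makes sense for all $s \ge 0$, and in addition pointwise wherever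
  the series converges absolutely. For $s > d/2$ the latter is the case everywhere, so that elements
  are genuine (continuous) functions; for small $s$ they are determined up to null sets only. The
  nonnegative integral in the $L^2$ condition makes it include square integrability of
  $u(\cdot,t)$.\<close>

definition fourier_sum :: "(real^'d \<Rightarrow> real \<Rightarrow> real) \<Rightarrow> bool" where
  "fourier_sum u \<longleftrightarrow>
     (\<forall>t. ((\<lambda>F. \<integral>\<^sup>+x\<in>Omega.
              ennreal ((norm (of_real (u x t) - (\<Sum>m\<in>F. coeff_fun u m t * char_fun m x)))\<^sup>2) \<partial>lborel)
            \<longlongrightarrow> 0) (finite_subsets_at_top UNIV)) \<and>
     (\<forall>x t. (\<lambda>m. coeff_fun u m t * char_fun m x) summable_on UNIV \<longrightarrow>
            of_real (u x t) = (\<Sum>\<^sub>\<infinity>m. coeff_fun u m t * char_fun m x))"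

definition X_space :: "real \<Rightarrow> real \<Rightarrow> (real^'d \<Rightarrow> real \<Rightarrow> real) set" where
  "X_space \<sigma> s = {u.
     (\<lambda>z. u (fst z) (snd z)) \<in> borel_measurable borel \<and>
     (\<forall>x t m k. u (x + (2 * pi) *\<^sub>R rvec m) (t + 2 * pi * of_int k) = u x t) \<and>
     (\<forall>m. coeff_fun u m \<in> H1) \<and>
     (\<lambda>m. (H1_norm (coeff_fun u m))\<^sup>2 * weight \<sigma> s m) summable_on UNIV \<and>
     fourier_sum u}"

definition X_norm :: "real \<Rightarrow> real \<Rightarrow> (real^'d \<Rightarrow> real \<Rightarrow> real) \<Rightarrow> real" where
  "X_norm \<sigma> s u = sqrt (\<Sum>\<^sub>\<infinity>m. (H1_norm (coeff_fun u m))\<^sup>2 * weight \<sigma> s m)"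

definition cell :: "((real^'d) \<times> real) set" where
  "cell = Omega \<times> {0<..<2 * pi}"

definition mean_zero :: "(real^'d \<Rightarrow> real \<Rightarrow> real) \<Rightarrow> bool" where
  "mean_zero u \<longleftrightarrow> (LINT z:cell|lborel. u (fst z) (snd z)) = 0"


section \<open>Distributional derivatives on the torus\<close>

definition dderiv :: "'a::real_normed_vector \<Rightarrow> ('a \<Rightarrow> real) \<Rightarrow> 'a \<Rightarrow> real" where
  "dderiv b f = (\<lambda>z. frechet_derivative f (at z) b)"

coinductive smooth :: "('a::euclidean_space \<Rightarrow> real) \<Rightarrow> bool" where
  "(\<And>z. f differentiable (at z)) \<Longrightarrow> (\<And>b. b \<in> Basis \<Longrightarrow> smooth (dderiv b f)) \<Longrightarrow> smooth f"

definition test_fun :: "((real^'d) \<times> real \<Rightarrow> real) \<Rightarrow> bool" where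
  "test_fun \<phi> \<longleftrightarrow> smooth \<phi> \<and>
     (\<forall>x t m k. \<phi> (x + (2 * pi) *\<^sub>R rvec m, t + 2 * pi * of_int k) = \<phi> (x, t))"

definition weak_tt :: "(real^'d \<Rightarrow> real \<Rightarrow> real) \<Rightarrow> (real^'d \<Rightarrow> real \<Rightarrow> real) \<Rightarrow> bool" where
  "weak_tt u v \<longleftrightarrow> (\<forall>\<phi>. test_fun \<phi> \<longrightarrow>
     (LINT z:cell|lborel. v (fst z) (snd z) * \<phi> z) =
     (LINT z:cell|lborel. u (fst z) (snd z) * dderiv (0, 1) (dderiv (0, 1) \<phi>) z))"

definition weak_laplacian :: "(real^'d \<Rightarrow> real \<Rightarrow> real) \<Rightarrow> (real^'d \<Rightarrow> real \<Rightarrow> real) \<Rightarrow> bool" where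
  "weak_laplacian u v \<longleftrightarrow> (\<forall>\<phi>. test_fun \<phi> \<longrightarrow>
     (LINT z:cell|lborel. v (fst z) (snd z) * \<phi> z) =
     (LINT z:cell|lborel. u (fst z) (snd z) *
        (\<Sum>j\<in>UNIV. dderiv (axis j 1, 0) (dderiv (axis j 1, 0) \<phi>) z)))"


section \<open>The forced Kirchhoff equation\<close>

text \<open>The gradient is the classical one: elements of $\tilde X_{\sigma,s}$ with $s > 1 + d/2$ are
  continuously differentiable in $x$.\<close>

definition dirichlet_energy :: "(real^'d \<Rightarrow> real \<Rightarrow> real) \<Rightarrow> real \<Rightarrow> real" where
  "dirichlet_energy u t =
     (LINT x:Omega|lborel. (\<Sum>j\<in>UNIV. (dderiv (axis j 1) (\<lambda>y. u y t) x)\<^sup>2))"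

text \<open>Equality in $\tilde X_{\sigma,s-2}$ is equality almost everywhere in $x$ for every $t$. The
  spatial and temporal $2\pi$-periodicity is part of the definition of the space.\<close>

definition classical_solution ::
  "(real^'d \<Rightarrow> real \<Rightarrow> real) \<Rightarrow> real \<Rightarrow> real \<Rightarrow> real \<Rightarrow> real \<Rightarrow> (real^'d \<Rightarrow> real \<Rightarrow> real) \<Rightarrow> bool" where
  "classical_solution g \<sigma> s \<omega> \<mu> u \<longleftrightarrow>
     u \<in> X_space \<sigma> s \<and>
     (\<exists>utt \<in> X_space \<sigma> (s - 2). \<exists>lap \<in> X_space \<sigma> (s - 2).
        weak_tt u utt \<and> weak_laplacian u lap \<and>
        (\<forall>t. AE x in lborel.
           \<omega>\<^sup>2 * utt x t - lap x t = \<mu> * (lap x t * dirichlet_energy u t + g x t)))"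

end

theory Submission
  imports Defs
begin

text \<open>On the \<open>m\<close>-th Fourier mode the equation is Hill's equation with potential
  \<open>P = (1 + mu a) / omega^2\<close>, where \<open>a\<close> is the Dirichlet energy of the solution, which depends on time
  only. Hence the problem reduces to a fixed point equation for the single function \<open>P\<close>. The
  periodic solution operator of mode \<open>m\<close> is cut off where the distance of \<open>P\<close> to resonance is
  less than \<open>G |m|^(-tau)\<close>; the cut-off operator is Lipschitz in \<open>P\<close> with a loss of powers of \<open>|m|\<close>
  that the regularity of \<open>g\<close> compensates, so a contraction gives \<open>P\<close> for every parameter and no
  Nash-Moser scheme is needed. At the fixed point \<open>P\<close> is a small perturbation of \<open>1 / omega^2\<close>
  in the Lipschitz sense, which bounds the measure of the frequencies at which the cut-off acts.
  Two solutions differ by a solution of Hill's equation whose right-hand side is controlled by the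
  difference of the potentials, whence uniqueness.\<close>

text \<open>A resonance need not be simple: where the monodromy is close to the identity, all
  homogeneous solutions are nearly periodic, and following one eigenvalue as the frequency varies
  fails. The solution space still has dimension two, and this alone controls the resonant set: of
  three nearby resonant frequencies two lie very close together. The exponents come from the cut-off
  level \<open>G |m|^(-ta)\<close>. A solution costs \<open>1/G\<close>, its Lipschitz constant
  \<open>1/G^2\<close>, so the quadratic energy has Lipschitz constant of order
  \<open>G^(-3)\<close>; its coupling is proportional to \<open>mu^3\<close>, which is why
  \<open>mu\<close> stays below a multiple of \<open>G\<close>. The Lipschitz bound involves
  \<open>P'\<close> as well as \<open>P\<close>, so the contraction runs on pairs. All constants
  degenerate as the frequency window exhausts the half-line. They are absorbed into a threshold for
  \<open>gamma\<close> that depends on the window; above it the window contributes no parameters and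
  the constant in the density claim makes that claim trivial. Hence \<open>delta = 1\<close> works,
  and one bound \<open>C\<close> serves all frequencies.\<close>

abbreviation JTf (binder "JT" 10) where "JTf f \<equiv> set_lebesgue_integral lborel {0..2*pi} f"
abbreviation JOf (binder "JO" 10) where "JOf f \<equiv> set_lebesgue_integral lborel Omega f"
abbreviation JCf (binder "JC" 10) where "JCf f \<equiv> set_lebesgue_integral lborel cell f"
abbreviation "cts f \<equiv> continuous_on UNIV f"
abbreviation "cF \<equiv> coeff_fun"
abbreviation "nv m \<equiv> norm (rvec m)"
abbreviation "bM \<equiv> borel_measurable borel"
abbreviation "fsat \<equiv> finite_subsets_at_top UNIV"
abbreviation "sil \<equiv> set_integrable lborel"
abbreviation hrdf (infix "hrd" 50) where "f hrd D \<equiv> (f has_real_derivative D)"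
abbreviation hvdf (infix "hvd" 50) where "f hvd D \<equiv> (f has_vector_derivative D)"
abbreviation "cor \<equiv> complex_of_real"
lemmas sli = set_lebesgue_integral_def
lemmas sid = set_integrable_def
lemmas bmcI = borel_measurable_continuous_onI
lemmas hrv = has_real_derivative_iff_has_vector_derivative

section \<open>Hill's equation and its distance to resonance\<close>

lemma antiderivative_UNIV:
 fixes g :: "real => real"
 assumes "cts g"
 obtains G where "!!t. (G hrd g t) (at t)" "G t0=c"
proof -
 have "\<exists>F. \<forall>x::real. (-\<infinity>::ereal)<x-->x<(\<infinity>::ereal)-->(F hvd g x) (at x)" by (rule einterval_antiderivative)
    (use assms in \<open>auto simp: continuous_on_eq_continuous_at\<close>)
 then obtain F where F: "!!x. (F hvd g x) (at x)" by auto
 show ?thesis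
 proof (rule that[of "%t. F t-F t0+c"])
  fix t show "((%t. F t-F t0+c) hrd g t) (at t)" using F[of t] by (auto simp: hrv intro!: derivative_eq_intros)
 qed simp
qed

lemma nonneg_of_second_derivative_nonneg:
 fixes D D' D'' :: "real => real"
 assumes d1: "!!t. (D hrd D' t) (at t)"
  and d2: "!!t. (D' hrd D'' t) (at t)"
  and "!!t. D'' t>=0" and "D 0=0" and "D' 0=0"
 shows "D t>=0"
proof -
 have mono: "D' s<=D' t" if "s<=t" for s t by (rule DERIV_nonneg_imp_nondecreasing[OF that]) (use d2 assms(3) in blast)
 show ?thesis
 proof (cases "t>=0")
  case True
  have "D 0<=D t" by (rule DERIV_nonneg_imp_nondecreasing[OF True]) (use d1 mono[of 0] assms(5) in fastforce)
  then show ?thesis using assms by simp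
 next
  case False
  then have "t<=0" by simp
  have "D t>=D 0" by (rule DERIV_nonpos_imp_nonincreasing[OF \<open>t \<le> 0\<close>]) (use d1 mono[of _ 0] assms(5) in fastforce)
  then show ?thesis using assms by simp
 qed
qed

text \<open>Comparison with the exact double primitive of \<open>C * cosh (L * t)\<close>. The gain
  \<open>1/L^2\<close> is what makes the integral operator of the equation contract in a norm
  weighted by \<open>cosh (L * t)\<close>.\<close>

lemma double_primitive_cosh_bound:
 fixes G G' g :: "real => real"
 assumes d1: "!!t. (G hrd G' t) (at t)"
  and d2: "!!t. (G' hrd g t) (at t)"
  and "G 0=0" "G' 0=0" and L: "L>0"
  and g: "!!t. abs(g t)<=C * cosh (L * t)"
 shows "abs(G t)<=C*(cosh (L * t)-1)/L^2"
proof -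
 have c1: "((%t. C*(cosh (L * t)-1)/L^2) hrd C * sinh (L * t)/L) (at t)" for t using L by (auto intro!: derivative_eq_intros simp: power2_eq_square)
 have c2: "((%t. C * sinh (L * t)/L) hrd C * cosh (L * t)) (at t)" for t using L by (auto intro!: derivative_eq_intros)
 have "0<=C*(cosh (L * t)-1)/L^2-G t" by (rule nonneg_of_second_derivative_nonneg[where D = "%t. C*(cosh (L * t)-1)/L^2-G t"
     and D' = "%t. C * sinh (L * t)/L-G' t" and D'' = "%t. C * cosh (L * t)-g t"])
   (use g assms in \<open>auto intro!: DERIV_diff c1 c2 d1 d2 simp: abs_le_iff\<close>)
 moreover have "0<=C*(cosh (L * t)-1)/L^2+G t"
 proof (rule nonneg_of_second_derivative_nonneg[where D = "%t. C*(cosh (L * t)-1)/L^2+G t"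
     and D' = "%t. C * sinh (L * t)/L+G' t" and D'' = "%t. C * cosh (L * t)+g t"])
  fix t show "0<=C * cosh (L * t)+g t" using g[of t] by (simp add: abs_le_iff)
 qed (use assms in \<open>auto intro!: DERIV_add c1 c2 d1 d2\<close>)
 ultimately show ?thesis by (simp add: abs_le_iff)
qed

lemma abs_le_cosh:
 fixes t L :: real
 assumes "L>=1"
 shows "abs(t)<=cosh (L * t)"
proof -
 have "abs(t^2/2)<=1*(cosh (L * t)-1)/L^2" by (rule double_primitive_cosh_bound[where G' = "%t. t" and g = "%t. 1"])
    (use assms in \<open>auto intro!: derivative_eq_intros simp: cosh_real_ge_1\<close>)
 also have "... <= (cosh (L * t)-1)/1" unfolding mult_1 using assms by (intro divide_left_mono) (auto simp: cosh_real_ge_1 one_le_power)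
 finally have "t^2/2<=cosh (L * t)-1" by simp
 moreover have "abs(t)<=1/2+t^2/2" using zero_le_power2[of "abs(t)-1"] by (simp add: power2_diff)
 ultimately show ?thesis by linarith
qed

text \<open>One contraction on the whole line replaces local existence and continuation: for bounded
  coefficients the solution grows at most like \<open>cosh (L * t)\<close>, and in that weight the
  integral form of the equation contracts.\<close>

lemma ode_exists_aux:
 fixes A f :: "real => real"
 assumes cA: "cts A" and bA: "!!t. abs(A t)<=K"
  and cf: "cts f" and bf: "!!t. abs(f t)<=M"
 shows "\<exists>v v'. v 0=x0&v' 0=y0 &
     (\<forall>t. (v hrd v' t) (at t)&(v' hrd f t-A t * v t) (at t))"
proof -
 have K0: "K>=0" using bA[of 0] by linarith
 have M0: "M>=0" using bf[of 0] by linarith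
 \<comment> \<open>Chosen so that \<open>K / L^2 <= 1/2\<close>, the contraction constant, and
   \<open>L >= 1\<close>, which the bound of \<open>t\<close> by \<open>cosh (L * t)\<close>
   requires.\<close>
 define L where "L=1+2 * K"
 have L1: "L>=1" using K0 by (simp add: L_def)
 have L2: "2 * K<=L^2" "L^2>=1" using K0 by (auto simp: L_def power2_eq_square algebra_simps)
 have ch: "cosh (L * t)>=1" for t by (simp add: cosh_real_ge_1)
 have ex: "\<exists>G G'. G 0=0&G' 0=0&(\<forall>t. (G hrd G' t) (at t)&(G' hrd g t) (at t))"
  if g: "cts g" for g :: "real => real"
 proof -
  obtain G' where G': "!!t. (G' hrd g t) (at t)" "G' 0=0" using antiderivative_UNIV[OF g, of 0 0] by auto
  then have "cts G'" by (meson DERIV_continuous_on has_field_derivative_at_within)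
  then obtain G where "!!t. (G hrd G' t) (at t)" "G 0=0" using antiderivative_UNIV[of G' 0 0] by auto
  with G' show ?thesis by blast
 qed
 define J where "J g=(SOME G. \<exists>G'. G 0=0&G' 0=0&(\<forall>t. (G hrd G' t) (at t)&(G' hrd g t) (at t)))"
  for g :: "real => real"
 have J: "\<exists>G'. J g 0=0&G' 0=0&(\<forall>t. (J g hrd G' t) (at t)&(G' hrd g t) (at t))"
  if g: "cts g" for g unfolding J_def using someI_ex[OF ex[OF g]] .
 define h where "h w=(%s. f s-A s*(cosh (L * s) * w s))" for w :: "real => real"
 have cosh_cont: "cts (%t. cosh (L * t))" by (intro continuous_intros)
 have ch_h: "cts (h w)" if "cts w" for w unfolding h_def by (intro continuous_intros cA cf that)
 \<comment> \<open>The unknown \<open>w\<close> is the solution divided by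
   \<open>cosh (L * t)\<close>; it is bounded, so the fixed point can be sought among bounded
   continuous functions.\<close>
 define U where "U w=(%t. (x0+y0 * t+J (h w) t)/cosh (L * t))" for w
 have U_b: "U w\<in>bcontfun" if w: "cts w" "!!t. abs(w t)<=B" for w B
 proof -
  obtain G' where G': "J (h w) 0=0" "G' 0=0" "!!t. (J (h w) hrd G' t) (at t)" "!!t. (G' hrd h w t) (at t)" using J[OF ch_h[OF w(1)]] by blast
  have B0: "B>=0" using w(2)[of 0] by linarith
  have "abs(h w t)<=(M+K * B) * cosh (L * t)" for t
  proof -
   have "abs(h w t)<=abs(f t)+abs(A t) * abs(w t) * cosh (L * t)" unfolding h_def using ch[of t] by (intro order_trans[OF abs_triangle_ineq4]) (simp add: abs_mult)
   also have "... <= M * cosh (L * t)+K * B * cosh (L * t)" using ch[of t] bf[of t] bA[of t] w(2)[of t] K0 M0 B0 by (intro add_mono mult_right_mono mult_mono) (auto intro: order_trans[of _ "M*1"] mult_left_mono)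
   finally show ?thesis by (simp add: algebra_simps)
  qed
  then have Jb: "abs(J (h w) t)<=(M+K * B)*(cosh (L * t)-1)/L^2" for t using double_primitive_cosh_bound[OF G'(3,4,1,2)] L1 by simp
  have "abs(U w t)<=abs(x0)+abs(y0)+(M+K * B)" for t
  proof -
   have a: "abs(J (h w) t)<=(M+K * B) * cosh (L * t)"
   proof -
    have "(M+K * B)*(cosh (L * t)-1)/L^2<=(M+K * B)*(cosh (L * t)-1)/1" using L2 M0 K0 B0 ch[of t] by (intro divide_left_mono) auto
    also have "... <= (M+K * B) * cosh (L * t)" using M0 K0 B0 by (simp add: mult_left_mono)
    finally show ?thesis using Jb[of t] by linarith
   qed
   have b: "abs(x0)<=abs(x0) * cosh (L * t)" using ch[of t] by (simp add: mult_le_cancel_left1)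
   have c: "abs(y0 * t)<=abs(y0) * cosh (L * t)"  using abs_le_cosh[OF L1, of t] by (simp add: abs_mult mult_left_mono)
   have "abs(x0+y0 * t+J (h w) t)<=(abs(x0)+abs(y0)+(M+K * B)) * cosh (L * t)" using a b c unfolding distrib_right by linarith
   then show ?thesis using ch[of t] by (simp add: U_def field_simps)
  qed
  moreover have "cts (U w)"
  proof -
   have "cts (J (h w))" using G'(3) by (meson DERIV_continuous_on has_field_derivative_at_within)
   moreover have "cosh (L * t)~=0" for t using ch[of t] by linarith
   ultimately show ?thesis unfolding U_def by (intro continuous_intros) auto
  qed
  ultimately show ?thesis unfolding bcontfun_def by (auto intro!: boundedI[where B = "abs(x0)+abs(y0)+(M+K * B)"])
 qed
 define T where "T w=Bcontfun (U (apply_bcontfun w))" for w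
 have T: "apply_bcontfun (T w)=U (apply_bcontfun w)" for w
 proof -
  have "U (apply_bcontfun w)\<in>bcontfun"
  proof (rule U_b)
   show "abs(w t)<=norm w" for t using norm_bounded[of w t] by simp
  qed simp
  then show ?thesis unfolding T_def by (rule Bcontfun_inverse)
 qed
 have contr: "dist (T w1) (T w2)<=1/2 * dist w1 w2" for w1 w2
 proof (rule dist_bound)
  fix t
  have cw: "cts (apply_bcontfun w)" for w :: "real \<Rightarrow>\<^sub>C real" by simp
  obtain G1 where G1: "J (h w1) 0=0" "G1 0=0" "!!t. (J (h w1) hrd G1 t) (at t)" "!!t. (G1 hrd h w1 t) (at t)" using J[OF ch_h[OF cw]] by blast
  obtain G2 where G2: "J (h w2) 0=0" "G2 0=0" "!!t. (J (h w2) hrd G2 t) (at t)" "!!t. (G2 hrd h w2 t) (at t)" using J[OF ch_h[OF cw]] by blast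
  have "abs(h w1 t-h w2 t)<=(K * dist w1 w2) * cosh (L * t)" for t
  proof -
   have "h w1 t-h w2 t=A t * cosh (L * t)*(w2 t-w1 t)" by (simp add: h_def algebra_simps)
   then have "abs(h w1 t-h w2 t)=(abs(A t) * dist (w1 t) (w2 t)) * cosh (L * t)" using ch[of t] by (simp add: abs_mult dist_real_def abs_minus_commute)
   also have "... <= (K * dist w1 w2) * cosh (L * t)" using ch[of t] bA[of t] K0 dist_bounded[of w1 t w2] by (intro mult_right_mono mult_mono) auto
   finally show ?thesis .
  qed
  then have "abs(J (h w1) t-J (h w2) t)<=(K * dist w1 w2)*(cosh (L * t)-1)/L^2" by (intro double_primitive_cosh_bound[where G = "%t. J (h w1) t-J (h w2) t" and G' = "%t. G1 t-G2 t" and g = "%t. h w1 t-h w2 t"])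
     (use G1 G2 L1 in \<open>auto intro!: DERIV_diff\<close>)
  also have "... <= (1/2 * dist w1 w2) * cosh (L * t)"
  proof -
   have "(K * dist w1 w2)*(cosh (L * t)-1)/L^2=(K/L^2)*(dist w1 w2*(cosh (L * t)-1))" by simp
   also have "... <= 1/2*(dist w1 w2*(cosh (L * t)-1))" using L2 ch[of t] by (intro mult_right_mono) (auto intro!: divide_le_eq[THEN iffD2])
   also have "... <= (1/2 * dist w1 w2) * cosh (L * t)" unfolding mult.assoc by (intro mult_left_mono) auto
   finally show ?thesis .
  qed
  finally have *: "abs(J (h w1) t-J (h w2) t)<=(1/2 * dist w1 w2) * cosh (L * t)" .
  have "dist (T w1 t) (T w2 t)=abs(J (h w1) t-J (h w2) t)/cosh (L * t)" using ch[of t] by (simp add: T U_def dist_real_def diff_divide_distrib[symmetric])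
  moreover have "cosh (L * t)>0" using ch[of t] by linarith
  ultimately show "dist (T w1 t) (T w2 t)<=1/2 * dist w1 w2" using * by (simp only: pos_divide_le_eq)
 qed
 have "\<exists>!w. T w=w" by (rule banach_fix_type[where c = "1/2"]) (use contr in auto)
 then obtain w where w: "T w=w" by blast
 have cw: "cts (apply_bcontfun w)" by simp
 obtain G where G: "J (h w) 0=0" "G 0=0" "!!t. (J (h w) hrd G t) (at t)" "!!t. (G hrd h w t) (at t)" using J[OF ch_h[OF cw]] by blast
 have weq: "cosh (L * t) * w t=x0+y0 * t+J (h w) t" for t using fun_cong[OF T[of w], of t] ch[of t] w by (simp add: U_def field_simps)
 show ?thesis
 proof (intro exI conjI allI)
  show "x0+y0*0+J (h w) 0=x0" "y0+G 0=y0" using G by auto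
  fix t
  show "((%t. x0+y0 * t+J (h w) t) hrd y0+G t) (at t)" using G(3)[of t] by (auto intro!: derivative_eq_intros)
  have "((%t. y0+G t) hrd 0+h w t) (at t)" by (intro DERIV_add DERIV_const G(4))
  moreover have "0+h w t=f t-A t*(cosh (L * t) * w t)" by (simp add: h_def)
  ultimately show "((%t. y0+G t) hrd f t-A t*(x0+y0 * t+J (h w) t)) (at t)" using weq[of t] by metis
 qed
qed

lemma ode_exists:
 fixes A f :: "real => real"
 assumes cA: "cts A" and bA: "!!t. abs(A t)<=K"
  and cf: "cts f" and bf: "!!t. abs(f t)<=M"
 obtains v v' where "v t0=x0" "v' t0=y0"
   "!!t. (v hrd v' t) (at t)" "!!t. (v' hrd f t-A t * v t) (at t)"
proof -
 have "\<exists>v v'. v 0=x0&v' 0=y0 &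
     (\<forall>t. (v hrd v' t) (at t)&(v' hrd f (t+t0)-A (t+t0) * v t) (at t))"
 proof (rule ode_exists_aux)
  show "cts (%t. A (t+t0))" "cts (%t. f (t+t0))" by (intro continuous_on_compose2[OF cA] continuous_on_compose2[OF cf] continuous_intros; simp)+
 qed (rule bA bf)+
 then obtain v v' where v: "v 0=x0" "v' 0=y0"
  "!!t. (v hrd v' t) (at t)" "!!t. (v' hrd f (t+t0)-A (t+t0) * v t) (at t)" by blast
 show ?thesis
 proof (rule that[of "%t. v (t-t0)" "%t. v' (t-t0)"])
  fix t
  have s: "((%t. t-t0) hrd 1) (at t)" by (auto intro!: derivative_eq_intros)
  show "((%t. v (t-t0)) hrd v' (t-t0)) (at t)" using DERIV_chain2[OF v(3) s] by simp
  show "((%t. v' (t-t0)) hrd f t-A t * v (t-t0)) (at t)" using DERIV_chain2[OF v(4) s] by simp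
 qed (use v in auto)
qed

text \<open>The bound on the absolute value of \<open>G'\<close> makes \<open>exp (- c t) G\<close>
  nonincreasing and \<open>exp (c t) G\<close> nondecreasing, so data given at any time control the
  solution in both time directions.\<close>

lemma gronwall_two_sided:
 fixes G G' :: "real => real"
 assumes d: "!!t. (G hrd G' t) (at t)" and c: "!!x. [|min s t<=x; x<=max s t|]==>abs(G' x)<=c * G x"
 shows "G t<=exp (c * abs(t-s)) * G s"
proof (cases "s<=t")
 case True
 have "exp (- (c * t)) * G t<=exp (- (c * s)) * G s"
 proof (rule DERIV_nonpos_imp_nonincreasing[OF True])
  fix x assume x: "s<=x" "x<=t"
  have "((%t. exp (- (c * t)) * G t) hrd exp (- (c * x))*(G' x-c * G x)) (at x)" by (auto intro!: derivative_eq_intros d simp: algebra_simps)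
  moreover have "exp (- (c * x))*(G' x-c * G x)<=0" using c[of x] x by (intro mult_nonneg_nonpos) (auto simp: abs_le_iff)
  ultimately show "\<exists>y. ((%t. exp (- (c * t)) * G t) hrd y) (at x)&y<=0" by blast
 qed
 then have "exp (c * t)*(exp (- (c * t)) * G t)<=exp (c * t)*(exp (- (c * s)) * G s)" by (intro mult_left_mono) auto
 then have "(exp (c * t) * exp (- (c * t))) * G t<=(exp (c * t) * exp (- (c * s))) * G s" by (simp only: mult.assoc)
 moreover have "c * t + - (c * s)=c*(t-s)" by (simp add: algebra_simps)
 ultimately show ?thesis using True by (simp add: exp_add[symmetric])
next
 case False
 then have "t<=s" by simp
 have "exp (c * t) * G t<=exp (c * s) * G s"
 proof (rule DERIV_nonneg_imp_nondecreasing[OF \<open>t \<le> s\<close>])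
  fix x assume x: "t<=x" "x<=s"
  have "((%t. exp (c * t) * G t) hrd exp (c * x)*(G' x+c * G x)) (at x)" by (auto intro!: derivative_eq_intros d simp: algebra_simps)
  moreover have "exp (c * x)*(G' x+c * G x)>=0" using c[of x] x by (intro mult_nonneg_nonneg) (auto simp: abs_le_iff)
  ultimately show "\<exists>y. ((%t. exp (c * t) * G t) hrd y) (at x)&y>=0" by blast
 qed
 then have "exp (- (c * t))*(exp (c * t) * G t)<=exp (- (c * t))*(exp (c * s) * G s)" by (intro mult_left_mono) auto
 then have "(exp (- (c * t)) * exp (c * t)) * G t<=(exp (- (c * t)) * exp (c * s)) * G s" by (simp only: mult.assoc)
 moreover have "- (c * t)+c * s=c*(s-t)" by (simp add: algebra_simps)
 ultimately show ?thesis using False by (simp add: exp_add[symmetric])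
qed

section \<open>Energy growth, monodromy and gap for Hill's equation\<close>

definition potential :: "real => (real => real) => (real => real) => bool" where
 "potential b P P' \<longleftrightarrow> (\<forall>t. (P hrd P' t) (at t))&cts P' &
     (\<forall>t. 1/b<=P t&P t<=b&abs(P' t)<=b)&(\<forall>t. P (t+2 * pi)=P t)"

definition hill_sol :: "real => (real => real) => (real => real) => (real => real) => (real => real) => bool" where
 "hill_sol l P f v v' \<longleftrightarrow> (\<forall>t. (v hrd v' t) (at t) &
     (v' hrd f t-l^2 * P t * v t) (at t))"

text \<open>The phase space norm adapted to the frequency: the factor \<open>l\<close> balances
  \<open>v\<close> against \<open>v'\<close>, and growth bounds in this norm do not depend on
  \<open>l\<close>.\<close>

definition pnorm :: "real => (real => real) => (real => real) => real => real" where
 "pnorm l v v' t=l * abs(v t)+abs(v' t)"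

definition phase_jump :: "real => (real => real) => (real => real) => real" where
 "phase_jump l v v'=l * abs(v (2 * pi)-v 0)+abs(v' (2 * pi)-v' 0)"

text \<open>The smallest stretching factor of the monodromy map minus the identity, measured in the
  phase norm. The infimum over solutions avoids matrices, and dependence on \<open>P\<close> reduces
  to comparing solutions with equal initial data.\<close>

definition gap :: "real => (real => real) => real" where
 "gap l P=Inf {phase_jump l v v' | v v'. hill_sol l P (%_. 0) v v'&pnorm l v v' 0=1}"

text \<open>The exponential is Gronwall's factor over one period; \<open>2 * b^2\<close> is the
  product of the two constants that compare the energy with the squared phase norm.\<close>

definition ecst :: "real => real" where
 "ecst b=2 * b^2 * exp (2 * pi*(b^2+1))"

lemma potentialD:
 assumes "potential b P P'"
 shows "(P hrd P' t) (at t)" "1/b<=P t" "P t<=b" "abs(P' t)<=b"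
  "P (t+2 * pi)=P t" "cts P'" using assms unfolding potential_def by blast+

lemma potential_cont: "potential b P P'==>cts P" by (rule DERIV_continuous_on[OF has_field_derivative_at_within], erule potentialD(1))

lemma hill_solD:
 assumes "hill_sol l P f v v'"
 shows "(v hrd v' t) (at t)" "(v' hrd f t-l^2 * P t * v t) (at t)" using assms unfolding hill_sol_def by blast+

lemma hill_sol_cont:
 assumes "hill_sol l P f v v'"
 shows "cts v" "cts v'" by (rule DERIV_continuous_on[OF has_field_derivative_at_within], rule hill_solD[OF assms])+

lemma hill_sol_add:
 assumes "hill_sol l P f v v'" "hill_sol l P g w w'"
 shows "hill_sol l P (%t. f t+g t) (%t. v t+w t) (%t. v' t+w' t)" unfolding hill_sol_def
proof (intro allI conjI)
 fix t
 show "((%t. v t+w t) hrd v' t+w' t) (at t)" by (intro DERIV_add hill_solD[OF assms(1)] hill_solD[OF assms(2)])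
 have "((%t. v' t+w' t) hrd (f t-l^2 * P t * v t)+(g t-l^2 * P t * w t)) (at t)" by (intro DERIV_add hill_solD[OF assms(1)] hill_solD[OF assms(2)])
 then show "((%t. v' t+w' t) hrd f t+g t-l^2 * P t*(v t+w t)) (at t)" by (simp add: algebra_simps)
qed

lemma hill_sol_scale:
 assumes "hill_sol l P f v v'"
 shows "hill_sol l P (%t. c * f t) (%t. c * v t) (%t. c * v' t)" unfolding hill_sol_def
proof (intro allI conjI)
 fix t
 show "((%t. c * v t) hrd c * v' t) (at t)" by (intro DERIV_cmult hill_solD[OF assms(1)])
 have "((%t. c * v' t) hrd c*(f t-l^2 * P t * v t)) (at t)" by (intro DERIV_cmult hill_solD[OF assms(1)])
 then show "((%t. c * v' t) hrd c * f t-l^2 * P t*(c * v t)) (at t)" by (simp add: algebra_simps)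
qed

lemma hill_sol_diff:
 assumes "hill_sol l P f v v'" "hill_sol l P g w w'"
 shows "hill_sol l P (%t. f t-g t) (%t. v t-w t) (%t. v' t-w' t)" using hill_sol_add[OF assms(1) hill_sol_scale[OF assms(2), of "-1"]] by simp

text \<open>The difference of two potentials becomes a forcing; every comparison of solutions
  belonging to different potentials starts here.\<close>

lemma hill_sol_change_potential:
 assumes "hill_sol l P f v v'"
 shows "hill_sol l Q (%t. f t+l^2*(Q t-P t) * v t) v v'" using assms unfolding hill_sol_def by (simp add: algebra_simps)

lemma ec_ge_1: "b>=1==>ecst b>=1"
proof -
 assume b: "b>=1"
 have "1<=2 * b^2" using one_le_power[OF b, of 2] by linarith
 then have "1*1<=(2 * b^2) * exp (2 * pi*(b^2+1))" by (intro mult_mono) auto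
 then show ?thesis by (simp add: ecst_def)
qed

lemma pn_nonneg: "l>=0==>pnorm l v v' t>=0" by (simp add: pnorm_def)

text \<open>In the derivative of the energy the terms with \<open>l^2 * P * v * v'\<close> cancel.
  What remains contains \<open>P'\<close> and \<open>f\<close> only, and since
  \<open>abs (P') <= b <= b * (b * P)\<close> it is bounded by the energy with a factor free of
  \<open>l\<close>. Adding \<open>M^2\<close> makes the forcing part of the energy.\<close>

lemma hill_energy_growth:
 assumes b: "b>=1" and P: "potential b P P'" and l: "l>=0"
  and v: "hill_sol l P f v v'" and f: "!!x. [|min s t<=x; x<=max s t|]==>abs(f x)<=M"
 shows "(v' t)^2+l^2 * P t*(v t)^2+M^2
    <= exp ((b^2+1) * abs(t-s))*((v' s)^2+l^2 * P s*(v s)^2+M^2)"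
proof (rule gronwall_two_sided[where G' = "%t. 2 * v' t * f t+l^2 * P' t*(v t)^2"])
 fix t
 show "((%t. (v' t)^2+l^2 * P t*(v t)^2+M^2) hrd 2 * v' t * f t+l^2 * P' t*(v t)^2) (at t)" by (auto intro!: derivative_eq_intros hill_solD[OF v] potentialD(1)[OF P] simp: power2_eq_square algebra_simps)
next
 fix x assume x: "min s t<=x" "x<=max s t"
 have Ppos: "P x>=0" "1<=b * P x" using potentialD(2)[OF P, of x] b by (auto simp: field_simps intro: order_trans[of 0 "1/b"])
 have "abs(2 * v' x * f x)<=(v' x)^2+(f x)^2" using zero_le_power2[of "abs(v' x)-abs(f x)"] by (simp add: power2_diff abs_mult)
 also have "(f x)^2<=M^2" using f[OF x] by (metis abs_ge_zero power2_abs power_mono)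
 finally have 1: "abs(2 * v' x * f x)<=(v' x)^2+M^2" by simp
 have "abs(l^2 * P' x*(v x)^2)<=(l^2*(v x)^2) * b"
 proof -
  have "abs(P' x)*(l^2*(v x)^2)<=b*(l^2*(v x)^2)" using potentialD(4)[OF P, of x] by (intro mult_right_mono) auto
  then show ?thesis by (simp add: abs_mult mult_ac)
 qed
 also have "... <= (l^2*(v x)^2)*(b*(b * P x))" using Ppos b by (intro mult_left_mono) (auto simp: mult_le_cancel_left1)
 finally have 2: "abs(l^2 * P' x*(v x)^2)<=b^2*(l^2 * P x*(v x)^2)" by (simp add: power2_eq_square algebra_simps)
 have 3: "0<=b^2*((v' x)^2+M^2)" "0<=l^2 * P x*(v x)^2" using Ppos by auto
 show "abs(2 * v' x * f x+l^2 * P' x*(v x)^2)<=(b^2+1)*((v' x)^2+l^2 * P x*(v x)^2+M^2)" using 1 2 3 abs_triangle_ineq[of "2 * v' x * f x" "l^2 * P' x*(v x)^2"] unfolding distrib_right distrib_left mult_1 by linarith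
qed

lemma pn_growth:
 assumes b: "b>=1" and P: "potential b P P'" and l: "l>=0"
  and v: "hill_sol l P f v v'" and f: "!!x. x\<in>{0..2*pi}==>abs(f x)<=M"
  and st: "s\<in>{0..2*pi}" "t\<in>{0..2*pi}"
 shows "pnorm l v v' t<=ecst b*(pnorm l v v' s+M)"
proof -
 define E where "E t=(v' t)^2+l^2 * P t*(v t)^2" for t
 have M0: "M>=0" using f[of 0] by force
 have Ppos: "P t>=0" "1<=b * P t" for t using potentialD(2)[OF P, of t] b by (auto simp: field_simps intro: order_trans[of 0 "1/b"])
 have up: "E s<=b*(pnorm l v v' s)^2"
 proof -
  have "E s<=b*(v' s)^2+l^2 * b*(v s)^2" unfolding E_def using b potentialD(3)[OF P, of s] by (intro add_mono mult_right_mono mult_left_mono) (auto simp: mult_le_cancel_right1)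
  also have "... = b*(abs(v' s)^2+(l * abs(v s))^2)" by (simp add: power_mult_distrib algebra_simps)
  also have "... <= b*(pnorm l v v' s)^2" unfolding pnorm_def using b l by (intro mult_left_mono) (auto simp: power2_sum)
  finally show ?thesis .
 qed
 have lo: "(pnorm l v v' t)^2<=2 * b * E t"
 proof -
  have "(pnorm l v v' t)^2<=2*(abs(v' t)^2+(l * abs(v t))^2)" using zero_le_power2[of "abs(v' t)-l * abs(v t)"] unfolding pnorm_def by (simp add: power2_sum power2_diff mult_ac)
  also have "... = 2*((v' t)^2*1+l^2*(v t)^2*1)" by (simp add: power_mult_distrib)
  also have "... <= 2*((v' t)^2 * b+l^2*(v t)^2*(b * P t))" using b Ppos by (intro mult_left_mono add_mono) auto
  finally show ?thesis by (simp add: E_def algebra_simps)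
 qed
 have "E t<=E t+M^2" by simp
 also have "... <= exp ((b^2+1) * abs(t-s))*(E s+M^2)" unfolding E_def by (rule hill_energy_growth[OF b P l v], rule f) (use st in \<open>auto simp: min_def max_def split: if_splits\<close>)
 also have "... <= exp (2 * pi*(b^2+1))*(b*(pnorm l v v' s)^2+b * M^2)"
 proof (intro mult_mono add_mono up)
  show "exp ((b^2+1) * abs(t-s))<=exp (2 * pi*(b^2+1))" using st by (auto simp: mult.commute intro!: mult_right_mono)
  show "M^2<=b * M^2" using b by (simp add: mult_le_cancel_right1)
  show "0<=E s+M^2" using Ppos by (simp add: E_def)
 qed auto
 also have "... <= exp (2 * pi*(b^2+1))*(b*(pnorm l v v' s+M)^2)" using b M0 pn_nonneg[OF l] by (intro mult_left_mono) (auto simp: power2_sum distrib_left[symmetric])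
 finally have "(pnorm l v v' t)^2<=2 * b*(exp (2 * pi*(b^2+1))*(b*(pnorm l v v' s+M)^2))" using lo b by (meson mult_left_mono order_trans zero_le_mult_iff zero_le_numeral zero_le_one)
 also have "... = ecst b*(pnorm l v v' s+M)^2" by (simp add: ecst_def power2_eq_square)
 also have "... <= (ecst b)^2*(pnorm l v v' s+M)^2" using ec_ge_1[OF b] by (intro mult_right_mono) (auto simp: power2_eq_square)
 also have "... = (ecst b*(pnorm l v v' s+M))^2" by (simp add: power_mult_distrib)
 finally show ?thesis by (rule power2_le_imp_le) (use ec_ge_1[OF b] M0 pn_nonneg[OF l] in auto)
qed

lemma hill_sol_zero:
 assumes b: "b>=1" and P: "potential b P P'" and l: "l>0"
  and v: "hill_sol l P (%_. 0) v v'" and "v s=0" "v' s=0"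
 shows "v t=0" "v' t=0"
proof -
 have "(v' t)^2+l^2 * P t*(v t)^2+0^2<=exp ((b^2+1) * abs(t-s))*((v' s)^2+l^2 * P s*(v s)^2+0^2)" by (rule hill_energy_growth[OF b P less_imp_le[OF l] v]) simp
 then have le: "(v' t)^2+l^2 * P t*(v t)^2<=0" using assms by simp
 have Ppos: "P t>0" using potentialD(2)[OF P, of t] b by (meson divide_pos_pos less_le_trans zero_less_one)
 have "0<=l^2 * P t*(v t)^2" using Ppos by simp
 then have "(v' t)^2=0" "l^2 * P t*(v t)^2=0" using le zero_le_power2[of "v' t"] by linarith+
 then show "v t=0" "v' t=0" using l Ppos by auto
qed

lemma hill_sol_exists:
 assumes P: "potential b P P'" and cf: "cts f" and bf: "!!t. abs(f t)<=M"
 obtains v v' where "hill_sol l P f v v'" "v t0=x0" "v' t0=y0"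
proof -
 have "abs(l^2 * P t)<=l^2 * max b 0" for t
 proof (cases "b>0")
  case True
  then have "P t>=0" using potentialD(2)[OF P, of t] by (auto intro: order_trans[of 0 "1/b"])
  then show ?thesis using potentialD(3)[OF P, of t] True by (simp add: abs_mult mult_left_mono)
 next
  case False
  then have "abs(P' t)<=0" using potentialD(4)[OF P, of t] by linarith
  with False potentialD(4)[OF P, of t] have "b=0" by linarith
  then show ?thesis using potentialD(2,3)[OF P, of t] by simp
 qed
 moreover have "cts (%t. l^2 * P t)" by (intro continuous_intros potential_cont[OF P])
 ultimately obtain v v' where "v t0=x0" "v' t0=y0"
   "!!t. (v hrd v' t) (at t)" "!!t. (v' hrd f t-l^2 * P t * v t) (at t)" using ode_exists[of "%t. l^2 * P t" "l^2 * max b 0" f M t0 x0 y0] cf bf by blast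
 then show ?thesis using that unfolding hill_sol_def by blast
qed

lemma hs_exists_hom:
 assumes P: "potential b P P'"
 obtains v v' where "hill_sol l P (%_. 0) v v'" "v t0=x0" "v' t0=y0" using hill_sol_exists[OF P, of "%_. 0" 0 l t0 x0 y0] by auto

lemma phase_jump_nonneg: "l>=0==>phase_jump l v v'>=0" by (simp add: phase_jump_def)

lemma gap_bdd: "l>=0==>bdd_below {phase_jump l v v' | v v'. hill_sol l P (%_. 0) v v'&pnorm l v v' 0=1}" by (rule bdd_belowI[of _ 0]) (auto simp: phase_jump_nonneg)

lemma gap_le_jump:
 assumes l: "l>0" and v: "hill_sol l P (%_. 0) v v'"
 shows "gap l P * pnorm l v v' 0<=phase_jump l v v'"
proof (cases "pnorm l v v' 0=0")
 case True
 then show ?thesis using l by (simp add: phase_jump_nonneg)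
next
 case False
 then have pos: "pnorm l v v' 0>0" using pn_nonneg[of l v v' 0] l by simp
 define c where "c=1/pnorm l v v' 0"
 have c0: "c>0" using pos by (simp add: c_def)
 have s: "hill_sol l P (%_. 0) (%t. c * v t) (%t. c * v' t)" using hill_sol_scale[OF v, of c] by simp
 have n: "pnorm l (%t. c * v t) (%t. c * v' t) 0=c * pnorm l v v' 0" using c0 by (simp add: pnorm_def abs_mult algebra_simps)
 have j: "phase_jump l (%t. c * v t) (%t. c * v' t)=c * phase_jump l v v'"
 proof -
  have "abs(c * x-c * y)=c * abs(x-y)" for x y :: real using c0 unfolding right_diff_distrib[symmetric] by (simp add: abs_mult)
  then show ?thesis unfolding phase_jump_def by (simp add: distrib_left mult.left_commute)
 qed
 have "gap l P<=c * phase_jump l v v'" unfolding gap_def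
 proof (rule cInf_lower)
  show "c * phase_jump l v v'\<in>{phase_jump l v v' |v v'. hill_sol l P (%_. 0) v v'&pnorm l v v' 0=1}" using s n pos unfolding j[symmetric] by (auto simp: c_def)
 qed (use gap_bdd l in auto)
 then show ?thesis using pos by (simp add: c_def field_simps)
qed

lemma gap_attained_approx:
 assumes P: "potential b P P'" and l: "l>0" and e: "gap l P<e"
 obtains v v' where "hill_sol l P (%_. 0) v v'" "pnorm l v v' 0=1" "phase_jump l v v'<e"
proof -
 obtain v v' where v: "hill_sol l P (%_. 0) v v'" "v 0=0" "v' 0=1" using hs_exists_hom[OF P] .
 then have ne: "{phase_jump l v v' | v v'. hill_sol l P (%_. 0) v v'&pnorm l v v' 0=1}~={}" using v by (force simp: pnorm_def)
 from cInf_lessD[OF ne e[unfolded gap_def]] show ?thesis using that by blast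
qed

text \<open>The difference solves the equation for \<open>P\<close> with forcing
  \<open>l^2 * (Q - P) * v\<close>. One factor \<open>l\<close> is absorbed by the phase norm of
  \<open>v\<close>; the other remains and is the price of changing the potential.\<close>

lemma phase_norm_perturb:
 assumes b: "b>=1" and P: "potential b P P'" and Q: "potential b Q Q'" and l: "l>0"
  and D: "!!t. abs(P t-Q t)<=D"
  and v: "hill_sol l Q (%_. 0) v v'" and u: "hill_sol l P (%_. 0) u u'"
  and eq: "u 0=v 0" "u' 0=v' 0" and t: "t\<in>{0..2*pi}"
 shows "pnorm l (%t. u t-v t) (%t. u' t-v' t) t<=(ecst b)^2 * l * D * pnorm l v v' 0"
proof -
 let ?K = "ecst b"
 have K: "?K>=1" using ec_ge_1[OF b] .
 have D0: "D>=0" using D[of 0] by linarith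
 have w: "hill_sol l P (%t. l^2*(Q t-P t) * v t) (%t. u t-v t) (%t. u' t-v' t)" using hill_sol_diff[OF u hill_sol_change_potential[OF v, of P]] by (simp add: algebra_simps)
 have vb: "pnorm l v v' x <= ?K * pnorm l v v' 0" if "x\<in>{0..2*pi}" for x using pn_growth[OF b Q less_imp_le[OF l] v, of 0 0 x] that by auto
 have "pnorm l (%t. u t-v t) (%t. u' t-v' t) t
    <= ?K*(pnorm l (%t. u t-v t) (%t. u' t-v' t) 0+l * D*(?K * pnorm l v v' 0))"
 proof (rule pn_growth[OF b P less_imp_le[OF l] w _ _ t])
  fix x :: real assume x: "x\<in>{0..2*pi}"
  have "abs(l^2*(Q x-P x) * v x)=l * abs(P x-Q x)*(l * abs(v x))" using l by (simp add: abs_mult power2_eq_square abs_minus_commute)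
  also have "... <= l * D * pnorm l v v' x" using D[of x] l D0 by (intro mult_mono mult_left_mono) (auto simp: pnorm_def)
  also have "... <= l * D*(?K * pnorm l v v' 0)" using vb[OF x] l D0 by (intro mult_left_mono) auto
  finally show "abs(l^2*(Q x-P x) * v x)<=l * D*(?K * pnorm l v v' 0)" .
 qed simp
 then show ?thesis using eq by (simp add: pnorm_def power2_eq_square algebra_simps)
qed

text \<open>A nearly minimal solution for \<open>Q\<close> is compared with the solution for
  \<open>P\<close> that has the same data at 0, so the two jumps differ only through the values at
  \<open>2 * pi\<close>.\<close>

lemma gap_le_gap_add:
 assumes b: "b>=1" and P: "potential b P P'" and Q: "potential b Q Q'" and l: "l>0"
  and D: "!!t. abs(P t-Q t)<=D"
 shows "gap l P<=gap l Q+(ecst b)^2 * l * D"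
proof (rule field_le_epsilon)
 fix e :: real assume "e>0"
 then obtain v v' where v: "hill_sol l Q (%_. 0) v v'" "pnorm l v v' 0=1" "phase_jump l v v'<gap l Q+e" using gap_attained_approx[OF Q l, of "gap l Q+e"] by auto
 obtain u u' where u: "hill_sol l P (%_. 0) u u'" "u 0=v 0" "u' 0=v' 0" using hs_exists_hom[OF P] .
 have n: "pnorm l u u' 0=1" using v(2) u(2,3) by (simp add: pnorm_def)
 have "gap l P<=phase_jump l u u'" using gap_le_jump[OF l u(1)] n by simp
 also have "... <= phase_jump l v v'+pnorm l (%t. u t-v t) (%t. u' t-v' t) (2 * pi)"
 proof -
  have "abs(u (2*pi)-u 0)<=abs(v (2*pi)-v 0)+abs(u (2*pi)-v (2*pi))" "abs(u' (2*pi)-u' 0)<=abs(v' (2*pi)-v' 0)+abs(u' (2*pi)-v' (2*pi))" using u by linarith+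
  then show ?thesis using l mult_left_mono[of "abs(u (2*pi)-u 0)" "abs(v (2*pi)-v 0)+abs(u (2*pi)-v (2*pi))" l] unfolding phase_jump_def pnorm_def by (simp add: distrib_left)
 qed
 also have "... <= gap l Q+e+(ecst b)^2 * l * D*1" using v phase_norm_perturb[OF b P Q l D v(1) u, of "2*pi"] by (intro add_mono) auto
 finally show "gap l P<=gap l Q+(ecst b)^2 * l * D+e" by simp
qed

lemma gap_lipschitz:
 assumes b: "b>=1" and P: "potential b P P'" and Q: "potential b Q Q'" and l: "l>0"
  and D: "!!t. abs(P t-Q t)<=D"
 shows "abs(gap l P-gap l Q)<=(ecst b)^2 * l * D"
proof -
 have D': "abs(Q t-P t)<=D" for t using D[of t] by linarith
 show ?thesis using gap_le_gap_add[OF b P Q l D] gap_le_gap_add[OF b Q P l D'] by linarith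
qed

lemma periodic_boundary_imp_periodic:
 assumes b: "b>=1" and P: "potential b P P'" and l: "l>0"
  and v: "hill_sol l P f v v'" and f: "!!t. f (t+2 * pi)=f t"
  and eq: "v (2 * pi)=v 0" "v' (2 * pi)=v' 0"
 shows "v (t+2 * pi)=v t" "v' (t+2 * pi)=v' t"
proof -
 have s: "((%t. t+2 * pi) hrd 1) (at t)" for t by (auto intro!: derivative_eq_intros)
 have "hill_sol l P f (%t. v (t+2 * pi)) (%t. v' (t+2 * pi))" unfolding hill_sol_def
 proof (intro allI conjI)
  fix t
  show "((%t. v (t+2 * pi)) hrd v' (t+2 * pi)) (at t)" using DERIV_chain2[OF hill_solD(1)[OF v] s] by simp
  show "((%t. v' (t+2 * pi)) hrd f t-l^2 * P t * v (t+2 * pi)) (at t)" using DERIV_chain2[OF hill_solD(2)[OF v] s[of t]] unfolding f potentialD(5)[OF P] by simp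
 qed
 from hill_sol_diff[OF this v]
 have "hill_sol l P (%_. 0) (%t. v (t+2 * pi)-v t) (%t. v' (t+2 * pi)-v' t)" by simp
 from hill_sol_zero[OF b P l this, of 0 t] eq show "v (t+2 * pi)=v t" "v' (t+2 * pi)=v' t" by auto
qed

lemma real_plane_linear_surj:
 fixes a b c d :: real
 assumes inj: "!!x y. a * x+b * y=0==>c * x+d * y=0==>x=0&y=0"
 obtains x y where "a * x+b * y=p" "c * x+d * y=q"
proof -
 have D: "a * d-b * c~=0"
 proof
  assume D: "a * d-b * c=0"
  have "d=0&c=0" using inj[of d "-c"] D by (simp add: algebra_simps)
  moreover have "b=0&a=0" using inj[of b "-a"] D by (simp add: algebra_simps)
  ultimately show False using inj[of 1 0] by simp
 qed
 show ?thesis by (rule that[of "(d * p-b * q)/(a * d-b * c)" "(a * q-c * p)/(a * d-b * c)"])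
    (use D in \<open>simp_all add: divide_simps, simp_all add: algebra_simps\<close>)
qed

text \<open>A positive gap makes the linear map from initial data to jumps injective; on the plane
  of homogeneous solutions it is then onto.\<close>

lemma hom_sol_with_jump:
 assumes P: "potential b P P'" and l: "l>0" and g: "gap l P>0"
 obtains w w' where "hill_sol l P (%_. 0) w w'" "w (2 * pi)-w 0=p" "w' (2 * pi)-w' 0=q"
proof -
 obtain v v' where v: "hill_sol l P (%_. 0) v v'" "v 0=1" "v' 0=0" using hs_exists_hom[OF P] .
 obtain u u' where u: "hill_sol l P (%_. 0) u u'" "u 0=0" "u' 0=1" using hs_exists_hom[OF P] .
 have s: "hill_sol l P (%_. 0) (%t. x * v t+y * u t) (%t. x * v' t+y * u' t)" for x y using hill_sol_add[OF hill_sol_scale[OF v(1), of x] hill_sol_scale[OF u(1), of y]] by simp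
 have "\<exists>x y. (v (2*pi)-v 0) * x+(u (2*pi)-u 0) * y=p&(v' (2*pi)-v' 0) * x+(u' (2*pi)-u' 0) * y=q"
 proof (rule real_plane_linear_surj[of "v (2*pi)-v 0" "u (2*pi)-u 0" "v' (2*pi)-v' 0" "u' (2*pi)-u' 0" p q])
  fix x y
  assume 0: "(v (2*pi)-v 0) * x+(u (2*pi)-u 0) * y=0" "(v' (2*pi)-v' 0) * x+(u' (2*pi)-u' 0) * y=0"
  have "phase_jump l (%t. x * v t+y * u t) (%t. x * v' t+y * u' t)=0" using 0 unfolding phase_jump_def by (simp add: algebra_simps)
  with gap_le_jump[OF l s[of x y]] have "gap l P * pnorm l (%t. x * v t+y * u t) (%t. x * v' t+y * u' t) 0<=0" by simp
  then have "pnorm l (%t. x * v t+y * u t) (%t. x * v' t+y * u' t) 0<=0" using g by (simp add: mult_le_0_iff)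
  then have "l * abs(x)+abs(y)<=0" using u v by (simp add: pnorm_def)
  then have "abs(y)=0" "l * abs(x)=0" using l by (smt (verit) mult_nonneg_nonneg)+
  then show "x=0&y=0" using l by auto
 qed blast
 then obtain x y where "(v (2*pi)-v 0) * x+(u (2*pi)-u 0) * y=p" "(v' (2*pi)-v' 0) * x+(u' (2*pi)-u' 0) * y=q" by blast
 then show ?thesis by (intro that[OF s[of x y]]) (simp_all add: algebra_simps)
qed

text \<open>The solution with zero data is corrected by the homogeneous solution with the opposite
  jump.\<close>

lemma periodic_sol_exists:
 assumes b: "b>=1" and P: "potential b P P'" and l: "l>0" and g: "gap l P>0"
  and cf: "cts f" and pf: "!!t. f (t+2 * pi)=f t" and bf: "!!t. abs(f t)<=M"
 obtains v v' where "hill_sol l P f v v'" "!!t. v (t+2 * pi)=v t" "!!t. v' (t+2 * pi)=v' t"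
proof -
 obtain V V' where V: "hill_sol l P f V V'" "V 0=0" "V' 0=0" using hill_sol_exists[OF P cf bf] .
 obtain w w' where w: "hill_sol l P (%_. 0) w w'" "w (2 * pi)-w 0 = - (V (2 * pi)-V 0)" "w' (2 * pi)-w' 0 = - (V' (2 * pi)-V' 0)" using hom_sol_with_jump[OF P l g] .
 have s: "hill_sol l P f (%t. V t+w t) (%t. V' t+w' t)" using hill_sol_add[OF V(1) w(1)] by simp
 have e: "V (2 * pi)+w (2 * pi)=V 0+w 0" "V' (2 * pi)+w' (2 * pi)=V' 0+w' 0" using w(2,3) by linarith+
 show ?thesis
 proof (rule that)
  show "hill_sol l P f (%t. V t+w t) (%t. V' t+w' t)" by (rule s)
  fix t
  show "V (t+2 * pi)+w (t+2 * pi)=V t+w t" by (rule periodic_boundary_imp_periodic(1)[OF b P l s pf e])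
  show "V' (t+2 * pi)+w' (t+2 * pi)=V' t+w' t" by (rule periodic_boundary_imp_periodic(2)[OF b P l s pf e])
 qed
qed

text \<open>A periodic solution differs from the one with given data at 0 by a homogeneous solution
 whose jump is known, hence small compared with the gap.\<close>

lemma periodic_sol_diff_bound:
 assumes b: "b>=1" and P: "potential b P P'" and l: "l>0" and g: "gap l P>=e" "e>0"
  and v: "hill_sol l P f v v'" and per: "v (2 * pi)=v 0" "v' (2 * pi)=v' 0"
  and V: "hill_sol l P f V V'" and t: "t\<in>{0..2*pi}"
 shows "pnorm l (%t. v t-V t) (%t. v' t-V' t) t<=ecst b*(phase_jump l V V'/e)"
proof -
 have w: "hill_sol l P (%_. 0) (%t. v t-V t) (%t. v' t-V' t)" using hill_sol_diff[OF v V] by simp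
 let ?n = "pnorm l (%t. v t-V t) (%t. v' t-V' t) 0"
 have n0: "?n>=0" using l by (simp add: pn_nonneg)
 have "e * ?n<=gap l P * ?n" using g n0 by (intro mult_right_mono) auto
 also have "... <= phase_jump l (%t. v t-V t) (%t. v' t-V' t)" by (rule gap_le_jump[OF l w])
 also have "... = phase_jump l V V'"
 proof -
  have "(v (2*pi)-V (2*pi))-(v 0-V 0) = - (V (2*pi)-V 0)" "(v' (2*pi)-V' (2*pi))-(v' 0-V' 0) = - (V' (2*pi)-V' 0)" using per by auto
  then show ?thesis unfolding phase_jump_def by (simp only: abs_minus_cancel)
 qed
 finally have "?n<=phase_jump l V V'/e" using g by (simp add: field_simps)
 moreover have "pnorm l (%t. v t-V t) (%t. v' t-V' t) t<=ecst b*(?n+0)" by (rule pn_growth[OF b P less_imp_le[OF l] w]) (use t in auto)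
 ultimately show ?thesis using ec_ge_1[OF b] by (smt (verit) mult_left_mono)
qed

text \<open>Uses the supremum of the forcing alone and therefore lacks the factor \<open>1/l\<close>
  of \<open>periodic_sol_bound\<close>. It is the version for the uniqueness proof, where the
  forcing contains a potential that is only continuous.\<close>

lemma periodic_sol_bound_C0:
 assumes b: "b>=1" and P: "potential b P P'" and l: "l>0" and g: "gap l P>=e" "0<e" "e<=1"
  and v: "hill_sol l P f v v'" and per: "!!t. v (t+2 * pi)=v t" "!!t. v' (t+2 * pi)=v' t"
  and cf: "cts f" and bf: "!!t. abs(f t)<=M" and t: "t\<in>{0..2*pi}"
 shows "pnorm l v v' t<=2*(ecst b)^2 * M/e"
proof -
 let ?K = "ecst b"
 have K: "?K>=1" using ec_ge_1[OF b] .
 have M0: "M>=0" using bf[of 0] by linarith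
 obtain V V' where V: "hill_sol l P f V V'" "V 0=0" "V' 0=0" using hill_sol_exists[OF P cf bf] .
 have VN: "pnorm l V V' t <= ?K * M" if "t\<in>{0..2*pi}" for t using pn_growth[OF b P less_imp_le[OF l] V(1), of M 0 t] bf V(2,3) that by (simp add: pnorm_def)
 have "phase_jump l V V'=pnorm l V V' (2 * pi)" using V by (simp add: phase_jump_def pnorm_def)
 then have J: "phase_jump l V V' <= ?K * M" using VN[of "2*pi"] by simp
 have "pnorm l v v' t<=pnorm l (%t. v t-V t) (%t. v' t-V' t) t+pnorm l V V' t"
 proof -
  have "l * abs(v t)<=l*(abs(v t-V t)+abs(V t))" using l by (intro mult_left_mono) auto
  then show ?thesis unfolding pnorm_def distrib_left by linarith
 qed
 also have "... <= ?K*(phase_jump l V V'/e) + ?K * M" using per[of 0] by (intro add_mono periodic_sol_diff_bound[OF b P l g(1,2) v _ _ V(1) t] VN[OF t]) auto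
 also have "... <= ?K*(?K * M/e) + ?K*(?K * M/e)"
 proof (intro add_mono mult_left_mono divide_right_mono J)
  have "1 * M <= ?K * M" using K M0 by (intro mult_right_mono) auto
  also have "... <= ?K * M/e" using g K M0 by (simp add: pos_le_divide_eq mult_left_le)
  finally show "M <= ?K * M/e" by simp
 qed (use K g in auto)
 also have "... = 2 * ?K^2 * M/e" by (simp add: power2_eq_square)
 finally show ?thesis .
qed

text \<open>One constant bounds the supremum and the integral of the absolute weak derivative over a
  period. Real and imaginary parts of \<open>H1\<close> functions and periodic functions of class C1
  both fall under this notion.\<close>

definition forcing :: "real => (real => real) => bool" where
 "forcing M f \<longleftrightarrow> cts f&(\<forall>t. f (t+2 * pi)=f t)&(\<forall>t. abs(f t)<=M) &
    (\<exists>w. sil {0..2 * pi} w &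
       (\<forall>t\<in>{0..2 * pi}. f t-f 0=(LINT s:{0..t}|lborel. w s)) &
       (JT s. abs(w s))<=M)"

section \<open>Integration by parts and the gain of one power of the frequency\<close>

lemma set_integral_FTC:
 fixes F f :: "real => real"
 assumes "a<=b" and "!!t. (F hrd f t) (at t)" and "cts f"
 shows "(LINT t:{a..b}|lborel. f t)=F b-F a" unfolding sli
proof (rule integral_FTC_atLeastAtMost[OF assms(1)])
 show "(F hvd f t) (at t within {a..b})" for t using assms(2)[of t] by (auto simp: hrv intro: has_vector_derivative_at_within)
 show "continuous_on {a..b} f" using assms(3) by (rule continuous_on_subset) simp
qed

text \<open>Fubini for \<open>w s * g' t\<close> over the triangle \<open>0 <= s <= t <= T\<close>:
  integrating in \<open>t\<close> first produces \<open>g T - g s\<close>, integrating in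
  \<open>s\<close> first produces \<open>f t - f 0\<close>.\<close>

lemma integral_by_parts_absolutely_continuous:
 fixes f w g g' :: "real => real"
 assumes w: "sil {0..T} w" and T: "T>=0"
  and f: "!!t. t\<in>{0..T}==>f t-f 0=(LINT s:{0..t}|lborel. w s)"
  and g: "!!t. (g hrd g' t) (at t)" and g': "cts g'"
 shows "sil {0..T} (%t. f t * g' t)" "sil {0..T} (%t. w t * g t)"
  "(LINT t:{0..T}|lborel. f t * g' t)=f T * g T-f 0 * g 0-(LINT t:{0..T}|lborel. w t * g t)"
proof -
 have gc: "cts g" by (rule DERIV_continuous_on[OF has_field_derivative_at_within], rule g)
 have bnd: "\<exists>B. \<forall>t\<in>{0..T}. abs(h t)<=B" if "cts h" for h :: "real => real"
 proof -
  have "compact (h ` {0..T})" using that by (intro compact_continuous_image) (auto intro: continuous_on_subset)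
  then show ?thesis by (auto dest!: compact_imp_bounded simp: bounded_iff)
 qed
 obtain B where B: "!!t. t\<in>{0..T}==>abs(g t)<=B" using bnd[OF gc] by blast
 obtain B' where B': "!!t. t\<in>{0..T}==>abs(g' t)<=B'" using bnd[OF g'] by blast
 have gm[measurable]: "g\<in>bM" "g'\<in>bM" using gc g' by (auto intro: bmcI)
 have wm[measurable]: "(%t. indicator {0..T} t *\<^sub>R w t)\<in>borel_measurable lborel" using w unfolding sid by auto
 define W where "W=(%t. indicator {0..T} t *\<^sub>R w t)"
 have Wi: "integrable lborel W" using w by (simp add: W_def sid)
 have Wm[measurable]: "W\<in>bM" using wm by (simp add: W_def)
 show wg: "sil {0..T} (%t. w t * g t)" unfolding sid
 proof (rule Bochner_Integration.integrable_bound)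
  show "integrable lborel (%t. B * W t)" using Wi by simp
  have "(%t. indicator {0..T} t *\<^sub>R (w t * g t))=(%t. W t * g t)" by (auto simp: W_def indicator_def)
  then show "(%t. indicator {0..T} t *\<^sub>R (w t * g t))\<in>borel_measurable lborel" by simp
  show "AE x in lborel. norm (indicator {0..T} x *\<^sub>R (w x * g x))<=norm (B * W x)"
  proof (rule AE_I2)
   fix x show "norm (indicator {0..T} x *\<^sub>R (w x * g x))<=norm (B * W x)" using B[of x] by (auto simp: W_def indicator_def abs_mult mult.commute intro!: mult_right_mono)
  qed
 qed
 define H where "H=(%(s,t). W s*(indicator {s..T} t * g' t))"
 have Hm[measurable]: "H\<in>borel_measurable (lborel \<Otimes>\<^sub>M lborel)"
 proof -
  have "(%p::real\<times>real. indicator {p. fst p<=snd p&snd p<=T} p * g' (snd p) * W (fst p))\<in>borel_measurable (borel \<Otimes>\<^sub>M borel)" by measurable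
  moreover have "H=(%p::real\<times>real. indicator {p. fst p<=snd p&snd p<=T} p * g' (snd p) * W (fst p))" by (auto simp: H_def indicator_def)
  ultimately show ?thesis by simp
 qed
 have inner: "(\<integral>t. H (s,t) \<partial>lborel)=W s*(g T-g s)" for s
 proof (cases "s\<in>{0..T}")
  case True
  have "(LINT t:{s..T}|lborel. g' t)=g T-g s" by (rule set_integral_FTC) (use True g g' in auto)
  then show ?thesis by (simp add: H_def sli)
 next
  case False
  then show ?thesis by (simp add: H_def W_def)
 qed
 have innerb: "integrable lborel (%t. H (s,t))" for s
 proof (cases "s\<in>{0..T}")
  case True
  have "sil {s..T} g'" by (rule borel_integrable_compact[unfolded sid[symmetric]]) (auto intro: continuous_on_subset[OF g'])
  then show ?thesis by (simp add: H_def sid)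
 next
  case False
  then show ?thesis by (simp add: H_def W_def)
 qed
 have Hint: "integrable (lborel \<Otimes>\<^sub>M lborel) H"
 proof (rule lborel_pair.Fubini_integrable[OF Hm])
  show "AE x in lborel. integrable lborel (%y. H (x,y))" using innerb by simp
  show "integrable lborel (%x. \<integral>y. norm (H (x,y)) \<partial>lborel)"
  proof (rule Bochner_Integration.integrable_bound)
   show "integrable lborel (%s. B' * T * W s)" using Wi by simp
   show "(%x. \<integral>y. norm (H (x,y)) \<partial>lborel)\<in>borel_measurable lborel" by measurable
   show "AE s in lborel. norm (\<integral>y. norm (H (s,y)) \<partial>lborel)<=norm (B' * T * W s)"
   proof (rule AE_I2)
    fix s
    have B0: "B'>=0" using B'[of 0] T by force
    have "(\<integral>y. norm (H (s,y)) \<partial>lborel)<=(\<integral>y. (abs(W s) * B') * indicator {0..T} y \<partial>lborel)"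
    proof (rule integral_mono)
     show "integrable lborel (%y. norm (H (s,y)))" using innerb by auto
     show "integrable lborel (%y. (abs(W s) * B') * indicator {0..T} y)" using T by (intro integrable_mult_right) auto
     fix y show "norm (H (s,y))<=(abs(W s) * B') * indicator {0..T} y" using B'[of y] B0 by (auto simp: H_def W_def indicator_def abs_mult intro!: mult_left_mono)
    qed
    also have "... = abs(W s) * B' * T" using T by simp
    finally show "norm (\<integral>y. norm (H (s,y)) \<partial>lborel)<=norm (B' * T * W s)" using T B0 by (simp add: abs_mult mult_ac)
   qed
  qed
 qed
 have outer: "(\<integral>s. H (s,t) \<partial>lborel)=indicator {0..T} t*((f t-f 0) * g' t)" for t
 proof (cases "t\<in>{0..T}")
  case True
  have "(%s. H (s,t))=(%s. (indicator {0..t} s *\<^sub>R w s) * g' t)" using True by (auto simp: H_def W_def indicator_def)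
  then have "(\<integral>s. H (s,t) \<partial>lborel)=(LINT s:{0..t}|lborel. w s) * g' t" by (simp add: sli)
  then show ?thesis using f[OF True] True by simp
 next
  case False
  have "H (s,t)=0" for s using False by (auto simp: H_def W_def indicator_def)
  then show ?thesis using False by simp
 qed
 have i1: "integrable lborel (%t. indicator {0..T} t*((f t-f 0) * g' t))" using lborel_pair.integrable_snd[of "%s t. H (s,t)"] Hint outer by simp
 have gi: "sil {0..T} g'" by (rule borel_integrable_compact[unfolded sid[symmetric]]) (auto intro: continuous_on_subset[OF g'])
 have gi': "integrable lborel (%t. f 0*(indicator {0..T} t * g' t))" using gi by (simp add: sid)
 have e: "(%t. indicator {0..T} t*(f t * g' t))=(%t. indicator {0..T} t*((f t-f 0) * g' t)+f 0*(indicator {0..T} t * g' t))" by (auto simp: algebra_simps)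
 show "sil {0..T} (%t. f t * g' t)" unfolding sid real_scaleR_def e by (intro Bochner_Integration.integrable_add i1 gi')
 have FTC: "(\<integral>t. indicator {0..T} t * g' t \<partial>lborel)=g T-g 0" using set_integral_FTC[OF T g g'] by (simp add: sli)
 have fT: "f T-f 0=(\<integral>s. W s \<partial>lborel)" using f[of T] T by (simp add: W_def sli)
 have "(\<integral>t. indicator {0..T} t*((f t-f 0) * g' t) \<partial>lborel)=(\<integral>s. W s*(g T-g s) \<partial>lborel)" using lborel_pair.Fubini_integral[of "%s t. H (s,t)"] Hint inner outer by simp
 also have "... = (\<integral>s. g T * W s-W s * g s \<partial>lborel)" by (simp add: algebra_simps)
 also have "... = g T*(f T-f 0)-(LINT t:{0..T}|lborel. w t * g t)"
 proof (subst Bochner_Integration.integral_diff)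
  show "integrable lborel (%s. g T * W s)" using Wi by simp
  have *: "(%t. indicator {0..T} t *\<^sub>R (w t * g t))=(%t. W t * g t)" by (auto simp: W_def indicator_def)
  show "integrable lborel (%s. W s * g s)" using wg unfolding sid * .
  show "(\<integral>s. g T * W s \<partial>lborel)-(\<integral>s. W s * g s \<partial>lborel)=g T*(f T-f 0)-(LINT t:{0..T}|lborel. w t * g t)" unfolding sli * using fT by simp
 qed
 finally have "(\<integral>t. indicator {0..T} t*((f t-f 0) * g' t) \<partial>lborel)=g T*(f T-f 0)-(LINT t:{0..T}|lborel. w t * g t)" .
 moreover have "(LINT t:{0..T}|lborel. f t * g' t)=(\<integral>t. indicator {0..T} t*((f t-f 0) * g' t) \<partial>lborel)+f 0*(g T-g 0)" unfolding sli real_scaleR_def e using FTC by (subst Bochner_Integration.integral_add[OF i1 gi']) (simp add: mult.commute)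
 ultimately show "(LINT t:{0..T}|lborel. f t * g' t)=f T * g T-f 0 * g 0-(LINT t:{0..T}|lborel. w t * g t)" by (simp add: algebra_simps)
qed

lemma set_integral_abs_le:
 fixes f :: "real => real"
 assumes "sil A f"
 shows "abs(LINT t:A|lborel. f t)<=(LINT t:A|lborel. abs(f t))" using integral_norm_bound[of lborel "%t. indicator A t *\<^sub>R f t"] unfolding sli by (simp add: abs_mult)

text \<open>The equation is tested against homogeneous solutions \<open>w\<close>, and \<open>w\<close> is replaced by
 \<open>- w'' / (l\<^sup>2 P)\<close>; integrating by parts once gains a factor \<open>1 / l\<close> over the bound in terms of
 the supremum of the forcing alone.\<close>

lemma wronskian_forcing_bound:
 assumes b: "b>=1" and P: "potential b P P'" and l: "l>0"
  and v: "hill_sol l P f v v'" and f: "forcing M f" and w: "hill_sol l P (%_. 0) w w'"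
  and wb: "!!t. t\<in>{0..2*pi}==>abs(w' t)<=B" and T: "T\<in>{0..2*pi}"
 shows "abs((v' T * w T-(v T-f T/(l^2 * P T)) * w' T)-(v' 0 * w 0-(v 0-f 0/(l^2 * P 0)) * w' 0))
    <= 8 * b^3 * M * B/l^2"
proof -
 have fc: "cts f" and fb: "!!t. abs(f t)<=M" using f unfolding forcing_def by auto
 obtain h where h: "sil {0..2 * pi} h"
  "!!t. t\<in>{0..2 * pi}==>f t-f 0=(LINT s:{0..t}|lborel. h s)" "(JT s. abs(h s))<=M" using f unfolding forcing_def by blast
 have M0: "M>=0" using fb[of 0] by linarith
 have B0: "B>=0" using wb[of 0] by force
 have sub: "{0..T}\<subseteq>{0..2*pi}" using T by auto
 have hT: "sil {0..T} h" using set_integrable_subset[OF h(1) _ sub] by simp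
 have Pp: "P t>0" "P t~=0" "1/P t<=b" for t
 proof -
  show "P t>0" using potentialD(2)[OF P, of t] b by (smt (verit) divide_pos_pos)
  then show "P t~=0" "1/P t<=b" using potentialD(2)[OF P, of t] b by (auto simp: field_simps)
 qed
 define g where "g t=w' t/P t" for t
 define g' where "g' t = - l\<^sup>2 * w t-w' t * P' t/(P t)^2" for t
 have gd: "(g hrd g' t) (at t)" for t unfolding g_def[abs_def] g'_def using Pp(2)[of t] by (auto intro!: derivative_eq_intros hill_solD[OF w] potentialD(1)[OF P] simp: field_simps power2_eq_square)
 have g'c: "cts g'" unfolding g'_def[abs_def] using Pp(2) by (intro continuous_intros hill_sol_cont[OF w] potential_cont[OF P] potentialD(6)[OF P]) auto
 have gb: "abs(g t)<=b * B" if "t\<in>{0..2*pi}" for t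
 proof -
  have "abs(g t)=abs(w' t)*(1/P t)" using Pp(1)[of t] by (simp add: g_def)
  also have "... <= B * b" using wb[OF that] Pp[of t] B0 by (intro mult_mono) (auto intro: less_imp_le)
  finally show ?thesis by (simp add: mult.commute)
 qed
 note parts = integral_by_parts_absolutely_continuous[OF hT _ _ gd g'c, of f]
 have p1: "sil {0..T} (%t. f t * g' t)"
  and p2: "sil {0..T} (%t. h t * g t)"
  and p3: "(LINT t:{0..T}|lborel. f t * g' t)=f T * g T-f 0 * g 0-(LINT t:{0..T}|lborel. h t * g t)" using parts h(2) T by auto
 define r where "r t=f t * w' t * P' t/(P t)^2" for t
 have rc: "cts r" unfolding r_def[abs_def] using Pp(2) by (intro continuous_intros fc hill_sol_cont[OF w] potential_cont[OF P] potentialD(6)[OF P]) auto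
 have ri: "sil {0..T} r" by (rule borel_integrable_compact[unfolded sid[symmetric]]) (auto intro: continuous_on_subset[OF rc])
 have rb: "abs(r t)<=M * B * b^3" if "t\<in>{0..2*pi}" for t
 proof -
  have "abs(r t)=(abs(f t) * abs(w' t))*(abs(P' t)*(1/P t*(1/P t)))" by (simp add: r_def abs_mult power2_eq_square)
  also have "... <= (M * B)*(b*(b * b))" using fb[of t] wb[OF that] potentialD(4)[OF P, of t] Pp[of t] M0 B0 b by (intro mult_mono) (auto intro: less_imp_le)
  finally show ?thesis by (simp add: power3_eq_cube)
 qed
 have ft: "l^2*(f t * w t) = - (f t * g' t)-r t" for t by (simp add: g'_def r_def algebra_simps)
 have W: "(LINT t:{0..T}|lborel. f t * w t)=(v' T * w T-v T * w' T)-(v' 0 * w 0-v 0 * w' 0)"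
 proof -
  define G where "G t=v' t * w t-v t * w' t" for t
  have "(LINT t:{0..T}|lborel. f t * w t)=G T-G 0"
  proof (rule set_integral_FTC)
   show "0<=T" using T by simp
   show "cts (%t. f t * w t)" by (intro continuous_intros fc hill_sol_cont(1)[OF w])
   show "(G hrd f t * w t) (at t)" for t unfolding G_def[abs_def] by (auto intro!: derivative_eq_intros hill_solD[OF w] hill_solD[OF v] simp: algebra_simps)
  qed
  then show ?thesis by (simp add: G_def)
 qed
 have "l^2*(LINT t:{0..T}|lborel. f t * w t)=(LINT t:{0..T}|lborel. - (f t * g' t)-r t)" unfolding ft[symmetric] by simp
 also have "... = - (LINT t:{0..T}|lborel. f t * g' t)-(LINT t:{0..T}|lborel. r t)"
 proof -
  have "(%t. indicator {0..T} t *\<^sub>R (- (f t * g' t)-r t))=(%t. - (indicator {0..T} t *\<^sub>R (f t * g' t))-indicator {0..T} t *\<^sub>R r t)" by (auto simp: algebra_simps)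
  then show ?thesis using p1 ri unfolding sli sid by (simp only: Bochner_Integration.integral_diff Bochner_Integration.integral_minus integrable_minus)
 qed
 finally have eq: "l^2*((v' T * w T-v T * w' T)-(v' 0 * w 0-v 0 * w' 0))+f T * g T-f 0 * g 0
     = (LINT t:{0..T}|lborel. h t * g t)-(LINT t:{0..T}|lborel. r t)" unfolding W p3 by simp
 have "abs(LINT t:{0..T}|lborel. h t * g t)<=(LINT t:{0..T}|lborel. abs(h t * g t))" by (rule set_integral_abs_le[OF p2])
 also have "... <= (JT t. abs(h t)*(b * B))" unfolding sli
 proof (rule integral_mono)
  show "integrable lborel (%t. indicator {0..T} t *\<^sub>R (abs(h t * g t)))" using set_integrable_abs[OF p2] by (simp add: sid)
  show "integrable lborel (%t. indicator {0..2*pi} t *\<^sub>R (abs(h t)*(b * B)))" using set_integrable_abs[OF h(1)] by (simp add: sid mult.assoc[symmetric])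
  fix t show "indicator {0..T} t *\<^sub>R (abs(h t * g t))<=indicator {0..2*pi} t *\<^sub>R (abs(h t)*(b * B))" using gb[of t] sub B0 b by (auto simp: indicator_def abs_mult intro!: mult_left_mono)
 qed
 also have "... = (JT t. abs(h t))*(b * B)" by simp
 also have "... <= M*(b * B)" using h(3) b B0 by (intro mult_right_mono) auto
 also have "... <= M * B * b^3"
 proof -
  have "b<=b^3" using b by (simp add: self_le_power)
  then have "M * B * b<=M * B * b^3" using M0 B0 by (intro mult_left_mono) auto
  then show ?thesis by (simp add: mult_ac)
 qed
 finally have 1: "abs(LINT t:{0..T}|lborel. h t * g t)<=M * B * b^3" .
 have "abs(LINT t:{0..T}|lborel. r t)<=(LINT t:{0..T}|lborel. abs(r t))" by (rule set_integral_abs_le[OF ri])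
 also have "... <= (JT t. M * B * b^3)" unfolding sli
 proof (rule integral_mono)
  show "integrable lborel (%t. indicator {0..T} t *\<^sub>R (abs(r t)))" using set_integrable_abs[OF ri] by (simp add: sid)
  show "integrable lborel (%t. indicator {0..2*pi} t *\<^sub>R (M * B * b^3))" by simp
  fix t show "indicator {0..T} t *\<^sub>R (abs(r t))<=indicator {0..2*pi} t *\<^sub>R (M * B * b^3)" using rb[of t] sub B0 b M0 by (auto simp: indicator_def)
 qed
 also have "... = 2 * pi*(M * B * b^3)" by (simp add: sli)
 also have "... <= 7*(M * B * b^3)" using pi_approx M0 B0 b by (intro mult_right_mono) (auto simp: pi_approx)
 finally have 2: "abs(LINT t:{0..T}|lborel. r t)<=7*(M * B * b^3)" .
 \<comment> \<open>The boundary terms \<open>f * g = f * w' / P\<close> of the integration by parts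
   join the Wronskian; they are the origin of the corrected function
   \<open>v - f / (l^2 * P)\<close>.\<close>
 have "l^2*((v' T * w T-(v T-f T/(l^2 * P T)) * w' T)-(v' 0 * w 0-(v 0-f 0/(l^2 * P 0)) * w' 0))
    = l^2*((v' T * w T-v T * w' T)-(v' 0 * w 0-v 0 * w' 0))+f T * g T-f 0 * g 0" using l Pp(2) by (simp add: g_def field_simps)
 then have "abs(l^2*((v' T * w T-(v T-f T/(l^2 * P T)) * w' T)-(v' 0 * w 0-(v 0-f 0/(l^2 * P 0)) * w' 0)))
    <= 8 * b^3 * M * B"
 proof -
  have "8 * b^3 * M * B=M * B * b^3+7*(M * B * b^3)" by (simp add: algebra_simps)
  then have *: "abs(X)<=8 * b^3 * M * B" if "X=Y" "Y=A-R" "abs(A)<=M * B * b^3" "abs(R)<=7*(M * B * b^3)" for X Y A R using that by linarith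
  assume "l^2*((v' T * w T-(v T-f T/(l^2 * P T)) * w' T)-(v' 0 * w 0-(v 0-f 0/(l^2 * P 0)) * w' 0))
    = l^2*((v' T * w T-v T * w' T)-(v' 0 * w 0-v 0 * w' 0))+f T * g T-f 0 * g 0"
  then show ?thesis by (rule *[OF _ eq 1 2])
 qed
 then show ?thesis using l by (simp add: abs_mult pos_le_divide_eq mult.commute)
qed

text \<open>In \<open>periodic_sol_bound\<close> three contributions are each estimated by
  \<open>ecst b / e\<close> times \<open>16 * ecst b * b^3 * M / l\<close>.\<close>

definition fcst :: "real => real" where
 "fcst b=48*(ecst b)^2 * b^3"

text \<open>Testing with the homogeneous solutions that have data \<open>(0, 1)\<close> and
  \<open>(1, 0)\<close> at \<open>T\<close> reads off the two components at \<open>T\<close>. The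
  data of \<open>v\<close> at 0 are chosen so that the boundary term there vanishes.\<close>

lemma corrected_phase_bound:
 assumes b: "b>=1" and P: "potential b P P'" and l: "l>0"
  and v: "hill_sol l P f v v'" and f: "forcing M f" and T: "T\<in>{0..2*pi}"
  and v0: "v 0=f 0/(l^2 * P 0)" "v' 0=0"
 shows "l * abs(v T-f T/(l^2 * P T))+abs(v' T)<=16 * ecst b * b^3 * M/l"
proof -
 let ?K = "ecst b"
 obtain w w' where w: "hill_sol l P (%_. 0) w w'" "w T=0" "w' T=1" using hs_exists_hom[OF P] .
 have wb: "abs(w' t) <= ?K" if "t\<in>{0..2*pi}" for t using pn_growth[OF b P less_imp_le[OF l] w(1), of 0 T t] that T w(2,3) l by (simp add: pnorm_def) (smt (verit) mult_nonneg_nonneg abs_ge_zero)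
 have 1: "abs(v T-f T/(l^2 * P T))<=8 * b^3 * M * ?K/l^2" using wronskian_forcing_bound[OF b P l v f w(1) wb T] v0 w(2,3) by simp
 obtain u u' where u: "hill_sol l P (%_. 0) u u'" "u T=1" "u' T=0" using hs_exists_hom[OF P] .
 have ub: "abs(u' t) <= ?K * l" if "t\<in>{0..2*pi}" for t using pn_growth[OF b P less_imp_le[OF l] u(1), of 0 T t] that T u(2,3) l by (simp add: pnorm_def) (smt (verit) mult_nonneg_nonneg abs_ge_zero)
 have 2: "abs(v' T)<=8 * b^3 * M*(?K * l)/l^2" using wronskian_forcing_bound[OF b P l v f u(1) ub T] v0 u(2,3) by simp
 have "l * abs(v T-f T/(l^2 * P T))<=l*(8 * b^3 * M * ?K/l^2)" using 1 l by (intro mult_left_mono) auto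
 also have "... = 8 * b^3 * M * ?K/l" using l by (simp add: power2_eq_square)
 finally show ?thesis using 2 l by (simp add: power2_eq_square field_simps)
qed

text \<open>The comparison solution \<open>V\<close> starts on \<open>f / (l^2 * P)\<close>. This
  function is periodic, so the jump of \<open>V\<close> is its corrected phase at
  \<open>2 * pi\<close> and inherits the gain \<open>1/l\<close>.\<close>

lemma periodic_sol_bound:
 assumes b: "b>=1" and P: "potential b P P'" and l: "l>0" and g: "gap l P>=e" "0<e" "e<=1"
  and v: "hill_sol l P f v v'" and per: "!!t. v (t+2 * pi)=v t" "!!t. v' (t+2 * pi)=v' t"
  and f: "forcing M f" and t: "t\<in>{0..2*pi}"
 shows "pnorm l v v' t<=fcst b * M/(l * e)"
proof -
 let ?K = "ecst b"
 let ?h = "%t. f t/(l^2 * P t)"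
 let ?A = "16 * ?K * b^3 * M/l"
 have K: "?K>=1" using ec_ge_1[OF b] .
 have fc: "cts f" and fb: "!!t. abs(f t)<=M" and fp: "!!t. f (t+2 * pi)=f t" using f unfolding forcing_def by auto
 have M0: "M>=0" using fb[of 0] by linarith
 have b3: "b^3>=b" "b^3>=1" using b by (auto simp: self_le_power one_le_power)
 obtain V V' where V: "hill_sol l P f V V'" "V 0 = ?h 0" "V' 0=0" using hill_sol_exists[OF P fc fb] .
 have Vb: "l * abs(V T - ?h T)+abs(V' T) <= ?A" if "T\<in>{0..2*pi}" for T by (rule corrected_phase_bound[OF b P l V(1) f that V(2,3)])
 have "?h (2 * pi) = ?h 0" using fp[of 0] potentialD(5)[OF P, of 0] by simp
 then have "phase_jump l V V'=l * abs(V (2*pi) - ?h (2*pi))+abs(V' (2*pi))" using V by (simp add: phase_jump_def)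
 then have J: "phase_jump l V V' <= ?A" using Vb[of "2*pi"] by simp
 have h: "l * abs(?h t)<=b * M/l"
 proof -
  have Pp: "P t>0" using potentialD(2)[OF P, of t] b by (smt (verit) divide_pos_pos)
  have Pi: "1/P t<=b" using potentialD(2)[OF P, of t] Pp b by (auto simp: field_simps)
  have "l * abs(?h t)=(abs(f t)*(1/P t))/l" using l Pp by (simp add: abs_mult power2_eq_square)
  also have "... <= (M * b)/l" using fb[of t] Pi Pp l M0 by (intro divide_right_mono mult_mono) auto
  finally show ?thesis by (simp add: mult.commute)
 qed
 have "pnorm l v v' t<=pnorm l (%t. v t-V t) (%t. v' t-V' t) t+(l * abs(V t - ?h t)+abs(V' t))+l * abs(?h t)"
 proof -
  have "l * abs(v t)<=l*(abs(v t-V t)+abs(V t - ?h t)+abs(?h t))" using l by (intro mult_left_mono) (linarith, simp)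
  then show ?thesis unfolding pnorm_def distrib_left by linarith
 qed
 also have "... <= ?K*(phase_jump l V V'/e) + ?A+b * M/l" using per[of 0] by (intro add_mono periodic_sol_diff_bound[OF b P l g(1,2) v _ _ V(1) t] Vb[OF t] h) auto
 also have "... <= ?K*(?A/e) + ?K*(?A/e) + ?K*(?A/e)"
 proof (intro add_mono mult_left_mono divide_right_mono J)
  have A0: "?A>=0" using K M0 l b by simp
  have "1 * ?A <= ?K * ?A" using K A0 by (intro mult_right_mono) auto
  also have "... <= ?K*(?A/e)" using g K A0 mult_left_le[of e ?A] by (intro mult_left_mono) (auto simp only: pos_le_divide_eq)
  finally show *: "?A <= ?K*(?A/e)" by simp
  have "b*1<=b^3*(16 * ?K)" using b3 K b by (intro mult_mono) auto
  then have "b * M/l<=(b^3*(16 * ?K)) * M/l" using M0 l by (intro divide_right_mono mult_right_mono) auto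
  also have "... = ?A" by (simp add: mult_ac)
  finally show "b * M/l <= ?K*(?A/e)" using * by linarith
 qed (use K g in auto)
 also have "... = fcst b * M/(l * e)" by (simp add: fcst_def power2_eq_square mult_ac)
 finally show ?thesis .
qed

lemma periodic_reduce:
 fixes v w :: "real => 'a"
 assumes "!!t. v (t+2 * pi)=v t" "!!t. w (t+2 * pi)=w t"
 obtains s where "s\<in>{0..<2*pi}" "v t=v s" "w t=w s"
proof -
 have up: "f (s+real n*(2 * pi))=f s" if "!!t. f (t+2 * pi)=f t" for f :: "real => 'a" and s n
 proof (induction n)
  case (Suc n)
  have "s+real (Suc n)*(2 * pi)=(s+real n*(2 * pi))+2 * pi" by (simp add: algebra_simps)
  then show ?case using that Suc by metis
 qed simp
 define k where "k = \<lfloor>t/(2 * pi)\<rfloor>"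
 define s where "s=t - of_int k*(2 * pi)"
 have "of_int k<=t/(2 * pi)" "t/(2 * pi) < of_int k+1" unfolding k_def by linarith+
 then have s: "s\<in>{0..<2*pi}" unfolding s_def by (auto simp: field_simps)
 have eq: "f t=f s" if "!!t. f (t+2 * pi)=f t" for f :: "real => 'a"
 proof (cases "k>=0")
  case True
  then have "t=s+real (nat k)*(2 * pi)" by (simp add: s_def)
  then show ?thesis using up[where f = f, OF that, of s "nat k"] by simp
 next
  case False
  then have "s=t+real (nat (- k))*(2 * pi)" by (simp add: s_def)
  then show ?thesis using up[where f = f, OF that, of t "nat (- k)"] by simp
 qed
 show ?thesis by (rule that[OF s eq eq]) (use assms in auto)
qed

text \<open>Makes the difference of two solutions available as a right-hand side. Here and in other
  estimates 7 is an upper bound for \<open>2 * pi\<close>.\<close>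

lemma forcing_C1:
 assumes d: "!!t. (f hrd f' t) (at t)" and c: "cts f'"
  and p: "!!t. f (t+2 * pi)=f t" and bf: "!!t. abs(f t)<=A" and bf': "!!t. abs(f' t)<=A"
 shows "forcing (7 * A) f" unfolding forcing_def
proof (intro conjI allI exI ballI)
 have A0: "A>=0" using bf[of 0] by linarith
 show "cts f" by (rule DERIV_continuous_on[OF has_field_derivative_at_within], rule d)
 show "f (t+2 * pi)=f t" for t by (rule p)
 show "abs(f t)<=7 * A" for t using bf[of t] A0 by linarith
 show i: "sil {0..2 * pi} f'" by (rule borel_integrable_compact[unfolded sid[symmetric]]) (auto intro: continuous_on_subset[OF c])
 show "f t-f 0=(LINT s:{0..t}|lborel. f' s)" if "t\<in>{0..2 * pi}" for t using set_integral_FTC[OF _ d c, of 0 t] that by simp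
 have "(JT s. abs(f' s))<=(JT s. A)" unfolding sli
 proof (rule integral_mono)
  show "integrable lborel (%s. indicator {0..2 * pi} s *\<^sub>R (abs(f' s)))" using set_integrable_abs[OF i] by (simp add: sid)
  show "integrable lborel (%s. indicator {0..2 * pi} s *\<^sub>R A)" by simp
 qed (use bf' in \<open>auto simp: indicator_def\<close>)
 also have "... = 2 * pi * A" by (simp add: sli)
 also have "... <= 7 * A" using pi_approx A0 by (intro mult_right_mono) auto
 finally show "(JT s. abs(f' s))<=7 * A" .
qed

section \<open>The cut-off periodic solution operator and its Lipschitz bound\<close>

definition cutoff :: "real => real" where
 "cutoff x=max 0 (min 1 (x-1))"

lemma cutoff_props: "0<=cutoff x" "cutoff x<=1" "abs(cutoff x-cutoff y)<=abs(x-y)"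
 "x<=1==>cutoff x=0" "x>=2==>cutoff x=1" by (auto simp: cutoff_def max_def min_def abs_if)

definition psol :: "real => (real => real) => (real => real) => (real => real)\<times>(real => real)" where
 "psol l P f=(SOME z. hill_sol l P f (fst z) (snd z) &
     (\<forall>t. fst z (t+2 * pi)=fst z t)&(\<forall>t. snd z (t+2 * pi)=snd z t))"

text \<open>Below the level \<open>e\<close> the value is 0 by fiat, since a periodic solution may
  fail to exist there; \<open>cutoff\<close> interpolates linearly between \<open>e\<close> and
  \<open>2 * e\<close>. Wherever the gap is at least \<open>2 * e\<close> the operator gives the
  true periodic solution.\<close>

definition cut_sol :: "real => real => (real => real) => (real => real) => real => real" where
 "cut_sol l e P f t=(if gap l P<=e then 0 else cutoff (gap l P/e) * fst (psol l P f) t)"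

definition cut_sol' :: "real => real => (real => real) => (real => real) => real => real" where
 "cut_sol' l e P f t=(if gap l P<=e then 0 else cutoff (gap l P/e) * snd (psol l P f) t)"

lemma psol_props:
 assumes b: "b>=1" and P: "potential b P P'" and l: "l>0" and g: "gap l P>=e" "0<e" "e<=1"
  and f: "forcing M f"
 shows "hill_sol l P f (fst (psol l P f)) (snd (psol l P f))"
  "fst (psol l P f) (t+2 * pi)=fst (psol l P f) t"
  "snd (psol l P f) (t+2 * pi)=snd (psol l P f) t"
  "pnorm l (fst (psol l P f)) (snd (psol l P f)) t<=fcst b * M/(l * e)"
proof -
 have fc: "cts f" and fb: "!!t. abs(f t)<=M" and fp: "!!t. f (t+2 * pi)=f t" using f unfolding forcing_def by auto
 have g0: "gap l P>0" using g by linarith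
 obtain v v' where v: "hill_sol l P f v v'" "!!t. v (t+2 * pi)=v t" "!!t. v' (t+2 * pi)=v' t" by (rule periodic_sol_exists[OF b P l g0 fc fp fb]) blast
 have *: "hill_sol l P f (fst (psol l P f)) (snd (psol l P f)) &
     (\<forall>t. fst (psol l P f) (t+2 * pi)=fst (psol l P f) t) &
     (\<forall>t. snd (psol l P f) (t+2 * pi)=snd (psol l P f) t)" unfolding psol_def by (rule someI[of _ "(v,v')"]) (use v in auto)
 then show "hill_sol l P f (fst (psol l P f)) (snd (psol l P f))"
  and p1: "fst (psol l P f) (t+2 * pi)=fst (psol l P f) t"
  and p2: "snd (psol l P f) (t+2 * pi)=snd (psol l P f) t" for t by auto
 obtain s where s: "s\<in>{0..<2*pi}" "fst (psol l P f) t=fst (psol l P f) s"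
  "snd (psol l P f) t=snd (psol l P f) s" using periodic_reduce[of "fst (psol l P f)" "snd (psol l P f)" t] * by auto
 have "pnorm l (fst (psol l P f)) (snd (psol l P f)) s<=fcst b * M/(l * e)" by (rule periodic_sol_bound[OF b P l g _ _ _ f]) (use * s in auto)
 then show "pnorm l (fst (psol l P f)) (snd (psol l P f)) t<=fcst b * M/(l * e)" using s by (simp add: pnorm_def)
qed

lemma fcst_pos: "b>=1==>fcst b>=1"
proof -
 assume b: "b>=1"
 have "1*(1*1)<=48*((ecst b)^2 * b^3)" using b ec_ge_1[OF b] by (intro mult_mono) (auto simp: one_le_power)
 then show ?thesis by (simp add: fcst_def mult.assoc)
qed

lemma cut_sol_props:
 assumes b: "b>=1" and P: "potential b P P'" and l: "l>0" and e: "0<e" "e<=1"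
  and f: "forcing M f"
 shows "(cut_sol l e P f hrd cut_sol' l e P f t) (at t)"
  "cts (cut_sol' l e P f)"
  "cut_sol l e P f (t+2 * pi)=cut_sol l e P f t"
  "cut_sol' l e P f (t+2 * pi)=cut_sol' l e P f t"
  "pnorm l (cut_sol l e P f) (cut_sol' l e P f) t<=fcst b * M/(l * e)"
  "gap l P>=2 * e==>hill_sol l P f (cut_sol l e P f) (cut_sol' l e P f)"
proof -
 have M0: "M>=0" using f unfolding forcing_def by (meson abs_ge_zero order_trans)
 have nn: "fcst b * M/(l * e)>=0" using M0 l e fcst_pos[OF b] by simp
 let ?v = "fst (psol l P f)" and ?v' = "snd (psol l P f)"
 let ?c = "cutoff (gap l P/e)"
 show "gap l P>=2 * e==>hill_sol l P f (cut_sol l e P f) (cut_sol' l e P f)"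
 proof -
  assume g: "gap l P>=2 * e"
  have "?c=1" using g e by (intro cutoff_props(5)) (simp add: field_simps)
  moreover have "\<not> gap l P<=e" using g e by simp
  ultimately have "cut_sol l e P f = ?v" "cut_sol' l e P f = ?v'" by (auto simp: cut_sol_def cut_sol'_def)
  then show ?thesis using psol_props(1)[OF b P l _ e f] g e by simp
 qed
 have "(cut_sol l e P f hrd cut_sol' l e P f t) (at t)&cts (cut_sol' l e P f) &
    cut_sol l e P f (t+2 * pi)=cut_sol l e P f t&cut_sol' l e P f (t+2 * pi)=cut_sol' l e P f t &
    pnorm l (cut_sol l e P f) (cut_sol' l e P f) t<=fcst b * M/(l * e)"
 proof (cases "gap l P<=e")
  case True
  then have "cut_sol l e P f=(%t. 0)" "cut_sol' l e P f=(%t. 0)" by (auto simp: cut_sol_def cut_sol'_def)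
  then show ?thesis using nn by (auto simp: pnorm_def)
 next
  case False
  then have eq: "cut_sol l e P f=(%t. ?c * ?v t)" "cut_sol' l e P f=(%t. ?c * ?v' t)" by (auto simp: cut_sol_def cut_sol'_def)
  have g: "gap l P>=e" using False by simp
  note pp = psol_props[OF b P l g e f]
  have "pnorm l (%t. ?c * ?v t) (%t. ?c * ?v' t) t = ?c * pnorm l ?v ?v' t" using cutoff_props(1)[of "gap l P/e"] by (simp add: pnorm_def abs_mult algebra_simps)
  also have "... <= 1 * pnorm l ?v ?v' t" using cutoff_props(2) l by (intro mult_right_mono pn_nonneg) auto
  finally have "pnorm l (%t. ?c * ?v t) (%t. ?c * ?v' t) t<=fcst b * M/(l * e)" using pp(4)[of t] by linarith
  then show ?thesis unfolding eq using pp(2,3)[of t] hill_solD(1)[OF pp(1)] hill_sol_cont(2)[OF pp(1)] by (auto intro!: DERIV_cmult continuous_intros)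
 qed
 then show "(cut_sol l e P f hrd cut_sol' l e P f t) (at t)"
  "cts (cut_sol' l e P f)"
  "cut_sol l e P f (t+2 * pi)=cut_sol l e P f t"
  "cut_sol' l e P f (t+2 * pi)=cut_sol' l e P f t"
  "pnorm l (cut_sol l e P f) (cut_sol' l e P f) t<=fcst b * M/(l * e)" by auto
qed

text \<open>The first summand is the cost of comparing two periodic solutions, the second that of
  comparing two cut-off factors.\<close>

definition lip_const :: "real => real" where
 "lip_const b=14*(fcst b)^2+(ecst b)^2 * fcst b"

text \<open>The difference of the solutions is periodic and is driven by
  \<open>l^2 * (Q - P) * u\<close>. This forcing is of class C1, so the bound with gain
  \<open>1/l\<close> is used twice, once for \<open>u\<close> and once for the difference, and
  cancels \<open>l^2\<close>. Its derivative contains \<open>Q' - P'\<close>, which is why the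
  derivatives of the potentials must be close too.\<close>

lemma periodic_sol_lipschitz:
 assumes b: "b>=1" and P: "potential b P P'" and Q: "potential b Q Q'" and l: "l>=1"
  and e: "0<e" "e<=1" and g: "gap l P>=e" "gap l Q>=e" and f: "forcing M f"
  and D: "!!t. abs(P t-Q t)<=D" "!!t. abs(P' t-Q' t)<=D"
 shows "pnorm l (%t. fst (psol l P f) t-fst (psol l Q f) t)
     (%t. snd (psol l P f) t-snd (psol l Q f) t) t
    <= 14*(fcst b)^2 * M/e^2 * D"
proof -
 let ?C = "fcst b"
 have l0: "l>0" using l by simp
 have D0: "D>=0" using D(1)[of 0] by linarith
 let ?v = "fst (psol l P f)" and ?v' = "snd (psol l P f)"
 let ?u = "fst (psol l Q f)" and ?u' = "snd (psol l Q f)"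
 note vp = psol_props[OF b P l0 g(1) e f]
 note up = psol_props[OF b Q l0 g(2) e f]
 define N where "N = ?C * M/(l * e)"
 have N: "l * abs(?u t)+abs(?u' t)<=N" for t using up(4)[of t] by (simp add: pnorm_def N_def)
 have N1: "l * abs(?u t)<=N" "abs(?u' t)<=N" for t using N[of t] l0 mult_nonneg_nonneg[of l "abs(?u t)"] abs_ge_zero[of "?u' t"] by linarith+
 have N0: "N>=0" using N1(2)[of 0] by linarith
 define F where "F t=l^2*(Q t-P t) * ?u t" for t
 define F' where "F' t=l^2*((Q' t-P' t) * ?u t+(Q t-P t) * ?u' t)" for t
 have w: "hill_sol l P F (%t. ?v t - ?u t) (%t. ?v' t - ?u' t)"
 proof -
  have "hill_sol l P (%t. f t+l^2*(P t-Q t) * ?u t) ?u ?u'" by (rule hill_sol_change_potential[OF up(1)])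
  from hill_sol_diff[OF vp(1) this]
  have "hill_sol l P (%t. f t-(f t+l^2*(P t-Q t) * ?u t)) (%t. ?v t - ?u t) (%t. ?v' t - ?u' t)" .
  moreover have "(%t. f t-(f t+l^2*(P t-Q t) * ?u t))=F" by (rule ext) (simp add: F_def algebra_simps)
  ultimately show ?thesis by simp
 qed
 have "forcing (7*(2 * l^2 * D * N)) F"
 proof (rule forcing_C1)
  fix t
  show "(F hrd F' t) (at t)" unfolding F_def[abs_def] F'_def by (auto intro!: derivative_eq_intros potentialD(1)[OF P] potentialD(1)[OF Q] hill_solD(1)[OF up(1)] simp: algebra_simps)
  show "cts F'" unfolding F'_def[abs_def] by (intro continuous_intros potentialD(6)[OF P] potentialD(6)[OF Q] potential_cont[OF P] potential_cont[OF Q] hill_sol_cont[OF up(1)])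
  show "F (t+2 * pi)=F t" unfolding F_def by (simp add: potentialD(5)[OF P] potentialD(5)[OF Q] up(2))
  have a: "abs(?u t)<=N" using N1(1)[of t] l mult_right_mono[OF l abs_ge_zero[of "?u t"]] by linarith
  have "abs(F t)=l^2*(abs(P t-Q t) * abs(?u t))" by (simp add: F_def abs_mult abs_minus_commute)
  also have "... <= l^2*(D * N)" using D(1)[of t] a D0 by (intro mult_left_mono mult_mono) auto
  finally show "abs(F t)<=2 * l^2 * D * N" using D0 N0 mult_nonneg_nonneg[of "l^2" "D * N"] by simp
  have "abs(F' t)=l^2 * abs((Q' t-P' t) * ?u t+(Q t-P t) * ?u' t)" by (simp add: F'_def abs_mult)
  also have "... <= l^2*(abs(P' t-Q' t) * abs(?u t)+abs(P t-Q t) * abs(?u' t))" using abs_triangle_ineq[of "(Q' t-P' t) * ?u t" "(Q t-P t) * ?u' t"] by (intro mult_left_mono) (auto simp: abs_mult abs_minus_commute)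
  also have "... <= l^2*(D * N+D * N)" using D[of t] a N1(2)[of t] D0 by (intro mult_left_mono add_mono mult_mono) auto
  finally show "abs(F' t)<=2 * l^2 * D * N" by simp
 qed
 moreover have pw: "?v (t+2 * pi) - ?u (t+2 * pi) = ?v t - ?u t" "?v' (t+2 * pi) - ?u' (t+2 * pi) = ?v' t - ?u' t" for t using vp(2,3)[of t] up(2,3)[of t] by auto
 ultimately have le: "pnorm l (%t. ?v t - ?u t) (%t. ?v' t - ?u' t) s <= ?C*(7*(2 * l^2 * D * N))/(l * e)"
  if "s\<in>{0..2*pi}" for s by (intro periodic_sol_bound[OF b P l0 g(1) e w]) (use that in auto)
 obtain s where s: "s\<in>{0..<2*pi}" "?v t - ?u t = ?v s - ?u s" "?v' t - ?u' t = ?v' s - ?u' s" using periodic_reduce[of "%t. ?v t - ?u t" "%t. ?v' t - ?u' t" t] pw by auto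
 have "pnorm l (%t. ?v t - ?u t) (%t. ?v' t - ?u' t) t <= ?C*(7*(2 * l^2 * D * N))/(l * e)" using le[of s] s by (simp add: pnorm_def)
 also have "... = 14 * ?C^2 * M/e^2 * D" using l0 e by (simp add: N_def power2_eq_square field_simps)
 finally show ?thesis .
qed

text \<open>If only one potential lies above the level, the cut-off factor of the other is 0, so the
  remaining solution carries a difference of cut-off factors. The factor \<open>l\<close> in the
  Lipschitz bound of the gap is cancelled by the \<open>1/l\<close> in the size of the
  solution.\<close>

lemma cut_sol_lipschitz:
 assumes b: "b>=1" and P: "potential b P P'" and Q: "potential b Q Q'" and l: "l>=1"
  and e: "0<e" "e<=1" and f: "forcing M f"
  and D: "!!t. abs(P t-Q t)<=D" "!!t. abs(P' t-Q' t)<=D"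
 shows "pnorm l (%t. cut_sol l e P f t-cut_sol l e Q f t) (%t. cut_sol' l e P f t-cut_sol' l e Q f t) t
    <= lip_const b * M/e^2 * D"
proof -
 let ?C = "fcst b" and ?K = "ecst b"
 have l0: "l>0" using l by simp
 have M0: "M>=0" using f unfolding forcing_def by (meson abs_ge_zero order_trans)
 have D0: "D>=0" using D(1)[of 0] by linarith
 have C: "?C>=1" using fcst_pos[OF b] .
 let ?cP = "cutoff (gap l P/e)" and ?cQ = "cutoff (gap l Q/e)"
 have cc: "abs(?cP - ?cQ) <= ?K^2 * l * D/e"
 proof -
  have "abs(?cP - ?cQ)<=abs(gap l P/e-gap l Q/e)" by (rule cutoff_props)
  also have "... = abs(gap l P-gap l Q)/e" using e by (simp add: diff_divide_distrib[symmetric])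
  also have "... <= ?K^2 * l * D/e" using gap_lipschitz[OF b P Q l0 D(1)] e by (intro divide_right_mono) auto
  finally show ?thesis .
 qed
 have key: "abs(c1-c2) * n <= ?K^2 * ?C * M/e^2 * D" if "abs(c1-c2) <= ?K^2 * l * D/e" "n <= ?C * M/(l * e)" "n>=0" for c1 c2 n
 proof -
  have "abs(c1-c2) * n<=(?K^2 * l * D/e)*(?C * M/(l * e))" using that D0 l0 e by (intro mult_mono) auto
  also have "... = ?K^2 * ?C * M/e^2 * D" using l0 e by (simp add: power2_eq_square)
  finally show ?thesis .
 qed
 have t2: "lip_const b * M/e^2 * D=14 * ?C^2 * M/e^2 * D + ?K^2 * ?C * M/e^2 * D" by (simp add: lip_const_def algebra_simps add_divide_distrib)
 have nn: "0<=14 * ?C^2 * M/e^2 * D" "0 <= ?K^2 * ?C * M/e^2 * D" using C M0 D0 by auto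
 have scale: "pnorm l (%t. c * x t) (%t. c * y t) t=abs(c) * pnorm l x y t" for c x y by (simp add: pnorm_def abs_mult algebra_simps)
 consider "gap l P<=e" "gap l Q<=e" | "gap l P>e" "gap l Q<=e" | "gap l P<=e" "gap l Q>e" | "gap l P>e" "gap l Q>e" by linarith
 then show ?thesis
 proof cases
  case 1
  then show ?thesis using nn t2 by (simp add: cut_sol_def cut_sol'_def pnorm_def)
 next
  case 2
  have z: "?cQ=0" using 2 e by (intro cutoff_props(4)) simp
  have "pnorm l (%t. cut_sol l e P f t-cut_sol l e Q f t) (%t. cut_sol' l e P f t-cut_sol' l e Q f t) t
       = abs(?cP - ?cQ) * pnorm l (fst (psol l P f)) (snd (psol l P f)) t" using 2 z by (simp add: cut_sol_def cut_sol'_def scale)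
  also have "... <= ?K^2 * ?C * M/e^2 * D" by (rule key[OF cc]) (use psol_props(4)[OF b P l0 _ e f] pn_nonneg 2 l0 in auto)
  finally show ?thesis using nn t2 by linarith
 next
  case 3
  have z: "?cP=0" using 3 e by (intro cutoff_props(4)) simp
  have "pnorm l (%t. cut_sol l e P f t-cut_sol l e Q f t) (%t. cut_sol' l e P f t-cut_sol' l e Q f t) t
       = abs(?cP - ?cQ) * pnorm l (fst (psol l Q f)) (snd (psol l Q f)) t" using 3 z scale[of "- ?cQ" "fst (psol l Q f)" "snd (psol l Q f)"] by (simp add: cut_sol_def cut_sol'_def)
  also have "... <= ?K^2 * ?C * M/e^2 * D" by (rule key[OF cc]) (use psol_props(4)[OF b Q l0 _ e f] pn_nonneg 3 l0 in auto)
  finally show ?thesis using nn t2 by linarith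
 next
  case 4
  let ?v = "fst (psol l P f)" and ?v' = "snd (psol l P f)"
  let ?u = "fst (psol l Q f)" and ?u' = "snd (psol l Q f)"
  have tri: "pnorm l (%t. x t+y t) (%t. x' t+y' t) t<=pnorm l x x' t+pnorm l y y' t" for x x' y y' using mult_left_mono[OF abs_triangle_ineq[of "x t" "y t"], of l] abs_triangle_ineq[of "x' t" "y' t"] l0 unfolding pnorm_def distrib_left by linarith
  have "pnorm l (%t. cut_sol l e P f t-cut_sol l e Q f t) (%t. cut_sol' l e P f t-cut_sol' l e Q f t) t
      = pnorm l (%t. ?cP*(?v t - ?u t)+(?cP - ?cQ) * ?u t) (%t. ?cP*(?v' t - ?u' t)+(?cP - ?cQ) * ?u' t) t" using 4 by (simp add: cut_sol_def cut_sol'_def algebra_simps)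
  also have "... <= abs(?cP) * pnorm l (%t. ?v t - ?u t) (%t. ?v' t - ?u' t) t+abs(?cP - ?cQ) * pnorm l ?u ?u' t" using tri[of "%t. ?cP*(?v t - ?u t)" "%t. (?cP - ?cQ) * ?u t" "%t. ?cP*(?v' t - ?u' t)" "%t. (?cP - ?cQ) * ?u' t"] unfolding scale .
  also have "... <= 1*(14 * ?C^2 * M/e^2 * D) + ?K^2 * ?C * M/e^2 * D"
  proof (rule add_mono[OF mult_mono])
   show "abs(?cP)<=1" using cutoff_props(1,2)[of "gap l P/e"] by simp
   show "pnorm l (%t. ?v t - ?u t) (%t. ?v' t - ?u' t) t<=14 * ?C^2 * M/e^2 * D" by (rule periodic_sol_lipschitz[OF b P Q l e _ _ f D]) (use 4 in auto)
   show "abs(?cP - ?cQ) * pnorm l ?u ?u' t <= ?K^2 * ?C * M/e^2 * D" by (rule key[OF cc]) (use psol_props(4)[OF b Q l0 _ e f] pn_nonneg 4 l0 in auto)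
  qed (use l0 in \<open>auto simp: pn_nonneg\<close>)
  finally show ?thesis using t2 by simp
 qed
qed

section \<open>Clustering of near-resonant parameters\<close>

lemma gram_three_vectors:
 fixes A B C c :: real
 defines "q \<equiv> %x y x' y'. A * x * x'+B*(x * y'+y * x')+C * y * y'"
 assumes c: "c>0" and d: "q x1 y1 x1 y1>=c" "q x2 y2 x2 y2>=c" "q x3 y3 x3 y3>=c"
 shows "abs(q x1 y1 x2 y2)>=c/2 \<or> abs(q x1 y1 x3 y3)>=c/2 \<or> abs(q x2 y2 x3 y3)>=c/2"
proof (rule ccontr)
 assume neg: "\<not> ?thesis"
 define a1 a2 a3 where "a1=q x1 y1 x1 y1" and "a2=q x2 y2 x2 y2" and "a3=q x3 y3 x3 y3"
 define u v w where "u=q x1 y1 x2 y2" and "v=q x1 y1 x3 y3" and "w=q x2 y2 x3 y3"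
 have a: "a1>=c" "a2>=c" "a3>=c" using d by (auto simp: a1_def a2_def a3_def)
 have o: "abs(u)<c/2" "abs(v)<c/2" "abs(w)<c/2" using neg by (auto simp: u_def v_def w_def)
 \<comment> \<open>The Gram determinant of three vectors in a plane vanishes. If all off-diagonal
   entries were below \<open>c/2\<close>, it would exceed \<open>a1 * a2 * a3\<close> times
   \<open>1 - 3/4 - 2/8 = 0\<close>.\<close>
 have det: "a1 * a2 * a3+2 * u * v * w-a1 * w^2-a2 * v^2-a3 * u^2=0" unfolding a1_def a2_def a3_def u_def v_def w_def q_def power2_eq_square by algebra
 have sq: "x^2<c^2/4" if "abs(x)<c/2" for x :: real using power_strict_mono[OF that, of 2] c by (simp add: power_divide)
 have t: "z * x^2<z*(p * r)/4" if "abs(x)<c/2" "z>=c" "p>=c" "r>=c" for x z p r :: real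
 proof -
  have "z * x^2<z*(c^2/4)" using sq[OF that(1)] that c by (intro mult_strict_left_mono) auto
  also have "... <= z*((p * r)/4)" using that c by (intro mult_left_mono) (auto simp: power2_eq_square intro!: mult_mono)
  finally show ?thesis by simp
 qed
 have 1: "a1 * w^2<a1*(a2 * a3)/4" "a2 * v^2<a2*(a1 * a3)/4" "a3 * u^2<a3*(a1 * a2)/4" using t o a by auto
 have "abs(u * v * w)<=c/2*(c/2)*(c/2)" unfolding abs_mult using o c by (intro mult_mono) auto
 also have "... = c * c * c/8" by simp
 also have "... <= a1 * a2 * a3/8" using a c by (intro divide_right_mono mult_mono) auto
 finally have 2: "abs(u * v * w)<=a1 * a2 * a3/8" .
 show False using det 1 2 by (simp add: mult_ac)
qed

text \<open>\<open>4 * b + 5\<close> is the sum of the factors 4, \<open>4 * b\<close> and 1 of the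
  potential terms left over by equipartition; \<open>(ecst b)^2\<close> carries the phase norm from
  time 0 to time \<open>t\<close>.\<close>

definition mass_const :: "real => real" where
 "mass_const b=1/((ecst b)^2*(4 * b+5))"

lemma mass_const_pos: "b>=1==>mass_const b>0" using ec_ge_1[of b] by (simp add: mass_const_def zero_less_power)

text \<open>Equipartition: integrating \<open>(\<zeta> v v' - \<zeta>' v\<^sup>2 / 2)'\<close> with \<open>\<zeta> = 1 - cos\<close> shows that the kinetic
 part of the energy is controlled by the potential part.\<close>

lemma hom_sol_mass_lower_bound:
 assumes b: "b>=1" and P: "potential b P P'" and l: "l>=1" and v: "hill_sol l P (%_. 0) v v'"
 shows "integral {0..2*pi} (%t. (l * v t)^2)>=mass_const b*(pnorm l v v' 0)^2"
proof -
 let ?K = "ecst b" and ?n = "pnorm l v v' 0"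
 have K: "?K>=1" using ec_ge_1[OF b] .
 define G where "G t=(1-cos t) * v t * v' t-sin t*(v t)^2/2" for t
 define G' where "G' t=(1-cos t)*(v' t)^2-(1-cos t)*(l^2 * P t*(v t)^2)-cos t*(v t)^2/2" for t
 have Gd: "(G hrd G' t) (at t)" for t unfolding G_def[abs_def] G'_def by (auto intro!: derivative_eq_intros hill_solD[OF v] simp: algebra_simps power2_eq_square)
 have Gi: "(G' has_integral G (2*pi)-G 0) {0..2*pi}" by (rule fundamental_theorem_of_calculus)
    (use Gd in \<open>auto simp: hrv[symmetric] intro: has_field_derivative_at_within\<close>)
 \<comment> \<open>\<open>1 - cos\<close> and its derivative vanish at both ends, so the boundary
   terms drop out although \<open>v\<close> is in general not periodic.\<close>
 then have Gi: "(G' has_integral 0) {0..2*pi}" by (simp add: G_def)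
 have vc: "cts v" using hill_sol_cont[OF v] by auto
 have i: "(%t. (l * v t)^2) integrable_on {0..2*pi}" by (intro integrable_continuous_real continuous_intros continuous_on_subset[OF vc]) auto
 have R: "((%t. 2 * G' t+(4 * b+5)*(l * v t)^2) has_integral 2*0+(4 * b+5) * integral {0..2*pi} (%t. (l * v t)^2)) {0..2*pi}" by (intro has_integral_add has_integral_mult_right Gi integrable_integral i)
 have "((%t. 1-cos t) has_integral (2*pi-sin (2*pi))-(0-sin 0)) {0..2*pi}" by (rule fundamental_theorem_of_calculus)
    (auto simp: hrv[symmetric] intro!: derivative_eq_intros)
 then have "((%t. (1-cos t)*(?n / ?K)^2) has_integral (2 * pi)*(?n / ?K)^2) {0..2*pi}" by (intro has_integral_mult_left) simp
 from has_integral_le[OF this R]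
 have "(2 * pi)*(?n / ?K)^2<=(4 * b+5) * integral {0..2*pi} (%t. (l * v t)^2)"
 proof -
  have "(1-cos t)*(?n / ?K)^2<=2 * G' t+(4 * b+5)*(l * v t)^2" if t: "t\<in>{0..2*pi}" for t
  proof -
   have z: "0<=1-cos t" "1-cos t<=2" using cos_ge_minus_one[of t] cos_le_one[of t] by linarith+
   have "?n <= ?K * pnorm l v v' t" using pn_growth[OF b P _ v, of 0 t 0] t l by auto
   then have "?n / ?K<=pnorm l v v' t" using K by (simp add: pos_divide_le_eq mult.commute)
   then have "(?n / ?K)^2<=(pnorm l v v' t)^2" using K l by (intro power_mono) (auto simp: pn_nonneg)
   also have "... <= 2*(l * v t)^2+2*(v' t)^2" using zero_le_power2[of "abs(v' t)-l * abs(v t)"] unfolding pnorm_def by (simp add: power2_sum power2_diff power_mult_distrib mult_ac)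
   finally have "(1-cos t)*(?n / ?K)^2<=(1-cos t)*(2*(l * v t)^2+2*(v' t)^2)" using z by (intro mult_left_mono)
   moreover have "(1-cos t)*(2*(l * v t)^2+2*(v' t)^2)=2 * G' t+(1-cos t)*(2*(l * v t)^2)+(1-cos t)*(2 * P t*(l * v t)^2)+cos t*(v t)^2" by (simp add: G'_def power_mult_distrib algebra_simps)
   moreover have "(1-cos t)*(2*(l * v t)^2)<=2*(2*(l * v t)^2)" using z by (intro mult_right_mono) auto
   moreover have "(1-cos t)*(2 * P t*(l * v t)^2)<=2*(2 * b*(l * v t)^2)"
   proof -
    have "0<=P t" using potentialD(2)[OF P, of t] b by (auto intro: order_trans[of 0 "1/b"])
    then show ?thesis using z potentialD(3)[OF P, of t] by (intro mult_mono) auto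
   qed
   moreover have "cos t*(v t)^2<=(l * v t)^2"
   proof -
    have "cos t*(v t)^2<=1*(v t)^2" by (intro mult_right_mono) auto
    also have "... <= l^2*(v t)^2" using l by (intro mult_right_mono) (auto simp: one_le_power)
    finally show ?thesis by (simp add: power_mult_distrib)
   qed
   ultimately show ?thesis by (simp add: algebra_simps)
  qed
  then show "(2 * pi)*(?n / ?K)^2<=(4 * b+5) * integral {0..2*pi} (%t. (l * v t)^2)" using has_integral_le[OF \<open>((\<lambda>t. (1 - cos t) * (?n / ?K)\<^sup>2) has_integral (2 * pi) * (?n / ?K)\<^sup>2) {0..2*pi}\<close> R] by simp
 qed
 moreover have "1*(?n / ?K)^2<=(2 * pi)*(?n / ?K)^2" using pi_gt3 by (intro mult_right_mono) auto
 ultimately have *: "(?n / ?K)^2<=(4 * b+5) * integral {0..2*pi} (%t. (l * v t)^2)" by linarith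
 have "mass_const b * ?n^2=(?n / ?K)^2/(4 * b+5)" by (simp add: mass_const_def power_divide)
 also have "... <= integral {0..2*pi} (%t. (l * v t)^2)" using * b by (simp add: pos_divide_le_eq mult.commute)
 finally show ?thesis .
qed

text \<open>Solutions are linear in their data at 0, so the inner product weighted by
  \<open>l^2\<close> is a symmetric bilinear form on a plane, which is the shape
  \<open>gram_three_vectors\<close> works with.\<close>

lemma hom_sol_bilinear:
 assumes b: "b>=1" and P: "potential b P P'" and l: "l>0"
 shows "\<exists>A B C. \<forall>v v' w w'. hill_sol l P (%_. 0) v v'-->hill_sol l P (%_. 0) w w' -->
    integral {0..2*pi} (%t. (l * v t)*(l * w t))=A * v 0 * w 0+B*(v 0 * w' 0+v' 0 * w 0)+C * v' 0 * w' 0"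
proof -
 obtain p p' where p: "hill_sol l P (%_. 0) p p'" "p 0=1" "p' 0=0" using hs_exists_hom[OF P] .
 obtain q q' where q: "hill_sol l P (%_. 0) q q'" "q 0=0" "q' 0=1" using hs_exists_hom[OF P] .
 have rep: "v t=v 0 * p t+v' 0 * q t" if v: "hill_sol l P (%_. 0) v v'" for v v' t
 proof -
  have "hill_sol l P (%_. 0) (%t. v t-(v 0 * p t+v' 0 * q t)) (%t. v' t-(v 0 * p' t+v' 0 * q' t))" using hill_sol_diff[OF v hill_sol_add[OF hill_sol_scale[OF p(1), of "v 0"] hill_sol_scale[OF q(1), of "v' 0"]]] by simp
  from hill_sol_zero(1)[OF b P l this, of 0 t] show ?thesis using p q by simp
 qed
 have c: "continuous_on {0..2*pi} p" "continuous_on {0..2*pi} q" using hill_sol_cont(1)[OF p(1)] hill_sol_cont(1)[OF q(1)] by (auto intro: continuous_on_subset)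
 show ?thesis
 proof (intro exI allI impI)
  fix v v' w w' assume v: "hill_sol l P (%_. 0) v v'" and w: "hill_sol l P (%_. 0) w w'"
  have "(%t. (l * v t)*(l * w t))=(%t. (v 0 * w 0)*(l^2 * p t * p t)+((v 0 * w' 0+v' 0 * w 0)*(l^2 * p t * q t)+(v' 0 * w' 0)*(l^2 * q t * q t)))" by (rule ext, subst rep[OF v], subst rep[OF w]) (simp add: power2_eq_square algebra_simps)
  moreover have "integral {0..2*pi} ... = (v 0 * w 0) * integral {0..2*pi} (%t. l^2 * p t * p t) +
      ((v 0 * w' 0+v' 0 * w 0) * integral {0..2*pi} (%t. l^2 * p t * q t)+(v' 0 * w' 0) * integral {0..2*pi} (%t. l^2 * q t * q t))" by (intro integral_unique has_integral_add has_integral_mult_right integrable_integral integrable_continuous_real continuous_intros c)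
  ultimately show "integral {0..2*pi} (%t. (l * v t)*(l * w t))=integral {0..2*pi} (%t. l^2 * p t * p t) * v 0 * w 0 +
       integral {0..2*pi} (%t. l^2 * p t * q t)*(v 0 * w' 0+v' 0 * w 0)+integral {0..2*pi} (%t. l^2 * q t * q t) * v' 0 * w' 0" by (simp only: algebra_simps)
 qed
qed

text \<open>The tolerance for treating a difference of potentials as constant. The errors add up to
  \<open>28 + 7 = 35\<close> times \<open>res_const b * (ecst b)^3\<close>, which is below
  \<open>mass_const b / 4\<close> because 35 is less than \<open>160/4\<close>.\<close>

definition res_const :: "real => real" where
 "res_const b=min 1 (mass_const b/(160*(ecst b)^3))"

lemma res_const_pos: "b>=1==>0<res_const b" "b>=1==>res_const b<=1" using mass_const_pos[of b] ec_ge_1[of b] by (auto simp: res_const_def)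

lemma abs_integral_le:
 fixes f :: "real => real"
 assumes "continuous_on {0..2*pi} f" and "!!t. t\<in>{0..2*pi}==>abs(f t)<=B"
 shows "abs(integral {0..2*pi} f)<=7 * B"
proof -
 have B0: "B>=0" using assms(2)[of 0] by force
 have "norm (integral {0..2*pi} f)<=B*(2*pi-0)" by (rule integral_bound) (use assms in auto)
 also have "... <= B*7" using pi_approx B0 by (intro mult_left_mono) auto
 finally show ?thesis by simp
qed

text \<open>The Wronskian of \<open>v\<close> and \<open>w\<close> has derivative
  \<open>(P - Q) * l^2 * v * w\<close> and nearly equal values at 0 and \<open>2 * pi\<close>,
  because both solutions nearly close up. If \<open>P - Q\<close> is almost the constant
  \<open>a\<close> and \<open>v\<close>, \<open>w\<close> are far from orthogonal, then
  \<open>a\<close> has to be small.\<close>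

lemma near_kernel_pair:
 assumes b: "b>=1" and P: "potential b P P'" and Q: "potential b Q Q'" and l: "l>0" and e: "0<e" "e<=1"
  and v: "hill_sol l P (%_. 0) v v'" "pnorm l v v' 0=1" "phase_jump l v v'<e"
  and w: "hill_sol l Q (%_. 0) w w'" "pnorm l w w' 0=1" "phase_jump l w w'<e"
  and diff: "!!t. abs(P t-Q t-a)<=c * abs(a)" and c: "c>=0"
  and I: "abs(integral {0..2*pi} (%t. (l * v t)*(l * w t)))>=d"
 shows "l*(d-7 * c*(ecst b)^2) * abs(a)<=4 * ecst b * e"
proof -
 let ?K = "ecst b"
 have K: "?K>=1" using ec_ge_1[OF b] .
 have vb: "pnorm l v v' t <= ?K" if "t\<in>{0..2*pi}" for t using pn_growth[OF b P less_imp_le[OF l] v(1), of 0 0 t] that v(2) by auto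
 have wb: "pnorm l w w' t <= ?K" if "t\<in>{0..2*pi}" for t using pn_growth[OF b Q less_imp_le[OF l] w(1), of 0 0 t] that w(2) by auto
 have X: "l * abs(x)<=B" "abs(y)<=B" if "l * abs(x)+abs(y)<=B" for x y B :: real using that mult_nonneg_nonneg[OF less_imp_le[OF l] abs_ge_zero[of x]] by linarith+
 have vc: "continuous_on {0..2*pi} v" and wc: "continuous_on {0..2*pi} w" using hill_sol_cont(1)[OF v(1)] hill_sol_cont(1)[OF w(1)] by (auto intro: continuous_on_subset)
 have Pc: "continuous_on {0..2*pi} P" and Qc: "continuous_on {0..2*pi} Q" using potential_cont[OF P] potential_cont[OF Q] by (auto intro: continuous_on_subset)
 define W where "W t=v t * w' t-v' t * w t" for t
 have "((%t. (P t-Q t)*((l * v t)*(l * w t))) has_integral W (2*pi)-W 0) {0..2*pi}"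
 proof (rule fundamental_theorem_of_calculus)
  fix t
  have "(W hrd (P t-Q t)*((l * v t)*(l * w t))) (at t)" unfolding W_def[abs_def] by (auto intro!: derivative_eq_intros hill_solD[OF v(1)] hill_solD[OF w(1)] simp: algebra_simps power2_eq_square)
  then show "(W hvd (P t-Q t)*((l * v t)*(l * w t))) (at t within {0..2*pi})" by (auto simp: hrv intro: has_vector_derivative_at_within)
 qed simp
 then have Wi: "integral {0..2*pi} (%t. (P t-Q t)*((l * v t)*(l * w t)))=W (2*pi)-W 0" by (rule integral_unique)
 have Wb: "l * abs(W (2*pi)-W 0)<=4 * ?K * e"
 proof -
  have jv: "l * abs(v (2*pi)-v 0)<=e" "abs(v' (2*pi)-v' 0)<=e" using X v(3) unfolding phase_jump_def by (meson less_imp_le)+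
  have jw: "l * abs(w (2*pi)-w 0)<=e" "abs(w' (2*pi)-w' 0)<=e" using X w(3) unfolding phase_jump_def by (meson less_imp_le)+
  have v0: "l * abs(v 0) <= ?K" "abs(v' 0) <= ?K" using X vb[of 0] unfolding pnorm_def by auto
  have w2: "l * abs(w (2*pi)) <= ?K" "abs(w' (2*pi)) <= ?K" using X wb[of "2*pi"] unfolding pnorm_def by auto
  have "W (2*pi)-W 0=(v (2*pi)-v 0) * w' (2*pi)+v 0*(w' (2*pi)-w' 0)-(v' (2*pi)-v' 0) * w (2*pi)-v' 0*(w (2*pi)-w 0)" by (simp add: W_def algebra_simps)
  then have "abs(W (2*pi)-W 0)<=abs(v (2*pi)-v 0) * abs(w' (2*pi))+abs(v 0) * abs(w' (2*pi)-w' 0)+abs(v' (2*pi)-v' 0) * abs(w (2*pi))+abs(v' 0) * abs(w (2*pi)-w 0)" unfolding abs_mult[symmetric] by linarith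
  then have "l * abs(W (2*pi)-W 0)<=l*(abs(v (2*pi)-v 0) * abs(w' (2*pi))+abs(v 0) * abs(w' (2*pi)-w' 0)+abs(v' (2*pi)-v' 0) * abs(w (2*pi))+abs(v' 0) * abs(w (2*pi)-w 0))" using l by (intro mult_left_mono) auto
  also have "... = (l * abs(v (2*pi)-v 0)) * abs(w' (2*pi))+(l * abs(v 0)) * abs(w' (2*pi)-w' 0)+abs(v' (2*pi)-v' 0)*(l * abs(w (2*pi)))+abs(v' 0)*(l * abs(w (2*pi)-w 0))" by (simp add: algebra_simps)
  also have "... <= e * ?K + ?K * e+e * ?K + ?K * e" by (intro add_mono mult_mono jv jw v0 w2) (use l e K in \<open>simp_all\<close>)
  finally show ?thesis by (simp add: mult.commute)
 qed
 have "abs(integral {0..2*pi} (%t. (P t-Q t-a)*((l * v t)*(l * w t))))<=7*(c * abs(a)*(?K * ?K))"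
 proof (rule abs_integral_le)
  show "continuous_on {0..2*pi} (%t. (P t-Q t-a)*((l * v t)*(l * w t)))" by (intro continuous_intros Pc Qc vc wc)
  fix t :: real assume t: "t\<in>{0..2*pi}"
  have "l * abs(v t) <= ?K" "l * abs(w t) <= ?K" using X vb[OF t] wb[OF t] unfolding pnorm_def by auto
  then show "abs((P t-Q t-a)*((l * v t)*(l * w t)))<=c * abs(a)*(?K * ?K)" unfolding abs_mult using diff[of t] l c K by (intro mult_mono) auto
 qed
 moreover have "integral {0..2*pi} (%t. (P t-Q t)*((l * v t)*(l * w t))) =
    integral {0..2*pi} (%t. (P t-Q t-a)*((l * v t)*(l * w t)))+a * integral {0..2*pi} (%t. (l * v t)*(l * w t))"
 proof -
  have "((%t. (P t-Q t-a)*((l * v t)*(l * w t))+a*((l * v t)*(l * w t))) has_integral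
      integral {0..2*pi} (%t. (P t-Q t-a)*((l * v t)*(l * w t)))+a * integral {0..2*pi} (%t. (l * v t)*(l * w t))) {0..2*pi}" by (intro has_integral_add has_integral_mult_right integrable_integral integrable_continuous_real continuous_intros Pc Qc vc wc)
  then show ?thesis by (intro integral_unique) (simp add: algebra_simps)
 qed
 moreover have "abs(a) * d<=abs(a * integral {0..2*pi} (%t. (l * v t)*(l * w t)))" unfolding abs_mult using I by (intro mult_left_mono) auto
 ultimately have "abs(a) * d-7*(c * abs(a)*(?K * ?K))<=abs(W (2*pi)-W 0)" using Wi by linarith
 then have "l*(abs(a) * d-7*(c * abs(a)*(?K * ?K)))<=l * abs(W (2*pi)-W 0)" using l by (intro mult_left_mono) auto
 then have "l*(abs(a) * d-7*(c * abs(a)*(?K * ?K)))<=4 * ?K * e" using Wb by linarith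
 then show ?thesis by (simp add: power2_eq_square algebra_simps)
qed

text \<open>16 is the factor 4 of the Wronskian bound times the 4 in the remaining lower bound
  \<open>mass_const b / 4\<close>.\<close>

definition gap_const :: "real => real" where
 "gap_const b=16 * ecst b/mass_const b"

text \<open>Homogeneous solutions form a plane, so of three near-kernel elements at least two are far from
 orthogonal; the Wronskian identity then forces the two parameters to be close.\<close>

lemma three_resonances:
 fixes P P' :: "nat => real => real" and a :: "nat => real"
 assumes b: "b>=1" and l: "l>=1" and e: "0<e" "e<=1"
  and P: "!!j. potential b (P j) (P' j)"
  and diff: "!!j k t. abs(P j t-P k t-(a j-a k))<=res_const b * abs(a j-a k)"
  and close: "!!j k. abs(a j-a k)<=res_const b/l"
  and g: "!!j. gap l (P j)<e"
 shows "abs(a 0-a 1)<=gap_const b * e/l \<or> abs(a 0-a 2)<=gap_const b * e/l \<or> abs(a 1-a 2)<=gap_const b * e/l"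
proof -
 let ?K = "ecst b" and ?c = "res_const b" and ?m = "mass_const b"
 have l0: "l>0" using l by simp
 have K: "?K>=1" using ec_ge_1[OF b] .
 have c: "?c>0" "?c<=1" using res_const_pos[OF b] by auto
 have m: "?m>0" using mass_const_pos[OF b] .
 have cm: "?c*(160 * ?K^3) <= ?m" using K by (simp add: res_const_def pos_le_divide_eq[symmetric])
 have "\<exists>v v'. hill_sol l (P j) (%_. 0) v v'&pnorm l v v' 0=1&phase_jump l v v'<e" for j using gap_attained_approx[OF P l0 g] by metis
 then obtain v v' where v: "!!j. hill_sol l (P j) (%_. 0) (v j) (v' j)" "!!j. pnorm l (v j) (v' j) 0=1"
  "!!j. phase_jump l (v j) (v' j)<e" by metis
 \<comment> \<open>The three near-kernel solutions belong to three potentials. Their initial data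
   are transported to the potential \<open>P 0\<close>, so that the comparison takes place in a
   single plane of solutions.\<close>
 have "\<exists>u u'. hill_sol l (P 0) (%_. 0) u u'&u 0=v j 0&u' 0=v' j 0" for j using hs_exists_hom[OF P] by metis
 then obtain u u' where u: "!!j. hill_sol l (P 0) (%_. 0) (u j) (u' j)" "!!j. u j 0=v j 0" "!!j. u' j 0=v' j 0" by metis
 have un: "pnorm l (u j) (u' j) 0=1" for j using u v(2)[of j] by (simp add: pnorm_def)
 have X: "l * abs(x)<=B" if "l * abs(x)+abs(y)<=B" for x y B :: real using that l0 mult_nonneg_nonneg[of l "abs(x)"] by auto
 have ub: "l * abs(u j t) <= ?K" if "t\<in>{0..2*pi}" for j t using pn_growth[OF b P[of 0] less_imp_le[OF l0] u(1)[of j], of 0 0 t] that un[of j] by (auto simp: pnorm_def intro: X)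
 have vb: "l * abs(v j t) <= ?K" if "t\<in>{0..2*pi}" for j t using pn_growth[OF b P[of j] less_imp_le[OF l0] v(1)[of j], of 0 0 t] that v(2)[of j] by (auto simp: pnorm_def intro: X)
 have uv: "l * abs(u j t-v j t)<=2 * ?K^2 * ?c" if "t\<in>{0..2*pi}" for j t
 proof -
  have "abs(P 0 s-P j s)<=2 * ?c/l" for s
  proof -
   have "abs(P 0 s-P j s) <= ?c * abs(a 0-a j)+abs(a 0-a j)" using diff[of 0 s j] by linarith
   also have "... <= 1*(?c/l) + ?c/l" using close[of 0 j] c l0 by (intro add_mono mult_mono) auto
   finally show ?thesis by simp
  qed
  from phase_norm_perturb[OF b P P l0 this v(1) u(1) u(2) u(3) that]
  have "pnorm l (%t. u j t-v j t) (%t. u' j t-v' j t) t <= ?K^2 * l*(2 * ?c/l)" by (simp add: v(2))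
  also have "... = 2 * ?K^2 * ?c" using l0 by simp
  finally show ?thesis unfolding pnorm_def by (rule X)
 qed
 have uc: "continuous_on {0..2*pi} (u j)" and vc: "continuous_on {0..2*pi} (v j)" for j using hill_sol_cont(1)[OF v(1)] hill_sol_cont(1)[OF u(1)] by (auto intro: continuous_on_subset)
 define q where "q j k=integral {0..2*pi} (%t. (l * u j t)*(l * u k t))" for j k
 obtain A B C where ABC: "\<forall>v v' w w'. hill_sol l (P 0) (%_. 0) v v'-->hill_sol l (P 0) (%_. 0) w w' -->
    integral {0..2*pi} (%t. (l * v t)*(l * w t))=A * v 0 * w 0+B*(v 0 * w' 0+v' 0 * w 0)+C * v' 0 * w' 0" using hom_sol_bilinear[OF b P[of 0] l0] by (elim exE)
 have q: "q j k=A * u j 0 * u k 0+B*(u j 0 * u' k 0+u' j 0 * u k 0)+C * u' j 0 * u' k 0" for j k unfolding q_def using ABC u(1)[of j] u(1)[of k] by simp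
 have qd: "q j j >= ?m" for j using hom_sol_mass_lower_bound[OF b P l u(1), of j] un[of j] by (simp add: q_def power2_eq_square)
 have pair: "abs(a j-a k)<=gap_const b * e/l" if qjk: "abs(q j k) >= ?m/2" for j k
 proof -
  have "abs(integral {0..2*pi} (%t. (l * v j t)*(l * v k t)-(l * u j t)*(l * u k t)))<=7*(4 * ?K^3 * ?c)"
  proof (rule abs_integral_le)
   show "continuous_on {0..2*pi} (%t. (l * v j t)*(l * v k t)-(l * u j t)*(l * u k t))" by (intro continuous_intros uc vc)
   fix t :: real assume t: "t\<in>{0..2*pi}"
   have "(l * v j t)*(l * v k t)-(l * u j t)*(l * u k t) = - ((l*(u j t-v j t))*(l * v k t))-(l * u j t)*(l*(u k t-v k t))" by (simp add: algebra_simps)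
   then have "abs((l * v j t)*(l * v k t)-(l * u j t)*(l * u k t))<=abs((l*(u j t-v j t))*(l * v k t))+abs((l * u j t)*(l*(u k t-v k t)))" by linarith
   also have "... = (l * abs(u j t-v j t))*(l * abs(v k t))+(l * abs(u j t))*(l * abs(u k t-v k t))" using l0 by (simp add: abs_mult)
   also have "... <= (2 * ?K^2 * ?c) * ?K + ?K*(2 * ?K^2 * ?c)" by (intro add_mono mult_mono uv[OF t] ub[OF t] vb[OF t]) (use l0 K c in \<open>simp_all\<close>)
   also have "... = 4 * ?K^3 * ?c" by (simp add: power2_eq_square power3_eq_cube)
   finally show "abs((l * v j t)*(l * v k t)-(l * u j t)*(l * u k t))<=4 * ?K^3 * ?c" .
  qed
  moreover have "integral {0..2*pi} (%t. (l * v j t)*(l * v k t)-(l * u j t)*(l * u k t))=integral {0..2*pi} (%t. (l * v j t)*(l * v k t))-q j k" unfolding q_def by (intro Henstock_Kurzweil_Integration.integral_diff integrable_continuous_real continuous_intros uc vc)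
  ultimately have I: "abs(integral {0..2*pi} (%t. (l * v j t)*(l * v k t))) >= ?m/2-28*(?K^3 * ?c)" using qjk by linarith
  have "l*(?m/2-28*(?K^3 * ?c)-7 * ?c * ?K^2) * abs(a j-a k)<=4 * ?K * e" by (rule near_kernel_pair[OF b P P l0 e v(1) v(2) v(3) v(1) v(2) v(3) diff _ I]) (use c in auto)
  moreover have "?m/4 <= ?m/2-28*(?K^3 * ?c)-7 * ?c * ?K^2"
  proof -
   have "?K^2 <= ?K^3" using K by (intro power_increasing) auto
   then have "?c * ?K^2 <= ?c * ?K^3" using c by (intro mult_left_mono) auto
   moreover have "0 <= ?c * ?K^3" using c K by simp
   moreover have "28*(?K^3 * ?c)=28*(?c * ?K^3)" "7 * ?c * ?K^2=7*(?c * ?K^2)" "?c*(160 * ?K^3)=160*(?c * ?K^3)" by simp_all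
   ultimately show ?thesis using cm by linarith
  qed
  ultimately have "l*(?m/4) * abs(a j-a k)<=4 * ?K * e" using l0 by (smt (verit) mult_left_mono mult_right_mono abs_ge_zero)
  then show ?thesis using l0 m by (simp add: gap_const_def field_simps)
 qed
 have "abs(q 0 1) >= ?m/2 \<or> abs(q 0 2) >= ?m/2 \<or> abs(q 1 2) >= ?m/2" using gram_three_vectors[OF m, of A "u 0 0" B "u' 0 0" C "u 1 0" "u' 1 0" "u 2 0" "u' 2 0"] qd[of 0] qd[of 1] qd[of 2] unfolding q by simp
 then show ?thesis using pair by blast
qed

text \<open>Two points more than \<open>r\<close> apart, if there are any, serve as centres: every
  third point is within \<open>r\<close> of one of them.\<close>

lemma two_clusters:
 fixes S :: "real set"
 assumes three: "!!x y z. x\<in>S==>y\<in>S==>z\<in>S==>abs(x-y)<=r \<or> abs(x-z)<=r \<or> abs(y-z)<=r"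
  and r: "r>=0"
 obtains x y where "S\<subseteq>{x-r..x+r}\<union>{y-r..y+r}"
proof (cases "\<exists>x\<in>S. \<exists>y\<in>S. abs(x-y)>r")
 case True
 then obtain x y where xy: "x\<in>S" "y\<in>S" "abs(x-y)>r" by blast
 have "S\<subseteq>{x-r..x+r}\<union>{y-r..y+r}"
 proof
  fix z assume "z\<in>S"
  then show "z\<in>{x-r..x+r}\<union>{y-r..y+r}" using three[OF xy(1,2), of z] xy(3) by auto
 qed
 then show ?thesis by (rule that)
next
 case False
 show ?thesis
 proof (cases "S={}")
  case True then show ?thesis using that by blast
 next
  case F2: False
  then obtain x where "x\<in>S" by blast
  then have "S\<subseteq>{x-r..x+r}\<union>{x-r..x+r}" using False by force
  then show ?thesis by (rule that)
 qed
qed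

text \<open>The interval is cut into windows of length \<open>h\<close>. Inside a window the
  three-point condition holds without restriction, so the points there fit into two intervals of
  total length \<open>4 * r\<close>.\<close>

lemma cluster_measure:
 fixes S :: "real set"
 assumes S: "S\<in>sets lborel" "S\<subseteq>{a..c}" and ac: "a<=c" and h: "h>0" and r: "r>=0"
  and three: "!!x y z. x\<in>S==>y\<in>S==>z\<in>S==>abs(x-y)<=h==>abs(x-z)<=h==>abs(y-z)<=h ==>
       abs(x-y)<=r \<or> abs(x-z)<=r \<or> abs(y-z)<=r"
 shows "emeasure lborel S<=ennreal (4 * r*((c-a)/h+1))"
proof -
 define n where "n=nat \<lfloor>(c-a)/h\<rfloor> + 1"
 define W where "W k=S\<inter>{a+real k * h..a+(real k+1) * h}" for k
 have cov: "S\<subseteq>(\<Union>k\<in>{..<n}. W k)"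
 proof
  fix x assume x: "x\<in>S"
  then have xa: "a<=x" "x<=c" using S by auto
  define k where "k=nat \<lfloor>(x-a)/h\<rfloor>"
  have nn: "0 <= \<lfloor>(x-a)/h\<rfloor>" using xa h by simp
  have "\<lfloor>(x-a)/h\<rfloor> <= \<lfloor>(c-a)/h\<rfloor>" using xa h by (intro floor_mono divide_right_mono) auto
  then have "k<n" by (simp add: k_def n_def nat_mono le_imp_less_Suc)
  moreover have "real k<=(x-a)/h" "(x-a)/h<real k+1" using nn unfolding k_def by linarith+
  then have "real k * h<=x-a" "x-a<=(real k+1) * h" using h by (auto simp: field_simps)
  then have "x\<in>W k" using x by (auto simp: W_def)
  ultimately show "x\<in>(\<Union>k\<in>{..<n}. W k)" by blast
 qed
 have Wm: "W k\<in>sets lborel" for k using S by (auto simp: W_def)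
 have Wk: "emeasure lborel (W k)<=ennreal (4 * r)" for k
 proof -
  obtain x y where xy: "W k\<subseteq>{x-r..x+r}\<union>{y-r..y+r}"
  proof (rule two_clusters[OF _ r])
   fix x y z assume "x\<in>W k" "y\<in>W k" "z\<in>W k"
   then show "abs(x-y)<=r \<or> abs(x-z)<=r \<or> abs(y-z)<=r" by (intro three) (auto simp: W_def abs_le_iff algebra_simps)
  qed blast
  have "emeasure lborel (W k)<=emeasure lborel ({x-r..x+r}\<union>{y-r..y+r})" by (rule emeasure_mono[OF xy]) auto
  also have "... <= emeasure lborel {x-r..x+r}+emeasure lborel {y-r..y+r}" by (rule emeasure_subadditive) auto
  also have "... = ennreal (2 * r)+ennreal (2 * r)" using r by simp
  also have "... = ennreal (4 * r)" using r by (subst ennreal_plus[symmetric]) auto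
  finally show ?thesis .
 qed
 have "emeasure lborel S<=emeasure lborel (\<Union>k\<in>{..<n}. W k)" by (rule emeasure_mono[OF cov]) (use Wm in auto)
 also have "... <= (\<Sum>k\<in>{..<n}. emeasure lborel (W k))" by (rule emeasure_subadditive_finite) (use Wm in auto)
 also have "... <= (\<Sum>k\<in>{..<n}. ennreal (4 * r))" by (rule sum_mono[OF Wk])
 also have "... = ennreal (real n*(4 * r))" by (simp add: ennreal_mult ennreal_of_nat_eq_real_of_nat r)
 also have "... <= ennreal (4 * r*((c-a)/h+1))"
 proof (rule ennreal_leI)
  have "0<=(c-a)/h" using ac h by simp
  then have "real n<=(c-a)/h+1" by (simp add: n_def)
  then have "real n*(4 * r)<=((c-a)/h+1)*(4 * r)" using r by (intro mult_right_mono) auto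
  then show "real n*(4 * r)<=4 * r*((c-a)/h+1)" by (simp add: mult_ac)
 qed
 finally show ?thesis .
qed

section \<open>Termwise continuity and differentiation of unordered sums\<close>

lemma infsum_tail_less:
 fixes B :: "'i => real"
 assumes "B summable_on I" and "e>0"
 obtains J where "finite J" "J\<subseteq>I" "abs(infsum B (I-J))<e"
proof -
 have "(sum B \<longlongrightarrow> infsum B I) (finite_subsets_at_top I)" using assms(1) by (rule infsum_tendsto)
 then have "eventually (%F. dist (sum B F) (infsum B I)<e) (finite_subsets_at_top I)" using \<open>e > 0\<close> by (rule tendstoD)
 then obtain J where J: "finite J" "J\<subseteq>I" "dist (sum B J) (infsum B I)<e" unfolding eventually_finite_subsets_at_top by blast
 have "infsum B (I-J)=infsum B I-infsum B J" by (rule infsum_Diff) (use assms J in auto)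
 then have "abs(infsum B (I-J))<e" using J by (simp add: dist_real_def abs_minus_commute)
 then show ?thesis using that J by blast
qed

lemma sob:
 fixes f :: "'i => 'b::banach"
 assumes "B summable_on I" "!!i. i\<in>I==>norm (f i)<=B i"
 shows "f summable_on I" "(%i. norm (f i)) summable_on I" "norm (infsum f I)<=infsum B I"
proof -
 show n: "(%i. norm (f i)) summable_on I" by (rule summable_on_comparison_test[OF assms(1)]) (use assms(2) in auto)
 then show "f summable_on I" by (rule abs_summable_summable)
 have "norm (infsum f I)<=(\<Sum>\<^sub>\<infinity>i\<in>I. norm (f i))" using n by (rule norm_infsum_bound)
 also have "... <= infsum B I" by (rule infsum_mono[OF n assms(1) assms(2)])
 finally show "norm (infsum f I)<=infsum B I" .
qed

lemma so_diff:
 fixes f g :: "'i => 'b::banach"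
 assumes "f summable_on I" "g summable_on I"
 shows "(%i. f i-g i) summable_on I" "(\<Sum>\<^sub>\<infinity>i\<in>I. f i-g i)=infsum f I-infsum g I"
proof -
 have g: "(%i. - g i) summable_on I" using assms(2) by (simp add: summable_on_uminus)
 show "(%i. f i-g i) summable_on I" using summable_on_add[OF assms(1) g] by simp
 show "(\<Sum>\<^sub>\<infinity>i\<in>I. f i-g i)=infsum f I-infsum g I" using infsum_add[OF assms(1) g] by (simp add: infsum_uminus)
qed

text \<open>Summable Lipschitz constants at the point \<open>x\<close> suffice: the finite part is
  differentiable, and the remainder contributes at most twice the tail of \<open>B\<close>. The tail
  is made smaller than \<open>e/4\<close>, which leaves \<open>e/2\<close> for the finite
  part.\<close>

lemma has_derivative_infsum:
 fixes f :: "'i => 'a::real_normed_vector => 'b::banach"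
 assumes der: "!!i. i\<in>I==>(f i has_derivative f' i) (at x)"
  and lip: "!!i y. i\<in>I==>norm (f i y-f i x)<=B i * norm (y-x)"
  and bd: "!!i h. i\<in>I==>norm (f' i h)<=B i * norm h"
  and B: "B summable_on I" and sm: "!!y. (%i. f i y) summable_on I"
 shows "((%y. \<Sum>\<^sub>\<infinity>i\<in>I. f i y) has_derivative (%h. \<Sum>\<^sub>\<infinity>i\<in>I. f' i h)) (at x)" unfolding has_derivative_at_alt
proof (intro conjI allI impI)
 have Bh: "(%i. B i * norm h) summable_on J" if "J\<subseteq>I" for h :: 'a and J using summable_on_cmult_left[of B J] summable_on_subset_banach[OF B that] by blast
 have s': "(%i. f' i h) summable_on J" if "J\<subseteq>I" for h J by (rule sob(1)[OF Bh[OF that, of h]]) (use bd that in auto)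
 show "bounded_linear (%h. \<Sum>\<^sub>\<infinity>i\<in>I. f' i h)"
 proof (rule bounded_linear_intro)
  fix h k r
  have l: "f' i (h+k)=f' i h+f' i k" "f' i (r *\<^sub>R h)=r *\<^sub>R f' i h" if "i\<in>I" for i using der[OF that] by (auto dest!: has_derivative_bounded_linear simp: linear_simps)
  show "(\<Sum>\<^sub>\<infinity>i\<in>I. f' i (h+k))=(\<Sum>\<^sub>\<infinity>i\<in>I. f' i h)+(\<Sum>\<^sub>\<infinity>i\<in>I. f' i k)" using l(1) s' by (simp add: infsum_add[symmetric] cong: infsum_cong)
  show "(\<Sum>\<^sub>\<infinity>i\<in>I. f' i (r *\<^sub>R h))=r *\<^sub>R (\<Sum>\<^sub>\<infinity>i\<in>I. f' i h)" using l(2) by (simp add: infsum_scaleR_right[symmetric] cong: infsum_cong)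
  have "norm (\<Sum>\<^sub>\<infinity>i\<in>I. f' i h)<=(\<Sum>\<^sub>\<infinity>i\<in>I. B i * norm h)" by (rule sob(3)[OF Bh[of I]]) (use bd in auto)
  also have "... = norm h * infsum B I" using B by (simp add: infsum_cmult_left mult.commute)
  finally show "norm (\<Sum>\<^sub>\<infinity>i\<in>I. f' i h)<=norm h * infsum B I" .
 qed
 fix e :: real assume e: "0<e"
 obtain J where J: "finite J" "J\<subseteq>I" "abs(infsum B (I-J))<e/4" using infsum_tail_less[OF B, of "e/4"] e by auto
 have "((%y. \<Sum>i\<in>J. f i y) has_derivative (%h. \<Sum>i\<in>J. f' i h)) (at x)" by (intro has_derivative_sum der) (use J in auto)
 then obtain d where d: "d>0" "!!y. norm (y-x)<d ==>
      norm ((\<Sum>i\<in>J. f i y)-(\<Sum>i\<in>J. f i x)-(\<Sum>i\<in>J. f' i (y-x)))<=e/2 * norm (y-x)" unfolding has_derivative_at_alt using e by (meson half_gt_zero)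
 show "\<exists>d>0. \<forall>y. norm (y-x)<d-->norm ((\<Sum>\<^sub>\<infinity>i\<in>I. f i y)-(\<Sum>\<^sub>\<infinity>i\<in>I. f i x)-(\<Sum>\<^sub>\<infinity>i\<in>I. f' i (y-x)))<=e * norm (y-x)"
 proof (intro exI[of _ d] conjI allI impI d(1))
  fix y assume y: "norm (y-x)<d"
  define r where "r i=f i y-f i x-f' i (y-x)" for i
  have rs: "r summable_on I" unfolding r_def[abs_def] by (intro so_diff(1) sm s') auto
  have rb: "norm (r i)<=2*(B i * norm (y-x))" if "i\<in>I" for i using lip[OF that, of y] bd[OF that, of "y-x"] norm_triangle_ineq4[of "f i y-f i x" "f' i (y-x)"] unfolding r_def by linarith
  have "(\<Sum>\<^sub>\<infinity>i\<in>I. f i y)-(\<Sum>\<^sub>\<infinity>i\<in>I. f i x)-(\<Sum>\<^sub>\<infinity>i\<in>I. f' i (y-x))=infsum r I" unfolding r_def[abs_def] by (simp add: so_diff sm s')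
  also have "... = infsum r J+infsum r (I-J)" using infsum_Un_disjoint[of r J "I-J"] rs J summable_on_subset_banach[OF rs] by (simp add: Un_absorb1 Un_Diff_cancel)
  finally have eq: "(\<Sum>\<^sub>\<infinity>i\<in>I. f i y)-(\<Sum>\<^sub>\<infinity>i\<in>I. f i x)-(\<Sum>\<^sub>\<infinity>i\<in>I. f' i (y-x))=infsum r J+infsum r (I-J)" .
  have "infsum r J=(\<Sum>i\<in>J. f i y)-(\<Sum>i\<in>J. f i x)-(\<Sum>i\<in>J. f' i (y-x))" using J(1) by (simp add: r_def sum_subtractf)
  then have 1: "norm (infsum r J)<=e/2 * norm (y-x)" using d(2)[OF y] by simp
  have "norm (infsum r (I-J))<=(\<Sum>\<^sub>\<infinity>i\<in>I-J. 2*(B i * norm (y-x)))" by (rule sob(3)) (use rb Bh[of "I-J"] in \<open>auto intro: summable_on_cmult_right\<close>)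
  also have "... = 2 * norm (y-x) * infsum B (I-J)"
  proof -
   have "(%i. 2*(B i * norm (y-x)))=(%i. (2 * norm (y-x)) * B i)" by (auto simp: mult_ac)
   then show ?thesis by (simp only: infsum_cmult_right')
  qed
  also have "... <= 2 * norm (y-x)*(e/4)" using J(3) by (intro mult_left_mono) auto
  finally have 2: "norm (infsum r (I-J))<=e/2 * norm (y-x)" by simp
  show "norm ((\<Sum>\<^sub>\<infinity>i\<in>I. f i y)-(\<Sum>\<^sub>\<infinity>i\<in>I. f i x)-(\<Sum>\<^sub>\<infinity>i\<in>I. f' i (y-x)))<=e * norm (y-x)" unfolding eq using norm_triangle_ineq[of "infsum r J" "infsum r (I-J)"] 1 2 by (simp add: field_simps)
 qed
qed

lemma has_real_derivative_infsum:
 fixes f f' :: "'i => real => real"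
 assumes der: "!!i t. i\<in>I==>(f i hrd f' i t) (at t)"
  and bd: "!!i t. i\<in>I==>abs(f' i t)<=B i" "!!i t. i\<in>I==>abs(f i t)<=B i"
  and B: "B summable_on I"
 shows "((%t. \<Sum>\<^sub>\<infinity>i\<in>I. f i t) hrd (\<Sum>\<^sub>\<infinity>i\<in>I. f' i t)) (at t)"
proof -
 have "((%t. \<Sum>\<^sub>\<infinity>i\<in>I. f i t) has_derivative (%h. \<Sum>\<^sub>\<infinity>i\<in>I. f' i t * h)) (at t)"
 proof (rule has_derivative_infsum[where B = B])
  fix i assume i: "i\<in>I"
  show "(f i has_derivative (%h. f' i t * h)) (at t)" using der[OF i, of t] by (simp add: has_field_derivative_def)
  show "norm (f i y-f i t)<=B i * norm (y-t)" for y by (rule field_differentiable_bound[where S = UNIV and f' = "f' i"])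
     (use der[OF i] bd(1)[OF i] in auto)
  show "norm (f' i t * h)<=B i * norm h" for h using bd(1)[OF i, of t] by (simp add: abs_mult mult_right_mono)
 next
  show "(%i. f i y) summable_on I" for y by (rule sob(1)[OF B]) (use bd(2) in auto)
 qed (rule B)
 moreover have "(%h. \<Sum>\<^sub>\<infinity>i\<in>I. f' i t * h)=(%h. (\<Sum>\<^sub>\<infinity>i\<in>I. f' i t) * h)" by (simp add: infsum_cmult_left')
 ultimately show ?thesis by (simp add: has_field_derivative_def)
qed

lemma continuous_infsum:
 fixes f :: "'i => 'a::topological_space => 'b::banach"
 assumes c: "!!i. i\<in>I==>continuous_on S (f i)" and bd: "!!i t. i\<in>I==>t\<in>S==>norm (f i t)<=B i"
  and B: "B summable_on I"
 shows "continuous_on S (%t. \<Sum>\<^sub>\<infinity>i\<in>I. f i t)"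
proof -
 have "uniform_limit S (%J t. \<Sum>i\<in>J. f i t) (%t. \<Sum>\<^sub>\<infinity>i\<in>I. f i t) (finite_subsets_at_top I)" by (rule Weierstrass_m_test_general[OF bd B])
 moreover have "eventually (%J. continuous_on S (%t. \<Sum>i\<in>J. f i t)) (finite_subsets_at_top I)" by (rule eventually_finite_subsets_at_top_weakI) (auto intro!: continuous_on_sum c)
 ultimately show ?thesis by (intro uniform_limit_theorem) auto
qed

section \<open>Families of Hill equations and the fixed point\<close>

text \<open>\<open>lam powr (- ta)\<close> is the shape of the cut-off level; its sum bounds the
  excluded measure. \<open>lam powr (3 * ta)\<close> is the price of the Lipschitz bound for the
  energy, where one small divisor enters through a solution and two through the difference of
  solutions.\<close>

locale hill_family =
 fixes I :: "'i set" and lam :: "'i => real" and f :: "'i => real => real" and M :: "'i => real" and ta :: real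
 assumes lam: "!!i. i\<in>I==>lam i>=1" and forc: "!!i. i\<in>I==>forcing (M i) (f i)" and tau: "ta>=1"
  and summ: "(%i. lam i powr (3 * ta)*(M i)^2) summable_on I"
  and countable: "countable I" and summ_lam: "(%i. lam i powr (- ta)) summable_on I"
begin

definition threshold :: "real => 'i => real" where "threshold G i=G * lam i powr (- ta)"

definition S0 :: real where "S0=(\<Sum>\<^sub>\<infinity>i\<in>I. lam i powr (3 * ta)*(M i)^2)"

definition sol :: "real => (real => real) => 'i => real => real" where
 "sol G P i=cut_sol (lam i) (threshold G i) P (f i)"

definition sol' :: "real => (real => real) => 'i => real => real" where
 "sol' G P i=cut_sol' (lam i) (threshold G i) P (f i)"

text \<open>Up to a constant factor this is the Dirichlet energy of the function with these modes,
  with the cut-off built in; it is therefore defined for every potential, resonant or not.\<close>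

definition nonlin :: "real => (real => real) => real => real" where
 "nonlin G P t=(\<Sum>\<^sub>\<infinity>i\<in>I. (lam i)^2*(sol G P i t)^2)"

definition nonlin' :: "real => (real => real) => real => real" where
 "nonlin' G P t=(\<Sum>\<^sub>\<infinity>i\<in>I. 2*(lam i)^2*(sol G P i t * sol' G P i t))"

lemma S0_nonneg: "S0>=0" unfolding S0_def by (rule infsum_nonneg) auto

lemma M_nonneg: "i\<in>I==>M i>=0"
proof -
 assume "i\<in>I"
 then have "abs(f i 0)<=M i" using forc[of i] unfolding forcing_def by blast
 then show "M i>=0" by linarith
qed

lemma threshold_bounds: "i\<in>I==>0<G==>G<=1==>0<threshold G i&threshold G i<=1"
proof -
 assume i: "i\<in>I" and G: "0<G" "G<=1"
 have "lam i powr (- ta)<=1" using lam[OF i] tau by (simp add: powr_le_one_le powr_minus_divide ge_one_powr_ge_zero)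
 then have "G * lam i powr (- ta)<=1*1" using G by (intro mult_mono) auto
 then show ?thesis using G lam[OF i] by (simp add: threshold_def)
qed

context
 fixes b G :: real
 assumes b: "b>=1" and G: "0<G" "G<=1"
begin

lemma sol_phase_norm:
 assumes P: "potential b P P'" and i: "i\<in>I"
 shows "pnorm (lam i) (sol G P i) (sol' G P i) t<=fcst b/G*(M i * lam i powr (ta-1))"
proof -
 have l: "lam i>0" using lam[OF i] by simp
 have "pnorm (lam i) (sol G P i) (sol' G P i) t<=fcst b * M i/(lam i * threshold G i)" unfolding sol_def sol'_def by (rule cut_sol_props(5)[OF b P l _ _ forc[OF i]]) (use threshold_bounds[OF i G] in auto)
 also have "... = fcst b/G*(M i * lam i powr (ta-1))" using l G by (simp add: threshold_def powr_diff powr_minus field_simps)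
 finally show ?thesis .
qed

lemma sol_bounds:
 assumes P: "potential b P P'" and i: "i\<in>I"
 shows "lam i * abs(sol G P i t)<=fcst b/G*(M i * lam i powr (ta-1))"
  "abs(sol' G P i t)<=fcst b/G*(M i * lam i powr (ta-1))"
  "abs(sol G P i t)<=fcst b/G*(M i * lam i powr (ta-1))"
proof -
 have l: "lam i>=1" using lam[OF i] .
 have n: "lam i * abs(sol G P i t)+abs(sol' G P i t)<=fcst b/G*(M i * lam i powr (ta-1))" using sol_phase_norm[OF P i, of t] by (simp add: pnorm_def)
 have p: "0<=lam i * abs(sol G P i t)" using l by simp
 have q: "1 * abs(sol G P i t)<=lam i * abs(sol G P i t)" using l by (intro mult_right_mono) auto
 show "lam i * abs(sol G P i t)<=fcst b/G*(M i * lam i powr (ta-1))"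
  "abs(sol' G P i t)<=fcst b/G*(M i * lam i powr (ta-1))"
  "abs(sol G P i t)<=fcst b/G*(M i * lam i powr (ta-1))" using n p q by linarith+
qed

lemma sol_diff_bounds:
 assumes P: "potential b P P'" and Q: "potential b Q Q'" and i: "i\<in>I"
  and D: "!!t. abs(P t-Q t)<=D" "!!t. abs(P' t-Q' t)<=D"
 shows "lam i * abs(sol G P i t-sol G Q i t)<=lip_const b/G^2*(M i * lam i powr (2 * ta)) * D"
  "abs(sol' G P i t-sol' G Q i t)<=lip_const b/G^2*(M i * lam i powr (2 * ta)) * D"
proof -
 have l: "lam i>=1" using lam[OF i] .
 have "pnorm (lam i) (%t. sol G P i t-sol G Q i t) (%t. sol' G P i t-sol' G Q i t) t
    <= lip_const b * M i/(threshold G i)^2 * D" unfolding sol_def sol'_def by (rule cut_sol_lipschitz[OF b P Q l _ _ forc[OF i] D]) (use threshold_bounds[OF i G] in auto)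
 also have "(threshold G i)^2=G^2 * lam i powr (- (2 * ta))" using l by (simp add: threshold_def power_mult_distrib powr_power mult.commute)
 also have "lip_const b * M i/(G^2 * lam i powr (- (2 * ta))) * D=lip_const b/G^2*(M i * lam i powr (2 * ta)) * D" using l G by (simp add: powr_minus field_simps)
 finally have n: "lam i * abs(sol G P i t-sol G Q i t)+abs(sol' G P i t-sol' G Q i t)<=lip_const b/G^2*(M i * lam i powr (2 * ta)) * D" by (simp add: pnorm_def)
 have p: "0<=lam i * abs(sol G P i t-sol G Q i t)" using l by simp
 show "lam i * abs(sol G P i t-sol G Q i t)<=lip_const b/G^2*(M i * lam i powr (2 * ta)) * D"
  "abs(sol' G P i t-sol' G Q i t)<=lip_const b/G^2*(M i * lam i powr (2 * ta)) * D" using n p by linarith+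
qed

definition bound :: "'i => real" where
 "bound i=2*(fcst b/G)^2*(lam i powr (3 * ta)*(M i)^2)"

definition lbound :: "'i => real" where
 "lbound i=4*(fcst b * lip_const b/G^3)*(lam i powr (3 * ta)*(M i)^2)"

lemma bound_summable: "bound summable_on I" "infsum bound I=2*(fcst b/G)^2 * S0"
proof -
 show "bound summable_on I" unfolding bound_def[abs_def] by (rule summable_on_cmult_right[OF summ])
 show "infsum bound I=2*(fcst b/G)^2 * S0" unfolding bound_def[abs_def] S0_def by (rule infsum_cmult_right')
qed

lemma lbound_summable: "lbound summable_on I" "infsum lbound I=4*(fcst b * lip_const b/G^3) * S0"
proof -
 show "lbound summable_on I" unfolding lbound_def[abs_def] by (rule summable_on_cmult_right[OF summ])
 show "infsum lbound I=4*(fcst b * lip_const b/G^3) * S0" unfolding lbound_def[abs_def] S0_def by (rule infsum_cmult_right')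
qed

lemma lip_const_nonneg: "lip_const b>=0" using fcst_pos[OF b] by (simp add: lip_const_def)

lemma nonlin_terms:
 assumes P: "potential b P P'" and i: "i\<in>I"
 shows "abs((lam i)^2*(sol G P i t)^2)<=bound i" "abs(2*(lam i)^2*(sol G P i t * sol' G P i t))<=bound i"
proof -
 define N where "N=fcst b/G*(M i * lam i powr (ta-1))"
 have l: "lam i>=1" using lam[OF i] .
 have N0: "N>=0" using fcst_pos[OF b] G M_nonneg[OF i] by (simp add: N_def)
 have x: "lam i * abs(sol G P i t)<=N" "abs(sol' G P i t)<=N" using sol_bounds[OF P i] by (auto simp: N_def)
 have pw: "2*(lam i * N^2)<=bound i"
 proof -
  have "lam i*(lam i powr (ta-1))^2=lam i powr (2 * ta-1)"
  proof -
   have "lam i*(lam i powr (ta-1))^2=lam i powr 1*(lam i powr (ta-1) * lam i powr (ta-1))" using l by (simp add: power2_eq_square)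
   also have "... = lam i powr (2 * ta-1)" by (simp only: powr_add[symmetric]) (simp add: algebra_simps)
   finally show ?thesis .
  qed
  also have "... <= lam i powr (3 * ta)" using l tau by (intro powr_mono) auto
  finally have "2*(fcst b/G)^2*(M i)^2*(lam i*(lam i powr (ta-1))^2)<=2*(fcst b/G)^2*(M i)^2 * lam i powr (3 * ta)" by (intro mult_left_mono) auto
  moreover have "2*(lam i * N^2)=2*(fcst b/G)^2*(M i)^2*(lam i*(lam i powr (ta-1))^2)" unfolding N_def power_mult_distrib by (simp only: mult_ac)
  moreover have "bound i=2*(fcst b/G)^2*(M i)^2 * lam i powr (3 * ta)" unfolding bound_def by (simp only: mult_ac)
  ultimately show ?thesis by linarith
 qed
 have "abs(2*(lam i)^2*(sol G P i t * sol' G P i t))=2*(lam i*((lam i * abs(sol G P i t)) * abs(sol' G P i t)))" using l by (simp add: abs_mult power2_eq_square)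
 also have "... <= 2*(lam i*(N * N))" by (intro mult_left_mono mult_mono x) (use l N0 in simp_all)
 finally show "abs(2*(lam i)^2*(sol G P i t * sol' G P i t))<=bound i" using pw by (simp add: power2_eq_square)
 have "abs((lam i)^2*(sol G P i t)^2)=(lam i * abs(sol G P i t))^2" by (simp add: power_mult_distrib)
 also have "... <= N^2" using x l by (intro power_mono) auto
 also have "... <= 2*(lam i * N^2)" using mult_right_mono[OF l, of "N^2"] zero_le_power2[of N] by linarith
 finally show "abs((lam i)^2*(sol G P i t)^2)<=bound i" using pw by linarith
qed

lemma nonlin_diff_terms:
 assumes P: "potential b P P'" and Q: "potential b Q Q'" and i: "i\<in>I"
  and D: "!!t. abs(P t-Q t)<=D" "!!t. abs(P' t-Q' t)<=D"
 shows "abs((lam i)^2*(sol G P i t)^2-(lam i)^2*(sol G Q i t)^2)<=lbound i * D"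
  "abs(2*(lam i)^2*(sol G P i t * sol' G P i t)-2*(lam i)^2*(sol G Q i t * sol' G Q i t))<=lbound i * D"
proof -
 define N where "N=fcst b/G*(M i * lam i powr (ta-1))"
 define L where "L=lip_const b/G^2*(M i * lam i powr (2 * ta)) * D"
 have l: "lam i>=1" using lam[OF i] .
 have D0: "D>=0" using D(1)[of 0] by linarith
 have N0: "N>=0" using fcst_pos[OF b] G M_nonneg[OF i] by (simp add: N_def)
 have L0: "L>=0" using lip_const_nonneg G M_nonneg[OF i] D0 by (simp add: L_def)
 have x: "lam i * abs(sol G P i t)<=N" "abs(sol' G P i t)<=N" using sol_bounds[OF P i] by (auto simp: N_def)
 have y: "lam i * abs(sol G Q i t)<=N" "abs(sol' G Q i t)<=N" using sol_bounds[OF Q i] by (auto simp: N_def)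
 have z: "lam i * abs(sol G P i t-sol G Q i t)<=L" "abs(sol' G P i t-sol' G Q i t)<=L" using sol_diff_bounds[OF P Q i D] by (auto simp: L_def)
 \<comment> \<open>The exponents add up to exactly \<open>3 * ta\<close>: 1 from the weight,
   \<open>ta - 1\<close> from a solution and \<open>2 * ta\<close> from a difference of
   solutions.\<close>
 have pw: "4*(lam i*(N * L))=lbound i * D"
 proof -
  have "lam i*(lam i powr (ta-1) * lam i powr (2 * ta))=lam i powr 1*(lam i powr (ta-1) * lam i powr (2 * ta))" using l by simp
  also have "... = lam i powr (3 * ta)" by (simp only: powr_add[symmetric]) (simp add: algebra_simps)
  finally have e: "lam i*(lam i powr (ta-1) * lam i powr (2 * ta))=lam i powr (3 * ta)" .
  have "4*(lam i*(N * L))=4*(fcst b * lip_const b/G^3)*(M i)^2 * D*(lam i*(lam i powr (ta-1) * lam i powr (2 * ta)))" by (simp add: N_def L_def power2_eq_square power3_eq_cube mult_ac)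
  then show ?thesis unfolding e lbound_def by (simp add: mult_ac)
 qed
 have d1: "2*(lam i)^2*(sol G P i t * sol' G P i t)-2*(lam i)^2*(sol G Q i t * sol' G Q i t)
     = 2*(lam i*((lam i*(sol G P i t-sol G Q i t)) * sol' G P i t+(lam i * sol G Q i t)*(sol' G P i t-sol' G Q i t)))" by (simp add: power2_eq_square algebra_simps)
 have l1: "abs(2*(lam i*((lam i*(sol G P i t-sol G Q i t)) * sol' G P i t+(lam i * sol G Q i t)*(sol' G P i t-sol' G Q i t))))<=2*(lam i*(L * N+N * L))"
 proof -
  have "abs((lam i*(sol G P i t-sol G Q i t)) * sol' G P i t+(lam i * sol G Q i t)*(sol' G P i t-sol' G Q i t))
      <= (lam i * abs(sol G P i t-sol G Q i t)) * abs(sol' G P i t)+(lam i * abs(sol G Q i t)) * abs(sol' G P i t-sol' G Q i t)" using l by (intro order_trans[OF abs_triangle_ineq]) (simp add: abs_mult)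
  also have "... <= L * N+N * L" by (intro add_mono mult_mono x y z) (use N0 L0 l in simp_all)
  finally show ?thesis using l by (simp add: abs_mult)
 qed
 have e1: "2*(lam i*(L * N+N * L))=lbound i * D" unfolding pw[symmetric] by (simp add: algebra_simps)
 show "abs(2*(lam i)^2*(sol G P i t * sol' G P i t)-2*(lam i)^2*(sol G Q i t * sol' G Q i t))<=lbound i * D" using l1 unfolding d1 e1 .
 have "abs((lam i)^2*(sol G P i t)^2-(lam i)^2*(sol G Q i t)^2)=abs((lam i*(sol G P i t-sol G Q i t))*(lam i * sol G P i t+lam i * sol G Q i t))" by (simp add: power2_eq_square algebra_simps)
 also have "... <= L*(N+N)" unfolding abs_mult
 proof (rule mult_mono)
  show "abs(lam i) * abs(sol G P i t-sol G Q i t)<=L" using z l by simp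
  have "abs(lam i * sol G P i t+lam i * sol G Q i t)<=lam i * abs(sol G P i t)+lam i * abs(sol G Q i t)" using l by (intro order_trans[OF abs_triangle_ineq]) (simp add: abs_mult)
  then show "abs(lam i * sol G P i t+lam i * sol G Q i t)<=N+N" using x y by linarith
 qed (use L0 in auto)
 also have "... = 2*(1*(N * L))" by simp
 also have "... <= 4*(lam i*(N * L))" using mult_right_mono[OF l, of "N * L"] mult_nonneg_nonneg[OF N0 L0] by linarith
 finally show "abs((lam i)^2*(sol G P i t)^2-(lam i)^2*(sol G Q i t)^2)<=lbound i * D" using pw by simp
qed

lemma nonlin_props:
 assumes P: "potential b P P'"
 shows "(nonlin G P hrd nonlin' G P t) (at t)" "cts (nonlin' G P)"
  "abs(nonlin G P t)<=infsum bound I" "abs(nonlin' G P t)<=infsum bound I"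
  "nonlin G P (t+2 * pi)=nonlin G P t"
proof -
 have d: "(sol G P i hrd sol' G P i t) (at t)" "cts (sol' G P i)"
   "sol G P i (t+2 * pi)=sol G P i t" if "i\<in>I" for i t unfolding sol_def sol'_def using cut_sol_props[OF b P _ _ _ forc[OF that]] threshold_bounds[OF that G] lam[OF that] by auto
 have dc: "cts (sol G P i)" if "i\<in>I" for i by (rule DERIV_continuous_on[OF has_field_derivative_at_within], rule d(1)[OF that])
 show "(nonlin G P hrd nonlin' G P t) (at t)" unfolding nonlin_def[abs_def] nonlin'_def by (rule has_real_derivative_infsum[OF _ _ _ bound_summable(1)])
    (use nonlin_terms[OF P] in \<open>auto intro!: derivative_eq_intros d\<close>)
 show "cts (nonlin' G P)" unfolding nonlin'_def[abs_def] by (rule continuous_infsum[OF _ _ bound_summable(1)])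
    (use nonlin_terms[OF P] in \<open>auto intro!: continuous_intros d dc\<close>)
 show "abs(nonlin G P t)<=infsum bound I" unfolding nonlin_def real_norm_def[symmetric] by (rule sob(3)[OF bound_summable(1)]) (use nonlin_terms(1)[OF P] in simp)
 show "abs(nonlin' G P t)<=infsum bound I" unfolding nonlin'_def real_norm_def[symmetric] by (rule sob(3)[OF bound_summable(1)]) (use nonlin_terms(2)[OF P] in simp)
 show "nonlin G P (t+2 * pi)=nonlin G P t" unfolding nonlin_def by (rule infsum_cong) (simp add: d(3))
qed

lemma nonlin_summable:
 assumes P: "potential b P P'"
 shows "(%i. (lam i)^2*(sol G P i t)^2) summable_on I" "(%i. 2*(lam i)^2*(sol G P i t * sol' G P i t)) summable_on I"
proof -
 show "(%i. (lam i)^2*(sol G P i t)^2) summable_on I"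
 proof (rule sob(1)[OF bound_summable(1)])
  fix i assume "i\<in>I"
  then show "norm ((lam i)^2*(sol G P i t)^2)<=bound i" using nonlin_terms(1)[OF P, of i t] by simp
 qed
 show "(%i. 2*(lam i)^2*(sol G P i t * sol' G P i t)) summable_on I"
 proof (rule sob(1)[OF bound_summable(1)])
  fix i assume "i\<in>I"
  then show "norm (2*(lam i)^2*(sol G P i t * sol' G P i t))<=bound i" using nonlin_terms(2)[OF P, of i t] by simp
 qed
qed

lemma nonlin_lipschitz:
 assumes P: "potential b P P'" and Q: "potential b Q Q'"
  and D: "!!t. abs(P t-Q t)<=D" "!!t. abs(P' t-Q' t)<=D"
 shows "abs(nonlin G P t-nonlin G Q t)<=infsum lbound I * D" "abs(nonlin' G P t-nonlin' G Q t)<=infsum lbound I * D"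
proof -
 have s: "(%i. lbound i * D) summable_on I" by (rule summable_on_cmult_left[OF lbound_summable(1)])
 have e: "(\<Sum>\<^sub>\<infinity>i\<in>I. lbound i * D)=infsum lbound I * D" by (simp add: infsum_cmult_left')
 have d1: "nonlin G P t-nonlin G Q t=(\<Sum>\<^sub>\<infinity>i\<in>I. (lam i)^2*(sol G P i t)^2-(lam i)^2*(sol G Q i t)^2)" unfolding nonlin_def by (rule so_diff(2)[OF nonlin_summable(1)[OF P, of t] nonlin_summable(1)[OF Q, of t], symmetric])
 have l1: "norm (\<Sum>\<^sub>\<infinity>i\<in>I. (lam i)^2*(sol G P i t)^2-(lam i)^2*(sol G Q i t)^2)<=(\<Sum>\<^sub>\<infinity>i\<in>I. lbound i * D)"
 proof (rule sob(3)[OF s])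
  fix i assume i: "i\<in>I"
  show "norm ((lam i)^2*(sol G P i t)^2-(lam i)^2*(sol G Q i t)^2)<=lbound i * D" using nonlin_diff_terms(1)[OF P Q i D] by simp
 qed
 show "abs(nonlin G P t-nonlin G Q t)<=infsum lbound I * D" using l1 unfolding d1 e real_norm_def .
 have d2: "nonlin' G P t-nonlin' G Q t=(\<Sum>\<^sub>\<infinity>i\<in>I. 2*(lam i)^2*(sol G P i t * sol' G P i t)-2*(lam i)^2*(sol G Q i t * sol' G Q i t))" unfolding nonlin'_def by (rule so_diff(2)[OF nonlin_summable(2)[OF P, of t] nonlin_summable(2)[OF Q, of t], symmetric])
 have l2: "norm (\<Sum>\<^sub>\<infinity>i\<in>I. 2*(lam i)^2*(sol G P i t * sol' G P i t)-2*(lam i)^2*(sol G Q i t * sol' G Q i t))<=(\<Sum>\<^sub>\<infinity>i\<in>I. lbound i * D)"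
 proof (rule sob(3)[OF s])
  fix i assume i: "i\<in>I"
  show "norm (2*(lam i)^2*(sol G P i t * sol' G P i t)-2*(lam i)^2*(sol G Q i t * sol' G Q i t))<=lbound i * D" using nonlin_diff_terms(2)[OF P Q i D] by simp
 qed
 show "abs(nonlin' G P t-nonlin' G Q t)<=infsum lbound I * D" using l2 unfolding d2 e real_norm_def .
qed

end

end

lemma emeasure_UN_le_infsum:
 fixes c :: "'i => real"
 assumes I: "countable I" and B: "!!i. i\<in>I==>B i\<in>sets N" and c: "c summable_on I"
  and le: "!!i. i\<in>I==>emeasure N (B i)<=ennreal (c i)" and c0: "!!i. i\<in>I==>0<=c i"
 shows "emeasure N (\<Union>i\<in>I. B i)<=ennreal (infsum c I)"
proof -
 let ?J = "to_nat_on I ` I"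
 define B' where "B' n=(if n \<in> ?J then B (from_nat_into I n) else {})" for n
 have inI: "from_nat_into I n\<in>I" if "n \<in> ?J" for n using that I by auto
 have U: "(\<Union>i\<in>I. B i)\<subseteq>(\<Union>n. B' n)"
 proof
  fix x assume "x\<in>(\<Union>i\<in>I. B i)"
  then obtain i where i: "i\<in>I" "x\<in>B i" by blast
  then have "x\<in>B' (to_nat_on I i)" using I by (auto simp: B'_def)
  then show "x\<in>(\<Union>n. B' n)" by blast
 qed
 have B's: "B' n\<in>sets N" for n using B inI by (auto simp: B'_def)
 have "emeasure N (\<Union>i\<in>I. B i)<=emeasure N (\<Union>n. B' n)" by (rule emeasure_mono[OF U]) (use B's in auto)
 also have "... <= (\<Sum>n. emeasure N (B' n))" by (rule emeasure_subadditive_countably) (use B's in auto)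
 also have "... <= ennreal (infsum c I)"
 proof (rule suminf_le_const)
  show "summable (%n. emeasure N (B' n))" by (rule summableI)
  fix m
  let ?F = "{..<m} \<inter> ?J"
  have inj: "inj_on (from_nat_into I) ?F" by (rule inj_onI) (use I in auto)
  have "(\<Sum>n<m. emeasure N (B' n))=(\<Sum>n\<in>?F. emeasure N (B (from_nat_into I n)))" by (simp add: B'_def sum.inter_restrict if_distrib[of "emeasure N"] cong: if_cong)
  also have "... <= (\<Sum>n\<in>?F. ennreal (c (from_nat_into I n)))" by (rule sum_mono) (use le inI in auto)
  also have "... = ennreal (\<Sum>n\<in>?F. c (from_nat_into I n))" by (rule sum_ennreal) (use c0 inI in auto)
  also have "(\<Sum>n\<in>?F. c (from_nat_into I n))=sum c (from_nat_into I ` ?F)" using sum.reindex[OF inj, of c] by simp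
  also have "ennreal ... <= ennreal (infsum c I)" by (rule ennreal_leI, rule finite_sum_le_infsum) (use c c0 inI in auto)
  finally show "(\<Sum>n<m. emeasure N (B' n))<=ennreal (infsum c I)" .
 qed
 finally show ?thesis .
qed

text \<open>Supplies the complete space for the fixed point: uniform limits of functions and of
  their derivatives are again a function and its derivative, and the pointwise bounds pass to the
  limit.\<close>

lemma closed_potentials:
 "closed {z :: (real \<Rightarrow>\<^sub>C real)\<times>(real \<Rightarrow>\<^sub>C real). potential b (apply_bcontfun (fst z)) (apply_bcontfun (snd z))}" unfolding closed_sequential_limits
proof (intro allI impI)
 fix z :: "nat => (real \<Rightarrow>\<^sub>C real)\<times>(real \<Rightarrow>\<^sub>C real)" and y
 assume z: "(\<forall>n. z n\<in>{z. potential b (apply_bcontfun (fst z)) (apply_bcontfun (snd z))})&z \<longlonglongrightarrow> y"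
 define p q where "p n=fst (z n)" and "q n=snd (z n)" for n
 define P Q where "P=fst y" and "Q=snd y"
 have pot: "potential b (p n) (q n)" for n using z by (simp add: p_def q_def)
 have "(%n. fst (z n)) \<longlonglongrightarrow> fst y" "(%n. snd (z n)) \<longlonglongrightarrow> snd y" using z by (auto intro: tendsto_fst tendsto_snd)
 then have lim: "p \<longlonglongrightarrow> P" "q \<longlonglongrightarrow> Q" by (auto simp: p_def[abs_def] q_def[abs_def] P_def Q_def)
 have pw: "(%n. apply_bcontfun (u n) t) \<longlonglongrightarrow> apply_bcontfun U t" if "u \<longlonglongrightarrow> U" for u :: "nat => (real \<Rightarrow>\<^sub>C real)" and U t
 proof (rule tendstoI)
  fix e :: real assume "e>0"
  with that have "eventually (%n. dist (u n) U<e) sequentially" by (rule tendstoD)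
  then show "eventually (%n. dist (apply_bcontfun (u n) t) (apply_bcontfun U t)<e) sequentially" by (rule eventually_mono) (rule le_less_trans[OF dist_bounded])
 qed
 have "\<exists>g. \<forall>x\<in>UNIV. (%n. p n x) \<longlonglongrightarrow> g x&(g has_derivative (%h. Q x * h)) (at x within UNIV)"
 proof (rule has_derivative_sequence[where f' = "%n x h. q n x * h"])
  show "(apply_bcontfun (p n) has_derivative (%h. q n x * h)) (at x within UNIV)" for n x using potentialD(1)[OF pot[of n], of x] by (simp add: has_field_derivative_def)
  show "(%n. p n 0) \<longlonglongrightarrow> P 0" by (rule pw[OF lim(1)])
  fix e :: real assume "e>0"
  with lim(2) have "eventually (%n. dist (q n) Q<e) sequentially" by (rule tendstoD)
  then show "\<forall>\<^sub>F n in sequentially. \<forall>x\<in>UNIV. \<forall>h. norm (q n x * h-Q x * h)<=e * norm h"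
  proof (rule eventually_mono, intro ballI allI)
   fix n x h assume d: "dist (q n) Q<e"
   have "norm (q n x * h-Q x * h)=dist (q n x) (Q x) * norm h" by (simp add: dist_real_def left_diff_distrib[symmetric] abs_mult)
   also have "... <= e * norm h" using dist_bounded[of "q n" x Q] d by (intro mult_right_mono) auto
   finally show "norm (q n x * h-Q x * h)<=e * norm h" .
  qed
 qed auto
 then obtain g where g: "!!x. (%n. p n x) \<longlonglongrightarrow> g x" "!!x. (g has_derivative (%h. Q x * h)) (at x)" by auto
 have "g=apply_bcontfun P" using LIMSEQ_unique[OF g(1) pw[OF lim(1)]] by blast
 then have der: "(P hrd Q t) (at t)" for t using g(2)[of t] by (simp add: has_field_derivative_def)
 have "potential b P Q" unfolding potential_def
 proof (intro conjI allI der)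
  show "cts (apply_bcontfun Q)" by simp
  fix t
  show "1/b<=P t" by (rule LIMSEQ_le_const[OF pw[OF lim(1)]]) (use potentialD(2)[OF pot] in auto)
  show "P t<=b" by (rule LIMSEQ_le_const2[OF pw[OF lim(1)]]) (use potentialD(3)[OF pot] in auto)
  show "abs(Q t)<=b" by (rule LIMSEQ_le_const2[OF tendsto_rabs[OF pw[OF lim(2)]]]) (use potentialD(4)[OF pot] in auto)
  have "(%n. p n (t+2 * pi))=(%n. p n t)" using potentialD(5)[OF pot] by auto
  then show "P (t+2 * pi)=P t" using LIMSEQ_unique[OF pw[OF lim(1), of "t+2 * pi"]] pw[OF lim(1), of t] by simp
 qed
 then show "y\<in>{z. potential b (apply_bcontfun (fst z)) (apply_bcontfun (snd z))}" by (simp add: P_def Q_def)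
qed

context hill_family
begin

text \<open>The potential and its derivative are carried as a pair, in accordance with the norm in
  which \<open>nonlin\<close> is Lipschitz.\<close>

definition fixes_pot :: "real => real => real => real => (real \<Rightarrow>\<^sub>C real) => (real \<Rightarrow>\<^sub>C real) => bool" where
 "fixes_pot b G ap bt p q \<longleftrightarrow> potential b p q&(\<forall>t. p t=ap+bt * nonlin G p t)&(\<forall>t. q t=bt * nonlin' G p t)"

context
 fixes b G :: real
 assumes b: "b>=1" and G: "0<G" "G<=1"
begin

abbreviation "BD \<equiv> infsum (bound b G) I"
abbreviation "LB \<equiv> infsum (lbound b G) I"

lemma BD_nonneg: "BD>=0" "LB>=0" using S0_nonneg G fcst_pos[OF b] lip_const_nonneg[OF b] unfolding bound_summable(2)[OF b G] lbound_summable(2)[OF b G] by simp_all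

text \<open>The bounds on \<open>ap\<close> leave room for a perturbation of size \<open>1/b\<close>
  on either side, and \<open>bt * BD <= 1/b\<close> keeps the perturbation within it. The factor
  \<open>1/4\<close> in each component becomes \<open>1/2\<close> for the distance of pairs.\<close>

lemma fixed_point_exists:
 assumes ap: "2/b<=ap" "ap<=b-1" and bt: "0<=bt" "bt * BD<=1/b" "bt * LB<=1/4"
 shows "\<exists>p q. fixes_pot b G ap bt p q"
proof -
 let ?S = "{z :: (real \<Rightarrow>\<^sub>C real)\<times>(real \<Rightarrow>\<^sub>C real). potential b (apply_bcontfun (fst z)) (apply_bcontfun (snd z))}"
 define T1 where "T1 z=(%t. ap+bt * nonlin G (apply_bcontfun (fst z)) t)" for z :: "(real \<Rightarrow>\<^sub>C real)\<times>(real \<Rightarrow>\<^sub>C real)"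
 define T2 where "T2 z=(%t. bt * nonlin' G (apply_bcontfun (fst z)) t)" for z :: "(real \<Rightarrow>\<^sub>C real)\<times>(real \<Rightarrow>\<^sub>C real)"
 define T where "T z=(Bcontfun (T1 z),Bcontfun (T2 z))" for z
 have b1: "1/b<=1" "1/b<=b" using b by (auto simp: field_simps intro: order_trans)
 have bdF: "abs(bt * x)<=1/b" if "abs(x)<=BD" for x
 proof -
  have "abs(bt * x)<=bt * BD" unfolding abs_mult using that bt(1) by (intro mult_mono) auto
  then show ?thesis using bt(2) by linarith
 qed
 have pot: "potential b (T1 z) (T2 z)" if "z \<in> ?S" for z
 proof -
  have P: "potential b (apply_bcontfun (fst z)) (apply_bcontfun (snd z))" using that by simp
  note np = nonlin_props[OF b G P]
  show ?thesis unfolding potential_def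
  proof (intro conjI allI)
   fix t
   show "(T1 z hrd T2 z t) (at t)" unfolding T1_def T2_def by (auto intro!: derivative_eq_intros np(1))
   show "cts (T2 z)" unfolding T2_def by (intro continuous_intros np(2))
   have x: "abs(bt * nonlin G (apply_bcontfun (fst z)) t)<=1/b" by (rule bdF[OF np(3)])
   have "2/b=1/b+1/b" by simp
   then show "1/b<=T1 z t" "T1 z t<=b" using x ap b1 unfolding T1_def by linarith+
   show "abs(T2 z t)<=b" using bdF[OF np(4)] b1 unfolding T2_def by (meson order_trans)
   show "T1 z (t+2 * pi)=T1 z t" unfolding T1_def by (simp add: np(5))
  qed
 qed
 have bc: "f\<in>bcontfun" if "cts f" "!!t. abs(f t)<=b" for f :: "real => real" unfolding bcontfun_def using that by (auto intro!: boundedI[where B = b])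
 have app: "apply_bcontfun (fst (T z))=T1 z" "apply_bcontfun (snd (T z))=T2 z" if "z \<in> ?S" for z
 proof -
  note P = pot[OF that]
  have "abs(T1 z t)<=b" for t
  proof -
   have "0<=1/b" using b by simp
   then show ?thesis using potentialD(2,3)[OF P, of t] by linarith
  qed
  then show "apply_bcontfun (fst (T z))=T1 z" unfolding T_def fst_conv by (intro Bcontfun_inverse bc potential_cont[OF P])
  show "apply_bcontfun (snd (T z))=T2 z" unfolding T_def snd_conv by (intro Bcontfun_inverse bc potentialD(6)[OF P] potentialD(4)[OF P])
 qed
 have ne: "?S~={}"
 proof -
  have "potential b (apply_bcontfun (const_bcontfun ap)) (apply_bcontfun (const_bcontfun 0 :: real \<Rightarrow>\<^sub>C real))" unfolding potential_def
  proof (intro conjI allI)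
   have "0<=1/b" using b by simp
   then show "1/b<=apply_bcontfun (const_bcontfun ap) t" "apply_bcontfun (const_bcontfun ap) t<=b" for t :: real using ap add_divide_distrib[of 1 1 b] by (simp_all add: const_bcontfun.rep_eq, linarith+)
  qed (use b in \<open>auto simp: const_bcontfun.rep_eq\<close>)
  then have "(const_bcontfun ap,const_bcontfun 0) \<in> ?S" by simp
  then show ?thesis by blast
 qed
 have "\<exists>!z. z \<in> ?S&T z=z"
 proof (rule Banach_fix[where c = "1/2"])
  show "complete ?S" using closed_potentials by (simp add: complete_eq_closed)
  show "?S~={}" by (rule ne)
  show "T ` ?S \<subseteq> ?S"
  proof
   fix w assume "w\<in>T ` ?S"
   then obtain z where z: "z \<in> ?S" "w=T z" by blast
   have "potential b (apply_bcontfun (fst (T z))) (apply_bcontfun (snd (T z)))" unfolding app[OF z(1)] by (rule pot[OF z(1)])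
   then show "w \<in> ?S" using z(2) by simp
  qed
  fix z w assume z: "z \<in> ?S" and w: "w \<in> ?S"
  let ?D = "dist z w"
  have P: "potential b (apply_bcontfun (fst z)) (apply_bcontfun (snd z))" and Q: "potential b (apply_bcontfun (fst w)) (apply_bcontfun (snd w))" using z w by auto
  have D: "abs(apply_bcontfun (fst z) t-apply_bcontfun (fst w) t) <= ?D" "abs(apply_bcontfun (snd z) t-apply_bcontfun (snd w) t) <= ?D" for t using dist_bounded[of "fst z" t "fst w"] dist_bounded[of "snd z" t "snd w"] dist_fst_le[of z w] dist_snd_le[of z w] by (auto simp: dist_real_def)
  note L = nonlin_lipschitz[OF b G P Q D]
  have c: "bt * x<=1/4 * ?D" if "x<=LB * ?D" for x
  proof -
   have "bt * x<=bt*(LB * ?D)" using that bt by (intro mult_left_mono) auto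
   also have "... = (bt * LB) * ?D" by simp
   also have "... <= 1/4 * ?D" using bt by (intro mult_right_mono) auto
   finally show ?thesis .
  qed
  have 1: "dist (fst (T z)) (fst (T w))<=1/4 * ?D"
  proof (rule dist_bound)
   fix t
   have "dist (T1 z t) (T1 w t)=bt * abs(nonlin G (apply_bcontfun (fst z)) t-nonlin G (apply_bcontfun (fst w)) t)" using bt(1) by (simp add: T1_def dist_real_def right_diff_distrib[symmetric] abs_mult)
   then show "dist (apply_bcontfun (fst (T z)) t) (apply_bcontfun (fst (T w)) t)<=1/4 * ?D" unfolding app[OF z] app[OF w] using c[OF L(1)] by simp
  qed
  have 2: "dist (snd (T z)) (snd (T w))<=1/4 * ?D"
  proof (rule dist_bound)
   fix t
   have "dist (T2 z t) (T2 w t)=bt * abs(nonlin' G (apply_bcontfun (fst z)) t-nonlin' G (apply_bcontfun (fst w)) t)" using bt(1) by (simp add: T2_def dist_real_def right_diff_distrib[symmetric] abs_mult)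
   then show "dist (apply_bcontfun (snd (T z)) t) (apply_bcontfun (snd (T w)) t)<=1/4 * ?D" unfolding app[OF z] app[OF w] using c[OF L(2)] by simp
  qed
  have "dist (T z) (T w)<=dist (fst (T z)) (fst (T w))+dist (snd (T z)) (snd (T w))" unfolding dist_prod_def by (rule sqrt_sum_squares_le_sum) auto
  then show "dist (T z) (T w)<=1/2 * ?D" using 1 2 by linarith
 qed auto
 then obtain z where z: "z \<in> ?S" "T z=z" by blast
 have e: "apply_bcontfun (fst z)=T1 z" "apply_bcontfun (snd z)=T2 z" using app[OF z(1)] z(2) by auto
 have "fixes_pot b G ap bt (fst z) (snd z)" unfolding fixes_pot_def
 proof (intro conjI allI)
  show "potential b (apply_bcontfun (fst z)) (apply_bcontfun (snd z))" using z(1) by simp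
  show "apply_bcontfun (fst z) t=ap+bt * nonlin G (apply_bcontfun (fst z)) t" for t using fun_cong[OF e(1), of t] unfolding T1_def .
  show "apply_bcontfun (snd z) t=bt * nonlin' G (apply_bcontfun (fst z)) t" for t using fun_cong[OF e(2), of t] unfolding T2_def .
 qed
 then show ?thesis by blast
qed

text \<open>Subtracting the two fixed point equations and absorbing the term with
  \<open>bt2 * LB <= 1/4\<close>. The second estimate is the one that matters: when
  \<open>bt2 * LB\<close> and the change of \<open>bt\<close> are small, the potential changes
  almost by the constant \<open>ap1 - ap2\<close>, as the clustering argument demands.\<close>

lemma fixed_point_compare:
 assumes f1: "fixes_pot b G ap1 bt1 p q" and f2: "fixes_pot b G ap2 bt2 p2 q2"
  and bt: "0<=bt2" "bt2 * LB<=1/4"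
 defines "A \<equiv> abs(ap1-ap2)+abs(bt1-bt2) * BD"
 shows "abs(p t-p2 t)<=2 * A" "abs(p t-p2 t-(ap1-ap2))<=abs(bt1-bt2) * BD+bt2 * LB*(2 * A)"
proof -
 have P: "potential b p q" and Q: "potential b p2 q2" using f1 f2 by (auto simp: fixes_pot_def)
 define D where "D=max (dist p p2) (dist q q2)"
 have D: "abs(p t-p2 t)<=D" "abs(q t-q2 t)<=D" for t using dist_bounded[of p t p2] dist_bounded[of q t q2] by (auto simp: D_def dist_real_def)
 have D0: "D>=0" by (simp add: D_def le_max_iff_disj)
 note L = nonlin_lipschitz[OF b G P Q D]
 note B = nonlin_props(3,4)[OF b G P]
 have c: "abs((bt1-bt2) * x+bt2 * y)<=abs(bt1-bt2) * BD+bt2 * LB * D" if "abs(x)<=BD" "abs(y)<=LB * D" for x y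
 proof -
  have "abs((bt1-bt2) * x)<=abs(bt1-bt2) * BD" unfolding abs_mult using that by (intro mult_left_mono) auto
  moreover have "abs(bt2 * y)<=bt2*(LB * D)" unfolding abs_mult using that bt by (intro mult_mono) auto
  ultimately show ?thesis by (simp add: mult.assoc)
 qed
 have pe: "p t-p2 t-(ap1-ap2)=(bt1-bt2) * nonlin G p t+bt2*(nonlin G p t-nonlin G p2 t)" for t
 proof -
  have "p t=ap1+bt1 * nonlin G p t" "p2 t=ap2+bt2 * nonlin G p2 t" using f1 f2 unfolding fixes_pot_def by blast+
  moreover have "x-y-(ap1-ap2)=(bt1-bt2) * X+bt2*(X-Y)" if "x=ap1+bt1 * X" "y=ap2+bt2 * Y" for x y X Y :: real using that by (simp add: algebra_simps)
  ultimately show ?thesis by blast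
 qed
 have qe: "q t-q2 t=(bt1-bt2) * nonlin' G p t+bt2*(nonlin' G p t-nonlin' G p2 t)" for t
 proof -
  have "q t=bt1 * nonlin' G p t" "q2 t=bt2 * nonlin' G p2 t" using f1 f2 unfolding fixes_pot_def by blast+
  moreover have "x-y=(bt1-bt2) * X+bt2*(X-Y)" if "x=bt1 * X" "y=bt2 * Y" for x y X Y :: real using that by (simp add: algebra_simps)
  ultimately show ?thesis by blast
 qed
 have pd: "abs(p t-p2 t-(ap1-ap2))<=abs(bt1-bt2) * BD+bt2 * LB * D" for t unfolding pe by (rule c[OF B(1) L(1)])
 have qd: "abs(q t-q2 t)<=abs(bt1-bt2) * BD+bt2 * LB * D" for t unfolding qe by (rule c[OF B(2) L(2)])
 have q4: "bt2 * LB * D<=1/4 * D" using bt D0 by (intro mult_right_mono) auto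
 have "dist p p2<=A+1/4 * D"
 proof (rule dist_bound)
  show "dist (p t) (p2 t)<=A+1/4 * D" for t using pd[of t] q4 unfolding A_def dist_real_def by linarith
 qed
 moreover have "dist q q2<=A+1/4 * D"
 proof (rule dist_bound)
  show "dist (q t) (q2 t)<=A+1/4 * D" for t using qd[of t] q4 unfolding A_def dist_real_def by linarith
 qed
 ultimately have "max (dist p p2) (dist q q2)<=A+1/4 * D" by (rule max.boundedI)
 then have DA: "D<=2 * A" using D0 unfolding D_def[symmetric] by linarith
 show "abs(p t-p2 t)<=2 * A" using D(1)[of t] DA by linarith
 have "bt2 * LB * D<=bt2 * LB*(2 * A)" using DA bt BD_nonneg by (intro mult_left_mono) auto
 then show "abs(p t-p2 t-(ap1-ap2))<=abs(bt1-bt2) * BD+bt2 * LB*(2 * A)" using pd[of t] by linarith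
qed

end

end

section \<open>Measure of the parameters at which the cut-off acts\<close>

lemma inverse_square_diff_bounds:
 fixes x y r R :: real
 assumes "0<r" "r<=x" "x<=R" "r<=y" "y<=R"
 shows "abs(1/x^2-1/y^2)<=2 * R/r^4 * abs(x-y)" "2 * r/R^4 * abs(x-y)<=abs(1/x^2-1/y^2)"
proof -
 have pos: "x>0" "y>0" "R>0" using assms by auto
 have "1/x^2-1/y^2=(y-x)*((x+y)/(x^2 * y^2))" using pos by (simp add: field_simps power2_eq_square)
 then have e: "abs(1/x^2-1/y^2)=abs(x-y)*((x+y)/(x^2 * y^2))" using pos by (simp add: abs_mult abs_minus_commute)
 have r4: "r^4=r^2 * r^2" "R^4=R^2 * R^2" by (simp_all add: power_add[symmetric])
 have sq: "r^2<=x^2" "r^2<=y^2" "x^2<=R^2" "y^2<=R^2" using assms by (auto intro!: power_mono)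
 have lo: "r^4<=x^2 * y^2" and hi: "x^2 * y^2<=R^4" unfolding r4 using sq by (intro mult_mono; simp)+
 have "(x+y)/(x^2 * y^2)<=(2 * R)/r^4" using assms lo pos by (intro frac_le) auto
 then have "abs(x-y)*((x+y)/(x^2 * y^2))<=abs(x-y)*((2 * R)/r^4)" by (rule mult_left_mono) simp
 then show "abs(1/x^2-1/y^2)<=2 * R/r^4 * abs(x-y)" unfolding e by (simp add: mult.commute)
 have "(2 * r)/R^4<=(x+y)/(x^2 * y^2)" using assms hi pos by (intro frac_le) auto
 then have "abs(x-y)*((2 * r)/R^4)<=abs(x-y)*((x+y)/(x^2 * y^2))" by (rule mult_left_mono) simp
 then show "2 * r/R^4 * abs(x-y)<=abs(1/x^2-1/y^2)" unfolding e by (simp add: mult.commute)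
qed

lemma cube_diff_bound:
 fixes a c A :: real
 assumes "0<=a" "a<=A" "0<=c" "c<=A"
 shows "abs(a^3-c^3)<=3 * A^2 * abs(a-c)"
proof -
 have "a^3-c^3=(a * a+a * c+c * c)*(a-c)" by (simp add: power3_eq_cube algebra_simps)
 then have "abs(a^3-c^3)=(a * a+a * c+c * c) * abs(a-c)" using assms by (simp add: abs_mult)
 also have "... <= (A * A+A * A+A * A) * abs(a-c)" using assms by (intro mult_right_mono add_mono mult_mono) auto
 finally show ?thesis by (simp add: power2_eq_square)
qed

context hill_family
begin

text \<open>Clustering is applied to the parameter \<open>1 / w^2\<close>. The number of windows
  grows like \<open>l\<close>, while the resonant part of each window has size of order
  \<open>e/l\<close>, so the total is of order \<open>e\<close> uniformly in
  \<open>l\<close>.\<close>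

lemma resonant_frequencies_measure:
 fixes P P' :: "real => real => real"
 assumes b: "b>=1" and r: "0<r" "r<=R" and l: "l>=1" and e: "0<e" "e<=1"
  and P: "!!w. w\<in>{r..R}==>potential b (P w) (P' w)"
  and diff: "!!v w t. v\<in>{r..R}==>w\<in>{r..R}==>abs(P v t-P w t-(1/v^2-1/w^2))<=res_const b * abs(1/v^2-1/w^2)"
  and S: "{w\<in>{r..R}. gap l (P w)<e}\<in>sets lborel"
 shows "emeasure lborel {w\<in>{r..R}. gap l (P w)<e}
    <= ennreal (2 * R^4/r * gap_const b*((R-r)*(2 * R)/(res_const b * r^4)+1) * e)"
proof -
 let ?g = "gap_const b" and ?c = "res_const b"
 let ?S = "{w\<in>{r..R}. gap l (P w)<e}"
 have R: "R>0" using r by simp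
 have c: "?c>0" using res_const_pos[OF b] by simp
 have g: "?g>0" using mass_const_pos[OF b] ec_ge_1[OF b] by (simp add: gap_const_def)
 \<comment> \<open>Frequencies within \<open>h\<close> of each other have \<open>1 / w^2\<close>
   within \<open>res_const b / l\<close>; \<open>\<rho>\<close> is the clustering distance
   \<open>gap_const b * e / l\<close> translated back to frequencies.\<close>
 define h where "h = ?c * r^4/(2 * R * l)"
 define \<rho> where "\<rho> = R^4/(2 * r) * ?g * e/l"
 have h0: "h>0" using c r R l by (simp add: h_def)
 have rho0: "\<rho> >= 0" using r R g e l by (simp add: \<rho>_def)
 have "emeasure lborel ?S<=ennreal (4 * \<rho> * ((R-r)/h+1))"
 proof (rule cluster_measure[OF S _ r(2) h0 rho0])
  show "?S\<subseteq>{r..R}" by auto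
  fix x y z assume xyz: "x \<in> ?S" "y \<in> ?S" "z \<in> ?S" and d: "abs(x-y)<=h" "abs(x-z)<=h" "abs(y-z)<=h"
  define w where "w=(%j::nat. if j=0 then x else if j=1 then y else z)"
  have wS: "w j \<in> ?S" for j using xyz by (simp add: w_def)
  then have wI: "w j\<in>{r..R}" and wg: "gap l (P (w j))<e" for j by auto
  have wd: "abs(w j-w k)<=h" for j k using d h0 by (auto simp: w_def abs_minus_commute)
  have close: "abs(1/(w j)^2-1/(w k)^2) <= ?c/l" for j k
  proof -
   have "abs(1/(w j)^2-1/(w k)^2)<=2 * R/r^4 * abs(w j-w k)" by (rule inverse_square_diff_bounds) (use wI[of j] wI[of k] r in auto)
   also have "... <= 2 * R/r^4 * h" using wd[of j k] r R by (intro mult_left_mono) auto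
   also have "... = ?c/l" using r R l by (simp add: h_def)
   finally show ?thesis .
  qed
  have far: "abs(x-y) <= \<rho>" if "abs(1/x^2-1/y^2) <= ?g * e/l" "x\<in>{r..R}" "y\<in>{r..R}" for x y
  proof -
   have "2 * r/R^4 * abs(x-y)<=abs(1/x^2-1/y^2)" by (rule inverse_square_diff_bounds) (use that r in auto)
   then have "2 * r/R^4 * abs(x-y) <= ?g * e/l" using that(1) by linarith
   then have "R^4/(2 * r)*(2 * r/R^4 * abs(x-y))<=R^4/(2 * r)*(?g * e/l)" using r R by (intro mult_left_mono) auto
   then show ?thesis using r R by (simp add: \<rho>_def)
  qed
  have "abs(1/(w 0)^2-1/(w 1)^2) <= ?g * e/l \<or> abs(1/(w 0)^2-1/(w 2)^2) <= ?g * e/l \<or> abs(1/(w 1)^2-1/(w 2)^2) <= ?g * e/l" by (rule three_resonances[OF b l e P[OF wI] diff[OF wI wI] close wg])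
  then show "abs(x-y) <= \<rho> \<or> abs(x-z) <= \<rho> \<or> abs(y-z) <= \<rho>" using far[of x y] far[of x z] far[of y z] xyz by (auto simp: w_def)
 qed
 also have "... <= ennreal (2 * R^4/r * ?g*((R-r)*(2 * R)/(?c * r^4)+1) * e)"
 proof (rule ennreal_leI)
  have "4 * \<rho> * ((R-r)/h+1)=2 * R^4/r * ?g * e*(((R-r)/h+1)/l)" by (simp add: \<rho>_def mult_ac)
  also have "((R-r)/h+1)/l=(R-r)*(2 * R)/(?c * r^4)+1/l" using c r R l by (simp add: h_def add_divide_distrib)
  also have "2 * R^4/r * ?g * e * ... <= 2 * R^4/r * ?g * e*((R-r)*(2 * R)/(?c * r^4)+1)" using l r R g e by (intro mult_left_mono add_left_mono) auto
  finally show "4 * \<rho> * ((R-r)/h+1)<=2 * R^4/r * ?g*((R-r)*(2 * R)/(?c * r^4)+1) * e" by (simp add: mult_ac)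
 qed
 finally show ?thesis .
qed

text \<open>The factor \<open>mu^3 <= (et * G)^3\<close> outweighs the \<open>G^(-2)\<close> and
  \<open>G^(-3)\<close> in the bounds for \<open>nonlin\<close>, so a single \<open>et0\<close>
  makes the coupling small for all admissible \<open>G\<close>. The bad set of each mode is measured
  slice by slice at fixed \<open>mu\<close>, where only the frequency varies.\<close>

lemma local_family:
 assumes r: "0<r" "r<=R" and cc: "cc>=0"
 shows "\<exists>b\<ge>1. \<exists>et0>0. \<exists>C\<ge>0. \<forall>et G. 0<et-->et<=et0-->0<G-->G<=1/2 -->
    (\<exists>A. \<exists>p q :: real\<times>real => real \<Rightarrow>\<^sub>C real. A\<in>sets borel&A\<subseteq>{r..R}\<times>{0<..<et * G} &
       (\<forall>z\<in>A. fixes_pot b G (1/(fst z)^2) (cc*(snd z)^3*(1/(fst z)^2)^3) (p z) (q z) &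
         (\<forall>i\<in>I. gap (lam i) (p z)>=2 * threshold G i)) &
       emeasure lborel ({r..R}\<times>{0<..<et * G}-A)<=ennreal (C * G*(et * G)))"
proof -
 have R: "R>0" using r by simp
 \<comment> \<open>Ensures \<open>2/b <= 1/R^2 <= ap z <= 1/r^2 <= b - 1\<close> on the whole
   parameter rectangle.\<close>
 define b where "b=max (2 * R^2) (1/r^2+1)"
 have b: "b>=1" using r by (simp add: b_def le_max_iff_disj)
 define ap where "ap z=1/(fst z)^2" for z :: "real\<times>real"
 define bt where "bt z=cc*(snd z)^3*(ap z)^3" for z :: "real\<times>real"
 \<comment> \<open>\<open>1/r^6\<close> bounds the cube of \<open>ap\<close> and
   \<open>3/r^4\<close> the Lipschitz constant of cubing; the sum with \<open>fcst\<close> and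
   \<open>lip_const\<close> covers both \<open>bound\<close> and \<open>lbound\<close> once the
   powers of \<open>G\<close> are removed.\<close>
 define H where "H=cc*(1/r^6+3/r^4)*(2*(fcst b)^2+4*(fcst b * lip_const b)) * S0"
 have C0: "fcst b>=1" "lip_const b>=0" using fcst_pos[OF b] lip_const_nonneg[OF b, of 1] by auto
 have H0: "H>=0" unfolding H_def using cc r C0 S0_nonneg by (intro mult_nonneg_nonneg) auto
 have c: "res_const b>0" "res_const b<=1" using res_const_pos[OF b] by auto
 \<comment> \<open>\<open>1/b\<close> is what the fixed point requires. The comparison of potentials
   at two frequencies produces an error of five times \<open>m\<close>, hence the
   \<open>res_const b / 8\<close>.\<close>
 define m where "m=min (1/b) (res_const b/8)"
 have m: "m>0" "m<=1/b" "m<=res_const b/8" using b c by (auto simp: m_def)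
 define et0 where "et0=min 1 (m/(H+1))"
 have eta0: "et0>0" "et0<=1" "et0 * H<=m"
 proof -
  show "et0>0" "et0<=1" using m H0 by (auto simp: et0_def)
  have "et0 * H<=m/(H+1)*(H+1)" using m H0 by (intro mult_mono) (auto simp: et0_def)
  then show "et0 * H<=m" using H0 by simp
 qed
 define C1 where "C1=2 * R^4/r * gap_const b*((R-r)*(2 * R)/(res_const b * r^4)+1)"
 have g: "gap_const b>0" using mass_const_pos[OF b] ec_ge_1[OF b] by (simp add: gap_const_def)
 have C1: "C1>=0" unfolding C1_def using r R g c by (intro mult_nonneg_nonneg add_nonneg_nonneg divide_nonneg_nonneg) auto
 define C where "C=2 * C1*(\<Sum>\<^sub>\<infinity>i\<in>I. lam i powr (- ta))"
 have C: "C>=0" unfolding C_def using C1 by (intro mult_nonneg_nonneg infsum_nonneg) auto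
 have main: "\<exists>A. \<exists>p q :: real\<times>real => real \<Rightarrow>\<^sub>C real. A\<in>sets borel&A\<subseteq>{r..R}\<times>{0<..<et * G} &
       (\<forall>z\<in>A. fixes_pot b G (ap z) (bt z) (p z) (q z)&(\<forall>i\<in>I. gap (lam i) (p z)>=2 * threshold G i)) &
       emeasure lborel ({r..R}\<times>{0<..<et * G}-A)<=ennreal (C * G*(et * G))"
  if eta: "0<et" "et<=et0" and G: "0<G" "G<=1/2" for et G
 proof -
  have G1: "G<=1" using G by simp
  define bt2 where "bt2=infsum (bound b G) I"
  define bt3 where "bt3=infsum (lbound b G) I"
  have bd0: "bt2>=0" "bt3>=0" unfolding bt2_def bt3_def by (rule BD_nonneg[OF b G(1) G1])+
  define Q where "Q={r..R}\<times>{0..et * G}"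
  have om: "0<fst z" "r<=fst z" "fst z<=R" "0<=snd z" "snd z<=et * G" if "z\<in>Q" for z using that r by (auto simp: Q_def)
  have al: "0<=ap z" "ap z<=1/r^2" "2/b<=ap z" "ap z<=b-1" if "z\<in>Q" for z
  proof -
   note o = om[OF that]
   show "0<=ap z" by (simp add: ap_def)
   show 1: "ap z<=1/r^2" unfolding ap_def using o r by (intro divide_left_mono power_mono) auto
   have "1/R^2<=ap z" unfolding ap_def using o R by (intro divide_left_mono power_mono) auto
   moreover have "2/b<=2/(2 * R^2)" using R b by (intro divide_left_mono) (auto simp: b_def)
   ultimately show "2/b<=ap z" by simp
   have "1/r^2+1<=b" by (simp add: b_def)
   then show "ap z<=b-1" using 1 by linarith
  qed
  have mu3: "(snd z)^3 * bt2<=et*(2*(fcst b)^2+4*(fcst b * lip_const b)) * S0"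
    "(snd z)^3 * bt3<=et*(2*(fcst b)^2+4*(fcst b * lip_const b)) * S0" if "z\<in>Q" for z
  proof -
   have e3: "et^3<=et"
   proof -
    have "et^3<=et^1" using eta eta0 by (intro power_decreasing) auto
    then show ?thesis by simp
   qed
   have "(snd z)^3<=(et * G)^3" using om[OF that] by (intro power_mono) auto
   also have "... = et^3 * G^3" by (simp add: power_mult_distrib)
   also have "... <= et * G^3" using e3 G by (intro mult_right_mono) auto
   finally have s: "(snd z)^3<=et * G^3" .
   have "(snd z)^3 * bt2<=et * G^3 * bt2" using s bd0 by (intro mult_right_mono) auto
   also have "... = et*(2*(fcst b)^2 * S0) * G" unfolding bt2_def bound_summable(2)[OF b G(1) G1] using G by (simp add: power2_eq_square power3_eq_cube)
   also have "... <= et*(2*(fcst b)^2 * S0)*1" using G eta S0_nonneg by (intro mult_left_mono) auto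
   also have "... <= et*(2*(fcst b)^2+4*(fcst b * lip_const b)) * S0" using eta C0 S0_nonneg by (simp add: mult.assoc[symmetric] mult_right_mono mult_left_mono)
   finally show "(snd z)^3 * bt2<=et*(2*(fcst b)^2+4*(fcst b * lip_const b)) * S0" .
   have "(snd z)^3 * bt3<=et * G^3 * bt3" using s bd0 by (intro mult_right_mono) auto
   also have "... = et*(4*(fcst b * lip_const b)) * S0" unfolding bt3_def lbound_summable(2)[OF b G(1) G1] using G by simp
   also have "... <= et*(2*(fcst b)^2+4*(fcst b * lip_const b)) * S0" using eta C0 S0_nonneg by (intro mult_right_mono mult_left_mono) auto
   finally show "(snd z)^3 * bt3<=et*(2*(fcst b)^2+4*(fcst b * lip_const b)) * S0" .
  qed
  have small: "cc * x * y<=m"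
   if "0<=x" "x<=1/r^6+3/r^4" "y<=et*(2*(fcst b)^2+4*(fcst b * lip_const b)) * S0" "0<=y" for x y
  proof -
   have "cc * x * y<=cc*(1/r^6+3/r^4)*(et*(2*(fcst b)^2+4*(fcst b * lip_const b)) * S0)" using that cc r by (intro mult_mono mult_left_mono mult_nonneg_nonneg add_nonneg_nonneg) auto
   also have "... = et * H" by (simp add: H_def)
   also have "... <= et0 * H" using eta H0 by (intro mult_right_mono) auto
   finally show ?thesis using eta0 by linarith
  qed
  have al3: "(ap z)^3<=1/r^6" if "z\<in>Q" for z
  proof -
   have "(ap z)^3<=(1/r^2)^3" using al[OF that] by (intro power_mono) auto
   then show ?thesis by (simp add: power_divide power_mult[symmetric])
  qed
  have r6: "1/r^6<=1/r^6+3/r^4" "3/r^4<=1/r^6+3/r^4" using r by auto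
  have be: "0<=bt z" "bt z * bt2<=m" "bt z * bt3<=m" if "z\<in>Q" for z
  proof -
   have mu0: "0<=(snd z)^3" using om[OF that] by simp
   show "0<=bt z" unfolding bt_def using cc mu0 al[OF that] by simp
   have a0: "0<=(ap z)^3" using al[OF that] by simp
   have "cc*(ap z)^3*((snd z)^3 * bt2)<=m" by (rule small[OF a0 order_trans[OF al3[OF that] r6(1)] mu3(1)[OF that]]) (use mu0 bd0 in simp)
   then show "bt z * bt2<=m" by (simp add: bt_def mult_ac)
   have "cc*(ap z)^3*((snd z)^3 * bt3)<=m" by (rule small[OF a0 order_trans[OF al3[OF that] r6(1)] mu3(2)[OF that]]) (use mu0 bd0 in simp)
   then show "bt z * bt3<=m" by (simp add: bt_def mult_ac)
  qed
  have m4: "m<=1/4" using m c by linarith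
  have "\<exists>pq. fixes_pot b G (ap z) (bt z) (fst pq) (snd pq)" if "z\<in>Q" for z
  proof -
   have "\<exists>p q. fixes_pot b G (ap z) (bt z) p q" by (rule fixed_point_exists[OF b G(1) G1])
      (use al[OF that] be[OF that] m m4 in \<open>auto simp: bt2_def bt3_def\<close>)
   then show ?thesis by auto
  qed
  then obtain pq where pq: "!!z. z\<in>Q==>fixes_pot b G (ap z) (bt z) (fst (pq z)) (snd (pq z))" by metis
  define p q where "p z=fst (pq z)" and "q z=snd (pq z)" for z
  have fp: "fixes_pot b G (ap z) (bt z) (p z) (q z)" if "z\<in>Q" for z using pq[OF that] by (simp add: p_def q_def)
  have pot: "potential b (p z) (q z)" if "z\<in>Q" for z using fp[OF that] by (simp add: fixes_pot_def)
  have cmp: "abs(p z t-p y t)<=2*(abs(ap z-ap y)+abs(bt z-bt y) * bt2)"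
   "abs(p z t-p y t-(ap z-ap y))<=abs(bt z-bt y) * bt2+bt y * bt3*(2*(abs(ap z-ap y)+abs(bt z-bt y) * bt2))"
   if "z\<in>Q" "y\<in>Q" for z y t using fixed_point_compare[OF b G(1) G1 fp[OF that(1)] fp[OF that(2)] be(1)[OF that(2)], of t] be(3)[OF that(2)] m4 unfolding bt2_def bt3_def by linarith+
  define h where "h i z=gap (lam i) (p z)" for i z
  \<comment> \<open>The fixed points are merely chosen, one for each parameter. The estimate
    \<open>cmp\<close> makes the gap at them continuous in the parameter, and the measurability of
    the resonant sets rests on this.\<close>
  have hc: "continuous_on Q (h i)" if i: "i\<in>I" for i unfolding continuous_on_def
  proof
   fix y assume y: "y\<in>Q"
   have l: "lam i>0" using lam[OF i] by simp
   have ac: "(ap \<longlongrightarrow> ap y) (at y within Q)" "(bt \<longlongrightarrow> bt y) (at y within Q)" unfolding bt_def[abs_def] ap_def[abs_def] using om(1)[OF y] by (auto intro!: tendsto_eq_intros)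
   have "((%z. (ecst b)^2 * lam i*(2*(abs(ap z-ap y)+abs(bt z-bt y) * bt2))) \<longlongrightarrow>
          (ecst b)^2 * lam i*(2*(abs(ap y-ap y)+abs(bt y-bt y) * bt2))) (at y within Q)" by (intro tendsto_intros ac)
   then have z0: "((%z. (ecst b)^2 * lam i*(2*(abs(ap z-ap y)+abs(bt z-bt y) * bt2))) \<longlongrightarrow> 0) (at y within Q)" by simp
   show "(h i \<longlongrightarrow> h i y) (at y within Q)"
   proof (rule LIM_zero_cancel, rule Lim_null_comparison[OF _ z0])
    show "\<forall>\<^sub>F z in at y within Q. norm (h i z-h i y)<=(ecst b)^2 * lam i*(2*(abs(ap z-ap y)+abs(bt z-bt y) * bt2))" unfolding eventually_at_filter
    proof (rule always_eventually, intro allI impI)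
     fix z assume "z\<in>Q"
     show "norm (h i z-h i y)<=(ecst b)^2 * lam i*(2*(abs(ap z-ap y)+abs(bt z-bt y) * bt2))" unfolding h_def real_norm_def by (rule gap_lipschitz[OF b pot[OF \<open>z \<in> Q\<close>] pot[OF y] l cmp(1)[OF \<open>z \<in> Q\<close> y]])
    qed
   qed
  qed
  have Qc: "closed Q" unfolding Q_def by (intro closed_Times closed_atLeastAtMost)
  define A where "A=({r..R}\<times>{0<..<et * G})\<inter>{z\<in>Q. \<forall>i\<in>I. h i z>=2 * threshold G i}"
  have box: "{r..R}\<times>{0<..<et * G}\<in>sets borel" by (auto intro!: borel_Times)
  have cl: "closed {z\<in>Q. h i z>=x}" if "i\<in>I" for i x
  proof -
   have "{z\<in>Q. h i z>=x}=Q\<inter>h i -` {x..}" by auto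
   then show ?thesis using continuous_closed_preimage[OF hc[OF that] Qc closed_atLeast] by simp
  qed
  have bad: "{z\<in>Q. h i z<x}\<in>sets borel" if "i\<in>I" for i x
  proof -
   have "{z\<in>Q. h i z<x}=Q - {z\<in>Q. h i z>=x}" by auto
   then show ?thesis using cl[OF that, of x] Qc by (simp add: borel_closed sets.Diff)
  qed
  have "closed {z\<in>Q. \<forall>i\<in>I. h i z>=2 * threshold G i}"
  proof -
   have "{z\<in>Q. \<forall>i\<in>I. h i z>=2 * threshold G i}=Q\<inter>(\<Inter>i\<in>I. {z\<in>Q. h i z>=2 * threshold G i})" by auto
   then show ?thesis using Qc cl by (auto intro!: closed_Int closed_INT)
  qed
  then have Ab: "A\<in>sets borel" unfolding A_def by (intro sets.Int box borel_closed)
  have boxQ: "{r..R}\<times>{0<..<et * G}\<subseteq>Q" by (auto simp: Q_def)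
  have slice: "emeasure lborel ((%w. (w,mu)) -` {z\<in>Q. h i z<2 * threshold G i})<=ennreal (C1*(2 * threshold G i)) * indicator {0..et * G} mu"
   if i: "i\<in>I" for i mu
  proof (cases "mu\<in>{0..et * G}")
   case False
   then have "(%w. (w,mu)) -` {z\<in>Q. h i z<2 * threshold G i}={}" by (auto simp: Q_def)
   then show ?thesis by (simp only: emeasure_empty zero_le)
  next
   case True
   then have wQ: "(w,mu)\<in>Q" if "w\<in>{r..R}" for w using that by (auto simp: Q_def)
   have thr: "0<threshold G i" "2 * threshold G i<=1"
   proof -
    show "0<threshold G i" using threshold_bounds[OF i G(1) G1] by simp
    \<comment> \<open>Here \<open>G <= 1/2\<close> enters: the resonance level is twice the
      threshold and must not exceed 1.\<close>
    have "threshold (2 * G) i<=1" using threshold_bounds[OF i, of "2 * G"] G by simp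
    then show "2 * threshold G i<=1" by (simp add: threshold_def)
   qed
   have eq: "(%w. (w,mu)) -` {z\<in>Q. h i z<2 * threshold G i}={w\<in>{r..R}. gap (lam i) (p (w,mu))<2 * threshold G i}" using True by (auto simp: Q_def h_def)
   have "emeasure lborel {w\<in>{r..R}. gap (lam i) (p (w,mu))<2 * threshold G i}<=ennreal (C1*(2 * threshold G i))" unfolding C1_def
   proof (rule resonant_frequencies_measure[OF b r lam[OF i]])
    show "potential b (p (w,mu)) (q (w,mu))" if "w\<in>{r..R}" for w by (rule pot[OF wQ[OF that]])
    have "(%w. (w,mu)) -` {z\<in>Q. h i z<2 * threshold G i}\<inter>space borel\<in>sets borel" by (rule measurable_sets[OF _ bad[OF i]]) (auto intro!: bmcI continuous_intros)
    then show "{w\<in>{r..R}. gap (lam i) (p (w,mu))<2 * threshold G i}\<in>sets lborel" unfolding eq by simp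
    fix v w t assume vw: "v\<in>{r..R}" "w\<in>{r..R}"
    let ?d = "abs(1/v^2-1/w^2)"
    have a: "ap (v,mu)=1/v^2" "ap (w,mu)=1/w^2" by (auto simp: ap_def)
    have "abs(bt (v,mu)-bt (w,mu))=cc * mu^3 * abs((1/v^2)^3-(1/w^2)^3)" using cc True by (simp add: bt_def a right_diff_distrib[symmetric] abs_mult)
    also have "... <= cc * mu^3*(3*(1/r^2)^2 * ?d)" using cc True al[OF wQ[OF vw(1)]] al[OF wQ[OF vw(2)]] by (intro mult_left_mono cube_diff_bound) (auto simp: a)
    finally have "abs(bt (v,mu)-bt (w,mu)) * bt2<=cc * mu^3*(3*(1/r^2)^2 * ?d) * bt2" using bd0 by (intro mult_right_mono)
    also have "... = cc*(3/r^4)*(mu^3 * bt2) * ?d" by (simp add: power_divide power_mult[symmetric] mult_ac)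
    also have "... <= m * ?d"
    proof (intro mult_right_mono small)
     show "mu^3 * bt2<=et*(2*(fcst b)^2+4*(fcst b * lip_const b)) * S0" using mu3(1)[OF wQ[OF vw(1)]] by simp
     show "0<=mu^3 * bt2" using True bd0 by simp
    qed (use r r6 in auto)
    finally have B: "abs(bt (v,mu)-bt (w,mu)) * bt2<=m * ?d" .
    have md: "m * ?d<=res_const b/8 * ?d" using m by (intro mult_right_mono) auto
    have md1: "m * ?d<=1 * ?d" using m4 by (intro mult_right_mono) auto
    have "bt (w,mu) * bt3*(2*(?d+abs(bt (v,mu)-bt (w,mu)) * bt2))<=m*(2*(?d+1 * ?d))" using be[OF wQ[OF vw(2)]] B md1 m bd0 by (intro mult_mono) auto
    then have B2: "bt (w,mu) * bt3*(2*(?d+abs(bt (v,mu)-bt (w,mu)) * bt2))<=4*(m * ?d)" by simp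
    have "abs(p (v,mu) t-p (w,mu) t-(1/v^2-1/w^2))<=m * ?d+4*(m * ?d)" using cmp(2)[OF wQ[OF vw(1)] wQ[OF vw(2)], of t] B B2 unfolding a by linarith
    moreover have "0<=res_const b * ?d" using c by simp
    ultimately show "abs(p (v,mu) t-p (w,mu) t-(1/v^2-1/w^2))<=res_const b * ?d" using md by linarith
   qed (use thr in auto)
   then show ?thesis unfolding eq using True by simp
  qed
  have bm: "emeasure lborel {z\<in>Q. h i z<2 * threshold G i}<=ennreal (C1*(2 * G)*(et * G) * lam i powr (- ta))" if i: "i\<in>I" for i
  proof -
   let ?B = "{z\<in>Q. h i z<2 * threshold G i}"
   have "?B\<in>sets (lborel \<Otimes>\<^sub>M lborel)" unfolding lborel_prod using bad[OF i] by simp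
   then have "emeasure lborel ?B=(\<integral>\<^sup>+ mu. emeasure lborel ((%w. (w,mu)) -` ?B) \<partial>lborel)" unfolding lborel_prod[symmetric] by (rule lborel_pair.emeasure_pair_measure_alt2)
   also have "... <= (\<integral>\<^sup>+ mu. ennreal (C1*(2 * threshold G i)) * indicator {0..et * G} mu \<partial>lborel)" by (rule nn_integral_mono) (rule slice[OF i])
   also have "... = ennreal (C1*(2 * threshold G i)) * ennreal (et * G)" using eta G by (simp add: nn_integral_cmult_indicator)
   also have "... = ennreal (C1*(2 * threshold G i)*(et * G))" using eta G C1 threshold_bounds[OF i G(1) G1] by (simp add: ennreal_mult)
   finally show ?thesis by (simp add: threshold_def mult_ac)
  qed
  have "{r..R}\<times>{0<..<et * G}-A\<subseteq>(\<Union>i\<in>I. {z\<in>Q. h i z<2 * threshold G i})" using boxQ by (auto simp: A_def not_le)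
  then have "emeasure lborel ({r..R}\<times>{0<..<et * G}-A)<=emeasure lborel (\<Union>i\<in>I. {z\<in>Q. h i z<2 * threshold G i})" by (rule emeasure_mono) (use bad countable in \<open>auto intro!: sets.countable_UN'\<close>)
  also have "... <= ennreal (\<Sum>\<^sub>\<infinity>i\<in>I. C1*(2 * G)*(et * G) * lam i powr (- ta))"
  proof (rule emeasure_UN_le_infsum[OF countable _ _ bm])
   show "(%i. C1*(2 * G)*(et * G) * lam i powr (- ta)) summable_on I" by (rule summable_on_cmult_right[OF summ_lam])
  qed (use bad C1 G eta in auto)
  also have "(\<Sum>\<^sub>\<infinity>i\<in>I. C1*(2 * G)*(et * G) * lam i powr (- ta))=C * G*(et * G)" unfolding C_def by (subst infsum_cmult_right') (simp add: mult_ac)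
  finally have meas: "emeasure lborel ({r..R}\<times>{0<..<et * G}-A)<=ennreal (C * G*(et * G))" .
  show ?thesis
  proof (intro exI conjI)
   show "A\<in>sets borel" by (rule Ab)
   show "A\<subseteq>{r..R}\<times>{0<..<et * G}" by (auto simp: A_def)
   show "\<forall>z\<in>A. fixes_pot b G (ap z) (bt z) (p z) (q z)&(\<forall>i\<in>I. gap (lam i) (p z)>=2 * threshold G i)" using fp by (auto simp: A_def h_def)
   show "emeasure lborel ({r..R}\<times>{0<..<et * G}-A)<=ennreal (C * G*(et * G))" by (rule meas)
  qed
 qed
 show ?thesis using b eta0(1) C main unfolding bt_def ap_def by blast
qed

end

section \<open>Periodic functions of class H1\<close>

text \<open>Cauchy-Schwarz against the constant 1, from the nonnegativity of the integral of
  \<open>(abs (f x) - c)^2\<close> as a quadratic polynomial in \<open>c\<close>. For measure zero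
  the polynomial degenerates to a linear one.\<close>

lemma si_CS:
 fixes f :: "'a => real"
 assumes A: "A\<in>sets N" "emeasure N A < \<infinity>" and m: "f\<in>borel_measurable N"
  and f2: "set_integrable N A (%x. (f x)^2)"
 shows "set_integrable N A f" "(LINT x:A|N. abs(f x))^2<=measure N A*(LINT x:A|N. (f x)^2)"
proof -
 let ?m = "measure N A" and ?S = "LINT x:A|N. (f x)^2" and ?L = "LINT x:A|N. abs(f x)"
 have one: "set_integrable N A (%x. c)" for c :: real unfolding sid using A by (simp add: integrable_mult_left)
 show fi: "set_integrable N A f" unfolding sid
 proof (rule Bochner_Integration.integrable_bound)
  show "integrable N (%x. indicator A x *\<^sub>R (1+(f x)^2))" using one[of 1] f2 unfolding sid scaleR_add_right by (rule Bochner_Integration.integrable_add)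
  show "(%x. indicator A x *\<^sub>R f x)\<in>borel_measurable N" using A m by simp
  have "abs(y)<=1+y^2" for y :: real
  proof -
   have "2 * abs(y)<=1+y^2" using zero_le_power2[of "abs(y)-1"] by (simp add: power2_diff)
   then show ?thesis using zero_le_power2[of y] by linarith
  qed
  then show "AE x in N. norm (indicator A x *\<^sub>R f x)<=norm (indicator A x *\<^sub>R (1+(f x)^2))" by (intro AE_I2) (auto simp: indicator_def)
 qed
 then have ai: "set_integrable N A (%x. abs(f x))" by (rule set_integrable_abs)
 have q: "0 <= ?S-2 * c * ?L+c^2 * ?m" for c
 proof -
  have "0<=(LINT x:A|N. (abs(f x)-c)^2)" unfolding sli by (rule integral_nonneg_AE) (auto simp: indicator_def)
  also have "(%x. (abs(f x)-c)^2)=(%x. ((f x)^2-(2 * c) * abs(f x))+c^2)" by (auto simp: power2_diff)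
  also have "(LINT x:A|N. ((f x)^2-(2 * c) * abs(f x))+c^2)=(LINT x:A|N. (f x)^2-(2 * c) * abs(f x))+(LINT x:A|N. c^2)" using f2 ai one by (intro set_integral_add set_integral_diff(1) set_integrable_mult_right) auto
  also have "(LINT x:A|N. (f x)^2-(2 * c) * abs(f x)) = ?S-(LINT x:A|N. (2 * c) * abs(f x))" using f2 ai by (intro set_integral_diff(2)) auto
  also have "(LINT x:A|N. (2 * c) * abs(f x))=2 * c * ?L" by simp
  also have "(LINT x:A|N. c^2)=c^2 * ?m" using A by (simp add: sli)
  finally show ?thesis .
 qed
 show "?L^2 <= ?m * ?S"
 proof (cases "?m=0")
  case True
  have L0: "?L>=0" unfolding sli by (rule integral_nonneg_AE) (auto simp: indicator_def)
  have "?L=0"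
  proof (rule ccontr)
   assume "?L~=0"
   then have "?L>0" using L0 by simp
   then show False using q[of "(?S+1)/(2 * ?L)"] True by (simp add: field_simps)
  qed
  then show ?thesis using True by simp
 next
  case False
  then have m0: "?m>0" using measure_nonneg[of N A] by linarith
  have "0<=(?S-2*(?L / ?m) * ?L+(?L / ?m)^2 * ?m) * ?m" using q[of "?L / ?m"] m0 by simp
  also have "... = ?m * ?S - ?L^2" using m0 by (simp add: field_simps power2_eq_square)
  finally show ?thesis by simp
 qed
qed

text \<open>Half-lines generate the Borel sets and are closed under intersection, so equality of the
  integrals spreads to all Borel sets by Dynkin induction; the total integral handles
  complements.\<close>

lemma AE_eq_of_interval_integrals:
 fixes f g :: "real => complex"
 assumes f: "integrable lborel f" and g: "integrable lborel g"
  and eq: "!!a. (LINT t:{..a}|lborel. f t)=(LINT t:{..a}|lborel. g t)"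
  and tot: "(\<integral>t. f t \<partial>lborel)=(\<integral>t. g t \<partial>lborel)"
 shows "AE t in lborel. f t=g t"
proof (rule sigma_finite_measure.density_unique_banach[OF sigma_finite_lborel f g])
 fix A :: "real set" assume "A\<in>sets lborel"
 then have A: "A\<in>sigma_sets UNIV (range (%a::real. {..a}))" by (simp add: borel_eq_atMost)
 have sb: "sigma_sets UNIV (range (%a::real. {..a}))=sets borel" by (simp add: borel_eq_atMost)
 have fi: "sil B f" "sil B g" if "B\<in>sets borel" for B unfolding sid using that f g by (auto intro!: integrable_mult_indicator)
 have IS: "Int_stable (range (%a::real. {..a}))"
 proof (rule Int_stableI_image)
  fix a c :: real show "\<exists>k\<in>UNIV. {..a}\<inter>{..c}={..k}" by (intro bexI[of _ "min a c"]) auto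
 qed
 have PW: "range (%a::real. {..a})\<subseteq>Pow UNIV" by simp
 show "(LINT t:A|lborel. f t)=(LINT t:A|lborel. g t)" using IS PW A
 proof (induction rule: sigma_sets_induct_disjoint)
  case (basic A) then show ?case using eq by auto
 next
  case empty then show ?case by (simp add: sli)
 next
  case (compl A)
  then have Ab: "A\<in>sets borel" unfolding sb by simp
  have c: "(LINT t:UNIV-A|lborel. h t)=(\<integral>t. h t \<partial>lborel)-(LINT t:A|lborel. h t)" if h: "integrable lborel h" for h :: "real => complex"
  proof -
   have "(%t. indicator (UNIV-A) t *\<^sub>R h t)=(%t. h t-indicator A t *\<^sub>R h t)" by (auto simp: indicator_def)
   then show ?thesis unfolding sli using h Ab by (simp add: integrable_mult_indicator)
  qed
  show ?case unfolding c[OF f] c[OF g] using compl tot by simp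
 next
  case (union A)
  have Ab: "range A\<subseteq>sets lborel" using union(2) unfolding sb by simp
  then have U: "(\<Union>i. A i)\<in>sets borel" by (auto intro!: sets.countable_UN)
  have "(LINT t:(\<Union>i. A i)|lborel. f t)=(\<Sum>i. (LINT t:A i|lborel. f t))" by (rule lebesgue_integral_countable_add) (use Ab union(1) fi[OF U] in \<open>auto simp: disjoint_family_on_def\<close>)
  also have "... = (\<Sum>i. (LINT t:A i|lborel. g t))" using union by simp
  also have "... = (LINT t:(\<Union>i. A i)|lborel. g t)" by (rule lebesgue_integral_countable_add[symmetric]) (use Ab union(1) fi[OF U] in \<open>auto simp: disjoint_family_on_def\<close>)
  finally show ?case .
 qed
qed

lemma si_open_closed:
 fixes f :: "real => 'b::{banach,second_countable_topology}"
 assumes "f\<in>bM"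
 shows "sil {a<..<b} f \<longleftrightarrow> sil {a..b} f"
  "(LINT t:{a<..<b}|lborel. f t)=(LINT t:{a..b}|lborel. f t)"
proof -
 have ae: "AE t in lborel. (indicator {a<..<b} t :: real)=indicator {a..b} t" using AE_lborel_singleton[of a] AE_lborel_singleton[of b] by eventually_elim (auto simp: indicator_def)
 show "sil {a<..<b} f \<longleftrightarrow> sil {a..b} f" unfolding sid by (rule integrable_cong_AE) (use assms ae in \<open>auto elim!: eventually_mono\<close>)
 show "(LINT t:{a<..<b}|lborel. f t)=(LINT t:{a..b}|lborel. f t)" unfolding sli by (rule integral_cong_AE) (use assms ae in \<open>auto elim!: eventually_mono\<close>)
qed

lemma periodic_int_shift:
 fixes w :: "real => 'a"
 assumes "!!t. w (t+2 * pi)=w t"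
 shows "w (t+2 * pi * of_int k)=w t"
proof (induction k arbitrary: t rule: int_induct[where k = 0])
 case (step1 i)
 have "w (t+2 * pi * of_int (i+1))=w ((t+2 * pi * of_int i)+2 * pi)" by (simp add: algebra_simps)
 then show ?case using assms step1 by metis
next
 case (step2 i)
 have "w (t+2 * pi * of_int i)=w ((t+2 * pi * of_int (i-1))+2 * pi)" by (simp add: algebra_simps)
 then show ?case using assms step2 by metis
qed simp

lemma H1_deriv_L2:
 assumes "H1_deriv v w"
 shows "w\<in>bM" "!!t. w (t+2 * pi)=w t"
  "sil {0..2*pi} (%t. (norm (w t))^2)" "sil {0..2*pi} w"
  "sil {0..2*pi} (%t. norm (w t))"
  "(JT t. norm (w t))^2<=2 * pi*(JT t. (norm (w t))^2)"
proof -
 show m[measurable]: "w\<in>bM" and "!!t. w (t+2 * pi)=w t" using assms unfolding H1_deriv_def periodic2pi_def by auto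
 have "(%t. (norm (w t))^2)\<in>bM" by measurable
 from si_open_closed(1)[OF this, of 0 "2*pi"] assms
 show s: "sil {0..2*pi} (%t. (norm (w t))^2)" unfolding H1_deriv_def by simp
 have nm: "(%t. norm (w t))\<in>borel_measurable lborel" by measurable
 have "emeasure lborel {0..2*pi} < \<infinity>" by simp
 note CS = si_CS[OF _ this nm s]
 show n: "sil {0..2*pi} (%t. norm (w t))" by (rule CS(1)) simp
 show "sil {0..2*pi} w"
 proof -
  have "(%t. indicator {0..2*pi} t *\<^sub>R w t)\<in>borel_measurable lborel" by measurable
  moreover have "integrable lborel (%t. norm (indicator {0..2*pi} t *\<^sub>R w t))" using n unfolding sid by (simp add: abs_mult)
  ultimately show ?thesis unfolding sid by (subst integrable_norm_iff[symmetric])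
 qed
 show "(JT t. norm (w t))^2<=2 * pi*(JT t. (norm (w t))^2)" using CS(2) by simp
qed

text \<open>Square integrability is assumed on one period only. Translates of that period, finitely
  many for each interval, give integrability on any bounded interval.\<close>

lemma H1_deriv_li:
 assumes "H1_deriv v w"
 shows "sil {a..b} w"
proof -
 note w = H1_deriv_L2[OF assms]
 have one: "sil {2*pi * of_int k..2*pi * of_int (k+1)} w" for k :: int
 proof -
  have "integrable lborel (%x. indicator {0..2*pi} (- 2*pi * of_int k+1 * x) *\<^sub>R w (- 2*pi * of_int k+1 * x))" using w(4) unfolding sid by (rule lborel_integrable_real_affine) simp
  moreover have "(%x. indicator {0..2*pi} (- 2*pi * of_int k+1 * x) *\<^sub>R w (- 2*pi * of_int k+1 * x))
       = (%x. indicator {2*pi * of_int k..2*pi * of_int (k+1)} x *\<^sub>R w x)"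
  proof
   fix x
   have "w (x+2 * pi * of_int (- k))=w x" by (rule periodic_int_shift[where w = w, OF w(2)])
   then have "w (- 2*pi * of_int k+1 * x)=w x" by (simp add: algebra_simps)
   moreover have "(- 2*pi * of_int k+1 * x\<in>{0..2*pi})=(x\<in>{2*pi * of_int k..2*pi * of_int (k+1)})" by (auto simp: algebra_simps)
   ultimately show "indicator {0..2*pi} (- 2*pi * of_int k+1 * x) *\<^sub>R w (- 2*pi * of_int k+1 * x)=indicator {2*pi * of_int k..2*pi * of_int (k+1)} x *\<^sub>R w x" by (simp add: indicator_def)
  qed
  ultimately show ?thesis by (simp add: sid)
 qed
 have many: "sil {- (2*pi*real n)..2*pi*real n} w" for n
 proof (induction n)
  case 0
  have "sil {0::real..0} w" by (rule set_integrable_subset[OF w(4)]) auto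
  then show ?case by simp
 next
  case (Suc n)
  have "sil ({2*pi * of_int (- int (Suc n))..2*pi * of_int (- int (Suc n)+1)}\<union>{- (2*pi*real n)..2*pi*real n}) w" by (rule set_integrable_Un[OF one Suc]) auto
  then have "sil (({2*pi * of_int (- int (Suc n))..2*pi * of_int (- int (Suc n)+1)}\<union>{- (2*pi*real n)..2*pi*real n})\<union>{2*pi * of_int (int n)..2*pi * of_int (int n+1)}) w" by (rule set_integrable_Un[OF _ one]) auto
  then show ?case
  proof (rule set_integrable_subset)
   show "{- (2*pi*real (Suc n))..2*pi*real (Suc n)}\<subseteq>({2*pi * of_int (- int (Suc n))..2*pi * of_int (- int (Suc n)+1)}\<union>{- (2*pi*real n)..2*pi*real n})\<union>{2*pi * of_int (int n)..2*pi * of_int (int n+1)}" by (auto simp: algebra_simps)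
  qed simp
 qed
 obtain n where n: "max (abs(a)) (abs(b))/(2*pi)<=real n" using real_arch_simple by blast
 then have "max (abs(a)) (abs(b))<=2*pi*real n" by (simp add: field_simps)
 then show ?thesis by (intro set_integrable_subset[OF many[of n]]) auto
qed

lemma H1_deriv_integral: "H1_deriv v w==>a<=b==>v b-v a=(LINT t:{a..b}|lborel. w t)" unfolding H1_deriv_def by blast

lemma H1_deriv_cont:
 assumes "H1_deriv v w"
 shows "cts v" unfolding continuous_on_eq_continuous_at[OF open_UNIV]
proof
 fix t :: real
 have i: "sil {t-1..t+1} w" by (rule H1_deriv_li[OF assms])
 have "w integrable_on {t-1..t+1}" using set_borel_integral_eq_integral(1)[OF i] .
 then have "continuous_on {t-1..t+1} (%x. v (t-1)+integral {t-1..x} w)" by (intro continuous_intros indefinite_integral_continuous_1)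
 moreover have "v (t-1)+integral {t-1..x} w=v x" if "x\<in>{t-1..t+1}" for x
 proof -
  have "v x-v (t-1)=(LINT s:{t-1..x}|lborel. w s)" using H1_deriv_integral[OF assms] that by simp
  also have "... = integral {t-1..x} w" by (rule set_borel_integral_eq_integral(2)[OF H1_deriv_li[OF assms]])
  finally show ?thesis by (simp add: algebra_simps)
 qed
 ultimately have "continuous_on {t-1..t+1} v" by (rule continuous_on_eq)
 then show "isCont v t" by (rule continuous_on_interior) (simp add: interior_atLeastAtMost_real)
qed

text \<open>\<open>H1_norm\<close> rests on an arbitrary choice of the weak derivative; this makes
  the choice immaterial and allows the norm to be computed from any weak derivative.\<close>

lemma H1_deriv_unique:
 assumes 1: "H1_deriv v w" and 2: "H1_deriv v u"
 shows "AE t in lborel. t\<in>{0..2*pi}-->w t=u t"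
proof -
 define f where "f z t=indicator {0..2*pi} t *\<^sub>R z t" for z :: "real => complex" and t :: real
 have i: "integrable lborel (f w)" "integrable lborel (f u)" using H1_deriv_L2(4)[OF 1] H1_deriv_L2(4)[OF 2] by (auto simp: sid f_def[abs_def])
 have e: "(LINT t:{..a}|lborel. f z t)=v (max 0 (min a (2*pi)))-v 0" if "H1_deriv v z" for a z
 proof -
  have "(LINT t:{..a}|lborel. f z t)=(LINT t:{0..max 0 (min a (2*pi))}|lborel. z t)"
  proof -
   have "AE t in lborel. indicator {..a} t *\<^sub>R f z t=indicator {0..max 0 (min a (2*pi))} t *\<^sub>R z t" using AE_lborel_singleton[of 0] by eventually_elim (auto simp: f_def indicator_def)
   then show ?thesis unfolding sli by (intro integral_cong_AE) (use H1_deriv_L2(1)[OF that] in \<open>auto simp: f_def[abs_def]\<close>)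
  qed
  then show ?thesis using H1_deriv_integral[OF that, of 0 "max 0 (min a (2*pi))"] by simp
 qed
 have tot: "(\<integral>t. f z t \<partial>lborel)=v (2*pi)-v 0" if "H1_deriv v z" for z using H1_deriv_integral[OF that, of 0 "2*pi"] by (simp add: f_def[abs_def] sli)
 have "AE t in lborel. f w t=f u t" by (rule AE_eq_of_interval_integrals[OF i]) (simp_all add: e[OF 1] e[OF 2] tot[OF 1] tot[OF 2])
 then show ?thesis by eventually_elim (auto simp: f_def)
qed

lemma H1_norm_eq:
 assumes "H1_deriv v w"
 shows "H1_norm v=sqrt ((JT t. (norm (v t))^2)+(JT t. (norm (w t))^2))"
proof -
 define u where "u=(SOME w. H1_deriv v w)"
 have u: "H1_deriv v u" unfolding u_def by (rule someI[of "H1_deriv v", OF assms])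
 have um[measurable]: "u\<in>bM" and wm[measurable]: "w\<in>bM" using H1_deriv_L2(1)[OF u] H1_deriv_L2(1)[OF assms] by auto
 have vm[measurable]: "v\<in>bM" using H1_deriv_cont[OF u] by (rule bmcI)
 have "(JT t. (norm (u t))^2)=(JT t. (norm (w t))^2)" unfolding sli
 proof (rule integral_cong_AE)
  show "AE t in lborel. indicator {0..2*pi} t *\<^sub>R (norm (u t))^2=indicator {0..2*pi} t *\<^sub>R (norm (w t))^2" using H1_deriv_unique[OF u assms] by eventually_elim (auto simp: indicator_def)
 qed measurable
 moreover have "(LINT t:{0<..<2*pi}|lborel. (norm (u t))^2)=(JT t. (norm (u t))^2)" by (rule si_open_closed(2)) measurable
 moreover have "(LINT t:{0<..<2*pi}|lborel. (norm (v t))^2)=(JT t. (norm (v t))^2)" by (rule si_open_closed(2)) measurable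
 ultimately show ?thesis unfolding H1_norm_def u_def[symmetric] by simp
qed

lemma H1E:
 assumes "v\<in>H1"
 obtains w where "H1_deriv v w" "!!t. v (t+2 * pi)=v t" using assms unfolding H1_def periodic2pi_def by blast

lemma H1_norm_nonneg: "H1_norm v>=0" unfolding H1_norm_def by (intro real_sqrt_ge_zero add_nonneg_nonneg) (auto simp: sli intro!: integral_nonneg_AE)

text \<open>The oscillation of \<open>v\<close> is at most the integral of its absolute derivative;
  comparing the value at one point with all others and averaging squares over a period gives the
  supremum bound. The constants come from \<open>2 * pi <= 7\<close>, with \<open>7 <= 3^2\<close>
  and \<open>2 * 7 <= 4^2\<close>.\<close>

lemma H1_norm_bounds:
 assumes v: "v\<in>H1" and w: "H1_deriv v w"
 shows "(JT t. norm (w t))<=3 * H1_norm v" "norm (v t)<=4 * H1_norm v"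
proof -
 define S T where "S=(JT t. (norm (v t))^2)" and "T=(JT t. (norm (w t))^2)"
 have per: "v (t+2 * pi)=v t" for t using v unfolding H1_def periodic2pi_def by blast
 have vc: "cts v" by (rule H1_deriv_cont[OF w])
 have ST0: "S>=0" "T>=0" unfolding S_def T_def by (auto simp: sli intro!: integral_nonneg_AE)
 have n2: "(H1_norm v)^2=S+T" using ST0 by (simp add: H1_norm_eq[OF w] S_def T_def)
 have n0: "H1_norm v>=0" by (rule H1_norm_nonneg)
 define L where "L=(JT t. norm (w t))"
 have L2: "L^2<=2 * pi * T" using H1_deriv_L2(6)[OF w] by (simp add: L_def T_def)
 have "2 * pi * T<=7 * T" using pi_approx ST0 by (intro mult_right_mono) auto
 then have L2': "L^2<=7 * T" using L2 by linarith
 have "L^2<=(3 * H1_norm v)^2" using L2' n2 ST0 by (simp add: power_mult_distrib)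
 then show "(JT t. norm (w t))<=3 * H1_norm v" unfolding L_def by (rule power2_le_imp_le) (use n0 in simp)
 have L0: "L>=0" unfolding L_def by (auto simp: sli intro!: integral_nonneg_AE)
 have dv: "norm (v x-v y)<=L" if "x\<in>{0..2*pi}" "y\<in>{0..2*pi}" "y<=x" for x y
 proof -
  have "norm (v x-v y)=norm (LINT t:{y..x}|lborel. w t)" using H1_deriv_integral[OF w that(3)] by simp
  also have "... <= (LINT t:{y..x}|lborel. norm (w t))" unfolding sli using integral_norm_bound[of lborel "%t. indicator {y..x} t *\<^sub>R w t"] by simp
  also have "... <= L" unfolding L_def sli
  proof (rule integral_mono)
   have "sil {y..x} (%t. norm (w t))" by (rule set_integrable_subset[OF H1_deriv_L2(5)[OF w]]) (use that in auto)
   then show "integrable lborel (%t. indicator {y..x} t *\<^sub>R norm (w t))" by (simp add: sid)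
   show "integrable lborel (%t. indicator {0..2*pi} t *\<^sub>R norm (w t))" using H1_deriv_L2(5)[OF w] by (simp add: sid)
  qed (use that in \<open>auto simp: indicator_def\<close>)
  finally show ?thesis .
 qed
 have dv': "norm (v x)<=norm (v y)+L" if "x\<in>{0..2*pi}" "y\<in>{0..2*pi}" for x y
 proof (cases "y<=x")
  case True
  then show ?thesis using dv[OF that True] norm_triangle_ineq2[of "v x" "v y"] by linarith
 next
  case False
  then show ?thesis using dv[OF that(2,1)] norm_triangle_ineq2[of "v x" "v y"] by (simp add: norm_minus_commute)
 qed
 obtain s where s: "s\<in>{0..<2*pi}" "v t=v s" using periodic_reduce[of v v t] per by blast
 have "(norm (v s))^2<=2*(norm (v y))^2+2 * L^2" if "y\<in>{0..2*pi}" for y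
 proof -
  have "(norm (v s))^2<=(norm (v y)+L)^2" using dv'[of s y] s that by (intro power_mono) auto
  also have "... <= 2*(norm (v y))^2+2 * L^2" using zero_le_power2[of "norm (v y)-L"] by (simp add: power2_sum power2_diff)
  finally show ?thesis .
 qed
 then have "(JT y. (norm (v s))^2)<=(JT y. 2*(norm (v y))^2+2 * L^2)" unfolding sli
 proof (intro integral_mono)
  show "integrable lborel (%y. indicator {0..2*pi} y *\<^sub>R (norm (v s))^2)" by simp
  show "integrable lborel (%y. indicator {0..2*pi} y *\<^sub>R (2*(norm (v y))^2+2 * L^2))" by (rule borel_integrable_compact) (auto intro!: continuous_intros continuous_on_subset[OF vc])
 qed (auto simp: indicator_def)
 also have "(JT y. 2*(norm (v y))^2+2 * L^2)=2 * S+2 * pi*(2 * L^2)"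
 proof -
  have "sil {0..2*pi} (%y. (norm (v y))^2)" unfolding sid by (rule borel_integrable_compact) (auto intro!: continuous_intros continuous_on_subset[OF vc])
  moreover have "sil {0..2*pi} (%y. 2 * L^2)" unfolding sid by simp
  ultimately show ?thesis by (subst set_integral_add(2)) (auto simp: S_def sli)
 qed
 finally have "2 * pi*(norm (v s))^2<=2 * S+2 * pi*(2 * L^2)" by (simp add: sli)
 also have "... <= 2 * pi * S+2 * pi*(2 * L^2)" using pi_gt3 ST0 by (intro add_right_mono mult_right_mono) auto
 also have "... = 2 * pi*(S+2 * L^2)" by (simp add: algebra_simps)
 finally have "(norm (v s))^2<=S+2 * L^2" by simp
 also have "... <= (4 * H1_norm v)^2" using L2' n2 ST0 by (simp add: power_mult_distrib)
 finally show "norm (v t)<=4 * H1_norm v" unfolding s(2) by (rule power2_le_imp_le) (use n0 in simp)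
qed

lemma H1_forcing_Re:
 assumes v: "v\<in>H1"
 shows "forcing (4 * H1_norm v) (%t. Re (v t))"
proof -
 obtain w where w: "H1_deriv v w" and per: "!!t. v (t+2 * pi)=v t" by (rule H1E[OF v]) blast
 have i: "sil {0..2*pi} (%t. Re (w t))" using H1_deriv_L2(4)[OF w] unfolding sid by (auto dest: integrable_Re)
 show ?thesis unfolding forcing_def
 proof (intro conjI allI exI ballI)
  show "cts (%t. Re (v t))" by (intro continuous_intros H1_deriv_cont[OF w])
  show "Re (v (t+2 * pi))=Re (v t)" for t using per by simp
  show "abs(Re (v t))<=4 * H1_norm v" for t using H1_norm_bounds(2)[OF v w, of t] abs_Re_le_cmod[of "v t"] by linarith
  show "sil {0..2*pi} (%t. Re (w t))" by (rule i)
  show "Re (v t)-Re (v 0)=(LINT s:{0..t}|lborel. Re (w s))" if "t\<in>{0..2*pi}" for t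
  proof -
   have ii: "integrable lborel (%s. indicator {0..t} s *\<^sub>R w s)" using H1_deriv_li[OF w, of 0 t] by (simp add: sid)
   have "Re (v t)-Re (v 0)=Re (LINT s:{0..t}|lborel. w s)" using H1_deriv_integral[OF w, of 0 t] that by (metis atLeastAtMost_iff minus_complex.simps(1))
   also have "... = (LINT s:{0..t}|lborel. Re (w s))" unfolding sli using integral_Re[OF ii] by simp
   finally show ?thesis .
  qed
  have "(JT s. abs(Re (w s)))<=(JT s. norm (w s))" by (rule set_integral_mono) (use i H1_deriv_L2(5)[OF w] in \<open>auto intro: abs_Re_le_cmod set_integrable_abs\<close>)
  also have "... <= 3 * H1_norm v" by (rule H1_norm_bounds(1)[OF v w])
  also have "... <= 4 * H1_norm v" using H1_norm_nonneg[of v] by simp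
  finally show "(JT s. abs(Re (w s)))<=4 * H1_norm v" .
 qed
qed

lemma H1_deriv_lin:
 assumes v: "H1_deriv v w" and u: "H1_deriv u z"
 shows "H1_deriv (%t. c * v t+u t) (%t. c * w t+z t)"
proof -
 note vw = H1_deriv_L2[OF v] and uz = H1_deriv_L2[OF u]
 have m[measurable]: "w\<in>bM" "z\<in>bM" using vw(1) uz(1) by auto
 show ?thesis unfolding H1_deriv_def
 proof (intro conjI allI impI)
  show "(%t. c * w t+z t)\<in>bM" by measurable
  show "periodic2pi (%t. c * w t+z t)" unfolding periodic2pi_def using vw(2) uz(2) by simp
  have b: "(norm (c * x+y))^2<=2*(norm c)^2*(norm x)^2+2*(norm y)^2" for x y :: complex
  proof -
   have "(norm (c * x+y))^2<=(norm c * norm x+norm y)^2" by (intro power_mono) (auto simp: norm_mult[symmetric] norm_triangle_ineq)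
   also have "... <= 2*(norm c * norm x)^2+2*(norm y)^2" using zero_le_power2[of "norm c * norm x-norm y"] by (simp add: power2_sum power2_diff)
   finally show ?thesis by (simp add: power_mult_distrib)
  qed
  have "sil {0..2*pi} (%t. (norm (c * w t+z t))^2)" unfolding sid
  proof (rule Bochner_Integration.integrable_bound)
   show "integrable lborel (%t. indicator {0..2*pi} t *\<^sub>R (2*(norm c)^2*(norm (w t))^2+2*(norm (z t))^2))" using set_integral_add(1)[OF set_integrable_mult_right[OF vw(3), of "2*(norm c)^2"] set_integrable_mult_right[OF uz(3), of 2]] by (simp add: sid)
  qed (use b in \<open>auto intro!: AE_I2 simp: indicator_def\<close>)
  then show "sil {0<..<2*pi} (%t. (norm (c * w t+z t))^2)" by (subst si_open_closed(1)) simp_all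
  fix a b :: real assume ab: "a<=b"
  have i: "sil {a..b} (%t. c * w t)" "sil {a..b} z" using H1_deriv_li[OF v] H1_deriv_li[OF u] by auto
  have "(LINT t:{a..b}|lborel. c * w t+z t)=c*(v b-v a)+(u b-u a)" unfolding H1_deriv_integral[OF v ab] H1_deriv_integral[OF u ab] using set_integral_add(2)[OF i] by simp
  then show "c * v b+u b-(c * v a+u a)=(LINT t:{a..b}|lborel. c * w t+z t)" by (simp add: algebra_simps)
 qed
qed

text \<open>The inequality \<open>|a + b|^2 <= 2 |a|^2 + 2 |b|^2\<close> is integrated for function
  and derivative; in this squared form it fits the weighted sums of the space norm directly.\<close>

lemma H1_lin:
 assumes v: "v\<in>H1" and u: "u\<in>H1"
 shows "(%t. c * v t+u t)\<in>H1" "(H1_norm (%t. c * v t+u t))^2<=2*(norm c)^2*(H1_norm v)^2+2*(H1_norm u)^2"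
proof -
 obtain w where w: "H1_deriv v w" and pv: "!!t. v (t+2 * pi)=v t" by (rule H1E[OF v]) blast
 obtain z where z: "H1_deriv u z" and pu: "!!t. u (t+2 * pi)=u t" by (rule H1E[OF u]) blast
 have d: "H1_deriv (%t. c * v t+u t) (%t. c * w t+z t)" by (rule H1_deriv_lin[OF w z])
 then show "(%t. c * v t+u t)\<in>H1" unfolding H1_def periodic2pi_def using pv pu by auto
 have b: "(norm (c * x+y))^2<=2*(norm c)^2*(norm x)^2+2*(norm y)^2" for x y :: complex
 proof -
  have "(norm (c * x+y))^2<=(norm c * norm x+norm y)^2" by (intro power_mono) (auto simp: norm_mult[symmetric] norm_triangle_ineq)
  also have "... <= 2*(norm c * norm x)^2+2*(norm y)^2" using zero_le_power2[of "norm c * norm x-norm y"] by (simp add: power2_sum power2_diff)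
  finally show ?thesis by (simp add: power_mult_distrib)
 qed
 have le: "(JT t. (norm (c * f t+g t))^2)<=2*(norm c)^2*(JT t. (norm (f t))^2)+2*(JT t. (norm (g t))^2)"
  if f: "sil {0..2*pi} (%t. (norm (f t))^2)" and g: "sil {0..2*pi} (%t. (norm (g t))^2)"
   and fg: "sil {0..2*pi} (%t. (norm (c * f t+g t))^2)" for f g :: "real => complex"
 proof -
  note i = set_integral_add[OF set_integrable_mult_right[OF f, of "2*(norm c)^2"] set_integrable_mult_right[OF g, of 2]]
  have "(JT t. (norm (c * f t+g t))^2)<=(JT t. 2*(norm c)^2*(norm (f t))^2+2*(norm (g t))^2)" by (rule set_integral_mono) (use fg i(1) b in auto)
  then show ?thesis using i(2) by simp
 qed
 have ci: "sil {0..2*pi} (%t. (norm (f t))^2)" if "cts f" for f :: "real => complex" unfolding sid by (rule borel_integrable_compact) (auto intro!: continuous_intros continuous_on_subset[OF that])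
 have 1: "(JT t. (norm (c * v t+u t))^2)<=2*(norm c)^2*(JT t. (norm (v t))^2)+2*(JT t. (norm (u t))^2)" by (rule le) (intro ci continuous_intros H1_deriv_cont[OF w] H1_deriv_cont[OF z])+
 have 2: "(JT t. (norm (c * w t+z t))^2)<=2*(norm c)^2*(JT t. (norm (w t))^2)+2*(JT t. (norm (z t))^2)" by (rule le) (use H1_deriv_L2(3)[OF w] H1_deriv_L2(3)[OF z] H1_deriv_L2(3)[OF d] in auto)
 have nn: "0<=(JT t. (norm (f t))^2)" for f :: "real => complex" by (auto simp: sli intro!: integral_nonneg_AE)
 have sq: "(H1_norm f)^2=(JT t. (norm (f t))^2)+(JT t. (norm (g t))^2)" if "H1_deriv f g" for f g using nn[of f] nn[of g] by (simp add: H1_norm_eq[OF that])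
 show "(H1_norm (%t. c * v t+u t))^2<=2*(norm c)^2*(H1_norm v)^2+2*(H1_norm u)^2" unfolding sq[OF d] sq[OF w] sq[OF z] distrib_left using 1 2 by linarith
qed

lemma H1_of_C1:
 fixes v v' :: "real => complex"
 assumes d: "!!t. (v hvd v' t) (at t)" and c: "cts v'"
  and p: "!!t. v (t+2 * pi)=v t" "!!t. v' (t+2 * pi)=v' t"
  and A: "!!t. norm (v t)<=A" "!!t. norm (v' t)<=A"
 shows "v\<in>H1" "H1_norm v<=4 * A"
proof -
 have A0: "A>=0" using norm_ge_zero A(1)[of 0] by (rule order_trans)
 have vc: "cts v" by (rule continuous_on_vector_derivative[OF has_vector_derivative_at_within, OF d])
 have ci: "sil {0..2*pi} (%t. (norm (f t))^2)" if "cts f" for f :: "real => complex" unfolding sid by (rule borel_integrable_compact) (auto intro!: continuous_intros continuous_on_subset[OF that])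
 have H: "H1_deriv v v'" unfolding H1_deriv_def
 proof (intro conjI allI impI)
  show m: "v'\<in>bM" using c by (rule bmcI)
  show "periodic2pi v'" using p by (simp add: periodic2pi_def)
  have "(%t. (norm (v' t))^2)\<in>bM" using m by measurable
  then show "sil {0<..<2*pi} (%t. (norm (v' t))^2)" using si_open_closed(1) ci[OF c] by blast
  fix a b :: real assume "a<=b"
  then show "v b-v a=(LINT t:{a..b}|lborel. v' t)" unfolding sli by (intro integral_FTC_atLeastAtMost[symmetric]) (auto intro: has_vector_derivative_at_within d continuous_on_subset[OF c])
 qed
 then show "v\<in>H1" using p by (auto simp: H1_def periodic2pi_def)
 have le: "(JT t. (norm (f t))^2)<=7 * A^2" if "cts f" "!!t. norm (f t)<=A" for f :: "real => complex"
 proof -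
  have "(JT t. (norm (f t))^2)<=(JT t. A^2)" by (rule set_integral_mono) (use ci[OF that(1)] that(2) in \<open>auto simp: sid intro: power_mono\<close>)
  also have "... = 2 * pi * A^2" by (simp add: sli)
  also have "... <= 7 * A^2" using pi_approx by (intro mult_right_mono) auto
  finally show ?thesis .
 qed
 have "(4 * A)^2=16 * A^2" by (simp add: power_mult_distrib)
 then have "(JT t. (norm (v t))^2)+(JT t. (norm (v' t))^2)<=(4 * A)^2" using le[OF vc A(1)] le[OF c A(2)] zero_le_power2[of A] by linarith
 then have "H1_norm v<=sqrt ((4 * A)^2)" unfolding H1_norm_eq[OF H] by (rule real_sqrt_le_mono)
 then show "H1_norm v<=4 * A" using A0 real_sqrt_abs[of "4 * A"] by linarith
qed

section \<open>Integration over a periodicity box\<close>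

lemma AE_not_hyperplane:
 fixes b :: "'a::euclidean_space"
 assumes "b\<in>Basis"
 shows "AE x in lborel. x\<bullet>b~=c"
proof -
 have cl: "closed {x. x\<bullet>b=c}" by (simp add: closed_hyperplane inner_commute closed_Collect_eq continuous_intros)
 have "{x. x\<bullet>b=c}\<in>null_sets lebesgue" using negligible_standard_hyperplane[OF assms, of c] by (simp add: negligible_iff_null_sets)
 then have "{x. x\<bullet>b=c}\<in>null_sets lborel" using cl by (simp add: null_sets_completion_iff borel_closed)
 then show ?thesis using AE_not_in by fastforce
qed

lemma sicb:
 fixes f :: "'a::euclidean_space => 'b::{banach,second_countable_topology}"
 assumes f: "cts f" and A: "A\<in>sets borel" "bounded A"
 shows "sil A f"
proof -
 obtain a where a: "A\<subseteq>cbox (-a) a" using bounded_subset_cbox_symmetric[OF A(2)] by blast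
 have "sil (cbox (-a) a) f" unfolding sid by (rule borel_integrable_compact) (auto intro: continuous_on_subset[OF f])
 then show ?thesis by (rule set_integrable_subset) (use A a in auto)
qed

lemma set_integral_translate:
 fixes f :: "'a::euclidean_space => complex"
 assumes "cts f" "A\<in>sets borel"
 shows "(LINT x:A|lborel. f (x+c))=(LINT x:{y. y-c\<in>A}|lborel. f x)"
proof -
 have m[measurable]: "f\<in>bM" using assms(1) by (rule bmcI)
 have [measurable]: "A\<in>sets borel" by fact
 have "{y. y-c\<in>A}=(%y. y-c) -` A\<inter>space borel" by auto
 also have "... \<in> sets borel" by measurable
 finally have [measurable]: "{y. y-c\<in>A}\<in>sets borel" .
 have "(LINT x:{y. y-c\<in>A}|lborel. f x)=(\<integral>x. indicator {y. y-c\<in>A} x *\<^sub>R f x \<partial>distr lborel borel ((+) c))" unfolding sli lborel_distr_plus ..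
 also have "... = (\<integral>x. indicator {y. y-c\<in>A} (c+x) *\<^sub>R f (c+x) \<partial>lborel)" by (rule integral_distr) measurable
 also have "... = (LINT x:A|lborel. f (x+c))" unfolding sli by (intro Bochner_Integration.integral_cong) (auto simp: indicator_def add.commute)
 finally show ?thesis by simp
qed

abbreviation "torus_box \<equiv> cbox 0 ((2 * pi) *\<^sub>R One)"

text \<open>The shifted slab is cut at \<open>2 * pi\<close> and the protruding piece is moved back
  by one period. The slabs \<open>S u v\<close> are half-open in direction \<open>b\<close>, so the
  pieces are disjoint.\<close>

lemma periodic_integral_shift:
 fixes f :: "'a::euclidean_space => complex"
 assumes f: "cts f" and b: "b\<in>Basis" and per: "!!x. f (x+(2 * pi) *\<^sub>R b)=f x"
  and s: "0<=s" "s<=2 * pi"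
 shows "(LINT x:torus_box|lborel. f (x+s *\<^sub>R b))=(LINT x:torus_box|lborel. f x)"
proof -
 define S where "S u v={x::'a. u<x\<bullet>b&x\<bullet>b<=v&(\<forall>i\<in>Basis - {b}. 0<=x\<bullet>i&x\<bullet>i<=2 * pi)}" for u v
 have Sm[measurable]: "S u v\<in>sets borel" for u v unfolding S_def by measurable
 have Sb: "bounded (S u v)" if "-7<=u" "v<=20" for u v
 proof (rule bounded_subset[OF bounded_cbox[of "(-20) *\<^sub>R One" "20 *\<^sub>R One"]], rule subsetI)
  fix x assume x: "x\<in>S u v"
  have "-20<=x\<bullet>i&x\<bullet>i<=20" if "i\<in>Basis" for i
  proof (cases "i=b")
   case True then show ?thesis using x \<open>-7 \<le> u\<close> \<open>v \<le> 20\<close> by (auto simp: S_def)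
  next
   case False
   then have "0<=x\<bullet>i&x\<bullet>i<=2 * pi" using x that by (auto simp: S_def)
   then show ?thesis using pi_approx by auto
  qed
  then show "x\<in>cbox ((-20) *\<^sub>R One) (20 *\<^sub>R One)" by (auto simp: mem_box)
 qed
 have p7: "2 * pi<7" using pi_approx by auto
 have KS: "(LINT x:torus_box|lborel. g x)=(LINT x:S 0 (2*pi)|lborel. g x)" if g: "cts g" for g :: "'a => complex" unfolding sli
 proof (rule integral_cong_AE)
  have [measurable]: "g\<in>bM" using g by (rule bmcI)
  show "(%x. indicator torus_box x *\<^sub>R g x)\<in>borel_measurable lborel" by measurable
  show "(%x. indicator (S 0 (2*pi)) x *\<^sub>R g x)\<in>borel_measurable lborel" by measurable
  show "AE x in lborel. indicator torus_box x *\<^sub>R g x=indicator (S 0 (2*pi)) x *\<^sub>R g x" using AE_not_hyperplane[OF b, of 0]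
  proof eventually_elim
   case (elim x)
   have "x\<in>torus_box \<longleftrightarrow> x\<in>S 0 (2*pi)" using elim b by (auto simp: S_def mem_box)
   then show ?case by (simp add: indicator_def)
  qed
 qed
 have fs: "cts (%x. f (x+s *\<^sub>R b))" by (rule continuous_on_compose2[OF f]) (auto intro!: continuous_intros)
 have i: "sil (S u v) f" if "-7<=u" "v<=20" for u v by (rule sicb[OF f Sm Sb[OF that]])
 have tr: "{y. y-r *\<^sub>R b\<in>S u v}=S (u+r) (v+r)" for r u v using b by (auto simp: S_def inner_diff_left inner_Basis)
 have "(LINT x:torus_box|lborel. f (x+s *\<^sub>R b))=(LINT x:S s (2*pi+s)|lborel. f x)" unfolding KS[OF fs] set_integral_translate[OF f Sm] tr by simp
 also have "S s (2*pi+s)=S s (2*pi)\<union>S (2*pi) (2*pi+s)" using s by (auto simp: S_def)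
 also have "(LINT x:S s (2*pi)\<union>S (2*pi) (2*pi+s)|lborel. f x)=(LINT x:S s (2*pi)|lborel. f x)+(LINT x:S (2*pi) (2*pi+s)|lborel. f x)"
 proof (rule set_integral_Un)
  show "S s (2*pi)\<inter>S (2*pi) (2*pi+s)={}" by (auto simp: S_def)
 qed (rule i; use s p7 in simp)+
 also have "(LINT x:S (2*pi) (2*pi+s)|lborel. f x)=(LINT x:S 0 s|lborel. f (x+(2*pi) *\<^sub>R b))" unfolding set_integral_translate[OF f Sm] tr by (simp add: add.commute)
 also have "... = (LINT x:S 0 s|lborel. f x)" by (simp add: per)
 also have "(LINT x:S s (2*pi)|lborel. f x) + ... = (LINT x:S s (2*pi)\<union>S 0 s|lborel. f x)"
 proof (rule set_integral_Un[symmetric])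
  show "S s (2*pi)\<inter>S 0 s={}" by (auto simp: S_def)
 qed (rule i; use s p7 in simp)+
 also have "S s (2*pi)\<union>S 0 s=S 0 (2*pi)" using s by (auto simp: S_def)
 finally show ?thesis using KS[OF f] by simp
qed

section \<open>Fourier series on the torus\<close>

text \<open>By periodicity the integral of \<open>D\<close> does not change under translation in
  direction \<open>b\<close>. Averaging over all translations and exchanging the integrals leaves an
  integral of a derivative over one full period of \<open>ps\<close>, which vanishes. No coordinate
  has to be split off.\<close>

lemma torus_integral_derivative:
 fixes ps D :: "'a::euclidean_space => complex"
 assumes b: "b\<in>Basis" and D: "cts D" and perD: "!!x. D (x+(2 * pi) *\<^sub>R b)=D x"
  and per: "!!x. ps (x+(2 * pi) *\<^sub>R b)=ps x"
  and der: "!!x. ((%h. ps (x+h *\<^sub>R b)) hvd D x) (at 0)"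
 shows "(LINT x:torus_box|lborel. D x)=0"
proof -
 have der': "((%h. ps (x+h *\<^sub>R b)) hvd D (x+s *\<^sub>R b)) (at s)" for x s
 proof -
  have "((%h. ps ((x+s *\<^sub>R b)+h *\<^sub>R b)) \<circ> (%h. h-s) hvd 1 *\<^sub>R D (x+s *\<^sub>R b)) (at s)"
  proof (rule vector_diff_chain_at)
   show "((%h. h-s) hvd 1) (at s)" by (auto intro!: derivative_eq_intros)
   show "((%h. ps ((x+s *\<^sub>R b)+h *\<^sub>R b)) hvd D (x+s *\<^sub>R b)) (at (s-s))" using der by simp
  qed
  then show ?thesis by (simp add: o_def algebra_simps)
 qed
 define g where "g=(%(x,s). indicator (torus_box\<times>{0..2*pi}) (x,s) *\<^sub>R D (x+s *\<^sub>R b) :: complex)"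
 have gi: "integrable (lborel \<Otimes>\<^sub>M lborel) g"
 proof -
  have "integrable lborel (%z::'a\<times>real. indicator (torus_box\<times>{0..2*pi}) z *\<^sub>R D (fst z+snd z *\<^sub>R b))" by (rule borel_integrable_compact)
     (auto intro!: compact_Times continuous_on_compose2[OF D] continuous_intros)
  then show ?thesis unfolding lborel_prod g_def by (simp add: case_prod_beta')
 qed
 have inner1: "(\<integral>s. g (x,s) \<partial>lborel)=0" for x
 proof (cases "x\<in>torus_box")
  case True
  have "(\<integral>s. indicator {0..2*pi} s *\<^sub>R D (x+s *\<^sub>R b) \<partial>lborel)=ps (x+(2*pi) *\<^sub>R b)-ps (x+0 *\<^sub>R b)" by (rule integral_FTC_atLeastAtMost)
     (auto intro!: has_vector_derivative_at_within der' continuous_on_compose2[OF D] continuous_intros)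
  then show ?thesis using True per[of x] by (simp add: g_def indicator_times)
 next
  case False then show ?thesis by (simp add: g_def indicator_times)
 qed
 have inner2: "(\<integral>x. g (x,s) \<partial>lborel)=indicator {0..2*pi} s *\<^sub>R (LINT x:torus_box|lborel. D x)" for s
 proof (cases "s\<in>{0..2*pi}")
  case True
  have "(\<integral>x. g (x,s) \<partial>lborel)=(LINT x:torus_box|lborel. D (x+s *\<^sub>R b))" using True by (simp add: g_def indicator_times sli)
  also have "... = (LINT x:torus_box|lborel. D x)" by (rule periodic_integral_shift[OF D b perD]) (use True in auto)
  finally show ?thesis using True by simp
 next
  case False then show ?thesis by (simp add: g_def indicator_times)
 qed
 have "(\<integral>s. (\<integral>x. g (x,s) \<partial>lborel) \<partial>lborel)=(\<integral>x. (\<integral>s. g (x,s) \<partial>lborel) \<partial>lborel)" using lborel_pair.Fubini_integral[of "%x s. g (x,s)"] gi by simp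
 then have "(\<integral>s. indicator {0..2*pi} s *\<^sub>R (LINT x:torus_box|lborel. D x) \<partial>lborel)=0" unfolding inner1 inner2 by simp
 moreover have "(\<integral>s. indicator {0..2*pi} s *\<^sub>R (LINT x:torus_box|lborel. D x) \<partial>lborel)=(2*pi) *\<^sub>R (LINT x:torus_box|lborel. D x)" by simp
 ultimately show ?thesis by simp
qed

lemma set_integral_torus_box:
 fixes f :: "'a::euclidean_space => 'b::{banach,second_countable_topology}"
 assumes [measurable]: "f\<in>bM"
 shows "(LINT x:box 0 ((2 * pi) *\<^sub>R One)|lborel. f x)=(LINT x:torus_box|lborel. f x)" unfolding sli
proof (rule integral_cong_AE)
 have "AE x::'a in lborel. \<forall>b\<in>Basis. x\<bullet>b~=0&x\<bullet>b~=2 * pi" by (rule AE_finite_allI) (auto intro!: AE_not_hyperplane)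
 then show "AE x in lborel. indicator (box 0 ((2 * pi) *\<^sub>R One)) x *\<^sub>R f x=indicator torus_box x *\<^sub>R f x"
 proof eventually_elim
  case (elim x)
  have "x\<in>box 0 ((2 * pi) *\<^sub>R One) \<longleftrightarrow> x\<in>torus_box" using elim by (auto simp: mem_box less_le)
  then show ?case by (simp add: indicator_def)
 qed
qed measurable

lemma Omega_eq: "(Omega :: (real^'d) set)=box 0 ((2 * pi) *\<^sub>R One)"
proof -
 have "(\<chi> j. 2 * pi)=(2 * pi) *\<^sub>R (One :: real^'d)"
 proof (rule euclidean_eqI)
  fix b :: "real^'d" assume b: "b\<in>Basis"
  then obtain j where "b=axis j 1" by (auto simp: Basis_vec_def)
  then have "(\<chi> j. 2 * pi)\<bullet>b=2 * pi" by (simp add: inner_axis)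
  then show "(\<chi> j. 2 * pi)\<bullet>b=((2 * pi) *\<^sub>R One)\<bullet>b" using b by simp
 qed
 then show ?thesis by (simp add: Omega_def)
qed

lemma cell_eq: "(cell :: ((real^'d)\<times>real) set)=box 0 ((2 * pi) *\<^sub>R One)"
proof -
 have "(2 * pi) *\<^sub>R (One :: (real^'d)\<times>real)=((2 * pi) *\<^sub>R One,2 * pi)"
 proof (rule euclidean_eqI)
  fix b :: "(real^'d)\<times>real" assume b: "b\<in>Basis"
  then have "((2 * pi) *\<^sub>R One,2 * pi)\<bullet>b=2 * pi" by (auto simp: Basis_prod_def inner_Pair_0)
  then show "((2 * pi) *\<^sub>R One)\<bullet>b=((2 * pi) *\<^sub>R One,2 * pi)\<bullet>b" using b by simp
 qed
 then show ?thesis unfolding cell_def Omega_eq by (simp add: box_prod zero_prod_def box_real)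
qed

lemma Omega_props: "Omega\<in>sets borel" "emeasure lborel (Omega :: (real^'d) set)=ennreal ((2 * pi) ^ CARD('d))"
 "measure lborel (Omega :: (real^'d) set)=(2 * pi) ^ CARD('d)" "bounded (Omega :: (real^'d) set)"
proof -
 show "Omega\<in>sets borel" "bounded (Omega :: (real^'d) set)" unfolding Omega_eq by auto
 have "emeasure lborel (Omega :: (real^'d) set)=ennreal (\<Prod>b\<in>Basis. ((2 * pi) *\<^sub>R One-0 :: real^'d)\<bullet>b)" unfolding Omega_eq by (rule emeasure_lborel_box) simp
 also have "(\<Prod>b\<in>Basis. ((2 * pi) *\<^sub>R One-0 :: real^'d)\<bullet>b)=(\<Prod>b\<in>(Basis :: (real^'d) set). 2 * pi)" by (rule prod.cong) simp_all
 also have "... = (2 * pi) ^ CARD('d)" by simp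
 finally show e: "emeasure lborel (Omega :: (real^'d) set)=ennreal ((2 * pi) ^ CARD('d))" .
 then show "measure lborel (Omega :: (real^'d) set)=(2 * pi) ^ CARD('d)" by (simp add: measure_def)
qed

lemma rvec_simps: "rvec 0=0" "rvec (m-n)=rvec m-rvec n" "rvec (- m) = - rvec m" "rvec m $ j = of_int (m $ j)" by (auto simp: rvec_def vec_eq_iff)

lemma chf_props: "norm (char_fun m x)=1" "char_fun 0 x=1" "char_fun (m-n) x=char_fun m x * cnj (char_fun n x)"
 "char_fun (- m) x=cnj (char_fun m x)" "continuous_on S (char_fun m)"
proof -
 show n: "norm (char_fun m x)=1" unfolding char_fun_def by (simp add: norm_exp_i_times)
 show "char_fun 0 x=1" by (simp add: char_fun_def rvec_simps)
 show "char_fun (m-n) x=char_fun m x * cnj (char_fun n x)" by (simp add: char_fun_def rvec_simps exp_cnj inner_diff_left exp_add[symmetric] algebra_simps)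
 show "char_fun (- m) x=cnj (char_fun m x)" by (simp add: char_fun_def rvec_simps exp_cnj)
 show "continuous_on S (char_fun m)" unfolding char_fun_def by (intro continuous_intros)
qed

lemma char_fun_periodic: "char_fun m (x+(2 * pi) *\<^sub>R rvec n)=char_fun m x"
proof -
 have "rvec m\<bullet>rvec n = of_int (\<Sum>j\<in>UNIV. m $ j * n $ j)" by (simp add: inner_vec_def rvec_simps)
 then have "\<i> * of_real (rvec m\<bullet>(x+(2 * pi) *\<^sub>R rvec n)) = \<i> * of_real (rvec m\<bullet>x) + \<i> * (of_int (\<Sum>j\<in>UNIV. m $ j * n $ j)*(of_real pi*2))" by (simp add: inner_add_right algebra_simps)
 then show ?thesis unfolding char_fun_def by (simp only: exp_plus_2pin)
qed

lemma axis_rvec: "axis j 1=rvec (axis j 1)" by (auto simp: rvec_def axis_def vec_eq_iff)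

lemma char_fun_derivative:
 "((%h. char_fun m (x+h *\<^sub>R axis j 1)) hvd \<i> * of_int (m $ j) * char_fun m x) (at 0)"
proof -
 have e: "char_fun m (x+h *\<^sub>R axis j 1)=char_fun m x * exp (\<i> * of_int (m $ j) * of_real h)" for h by (simp add: char_fun_def inner_add_right inner_axis rvec_simps exp_add[symmetric] algebra_simps)
 have "((%h. exp (\<i> * of_int (m $ j) * of_real h)) hvd \<i> * of_int (m $ j)) (at 0)" by (rule has_vector_derivative_real_field[where f = "%z. exp (\<i> * of_int (m $ j) * z)"]) (auto intro!: derivative_eq_intros)
 from has_vector_derivative_mult_right[OF this, of "char_fun m x"] show ?thesis unfolding e by (simp add: mult.commute)
qed

lemma integral_char_fun:
 "(JO x. char_fun m x)=(if m=0 then of_real ((2 * pi) ^ CARD('d)) else 0)" for m :: "int^'d"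
proof (cases "m=0")
 case True
 moreover have "measure lborel (Omega :: (real^'d) set)=(2 * pi) ^ CARD('d)" "(Omega :: (real^'d) set)\<in>sets borel" by (rule Omega_props)+
 moreover have "emeasure lborel (Omega :: (real^'d) set) < \<infinity>" unfolding Omega_props(2) by simp
 ultimately show ?thesis by (simp add: power_mult_distrib chf_props sli scaleR_conv_of_real)
next
 case False
 then obtain j where j: "m $ j~=0" by (auto simp: vec_eq_iff)
 have mm: "char_fun m\<in>bM" by (rule bmcI[OF chf_props(5)])
 have "(LINT x:torus_box|lborel. char_fun m x)=0"
 proof (rule torus_integral_derivative[where ps = "%x. (1/(\<i> * of_int (m $ j))) * char_fun m x" and b = "axis j 1 :: real^'d"])
  show "axis j (1::real)\<in>Basis" by (simp add: axis_in_Basis_iff Basis_real_def)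
  show "char_fun m (x+(2 * pi) *\<^sub>R axis j 1)=char_fun m x" for x unfolding axis_rvec by (rule char_fun_periodic)
  then show "(1/(\<i> * of_int (m $ j))) * char_fun m (x+(2 * pi) *\<^sub>R axis j 1)=(1/(\<i> * of_int (m $ j))) * char_fun m x" for x by simp
  show "((%h. (1/(\<i> * of_int (m $ j))) * char_fun m (x+h *\<^sub>R axis j 1)) hvd char_fun m x) (at 0)" for x using has_vector_derivative_mult_right[OF char_fun_derivative[of m x j], of "1/(\<i> * of_int (m $ j))"] j by simp
 qed (rule chf_props)
 then show ?thesis using False unfolding Omega_eq set_integral_torus_box[OF mm] by simp
qed

lemma set_integrable_Omega:
 fixes f :: "real^'d => 'b::{banach,second_countable_topology}"
 shows "cts f==>sil Omega f" by (rule sicb) (auto intro: Omega_props)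

lemma si_sum_swap:
 fixes f :: "'i => 'a => 'b::{banach,second_countable_topology}"
 assumes "!!i. i\<in>F==>set_integrable N A (f i)"
 shows "(LINT x:A|N. \<Sum>i\<in>F. f i x)=(\<Sum>i\<in>F. LINT x:A|N. f i x)" using assms unfolding sli sid by (simp add: scaleR_sum_right Bochner_Integration.integral_sum)

section \<open>Trigonometric sums, lattice sums and mean-square convergence\<close>

definition trig_sum :: "(int^'d => complex) => (int^'d) set => real^'d => complex" where
 "trig_sum c F x=(\<Sum>m\<in>F. c m * char_fun m x)"

lemma trig_sum_cont: "continuous_on S (trig_sum c F)" unfolding trig_sum_def[abs_def] by (intro continuous_intros chf_props)

lemma trig_sum_coeff:
 fixes n :: "int^'d"
 assumes "finite F"
 shows "(JO x. trig_sum c F x * cnj (char_fun n x)) = of_real ((2 * pi) ^ CARD('d))*(if n\<in>F then c n else 0)"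
proof -
 have "trig_sum c F x * cnj (char_fun n x)=(\<Sum>m\<in>F. c m * char_fun (m-n) x)" for x by (simp add: trig_sum_def sum_distrib_right chf_props mult.assoc)
 then have "(JO x. trig_sum c F x * cnj (char_fun n x))=(JO x. (\<Sum>m\<in>F. c m * char_fun (m-n) x))" by simp
 also have "... = (\<Sum>m\<in>F. (JO x. c m * char_fun (m-n) x))" by (rule si_sum_swap) (intro set_integrable_Omega continuous_intros chf_props)
 also have "... = (\<Sum>m\<in>F. of_real ((2 * pi) ^ CARD('d))*(if m=n then c m else 0))" by (rule sum.cong) (auto simp: integral_char_fun)
 also have "... = of_real ((2 * pi) ^ CARD('d))*(if n\<in>F then c n else 0)" using assms by (simp add: sum_distrib_left[symmetric] sum.delta)
 finally show ?thesis .
qed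

lemma trig_sum_parseval:
 fixes F :: "(int^'d) set"
 assumes "finite F"
 shows "(JO x. (norm (trig_sum c F x))^2)=(2 * pi) ^ CARD('d)*(\<Sum>m\<in>F. (norm (c m))^2)"
proof -
 have "cor ((norm (trig_sum c F x))^2)=(\<Sum>n\<in>F. cnj (c n)*(trig_sum c F x * cnj (char_fun n x)))" for x
 proof -
  have "cor ((norm (trig_sum c F x))^2)=trig_sum c F x * cnj (trig_sum c F x)" by (simp only: complex_norm_square)
  also have "cnj (trig_sum c F x)=(\<Sum>n\<in>F. cnj (c n) * cnj (char_fun n x))" by (simp add: trig_sum_def)
  finally show ?thesis by (simp add: sum_distrib_left mult_ac)
 qed
 then have "cor (JO x. (norm (trig_sum c F x))^2)=(JO x. (\<Sum>n\<in>F. cnj (c n)*(trig_sum c F x * cnj (char_fun n x))))" unfolding set_integral_complex_of_real[symmetric] by simp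
 also have "... = (\<Sum>n\<in>F. (JO x. cnj (c n)*(trig_sum c F x * cnj (char_fun n x))))" by (rule si_sum_swap) (intro set_integrable_Omega continuous_intros chf_props trig_sum_cont)
 also have "... = (\<Sum>n\<in>F. of_real ((2 * pi) ^ CARD('d)) * of_real ((norm (c n))^2))"
 proof (rule sum.cong)
  fix n assume n: "n\<in>F"
  have "(JO x. cnj (c n)*(trig_sum c F x * cnj (char_fun n x)))=cnj (c n)*(of_real ((2 * pi) ^ CARD('d)) * c n)" unfolding set_integral_mult_right trig_sum_coeff[OF assms] using n by simp
  then show "(JO x. cnj (c n)*(trig_sum c F x * cnj (char_fun n x))) = of_real ((2 * pi) ^ CARD('d)) * of_real ((norm (c n))^2)" unfolding complex_norm_square by (simp only: mult_ac)
 qed simp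
 also have "... = cor ((2 * pi) ^ CARD('d)*(\<Sum>m\<in>F. (norm (c m))^2))" by (simp add: sum_distrib_left)
 finally show ?thesis by (simp only: of_real_eq_iff)
qed

lemma norm_rvec_ge_1: "m~=0==>nv m>=1"
proof -
 assume "m~=0"
 then obtain j where "m $ j~=0" by (auto simp: vec_eq_iff)
 then have "1<=abs(real_of_int (m $ j))" by linarith
 also have "... <= nv m" using component_le_norm_cart[of "rvec m" j] by (simp add: rvec_simps)
 finally show ?thesis .
qed

text \<open>For nonzero \<open>m\<close> one has \<open>2 |m| >= 1 + |m_j|\<close> for every
  \<open>j\<close>, so the summand is dominated by a product of one-dimensional terms with exponent
  \<open>ta / d > 1\<close>; over a cube the sum of the products is the product of the sums.\<close>

lemma lattice_powr_summable:
 assumes ta: "ta>real CARD('d)"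
 shows "(%m::int^'d. nv m powr (- ta)) summable_on UNIV"
proof (rule nonneg_bdd_above_summable_on)
 define p where "p=ta/real CARD('d)"
 have p: "p>1" "p * real CARD('d)=ta" using ta by (auto simp: p_def field_simps)
 define g where "g k=(1+abs(real_of_int k)) powr (- p)" for k :: int
 have "summable (%n::nat. real n powr (- p))" using p by (simp add: summable_real_powr_iff)
 then have s: "summable (%n::nat. real (Suc n) powr (- p))" by (subst summable_Suc_iff)
 define Z where "Z=2*(\<Sum>n. real (Suc n) powr (- p))"
 have gN: "sum g {- int N..int N}<=Z" for N
 proof -
  have "sum g {- int N..int N}<=sum g (int ` {..N})+sum g ((%n. - int n) ` {..N})"
  proof -
   have "{- int N..int N}\<subseteq>int ` {..N}\<union>(%n. - int n) ` {..N}"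
   proof
    fix k assume k: "k\<in>{- int N..int N}"
    show "k\<in>int ` {..N}\<union>(%n. - int n) ` {..N}"
    proof (cases "k>=0")
     case True then show ?thesis using k by (intro UnI1 image_eqI[of _ _ "nat k"]) auto
    next
     case False then show ?thesis using k by (intro UnI2 image_eqI[of _ _ "nat (- k)"]) auto
    qed
   qed
   then have "sum g {- int N..int N}<=sum g (int ` {..N}\<union>(%n. - int n) ` {..N})" by (intro sum_mono2) (auto simp: g_def)
   also have "... <= sum g (int ` {..N})+sum g ((%n. - int n) ` {..N})" by (subst sum_Un) (auto simp: g_def intro!: sum_nonneg)
   finally show ?thesis .
  qed
  also have "... = 2*(\<Sum>n<Suc N. real (Suc n) powr (- p))" by (subst (1 2) sum.reindex) (auto simp: inj_on_def g_def lessThan_Suc_atMost add.commute)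
  also have "... <= Z" unfolding Z_def by (intro mult_left_mono sum_le_suminf s) auto
  finally show ?thesis .
 qed
 have Z0: "Z>=0" using gN[of 0] by (auto simp: g_def intro: order_trans[rotated])
 show "bdd_above (sum (%m::int^'d. nv m powr (- ta)) ` {F. F\<subseteq>UNIV&finite F})"
 proof (rule bdd_aboveI2)
  fix F :: "(int^'d) set" assume "F\<in>{F. F\<subseteq>UNIV&finite F}"
  then have F: "finite F" by simp
  define N where "N=(\<Sum>m\<in>F. \<Sum>j\<in>UNIV. nat (abs(m $ j)))"
  have N: "abs(m $ j)<=int N" if "m\<in>F" for m j
  proof -
   have "nat (abs(m $ j))<=(\<Sum>j\<in>UNIV. nat (abs(m $ j)))" by (rule member_le_sum) auto
   also have "... <= N" unfolding N_def using F that by (intro member_le_sum[where f = "%m. \<Sum>j\<in>UNIV. nat (abs(m $ j))"]) auto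
   finally show ?thesis by linarith
  qed
  have bound: "nv m powr (- ta)<=2 powr ta*(\<Prod>j\<in>UNIV. g (m $ j))" for m :: "int^'d"
  proof (cases "m=0")
   case True
   then show ?thesis by (simp add: rvec_simps g_def prod_nonneg)
  next
   case False
   have n1: "nv m>=1" by (rule norm_rvec_ge_1[OF False])
   have "(2 * nv m) powr (- ta)=(\<Prod>j\<in>(UNIV::'d set). (2 * nv m) powr (- p))"
   proof -
    have "((2 * nv m) powr (- p)) ^ CARD('d)=(2 * nv m) powr (real CARD('d)*(- p))" by (rule powr_power) (use n1 in auto)
    also have "real CARD('d)*(- p) = - ta" using p(2) by (simp add: mult.commute)
    finally show ?thesis by simp
   qed
   also have "... <= (\<Prod>j\<in>UNIV. g (m $ j))"
   proof (rule prod_mono, rule conjI)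
    fix j
    have "abs(real_of_int (m $ j))<=nv m" using component_le_norm_cart[of "rvec m" j] by (simp add: rvec_simps)
    then show "(2 * nv m) powr (- p)<=g (m $ j)" unfolding g_def using n1 p by (intro powr_mono2') auto
   qed simp
   finally have "(2 * nv m) powr (- ta)<=(\<Prod>j\<in>UNIV. g (m $ j))" .
   then have "2 powr ta*(2 * nv m) powr (- ta)<=2 powr ta*(\<Prod>j\<in>UNIV. g (m $ j))" by (rule mult_left_mono) simp
   moreover have "2 powr ta*(2 * nv m) powr (- ta)=nv m powr (- ta)" by (simp add: powr_mult powr_minus field_simps)
   ultimately show ?thesis by simp
  qed
  have "sum (%m::int^'d. nv m powr (- ta)) F<=(\<Sum>m\<in>F. 2 powr ta*(\<Prod>j\<in>UNIV. g (m $ j)))" by (rule sum_mono) (rule bound)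
  also have "... = 2 powr ta*(\<Sum>m\<in>F. \<Prod>j\<in>UNIV. g (m $ j))" by (simp add: sum_distrib_left)
  also have "(\<Sum>m\<in>F. \<Prod>j\<in>UNIV. g (m $ j))=(\<Sum>h\<in>vec_nth ` F. \<Prod>j\<in>UNIV. g (h j))" by (subst sum.reindex) (auto simp: inj_on_def vec_nth_inject)
  also have "... <= (\<Sum>h\<in>PiE (UNIV :: 'd set) (%_. {- int N..int N}). \<Prod>j\<in>UNIV. g (h j))"
  proof -
   have fin: "finite (PiE (UNIV::'d set) (%_. {- int N..int N}))" by (rule finite_PiE) auto
   have sub: "vec_nth ` F\<subseteq>PiE UNIV (%_. {- int N..int N})"
   proof
    fix h assume "h\<in>vec_nth ` F"
    then obtain m where "m\<in>F" "h=vec_nth m" by blast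
    then have "abs(h j)<=int N" for j using N by simp
    then show "h\<in>PiE UNIV (%_. {- int N..int N})" by (auto simp: abs_le_iff minus_le_iff)
   qed
   have nn: "0<=(\<Prod>j\<in>UNIV. g (h j))" for h :: "'d => int" by (rule prod_nonneg) (simp add: g_def)
   show ?thesis by (rule sum_mono2[OF fin sub, of "%h. \<Prod>j\<in>UNIV. g (h j)"]) (rule nn)
  qed
  also have "... = (\<Prod>j\<in>(UNIV::'d set). \<Sum>k\<in>{- int N..int N}. g k)" by (rule prod_sum_PiE[symmetric]) auto
  also have "... = (\<Sum>k\<in>{- int N..int N}. g k) ^ CARD('d)" by simp
  also have "... <= Z ^ CARD('d)" by (rule power_mono[OF gN]) (auto intro!: sum_nonneg simp: g_def)
  finally show "sum (%m::int^'d. nv m powr (- ta)) F<=2 powr ta * Z ^ CARD('d)" by simp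
 qed
qed simp

text \<open>The mean-square half of \<open>fourier_sum\<close> at a fixed time, with the
  coefficients as free data.\<close>

definition L2_conv :: "(real^'d => complex) => (int^'d => complex) => bool" where
 "L2_conv f c \<longleftrightarrow> f\<in>bM &
     ((%F. \<integral>\<^sup>+x\<in>Omega. ennreal ((norm (f x-trig_sum c F x))^2) \<partial>lborel) \<longlongrightarrow> 0) (fsat)"

lemma set_nn_int_eq:
 fixes f :: "'a::euclidean_space => real"
 assumes "sil A f" "!!x. f x>=0"
 shows "(\<integral>\<^sup>+x\<in>A. ennreal (f x) \<partial>lborel)=ennreal (LINT x:A|lborel. f x)"
proof -
 have "(\<integral>\<^sup>+x\<in>A. ennreal (f x) \<partial>lborel)=(\<integral>\<^sup>+x. ennreal (indicator A x *\<^sub>R f x) \<partial>lborel)" by (intro nn_integral_cong) (auto simp: indicator_def)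
 also have "... = ennreal (LINT x:A|lborel. f x)" unfolding sli by (rule nn_integral_eq_integral) (use assms in \<open>auto simp: sid\<close>)
 finally show ?thesis .
qed

lemma trig_sum_measurable[measurable]: "trig_sum c F\<in>bM" by (rule bmcI[OF trig_sum_cont])

lemma Omega_sets[measurable]: "Omega\<in>sets borel" by (rule Omega_props)

lemma L2_norm_pairing:
 fixes f ph :: "real^'d => complex"
 assumes f[measurable]: "f\<in>bM" and ph[measurable]: "ph\<in>bM"
  and B: "!!x. norm (ph x)<=B"
  and A: "(\<integral>\<^sup>+x\<in>Omega. ennreal ((norm (f x))^2) \<partial>lborel)<=ennreal A" and A0: "A>=0"
 shows "sil Omega (%x. f x * ph x)"
  "norm (JO x. f x * ph x)<=B * sqrt ((2 * pi) ^ CARD('d) * A)"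
  "sil Omega (%x. (norm (f x))^2)" "(JO x. (norm (f x))^2)<=A"
proof -
 have B0: "B>=0" using norm_ge_zero B[of 0] by (rule order_trans)
 have nn: "(\<integral>\<^sup>+x. ennreal (indicator Omega x *\<^sub>R (norm (f x))^2) \<partial>lborel)<=ennreal A" using A by (simp add: ennreal_mult'' mult.commute ennreal_indicator)
 show s: "sil Omega (%x. (norm (f x))^2)" unfolding sid
 proof (rule integrableI_nonneg)
  show "(\<integral>\<^sup>+x. ennreal (indicator Omega x *\<^sub>R (norm (f x))^2) \<partial>lborel) < \<infinity>" using nn by (rule le_less_trans) simp
 qed auto
 show l: "(JO x. (norm (f x))^2)<=A"
 proof -
  have "ennreal (JO x. (norm (f x))^2)=(\<integral>\<^sup>+x. ennreal (indicator Omega x *\<^sub>R (norm (f x))^2) \<partial>lborel)" unfolding sli by (rule nn_integral_eq_integral[symmetric]) (use s in \<open>auto simp: sid\<close>)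
  then show ?thesis using nn A0 by (metis ennreal_le_iff)
 qed
 have fin: "emeasure lborel (Omega :: (real^'d) set) < \<infinity>" unfolding Omega_props(2) by simp
 note CS = si_CS[OF _ fin, of "%x. norm (f x)"]
 have n: "sil Omega (%x. norm (f x))" by (rule CS(1)) (use s in auto)
 have "(JO x. norm (f x))^2<=(2 * pi) ^ CARD('d)*(JO x. (norm (f x))^2)" using CS(2) s by (simp add: Omega_props(3))
 also have "... <= (2 * pi) ^ CARD('d) * A" using l by (intro mult_left_mono) auto
 finally have L: "(JO x. norm (f x))<=sqrt ((2 * pi) ^ CARD('d) * A)" by (rule real_le_rsqrt)
 have nB: "integrable lborel (%x. B*(indicator Omega x *\<^sub>R norm (f x)))" using n by (simp add: sid)
 have le: "norm (indicator Omega x *\<^sub>R (f x * ph x))<=B*(indicator Omega x *\<^sub>R norm (f x))" for x using mult_left_mono[OF B[of x] norm_ge_zero[of "f x"]] by (auto simp: indicator_def norm_mult mult.commute[of B])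
 show i: "sil Omega (%x. f x * ph x)" unfolding sid by (rule Bochner_Integration.integrable_bound[OF nB]) (measurable, intro AE_I2, use order_trans[OF le abs_ge_self] in \<open>simp only: real_norm_def\<close>)
 have "norm (JO x. f x * ph x)<=(\<integral>x. norm (indicator Omega x *\<^sub>R (f x * ph x)) \<partial>lborel)" unfolding sli by (rule integral_norm_bound)
 also have "... <= (\<integral>x. B*(indicator Omega x *\<^sub>R norm (f x)) \<partial>lborel)" by (rule integral_mono[OF _ nB le]) (use i in \<open>simp only: sid integrable_norm\<close>)
 also have "... = B*(JO x. norm (f x))" by (simp add: sli)
 also have "... <= B * sqrt ((2 * pi) ^ CARD('d) * A)" using L B0 by (intro mult_left_mono)
 finally show "norm (JO x. f x * ph x)<=B * sqrt ((2 * pi) ^ CARD('d) * A)" .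
qed

lemma L2_conv_pairing:
 fixes f ph :: "real^'d => complex"
 assumes f: "L2_conv f c" and ph[measurable]: "ph\<in>bM" and B: "!!x. norm (ph x)<=B"
 shows "sil Omega (%x. f x * ph x)"
  "((%F. JO x. trig_sum c F x * ph x) \<longlongrightarrow> (JO x. f x * ph x)) (fsat)"
proof -
 let ?F = "finite_subsets_at_top (UNIV :: (int^'d) set)"
 have [measurable]: "f\<in>bM" using f by (simp add: L2_conv_def)
 define A where "A F=(\<integral>\<^sup>+x\<in>Omega. ennreal ((norm (f x-trig_sum c F x))^2) \<partial>lborel)" for F
 have A: "(A \<longlongrightarrow> 0) ?F" using f unfolding L2_conv_def A_def[abs_def] by simp
 then have ev: "eventually (%F. A F<1) ?F" by (rule order_tendstoD) simp
 have r: "((%F. enn2real (A F)) \<longlongrightarrow> 0) ?F" using A tendsto_enn2real[of A 0] by simp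
 have S: "sil Omega (%x. trig_sum c F x * ph x)" for F
 proof (rule L2_norm_pairing(1)[OF _ ph B])
  have "(\<integral>\<^sup>+x\<in>Omega. ennreal ((norm (trig_sum c F x))^2) \<partial>lborel)=ennreal (JO x. (norm (trig_sum c F x))^2)" by (rule set_nn_int_eq) (auto intro!: set_integrable_Omega continuous_intros trig_sum_cont)
  then show "(\<integral>\<^sup>+x\<in>Omega. ennreal ((norm (trig_sum c F x))^2) \<partial>lborel)<=ennreal (JO x. (norm (trig_sum c F x))^2)" by simp
  show "0<=(JO x. (norm (trig_sum c F x))^2)" by (auto simp: sli intro!: integral_nonneg_AE)
 qed measurable
 have d: "sil Omega (%x. (f x-trig_sum c F x) * ph x)"
   "norm (JO x. (f x-trig_sum c F x) * ph x)<=B * sqrt ((2 * pi) ^ CARD('d) * enn2real (A F))"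
  if "A F<1" for F
 proof -
  have le: "(\<integral>\<^sup>+x\<in>Omega. ennreal ((norm (f x-trig_sum c F x))^2) \<partial>lborel)<=ennreal (enn2real (A F))"
  proof -
   have "A F<top" using that by (rule less_trans) simp
   then show ?thesis by (simp add: A_def)
  qed
  show "sil Omega (%x. (f x-trig_sum c F x) * ph x)"
   "norm (JO x. (f x-trig_sum c F x) * ph x)<=B * sqrt ((2 * pi) ^ CARD('d) * enn2real (A F))" by (rule L2_norm_pairing[OF _ ph B le]; simp)+
 qed
 obtain F0 where F0: "A F0<1" using eventually_happens'[OF _ ev] by auto
 show fi: "sil Omega (%x. f x * ph x)" using set_integral_add(1)[OF d(1)[OF F0] S[of F0]] by (simp add: algebra_simps)
 show "((%F. JO x. trig_sum c F x * ph x) \<longlongrightarrow> (JO x. f x * ph x)) ?F"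
 proof (rule LIM_zero_cancel, rule Lim_null_comparison)
  have "((%F. B * sqrt ((2 * pi) ^ CARD('d) * enn2real (A F))) \<longlongrightarrow> B * sqrt ((2 * pi) ^ CARD('d)*0)) ?F" by (intro tendsto_intros r)
  then show "((%F. B * sqrt ((2 * pi) ^ CARD('d) * enn2real (A F))) \<longlongrightarrow> 0) ?F" by simp
  show "eventually (%F. norm ((JO x. trig_sum c F x * ph x)-(JO x. f x * ph x))<=B * sqrt ((2 * pi) ^ CARD('d) * enn2real (A F))) ?F" using ev
  proof eventually_elim
   case (elim F)
   have "(JO x. f x * ph x)-(JO x. trig_sum c F x * ph x)=(JO x. (f x-trig_sum c F x) * ph x)" using set_integral_diff(2)[OF fi S[of F]] by (simp add: algebra_simps)
   then show ?case using d(2)[OF elim] by (metis norm_minus_commute)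
  qed
 qed
qed

lemma L2_conv_coeff:
 fixes f :: "real^'d => complex"
 assumes f: "L2_conv f c"
 shows "(JO x. f x * cnj (char_fun n x)) = of_real ((2 * pi) ^ CARD('d)) * c n"
proof -
 have cm: "(%x. cnj (char_fun n x))\<in>bM" by (rule bmcI) (intro continuous_intros chf_props)
 have "((%F. JO x. trig_sum c F x * cnj (char_fun n x)) \<longlongrightarrow> (JO x. f x * cnj (char_fun n x))) (fsat)" by (rule L2_conv_pairing(2)[OF f cm, of 1]) (simp add: chf_props)
 moreover have "((%F. JO x. trig_sum c F x * cnj (char_fun n x)) \<longlongrightarrow> of_real ((2 * pi) ^ CARD('d)) * c n) (fsat)"
 proof (rule tendsto_eventually)
  show "\<forall>\<^sub>F F in fsat. (JO x. trig_sum c F x * cnj (char_fun n x)) = of_real ((2 * pi) ^ CARD('d)) * c n" unfolding eventually_finite_subsets_at_top by (intro exI[of _ "{n}"]) (auto simp: trig_sum_coeff)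
 qed
 ultimately show ?thesis by (rule tendsto_unique[OF finite_subsets_at_top_neq_bot])
qed

lemma trig_sum_nn_integral:
 fixes F :: "(int^'d) set"
 assumes "finite F"
 shows "(\<integral>\<^sup>+x\<in>Omega. ennreal ((norm (trig_sum c F x))^2) \<partial>lborel)=ennreal ((2 * pi) ^ CARD('d)*(\<Sum>m\<in>F. (norm (c m))^2))" unfolding trig_sum_parseval[OF assms, symmetric] by (rule set_nn_int_eq) (auto intro!: set_integrable_Omega continuous_intros trig_sum_cont)

lemma tail_infsum:
 fixes B :: "'i => real"
 assumes "B summable_on UNIV" "finite F"
 shows "infsum B (UNIV-F)=infsum B UNIV-sum B F" using infsum_Diff[OF assms(1), of F] assms(2) by simp

lemma tail_infsum_tendsto:
 fixes B :: "'i => real"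
 assumes "B summable_on UNIV"
 shows "((%F. infsum B (UNIV-F)) \<longlongrightarrow> 0) (fsat)"
proof -
 have "((%F. infsum B UNIV-sum B F) \<longlongrightarrow> infsum B UNIV-infsum B UNIV) (fsat)" by (intro tendsto_intros infsum_tendsto assms)
 then have "((%F. infsum B UNIV-sum B F) \<longlongrightarrow> 0) (fsat)" by simp
 then show ?thesis by (rule Lim_transform_eventually) (auto intro!: eventually_finite_subsets_at_top_weakI simp: tail_infsum[OF assms])
qed

lemma sum_diff_le_tail:
 fixes B :: "'i => real"
 assumes B: "B summable_on UNIV" "!!i. B i>=0" and F: "finite G"
 shows "sum B (G-F)<=infsum B (UNIV-F)" by (rule finite_sum_le_infsum) (use assms summable_on_subset_banach[OF B(1)] in auto)

text \<open>A rate of convergence that depends only on a summable majorant of the squared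
  coefficients, hence is uniform in time. The factor 2 stems from comparing with a larger partial
  sum, which is then let exhaust the lattice.\<close>

lemma L2_conv_tail_bound:
 fixes f :: "real^'d => complex"
 assumes f: "L2_conv f c" and B: "B summable_on UNIV" "!!m. (norm (c m))^2<=B m" and F: "finite F"
 shows "(\<integral>\<^sup>+x\<in>Omega. ennreal ((norm (f x-trig_sum c F x))^2) \<partial>lborel)<=ennreal (2*((2 * pi) ^ CARD('d) * infsum B (UNIV-F)))"
proof -
 let ?F = "finite_subsets_at_top (UNIV :: (int^'d) set)"
 let ?V = "(2 * pi) ^ CARD('d)"
 have [measurable]: "f\<in>bM" using f by (simp add: L2_conv_def)
 have B0: "B m>=0" for m using B(2)[of m] zero_le_power2[of "norm (c m)"] by linarith
 define A where "A G=(\<integral>\<^sup>+x\<in>Omega. ennreal ((norm (f x-trig_sum c G x))^2) \<partial>lborel)" for G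
 have A: "(A \<longlongrightarrow> 0) ?F" using f unfolding L2_conv_def A_def[abs_def] by simp
 have tl0: "0<=infsum B (UNIV-F)" by (rule infsum_nonneg) (rule B0)
 have le: "A F<=2 * A G+ennreal (2*(?V * infsum B (UNIV-F)))" if G: "finite G" "F\<subseteq>G" for G
 proof -
  have eq: "f x-trig_sum c F x=(f x-trig_sum c G x)+trig_sum c (G-F) x" for x using sum.subset_diff[OF G(2,1), of "%m. c m * char_fun m x"] by (simp add: trig_sum_def)
  have pw: "ennreal ((norm (f x-trig_sum c F x))^2) * indicator Omega x<=2*(ennreal ((norm (f x-trig_sum c G x))^2) * indicator Omega x)+2*(ennreal ((norm (trig_sum c (G-F) x))^2) * indicator Omega x)" for x
  proof (cases "x\<in>Omega")
   case True
   have "(norm (f x-trig_sum c F x))^2<=(norm (f x-trig_sum c G x)+norm (trig_sum c (G-F) x))^2" unfolding eq by (intro power_mono norm_triangle_ineq) auto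
   also have "... <= 2*(norm (f x-trig_sum c G x))^2+2*(norm (trig_sum c (G-F) x))^2" using zero_le_power2[of "norm (f x-trig_sum c G x)-norm (trig_sum c (G-F) x)"] by (simp add: power2_sum power2_diff)
   finally have "ennreal ((norm (f x-trig_sum c F x))^2)<=ennreal (2*(norm (f x-trig_sum c G x))^2+2*(norm (trig_sum c (G-F) x))^2)" by (rule ennreal_leI)
   then show ?thesis using True by (simp add: ennreal_mult' ennreal_plus)
  qed simp
  have "A F<=(\<integral>\<^sup>+x. 2*(ennreal ((norm (f x-trig_sum c G x))^2) * indicator Omega x)+2*(ennreal ((norm (trig_sum c (G-F) x))^2) * indicator Omega x) \<partial>lborel)" unfolding A_def by (rule nn_integral_mono) (rule pw)
  also have "... = 2 * A G+2*(\<integral>\<^sup>+x\<in>Omega. ennreal ((norm (trig_sum c (G-F) x))^2) \<partial>lborel)" unfolding A_def by (subst nn_integral_add) (auto simp: nn_integral_cmult)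
  also have "(\<integral>\<^sup>+x\<in>Omega. ennreal ((norm (trig_sum c (G-F) x))^2) \<partial>lborel)=ennreal (?V*(\<Sum>m\<in>G-F. (norm (c m))^2))" by (rule trig_sum_nn_integral) (use G in auto)
  also have "... <= ennreal (?V * infsum B (UNIV-F))"
  proof (intro ennreal_leI mult_left_mono)
   have "(\<Sum>m\<in>G-F. (norm (c m))^2)<=sum B (G-F)" by (rule sum_mono) (rule B)
   also have "... <= infsum B (UNIV-F)" by (rule sum_diff_le_tail[OF B(1) B0 G(1)])
   finally show "(\<Sum>m\<in>G-F. (norm (c m))^2)<=infsum B (UNIV-F)" .
  qed simp
  also have "2 * ... = ennreal (2*(?V * infsum B (UNIV-F)))" using tl0 by (simp add: ennreal_mult')
  finally show ?thesis by (simp add: add_left_mono mult_left_mono)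
 qed
 have "((%G. 2 * A G+ennreal (2*(?V * infsum B (UNIV-F)))) \<longlongrightarrow> 2*0+ennreal (2*(?V * infsum B (UNIV-F)))) ?F" by (intro tendsto_intros ennreal_tendsto_cmult A) simp
 then have "A F<=2*0+ennreal (2*(?V * infsum B (UNIV-F)))"
 proof (rule tendsto_lowerbound)
  show "\<forall>\<^sub>F G in ?F. A F<=2 * A G+ennreal (2*(?V * infsum B (UNIV-F)))" unfolding eventually_finite_subsets_at_top using F le by blast
 qed simp
 then show ?thesis by (simp add: A_def)
qed

section \<open>Coefficients of a function in the space, and a function from its coefficients\<close>

lemma weight_ge_1: "sg>=0==>s>=0==>weight sg s m>=1"
proof (cases "m=0")
 case False
 assume s: "sg>=0" "s>=0"
 have n: "nv m>=1" by (rule norm_rvec_ge_1[OF False])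
 have "1*1<=nv m powr (2 * s) * exp (2 * sg * nv m)" using s n by (intro mult_mono ge_one_powr_ge_zero) auto
 then show ?thesis using False by (simp add: weight_def)
qed (simp add: weight_def)

lemma weight_nonneg: "weight sg s m>=0" by (simp add: weight_def)

definition sup_bound :: "(real^'d => real => real) => int^'d => real" where
 "sup_bound u m=4 * H1_norm (cF u m)"

lemma coeff_fun_bound: "u\<in>X_space sg s==>norm (cF u m t)<=sup_bound u m"
proof -
 assume "u\<in>X_space sg s"
 then have "cF u m\<in>H1" by (simp add: X_space_def)
 then show ?thesis unfolding sup_bound_def by (metis H1E H1_norm_bounds(2))
qed

lemma sup_bound_nonneg: "sup_bound u m>=0" by (simp add: sup_bound_def H1_norm_nonneg)

lemma sup_bound_summable:
 assumes u: "u\<in>X_space sg s" and s: "sg>=0" "s>=0"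
 shows "(%m. (sup_bound u m)^2) summable_on UNIV"
proof -
 have "(%m. 16*((H1_norm (cF u m))^2 * weight sg s m)) summable_on UNIV" using u by (intro summable_on_cmult_right) (simp add: X_space_def)
 then show ?thesis
 proof (rule sob(1))
  fix m show "norm ((sup_bound u m)^2)<=16*((H1_norm (cF u m))^2 * weight sg s m)" using mult_left_mono[OF weight_ge_1[OF s, of m], of "(H1_norm (cF u m))^2"] by (simp add: sup_bound_def power_mult_distrib)
 qed
qed

lemma coeff_fun_cnj: "cF u (- m) t=cnj (cF u m t)"
proof -
 have "(JO x. of_real (u x t) * cnj (char_fun (- m) x))=cnj (JO x. of_real (u x t) * cnj (char_fun m x))" unfolding sli Bochner_Integration.integral_cnj[symmetric] by (simp add: chf_props)
 then show ?thesis by (simp add: coeff_fun_def)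
qed

lemma X_space_slice_measurable:
 assumes "u\<in>X_space sg s"
 shows "(%x. u x t)\<in>bM"
proof -
 have "(%z. u (fst z) (snd z))\<in>bM" using assms by (simp add: X_space_def)
 moreover have "(%x. (x,t))\<in>bM" by (intro bmcI continuous_intros)
 ultimately show ?thesis using measurable_compose[of "%x. (x,t)" borel borel "%z. u (fst z) (snd z)" borel] by simp
qed

lemma X_space_L2_conv:
 assumes u: "u\<in>X_space sg s"
 shows "L2_conv (%x. of_real (u x t)) (%m. cF u m t)"
proof -
 have [measurable]: "(%x. u x t)\<in>bM" by (rule X_space_slice_measurable[OF u])
 have "(%x. cor (u x t))\<in>bM" by measurable
 moreover have "fourier_sum u" using u by (simp add: X_space_def)
 ultimately show ?thesis unfolding L2_conv_def fourier_sum_def trig_sum_def by blast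
qed

text \<open>Cubes are finite, exhaust the lattice and are invariant under \<open>m -> - m\<close>;
  the last point keeps symmetric partial sums real.\<close>

definition lattice_ball :: "nat => (int^'d::finite) set" where "lattice_ball k={m. \<forall>j. abs(m $ j)<=int k}"

lemma finite_lattice_ball: "finite (lattice_ball k :: (int^'d::finite) set)"
proof (rule finite_subset)
 show "(lattice_ball k :: (int^'d) set)\<subseteq>vec_lambda ` PiE (UNIV :: 'd set) (%_. {- int k..int k})"
 proof
  fix m :: "int^'d" assume "m\<in>lattice_ball k"
  then have "abs(m $ j)<=int k" for j by (simp add: lattice_ball_def)
  then have "vec_nth m\<in>PiE UNIV (%_. {- int k..int k})" by (auto simp: abs_le_iff minus_le_iff)
  then show "m\<in>vec_lambda ` PiE UNIV (%_. {- int k..int k})" by (intro image_eqI[of _ _ "vec_nth m"]) auto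
 qed
 show "finite (vec_lambda ` PiE (UNIV :: 'd set) (%_. {- int k..int k}))" by (intro finite_imageI finite_PiE) auto
qed

lemma lattice_ball_mono: "k<=l==>lattice_ball k\<subseteq>lattice_ball l"
proof
 fix m assume kl: "k<=l" and m: "m\<in>lattice_ball k"
 have "abs(m $ j)<=int l" for j
 proof -
  have "abs(m $ j)<=int k" using m by (simp add: lattice_ball_def)
  then show ?thesis using kl by linarith
 qed
 then show "m\<in>lattice_ball l" by (simp add: lattice_ball_def)
qed

lemma lattice_ball_uminus: "uminus ` lattice_ball k\<subseteq>lattice_ball k" by (auto simp: lattice_ball_def)

lemma finite_subset_lattice_ball: "finite H ==> \<exists>k. H\<subseteq>lattice_ball k"
proof -
 assume H: "finite H"
 define k where "k=(\<Sum>m\<in>H. \<Sum>j\<in>UNIV. nat (abs(m $ j)))"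
 have "m\<in>lattice_ball k" if "m\<in>H" for m
 proof -
  have "nat (abs(m $ j))<=k" for j
  proof -
   have "nat (abs(m $ j))<=(\<Sum>j\<in>UNIV. nat (abs(m $ j)))" by (rule member_le_sum) auto
   also have "... <= k" unfolding k_def using H that by (intro member_le_sum[where f = "%m. \<Sum>j\<in>UNIV. nat (abs(m $ j))"]) auto
   finally show ?thesis .
  qed
  then show ?thesis by (auto simp: lattice_ball_def nat_le_iff)
 qed
 then show ?thesis by blast
qed

lemma countable_lattice: "countable (UNIV :: (int^'d) set)"
proof -
 have "(UNIV :: (int^'d) set)=(\<Union>k. lattice_ball k)" 
 proof (intro equalityI subsetI)
  fix m :: "int^'d"
  show "m\<in>(\<Union>k. lattice_ball k)" using finite_subset_lattice_ball[of "{m}"] by auto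
 qed simp
 then show ?thesis by (simp add: countable_finite[OF finite_lattice_ball])
qed

lemma trig_sum_real:
 assumes sym: "!!m. c (- m)=cnj (c m)" and F: "uminus ` F=F"
 shows "of_real (Re (trig_sum c F x))=trig_sum c F x"
proof -
 have "trig_sum c F x=(\<Sum>m\<in>uminus ` F. c m * char_fun m x)" by (simp add: trig_sum_def F)
 also have "... = (\<Sum>m\<in>F. c (- m) * char_fun (- m) x)" by (subst sum.reindex) auto
 also have "... = cnj (trig_sum c F x)" by (simp add: trig_sum_def sym chf_props)
 finally have "trig_sum c F x=cnj (trig_sum c F x)" .
 then have "Im (trig_sum c F x)=0" by (metis cnj.simps(2) equal_neg_zero)
 then show ?thesis by (simp add: complex_eq_iff)
qed

text \<open>For small smoothness the series converges in \<open>L\<^sup>2\<close> only. The function is the pointwise limit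
 along fixed symmetric partial sums that exhaust the lattice fast enough for almost everywhere
 convergence at each time.\<close>

lemma synthesis:
 fixes c :: "int^'d => real => complex"
 assumes s: "sg>=0" "s>=0" and H: "!!m. c m\<in>H1" and sym: "!!m t. c (- m) t=cnj (c m t)"
  and summ: "(%m. (H1_norm (c m))^2 * weight sg s m) summable_on UNIV"
 obtains u where "u\<in>X_space sg s" "!!m. cF u m=c m"
proof -
 let ?V = "(2 * pi) ^ CARD('d)"
 define B where "B m=(4 * H1_norm (c m))^2" for m
 have B0: "B m>=0" for m by (simp add: B_def)
 have cb: "(norm (c m t))^2<=B m" for m t
 proof -
  have "norm (c m t)<=4 * H1_norm (c m)" using H[of m] by (metis H1E H1_norm_bounds(2))
  then show ?thesis unfolding B_def by (intro power_mono) auto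
 qed
 have Bs: "B summable_on UNIV"
 proof (rule sob(1)[OF summable_on_cmult_right[OF summ, of 16]])
  fix m show "norm (B m)<=16*((H1_norm (c m))^2 * weight sg s m)" using mult_left_mono[OF weight_ge_1[OF s, of m], of "(H1_norm (c m))^2"] by (simp add: B_def power_mult_distrib)
 qed
 \<comment> \<open>Tails below \<open>(1/4)^k\<close> make the mean-square size of the k-th
   increment of the partial sums of order \<open>(1/2)^k\<close>, which is summable.\<close>
 have "\<exists>J. finite J&abs(infsum B (UNIV-J))<(1/4)^k" for k :: nat using infsum_tail_less[OF Bs, of "(1/4)^k"] by (metis zero_less_power zero_less_divide_1_iff zero_less_numeral)
 then obtain J where J: "!!k. finite (J k)" "!!k::nat. abs(infsum B (UNIV-J k))<(1/4)^k" by metis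
 \<comment> \<open>The cubes make the sets exhaust the lattice, the sets \<open>J i\<close> make the
   tails small, and their reflections keep the partial sums real.\<close>
 define F where "F k=lattice_ball k\<union>(\<Union>i\<le>k. J i\<union>uminus ` J i)" for k
 have Ffin: "finite (F k)" for k unfolding F_def using J finite_lattice_ball by auto
 have Fsym: "uminus ` F k=F k" for k
 proof -
  have "uminus ` (\<Union>i\<le>k. J i\<union>uminus ` J i)\<subseteq>(\<Union>i\<le>k. J i\<union>uminus ` J i)" unfolding image_UN image_Un image_image by auto
  then have sub: "uminus ` F k\<subseteq>F k" unfolding F_def image_Un by (rule Un_mono[OF lattice_ball_uminus])
  then have "uminus ` uminus ` F k\<subseteq>uminus ` F k" by blast
  then show ?thesis using sub by (simp add: image_image)
 qed
 have Fmono: "F k\<subseteq>F (Suc k)" for k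
 proof -
  have "lattice_ball k\<subseteq>F (Suc k)" unfolding F_def by (rule le_supI1) (simp add: lattice_ball_mono)
  moreover have "(\<Union>i\<le>k. J i\<union>uminus ` J i)\<subseteq>F (Suc k)" unfolding F_def by (rule le_supI2) (intro UN_mono, auto)
  ultimately show ?thesis unfolding F_def[of k] by (rule Un_least)
 qed
 have Flim: "filterlim F (fsat) sequentially" unfolding filterlim_finite_subsets_at_top
 proof (intro allI impI)
  fix H :: "(int^'d) set" assume "finite H&H\<subseteq>UNIV"
  then obtain k where "H\<subseteq>lattice_ball k" using finite_subset_lattice_ball by blast
  then have "H\<subseteq>F n" if "n>=k" for n unfolding F_def using lattice_ball_mono[OF that] by (intro le_supI1) (rule order_trans)
  then show "\<forall>\<^sub>F n in sequentially. finite (F n)&H\<subseteq>F n&F n\<subseteq>UNIV" using Ffin by (auto intro: eventually_sequentiallyI)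
 qed
 have tail: "infsum B (UNIV-F k)<=(1/4)^k" for k
 proof -
  have "infsum B (UNIV-F k)<=infsum B (UNIV-J k)" by (rule infsum_mono2) (use summable_on_subset_banach[OF Bs] B0 in \<open>auto simp: F_def\<close>)
  then show ?thesis using J(2)[of k] by linarith
 qed
 define S where "S k t=trig_sum (%m. c m t) (F k)" for k t
 have Sreal: "of_real (Re (S k t x))=S k t x" for k t x unfolding S_def by (rule trig_sum_real) (simp_all add: sym Fsym)
 define u where "u x t=lim (%k. Re (S k t x))" for x t
 have cc: "cts (c m)" for m using H[of m] by (metis H1E H1_deriv_cont)
 have Sjm: "(%z. Re (S k (snd z) (fst z)))\<in>bM" for k unfolding S_def trig_sum_def by (intro bmcI continuous_intros continuous_on_compose2[OF cc] continuous_on_compose2[OF chf_props(5)]) auto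
 have um: "(%z. u (fst z) (snd z))\<in>bM" unfolding u_def by (rule borel_measurable_lim_metric) (rule Sjm)
 have usm[measurable]: "(%x. u x t)\<in>bM" for t unfolding u_def S_def by (rule borel_measurable_lim_metric) measurable
 have conv: "AE x in lborel. x\<in>Omega-->(%k. Re (S k t x)) \<longlonglongrightarrow> u x t" for t
 proof -
  define d where "d k x=norm (trig_sum (%m. c m t) (F (Suc k)-F k) x)" for k x
  have dd: "S (Suc k) t x-S k t x=trig_sum (%m. c m t) (F (Suc k)-F k) x" for k x using sum.subset_diff[OF Fmono Ffin, of "%m. c m t * char_fun m x" k] by (simp add: S_def trig_sum_def)
  have dm[measurable]: "d k\<in>bM" for k unfolding d_def[abs_def] by measurable
  have dc: "cts (d k)" for k unfolding d_def[abs_def] by (intro continuous_intros trig_sum_cont)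
  have d0: "d k x>=0" for k x by (simp add: d_def)
  have fin: "emeasure lborel (Omega :: (real^'d) set) < \<infinity>" unfolding Omega_props(2) by simp
  \<comment> \<open>The integrals of the absolute increments are summable, so by monotone
    convergence the increments are summable at almost every point of \<open>Omega\<close>.\<close>
  have int: "(JO x. d k x) <= ?V*(1/2)^k" for k
  proof -
   have "(JO x. abs(d k x))^2<=measure lborel (Omega :: (real^'d) set)*(JO x. (d k x)^2)" by (rule si_CS(2)[OF _ fin]) (auto intro!: set_integrable_Omega continuous_intros dc)
   also have "(JO x. (d k x)^2) = ?V*(\<Sum>m\<in>F (Suc k)-F k. (norm (c m t))^2)" unfolding d_def by (rule trig_sum_parseval) (use Ffin in auto)
   also have "measure lborel (Omega :: (real^'d) set) * ... <= ?V*(?V*(1/4)^k)" unfolding Omega_props(3)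
   proof (intro mult_left_mono)
    have "(\<Sum>m\<in>F (Suc k)-F k. (norm (c m t))^2)<=sum B (F (Suc k)-F k)" by (rule sum_mono) (rule cb)
    also have "... <= infsum B (UNIV-F k)" by (rule sum_diff_le_tail[OF Bs B0 Ffin])
    finally show "(\<Sum>m\<in>F (Suc k)-F k. (norm (c m t))^2)<=(1/4)^k" using tail[of k] by linarith
   qed auto
   also have "... = (?V*(1/2)^k)^2"
   proof -
    have "((1/2::real)^k)^2=(1/4)^k" unfolding power2_eq_square power_mult_distrib[symmetric] by simp
    then show ?thesis by (simp add: power2_eq_square)
   qed
   finally show ?thesis using d0 by (simp add: power2_le_iff_abs_le abs_le_iff)
  qed
  have "(\<integral>\<^sup>+x. (\<Sum>k. ennreal (d k x) * indicator Omega x) \<partial>lborel)=(\<Sum>k. \<integral>\<^sup>+x. ennreal (d k x) * indicator Omega x \<partial>lborel)" by (rule nn_integral_suminf) measurable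
  also have "... = (\<Sum>k. ennreal (JO x. d k x))" by (intro suminf_cong set_nn_int_eq) (auto intro!: set_integrable_Omega dc simp: d0)
  also have "... <= (\<Sum>k. ennreal (?V*(1/2)^k))" by (intro suminf_le ennreal_leI int summableI)
  also have "... = ennreal (\<Sum>k. ?V*(1/2)^k)" by (rule suminf_ennreal2) (auto intro!: summable_mult summable_geometric)
  also have "... < \<infinity>" by simp
  finally have "(\<integral>\<^sup>+x. (\<Sum>k. ennreal (d k x) * indicator Omega x) \<partial>lborel) ~= \<infinity>" by simp
  then have "AE x in lborel. (\<Sum>k. ennreal (d k x) * indicator Omega x) ~= \<infinity>" by (rule nn_integral_PInf_AE[rotated]) measurable
  then show ?thesis
  proof eventually_elim
   case (elim x)
   show ?case
   proof
    assume "x\<in>Omega"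
    then have "(\<Sum>k. ennreal (d k x))~=top" using elim by simp
    then have "summable (%k. d k x)" using d0 by (intro summable_suminf_not_top)
    then have "summable (%k. norm (Re (S (Suc k) t x)-Re (S k t x)))"
    proof (rule summable_comparison_test'[where N = 0])
     fix k show "norm (norm (Re (S (Suc k) t x)-Re (S k t x)))<=d k x" using abs_Re_le_cmod[of "S (Suc k) t x-S k t x"] unfolding d_def dd[symmetric] by simp
    qed
    then have "summable (%k. Re (S (Suc k) t x)-Re (S k t x))" by (rule summable_norm_cancel)
    then have "convergent (%n. \<Sum>k<n. Re (S (Suc k) t x)-Re (S k t x))" by (simp add: summable_iff_convergent)
    then have "convergent (%n. Re (S n t x)-Re (S 0 t x))" by (simp only: sum_lessThan_telescope[of "%n. Re (S n t x)"])
    then have "convergent (%n. (Re (S n t x)-Re (S 0 t x))+Re (S 0 t x))" by (intro convergent_add convergent_const)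
    then have "convergent (%n. Re (S n t x))" by simp
    then show "(%k. Re (S k t x)) \<longlonglongrightarrow> u x t" unfolding u_def by (simp only: convergent_LIMSEQ_iff)
   qed
  qed
 qed
 \<comment> \<open>Fatou's lemma along the chosen subsequence carries the tail estimate to the limit
   function, which gives convergence of the full net of partial sums and hence the prescribed
   coefficients.\<close>
 have fatou: "(\<integral>\<^sup>+x\<in>Omega. ennreal ((norm (of_real (u x t)-trig_sum (%m. c m t) G x))^2) \<partial>lborel)<=ennreal (?V * infsum B (UNIV-G))"
  if G: "finite G" for G t
 proof -
  define h where "h k x=ennreal ((norm (S k t x-trig_sum (%m. c m t) G x))^2) * indicator Omega x" for k x
  have hm[measurable]: "h k\<in>borel_measurable lborel" for k unfolding h_def[abs_def] S_def by measurable
  have "(\<integral>\<^sup>+x\<in>Omega. ennreal ((norm (of_real (u x t)-trig_sum (%m. c m t) G x))^2) \<partial>lborel)=(\<integral>\<^sup>+x. liminf (%k. h k x) \<partial>lborel)"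
  proof (rule nn_integral_cong_AE)
   show "AE x in lborel. ennreal ((norm (of_real (u x t)-trig_sum (%m. c m t) G x))^2) * indicator Omega x=liminf (%k. h k x)" using conv[of t]
   proof eventually_elim
    case (elim x)
    show ?case
    proof (cases "x\<in>Omega")
     case True
     then have "(%k. cor (Re (S k t x))) \<longlonglongrightarrow> of_real (u x t)" using elim by (intro tendsto_of_real) auto
     then have "(%k. S k t x) \<longlonglongrightarrow> of_real (u x t)" unfolding Sreal .
     then have *: "(%k. ennreal ((norm (S k t x-trig_sum (%m. c m t) G x))^2)) \<longlonglongrightarrow> ennreal ((norm (of_real (u x t)-trig_sum (%m. c m t) G x))^2)" by (intro tendsto_ennrealI tendsto_intros)
     show ?thesis using True lim_imp_Liminf[OF sequentially_bot *] by (simp add: h_def)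
    next
     case False
     then show ?thesis by (simp add: h_def Liminf_const)
    qed
   qed
  qed
  also have "... <= liminf (%k. \<integral>\<^sup>+x. h k x \<partial>lborel)" by (rule nn_integral_liminf) measurable
  also have "... <= ennreal (?V * infsum B (UNIV-G))"
  proof (rule Liminf_le)
   have "eventually (%k. finite (F k)&G\<subseteq>F k&F k\<subseteq>UNIV) sequentially" using Flim G unfolding filterlim_finite_subsets_at_top by auto
   then show "\<forall>\<^sub>F k in sequentially. (\<integral>\<^sup>+x. h k x \<partial>lborel)<=ennreal (?V * infsum B (UNIV-G))"
   proof eventually_elim
    case (elim k)
    have "S k t x-trig_sum (%m. c m t) G x=trig_sum (%m. c m t) (F k-G) x" for x using sum.subset_diff[of G "F k" "%m. c m t * char_fun m x"] elim by (simp add: S_def trig_sum_def)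
    then have "(\<integral>\<^sup>+x. h k x \<partial>lborel)=ennreal (?V*(\<Sum>m\<in>F k-G. (norm (c m t))^2))" unfolding h_def using trig_sum_nn_integral[of "F k-G" "%m. c m t"] Ffin by simp
    also have "... <= ennreal (?V * infsum B (UNIV-G))"
    proof (intro ennreal_leI mult_left_mono)
     have "(\<Sum>m\<in>F k-G. (norm (c m t))^2)<=sum B (F k-G)" by (rule sum_mono) (rule cb)
     also have "... <= infsum B (UNIV-G)" by (rule sum_diff_le_tail[OF Bs B0 Ffin])
     finally show "(\<Sum>m\<in>F k-G. (norm (c m t))^2)<=infsum B (UNIV-G)" .
    qed simp
    finally show ?case .
   qed
  qed simp
  finally show ?thesis .
 qed
 have L2: "L2_conv (%x. of_real (u x t)) (%m. c m t)" for t unfolding L2_conv_def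
 proof
  show "(%x. cor (u x t))\<in>bM" by measurable
  have "((%G. ennreal (?V * infsum B (UNIV-G))) \<longlongrightarrow> ennreal (?V*0)) (fsat)" by (intro tendsto_ennrealI tendsto_intros tail_infsum_tendsto Bs)
  then have z: "((%G. ennreal (?V * infsum B (UNIV-G))) \<longlongrightarrow> 0) (fsat)" by simp
  show "((%G. \<integral>\<^sup>+x\<in>Omega. ennreal ((norm (of_real (u x t)-trig_sum (%m. c m t) G x))^2) \<partial>lborel) \<longlongrightarrow> 0) (fsat)" by (rule tendsto_sandwich[OF _ _ tendsto_const z])
     (intro eventually_finite_subsets_at_top_weakI fatou, simp, intro eventually_finite_subsets_at_top_weakI fatou)
 qed
 have coeff: "cF u m=c m" for m using L2_conv_coeff[OF L2] by (intro ext) (simp add: coeff_fun_def)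
 have "u\<in>X_space sg s" unfolding X_space_def mem_Collect_eq coeff
 proof (intro conjI allI um H summ)
  fix x t and m :: "int^'d" and k
  have "c n (t+2 * pi * of_int k)=c n t" for n using H[of n] periodic_int_shift[of "c n"] by (auto simp: H1_def periodic2pi_def)
  then show "u (x+(2 * pi) *\<^sub>R rvec m) (t+2 * pi * of_int k)=u x t" by (simp add: u_def S_def trig_sum_def char_fun_periodic)
 next
  show "fourier_sum u" unfolding fourier_sum_def coeff
  proof (intro conjI allI impI)
   show "((%F. \<integral>\<^sup>+x\<in>Omega. ennreal ((norm (of_real (u x t)-(\<Sum>m\<in>F. c m t * char_fun m x)))^2) \<partial>lborel) \<longlongrightarrow> 0) (fsat)" for t using L2[of t] unfolding L2_conv_def trig_sum_def by blast
   \<comment> \<open>Where the unordered series converges, the partial sums over \<open>F k\<close>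
     converge to the same value, so the limit that defines \<open>u\<close> satisfies the pointwise
     clause of \<open>fourier_sum\<close>.\<close>
   fix x t assume "(%m. c m t * char_fun m x) summable_on UNIV"
   then have "(sum (%m. c m t * char_fun m x) \<longlongrightarrow> (\<Sum>\<^sub>\<infinity>m. c m t * char_fun m x)) (fsat)" by (rule infsum_tendsto)
   from filterlim_compose[OF this Flim] have lim: "(%k. S k t x) \<longlonglongrightarrow> (\<Sum>\<^sub>\<infinity>m. c m t * char_fun m x)" by (simp add: S_def trig_sum_def)
   then have "(%k. Re (S k t x)) \<longlonglongrightarrow> Re (\<Sum>\<^sub>\<infinity>m. c m t * char_fun m x)" by (rule tendsto_Re)
   then have e: "u x t=Re (\<Sum>\<^sub>\<infinity>m. c m t * char_fun m x)" and c2: "(%k. Re (S k t x)) \<longlonglongrightarrow> u x t" unfolding u_def by (auto simp: limI)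
   have "(%k. cor (Re (S k t x))) \<longlonglongrightarrow> of_real (u x t)" using c2 by (rule tendsto_of_real)
   then have "(%k. S k t x) \<longlonglongrightarrow> of_real (u x t)" unfolding Sreal .
   then show "of_real (u x t)=(\<Sum>\<^sub>\<infinity>m. c m t * char_fun m x)" using lim LIMSEQ_unique by blast
  qed
 qed
 then show ?thesis using that coeff by blast
qed

section \<open>Absolute convergence, the gradient and the Dirichlet energy\<close>

definition jap :: "int^'d::finite => real" where "jap m=max 1 (nv m)"

lemma jap_ge_1: "jap m>=1" by (simp add: jap_def)

lemma jap_nonzero: "m~=0==>jap m=nv m" using norm_rvec_ge_1[of m] by (simp add: jap_def max_def)

lemma jap_0: "jap 0=1" by (simp add: jap_def rvec_simps)

lemma norm_le_jap: "nv m<=jap m" by (simp add: jap_def)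

lemma jap_weight: "sg>=0==>jap m powr (2 * s)<=weight sg s m"
proof (cases "m=0")
 case False
 assume "sg>=0"
 then have "jap m powr (2 * s)*1<=jap m powr (2 * s) * exp (2 * sg * nv m)" by (intro mult_left_mono) auto
 then show ?thesis using False by (simp add: weight_def jap_nonzero)
qed (simp add: weight_def jap_0)

lemma jap_summable:
 assumes "ta>real CARD('d::finite)"
 shows "(%m::int^'d. jap m powr (- ta)) summable_on UNIV"
proof -
 have z: "(%m::int^'d. if m=0 then 1 else 0 :: real) summable_on UNIV" by (rule finite_nonzero_values_imp_summable_on) simp
 show ?thesis by (rule sob(1)[OF summable_on_add[OF lattice_powr_summable[OF assms] z]])
    (auto simp: jap_0 jap_nonzero)
qed

text \<open>\<open>2 |x y| <= x^2 + y^2\<close> with \<open>x = jap m powr (a - s)\<close>: the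
  squares of \<open>x\<close> are summable over the lattice because \<open>2 * (s - a)\<close>
  exceeds the dimension.\<close>

lemma weighted_abs_summable:
 fixes h :: "int^'d::finite => real"
 assumes h: "(%m. (h m)^2 * weight sg s m) summable_on UNIV" and sg: "sg>=0" and s: "real CARD('d)<2*(s-a)"
 shows "(%m. jap m powr a * h m) summable_on UNIV"
proof (rule sob(1)[OF summable_on_add[OF jap_summable[OF s] h]])
 fix m :: "int^'d"
 have e: "jap m powr a=jap m powr (a-s) * jap m powr s" using jap_ge_1[of m] by (simp add: powr_add[symmetric])
 have sq: "(jap m powr (a-s))^2=jap m powr (- (2*(s-a)))" "(jap m powr s)^2=jap m powr (2 * s)" by (simp_all add: power2_eq_square powr_add[symmetric])
 have "2 * abs(jap m powr (a-s)*(jap m powr s * h m))<=(jap m powr (a-s))^2+(jap m powr s * h m)^2" using zero_le_power2[of "abs(jap m powr (a-s))-abs(jap m powr s * h m)"] by (simp only: power2_diff abs_mult[symmetric] power2_abs mult.assoc)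
 then have "abs(jap m powr a * h m)<=(jap m powr (a-s))^2+(jap m powr s * h m)^2" unfolding e mult.assoc by linarith
 also have "(jap m powr s * h m)^2=(h m)^2 * jap m powr (2 * s)" by (simp add: power_mult_distrib sq mult.commute)
 also have "... <= (h m)^2 * weight sg s m" by (intro mult_left_mono jap_weight sg) auto
 finally show "norm (jap m powr a * h m)<=jap m powr (- (2*(s-a)))+(h m)^2 * weight sg s m" by (simp add: sq)
qed

lemma X_space_weighted_summable:
 fixes u :: "real^'d => real => real"
 assumes u: "u\<in>X_space sg s" and sg: "sg>=0" and s: "real CARD('d)<2*(s-a)"
 shows "(%m. jap m powr a * sup_bound u m) summable_on UNIV"
proof -
 have "(%m. (H1_norm (cF u m))^2 * weight sg s m) summable_on UNIV" using u by (simp add: X_space_def)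
 from summable_on_cmult_right[OF weighted_abs_summable[OF this sg s], of 4]
 show ?thesis by (simp add: sup_bound_def mult.assoc mult.left_commute)
qed

lemma X_space_infsum:
 fixes u :: "real^'d => real => real"
 assumes u: "u\<in>X_space sg s" and sg: "sg>=0" and s: "real CARD('d)<2 * s"
 shows "sup_bound u summable_on UNIV" "(%m. cF u m t * char_fun m x) summable_on UNIV"
  "of_real (u x t)=(\<Sum>\<^sub>\<infinity>m. cF u m t * char_fun m x)"
proof -
 have "(%m. jap m powr 0 * sup_bound u m) summable_on UNIV" by (rule X_space_weighted_summable[OF u sg]) (use s in simp)
 moreover have "jap m powr 0=1" for m :: "int^'d" using jap_ge_1[of m] by (simp add: powr_def)
 ultimately show B: "sup_bound u summable_on UNIV" by simp
 show S: "(%m. cF u m t * char_fun m x) summable_on UNIV" by (rule sob(1)[OF B]) (simp add: norm_mult chf_props coeff_fun_bound[OF u])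
 show "of_real (u x t)=(\<Sum>\<^sub>\<infinity>m. cF u m t * char_fun m x)" using u S by (simp add: X_space_def fourier_sum_def)
qed

text \<open>Above half the dimension the pointwise clause of \<open>fourier_sum\<close> fixes the
  function everywhere. This is what turns uniqueness of the modes into equality of
  functions.\<close>

lemma X_space_eqI:
 fixes u v :: "real^'d => real => real"
 assumes u: "u\<in>X_space sg s" and v: "v\<in>X_space sg s" and sg: "sg>=0" and s: "real CARD('d)<2 * s"
  and eq: "!!m t. cF u m t=cF v m t"
 shows "u=v"
proof (intro ext)
 fix x t
 have "cor (u x t) = of_real (v x t)" unfolding X_space_infsum(3)[OF u sg s] X_space_infsum(3)[OF v sg s] eq ..
 then show "u x t=v x t" by simp
qed

lemma char_fun_lipschitz: "norm (char_fun m y-char_fun m x)<=nv m * norm (y-x)"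
proof -
 have e: "char_fun m y-char_fun m x=char_fun m x*(exp (\<i> * of_real (rvec m\<bullet>(y-x)))-1)" by (simp add: char_fun_def inner_diff_right ring_distribs exp_diff)
 have "norm (char_fun m y-char_fun m x)=2 * abs(sin ((rvec m\<bullet>(y-x))/2))" unfolding e norm_mult dist_exp_i_1 by (simp add: chf_props)
 also have "... <= 2 * abs((rvec m\<bullet>(y-x))/2)" using abs_sin_x_le_abs_x[of "(rvec m\<bullet>(y-x))/2"] by linarith
 also have "... <= nv m * norm (y-x)" using Cauchy_Schwarz_ineq2[of "rvec m" "y-x"] by simp
 finally show ?thesis .
qed

lemma char_fun_has_derivative:
 "(char_fun m has_derivative (%h. \<i> * of_real (rvec m\<bullet>h) * char_fun m x)) (at x)"
proof -
 have g: "((%x. \<i> * cor (rvec m\<bullet>x)) has_derivative (%h. \<i> * of_real (rvec m\<bullet>h))) (at x)" by (intro has_derivative_mult_right has_derivative_of_real has_derivative_inner_right has_derivative_ident)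
 show ?thesis using has_derivative_compose[OF g DERIV_exp[unfolded has_field_derivative_def]] by (simp add: char_fun_def[abs_def] mult_ac)
qed

lemma jap_sup_bound_summable:
 fixes u :: "real^'d => real => real"
 assumes u: "u\<in>X_space sg s" and sg: "sg>=0" and s: "real CARD('d)<2*(s-1)"
 shows "(%m. jap m * sup_bound u m) summable_on UNIV"
proof -
 have "(%m. jap m powr 1 * sup_bound u m) summable_on UNIV" by (rule X_space_weighted_summable[OF u sg s])
 moreover have "jap m powr 1=jap m" for m :: "int^'d" using jap_ge_1[of m] by simp
 ultimately show ?thesis by simp
qed

lemma gradient_term_bound:
 assumes u: "u\<in>X_space sg s"
 shows "norm (cF u m t*(\<i> * of_real (rvec m\<bullet>h) * char_fun m x))<=jap m * sup_bound u m * norm h"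
proof -
 have "abs(rvec m\<bullet>h)<=nv m * norm h" by (rule Cauchy_Schwarz_ineq2)
 also have "... <= jap m * norm h" by (intro mult_right_mono norm_le_jap) auto
 finally have "norm (cF u m t) * abs(rvec m\<bullet>h)<=sup_bound u m*(jap m * norm h)" by (intro mult_mono coeff_fun_bound[OF u] sup_bound_nonneg) auto
 then show ?thesis by (simp add: norm_mult chf_props mult_ac)
qed

text \<open>The characters have Lipschitz constants of size \<open>|m|\<close>, which are summable
  against the coefficients when \<open>s - 1\<close> exceeds half the dimension, so the series is
  differentiated term by term.\<close>

lemma X_space_dderiv:
 fixes u :: "real^'d => real => real"
 assumes u: "u\<in>X_space sg s" and sg: "sg>=0" and s: "real CARD('d)<2*(s-1)"
 shows "of_real (dderiv b (%y. u y t) x)=(\<Sum>\<^sub>\<infinity>m. cF u m t*(\<i> * of_real (rvec m\<bullet>b) * char_fun m x))"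
proof -
 have s': "real CARD('d)<2 * s" using s by simp
 have eq: "(%y. cor (u y t))=(%y. \<Sum>\<^sub>\<infinity>m. cF u m t * char_fun m y)" by (intro ext X_space_infsum(3)[OF u sg s'])
 have D: "((%y. cor (u y t)) has_derivative (%h. \<Sum>\<^sub>\<infinity>m. cF u m t*(\<i> * of_real (rvec m\<bullet>h) * char_fun m x))) (at x)" unfolding eq
 proof (rule has_derivative_infsum[where B = "%m. jap m * sup_bound u m"])
  show "((%y. cF u m t * char_fun m y) has_derivative (%h. cF u m t*(\<i> * of_real (rvec m\<bullet>h) * char_fun m x))) (at x)" for m by (intro has_derivative_mult_right char_fun_has_derivative)
  show "norm (cF u m t * char_fun m y-cF u m t * char_fun m x)<=jap m * sup_bound u m * norm (y-x)" for m y
  proof -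
   have "norm (char_fun m y-char_fun m x)<=jap m * norm (y-x)" using char_fun_lipschitz[of m y x] mult_right_mono[OF norm_le_jap[of m], of "norm (y-x)"] by simp
   then have "norm (cF u m t) * norm (char_fun m y-char_fun m x)<=sup_bound u m*(jap m * norm (y-x))" by (intro mult_mono coeff_fun_bound[OF u] sup_bound_nonneg) auto
   then show ?thesis unfolding right_diff_distrib[symmetric] norm_mult by (simp add: mult_ac)
  qed
  show "norm (cF u m t*(\<i> * of_real (rvec m\<bullet>h) * char_fun m x))<=jap m * sup_bound u m * norm h" for m h by (rule gradient_term_bound[OF u])
  show "(%m. jap m * sup_bound u m) summable_on UNIV" by (rule jap_sup_bound_summable[OF u sg s])
  show "(%m. cF u m t * char_fun m y) summable_on UNIV" for y by (rule X_space_infsum(2)[OF u sg s'])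
 qed
 define L where "L h=Re (\<Sum>\<^sub>\<infinity>m. cF u m t*(\<i> * of_real (rvec m\<bullet>h) * char_fun m x))" for h
 have R: "((%y. u y t) has_derivative L) (at x)" using bounded_linear.has_derivative[OF bounded_linear_Re D] unfolding L_def[abs_def] by simp
 then have "((%y. cor (u y t)) has_derivative (%h. of_real (L h))) (at x)" by (rule has_derivative_of_real)
 from has_derivative_unique[OF this D]
 have "cor (L b)=(\<Sum>\<^sub>\<infinity>m. cF u m t*(\<i> * of_real (rvec m\<bullet>b) * char_fun m x))" by (rule fun_cong)
 moreover have "dderiv b (%y. u y t) x=L b" unfolding dderiv_def frechet_derivative_at[OF R, symmetric] ..
 ultimately show ?thesis by simp
qed

lemma infsum_finite_sum:
 fixes f :: "'j => 'i => real"
 assumes "finite J" "!!j. j\<in>J==>f j summable_on I"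
 shows "(%i. \<Sum>j\<in>J. f j i) summable_on I&(\<Sum>\<^sub>\<infinity>i\<in>I. \<Sum>j\<in>J. f j i)=(\<Sum>j\<in>J. infsum (f j) I)" using assms
proof (induction J rule: finite_induct)
 case (insert j J)
 then show ?case using summable_on_add[of "f j" I "%i. \<Sum>j\<in>J. f j i"] infsum_add[of "f j" I "%i. \<Sum>j\<in>J. f j i"] by simp
qed simp

lemma trig_series_cont:
 fixes c :: "int^'d => complex"
 assumes "(%m. norm (c m)) summable_on UNIV"
 shows "cts (%x. \<Sum>\<^sub>\<infinity>m. c m * char_fun m x)" by (rule continuous_infsum[OF _ _ assms]) (auto intro!: continuous_intros chf_props simp: norm_mult chf_props)

lemma trig_series_tail:
 fixes c :: "int^'d => complex"
 assumes s: "(%m. norm (c m)) summable_on UNIV" and F: "finite F"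
 shows "norm ((\<Sum>\<^sub>\<infinity>m. c m * char_fun m x)-trig_sum c F x)<=(\<Sum>\<^sub>\<infinity>m\<in>UNIV-F. norm (c m))"
proof -
 have sm: "(%m. c m * char_fun m x) summable_on UNIV" by (rule sob(1)[OF s]) (simp add: norm_mult chf_props)
 have "(\<Sum>\<^sub>\<infinity>m. c m * char_fun m x)-trig_sum c F x=(\<Sum>\<^sub>\<infinity>m\<in>UNIV-F. c m * char_fun m x)" unfolding trig_sum_def using infsum_Diff[OF sm, of F] F by simp
 moreover have "norm (\<Sum>\<^sub>\<infinity>m\<in>UNIV-F. c m * char_fun m x)<=(\<Sum>\<^sub>\<infinity>m\<in>UNIV-F. norm (c m))" by (rule sob(3)) (auto simp: norm_mult chf_props intro: summable_on_subset_banach[OF s])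
 ultimately show ?thesis by simp
qed

lemma trig_series_L2_conv:
 fixes c :: "int^'d => complex"
 assumes s: "(%m. norm (c m)) summable_on UNIV"
 shows "L2_conv (%x. \<Sum>\<^sub>\<infinity>m. c m * char_fun m x) c" unfolding L2_conv_def
proof
 show "(%x. \<Sum>\<^sub>\<infinity>m. c m * char_fun m x)\<in>bM" by (rule bmcI[OF trig_series_cont[OF s]])
 define T where "T F=(\<Sum>\<^sub>\<infinity>m\<in>UNIV-F. norm (c m))" for F
 have "((%F. ennreal ((T F)^2*(2 * pi) ^ CARD('d))) \<longlongrightarrow> ennreal (0^2*(2 * pi) ^ CARD('d))) (fsat)" unfolding T_def by (intro tendsto_ennrealI tendsto_intros tail_infsum_tendsto[OF s])
 then have z: "((%F. ennreal ((T F)^2*(2 * pi) ^ CARD('d))) \<longlongrightarrow> 0) (fsat)" by simp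
 show "((%F. \<integral>\<^sup>+x\<in>Omega. ennreal ((norm ((\<Sum>\<^sub>\<infinity>m. c m * char_fun m x)-trig_sum c F x))^2) \<partial>lborel) \<longlongrightarrow> 0) (fsat)"
 proof (rule tendsto_sandwich[OF _ _ tendsto_const z])
  have "(\<integral>\<^sup>+x\<in>Omega. ennreal ((norm ((\<Sum>\<^sub>\<infinity>m. c m * char_fun m x)-trig_sum c F x))^2) \<partial>lborel)<=ennreal ((T F)^2*(2 * pi) ^ CARD('d))"
   if F: "finite F" for F
  proof -
   have "(\<integral>\<^sup>+x\<in>Omega. ennreal ((norm ((\<Sum>\<^sub>\<infinity>m. c m * char_fun m x)-trig_sum c F x))^2) \<partial>lborel)<=(\<integral>\<^sup>+x\<in>(Omega :: (real^'d) set). ennreal ((T F)^2) \<partial>lborel)" unfolding T_def by (intro nn_integral_mono mult_right_mono ennreal_leI power_mono trig_series_tail[OF s F]) auto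
   also have "... = ennreal ((T F)^2*(2 * pi) ^ CARD('d))" by (subst nn_integral_cmult_indicator) (auto simp: Omega_props(2) ennreal_mult')
   finally show ?thesis .
  qed
  then show "\<forall>\<^sub>F F in fsat. (\<integral>\<^sup>+x\<in>Omega. ennreal ((norm ((\<Sum>\<^sub>\<infinity>m. c m * char_fun m x)-trig_sum c F x))^2) \<partial>lborel)<=ennreal ((T F)^2*(2 * pi) ^ CARD('d))" by (intro eventually_finite_subsets_at_top_weakI)
 qed simp
qed

text \<open>The convergent partial sums are paired with the bounded function
  \<open>cnj (f x)\<close>; since the coefficients of the sum are known, each such pairing is a
  partial sum of the squares.\<close>

lemma trig_series_parseval:
 fixes c :: "int^'d => complex"
 assumes s: "(%m. norm (c m)) summable_on UNIV" and s2: "(%m. (norm (c m))^2) summable_on UNIV"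
 shows "(JO x. (norm (\<Sum>\<^sub>\<infinity>m. c m * char_fun m x))^2)=(2 * pi) ^ CARD('d)*(\<Sum>\<^sub>\<infinity>m. (norm (c m))^2)"
proof -
 define f where "f x=(\<Sum>\<^sub>\<infinity>m. c m * char_fun m x)" for x
 have L: "L2_conv f c" unfolding f_def[abs_def] by (rule trig_series_L2_conv[OF s])
 have fc: "cts f" unfolding f_def[abs_def] by (rule trig_series_cont[OF s])
 have fm: "(%x. cnj (f x))\<in>bM" by (intro bmcI continuous_intros fc)
 have fb: "norm (cnj (f x))<=(\<Sum>\<^sub>\<infinity>m. norm (c m))" for x using trig_series_tail[OF s, of "{}" x] by (simp add: f_def trig_sum_def)
 have "((%F. JO x. trig_sum c F x * cnj (f x)) \<longlongrightarrow> (JO x. f x * cnj (f x))) (fsat)" by (rule L2_conv_pairing(2)[OF L fm fb])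
 moreover have "((%F. JO x. trig_sum c F x * cnj (f x)) \<longlongrightarrow> of_real ((2 * pi) ^ CARD('d)*(\<Sum>\<^sub>\<infinity>m. (norm (c m))^2))) (fsat)"
 proof (rule Lim_transform_eventually)
  show "((%F. cor ((2 * pi) ^ CARD('d)*(\<Sum>m\<in>F. (norm (c m))^2))) \<longlongrightarrow> of_real ((2 * pi) ^ CARD('d)*(\<Sum>\<^sub>\<infinity>m. (norm (c m))^2))) (fsat)" by (intro tendsto_of_real tendsto_mult tendsto_const infsum_tendsto s2)
  have "cor ((2 * pi) ^ CARD('d)*(\<Sum>m\<in>F. (norm (c m))^2))=(JO x. trig_sum c F x * cnj (f x))" for F
  proof -
   have "(JO x. trig_sum c F x * cnj (f x))=(JO x. (\<Sum>m\<in>F. c m*(char_fun m x * cnj (f x))))" by (simp add: trig_sum_def sum_distrib_right mult.assoc)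
   also have "... = (\<Sum>m\<in>F. JO x. c m*(char_fun m x * cnj (f x)))" by (rule si_sum_swap) (intro set_integrable_Omega continuous_intros chf_props fc)
   also have "... = (\<Sum>m\<in>F. c m*(JO x. char_fun m x * cnj (f x)))" by simp
   also have "... = (\<Sum>m\<in>F. c m * cnj (JO x. f x * cnj (char_fun m x)))" unfolding sli Bochner_Integration.integral_cnj[symmetric] by (simp add: mult.commute)
   also have "... = cor ((2 * pi) ^ CARD('d)*(\<Sum>m\<in>F. (norm (c m))^2))" unfolding L2_conv_coeff[OF L] of_real_mult of_real_sum complex_norm_square sum_distrib_left by (intro sum.cong refl) (simp add: mult_ac)
   finally show ?thesis by simp
  qed
  then show "\<forall>\<^sub>F F in fsat. cor ((2 * pi) ^ CARD('d)*(\<Sum>m\<in>F. (norm (c m))^2))=(JO x. trig_sum c F x * cnj (f x))" by simp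
 qed
 ultimately have e: "(JO x. f x * cnj (f x)) = of_real ((2 * pi) ^ CARD('d)*(\<Sum>\<^sub>\<infinity>m. (norm (c m))^2))" by (rule tendsto_unique[OF finite_subsets_at_top_neq_bot])
 have "cor (JO x. (norm (f x))^2)=(JO x. f x * cnj (f x))" unfolding sli integral_complex_of_real[symmetric] by (intro Bochner_Integration.integral_cong refl) (simp add: complex_norm_square[symmetric] scaleR_conv_of_real)
 with e have "cor (JO x. (norm (f x))^2) = of_real ((2 * pi) ^ CARD('d)*(\<Sum>\<^sub>\<infinity>m. (norm (c m))^2))" by simp
 then show ?thesis unfolding of_real_eq_iff f_def .
qed

lemma energy_terms_summable:
 fixes u :: "real^'d => real => real"
 assumes u: "u\<in>X_space sg s" and sg: "sg>=0" and s: "1<=s"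
 shows "(%m. (jap m * sup_bound u m)^2) summable_on UNIV"
proof -
 have "(%m. (H1_norm (cF u m))^2 * weight sg s m) summable_on UNIV" using u by (simp add: X_space_def)
 from summable_on_cmult_right[OF this, of 16] show ?thesis
 proof (rule sob(1))
  fix m :: "int^'d"
  have "(jap m)^2=jap m powr 2" using jap_ge_1[of m] by simp
  also have "... <= jap m powr (2 * s)" using s jap_ge_1[of m] by (intro powr_mono) auto
  also have "... <= weight sg s m" by (rule jap_weight[OF sg])
  finally have "(H1_norm (cF u m))^2*(jap m)^2<=(H1_norm (cF u m))^2 * weight sg s m" by (intro mult_left_mono) auto
  then show "norm ((jap m * sup_bound u m)^2)<=16*((H1_norm (cF u m))^2 * weight sg s m)" by (simp add: sup_bound_def power_mult_distrib mult_ac)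
 qed
qed

lemma energy_term_bound:
 assumes u: "u\<in>X_space sg s"
 shows "(nv m)^2*(norm (cF u m t))^2<=(jap m * sup_bound u m)^2" unfolding power_mult_distrib[symmetric] by (intro power_mono mult_mono norm_le_jap coeff_fun_bound[OF u]) (use jap_ge_1[of m] in auto)

text \<open>Parseval for every partial derivative, added over the directions. From here on the
  energy is an expression in the modes, and its continuity in time follows from a majorant
  independent of time.\<close>

lemma dirichlet_energy_series:
 fixes u :: "real^'d => real => real"
 assumes u: "u\<in>X_space sg s" and sg: "sg>=0" and s: "real CARD('d)<2*(s-1)"
 shows "(%m. (nv m)^2*(norm (cF u m t))^2) summable_on UNIV"
  "dirichlet_energy u t=(2 * pi) ^ CARD('d)*(\<Sum>\<^sub>\<infinity>m. (nv m)^2*(norm (cF u m t))^2)"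
  "cts (dirichlet_energy u)"
proof -
 have s1: "1<=s" using le_less_trans[OF of_nat_0_le_iff s] by simp
 note B = energy_terms_summable[OF u sg s1]
 show E: "(%m. (nv m)^2*(norm (cF u m t))^2) summable_on UNIV" for t by (rule sob(1)[OF B]) (use energy_term_bound[OF u] in simp)
 define c where "c j m t=cF u m t*(\<i> * of_real (rvec m\<bullet>axis j 1))" for j m t
 have cn: "norm (c j m t)<=jap m * sup_bound u m" for j m t using gradient_term_bound[OF u, of m t "axis j 1" 0] by (simp add: c_def norm_mult chf_props)
 have cs: "(%m. norm (c j m t)) summable_on UNIV" for j t by (rule sob(1)[OF jap_sup_bound_summable[OF u sg s]]) (simp add: cn)
 have cs2: "(%m. (norm (c j m t))^2) summable_on UNIV" for j t by (rule sob(1)[OF B]) (simp add: power_mono[OF cn])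
 have d: "(dderiv (axis j 1) (%y. u y t) x)^2=(norm (\<Sum>\<^sub>\<infinity>m. c j m t * char_fun m x))^2" for j x t
 proof -
  have "norm (\<Sum>\<^sub>\<infinity>m. c j m t * char_fun m x)=norm (cor (dderiv (axis j 1) (%y. u y t) x))" unfolding X_space_dderiv[OF u sg s] c_def by (simp only: mult.assoc)
  then show ?thesis by simp
 qed
 have "dirichlet_energy u t=(2 * pi) ^ CARD('d)*(\<Sum>\<^sub>\<infinity>m. (nv m)^2*(norm (cF u m t))^2)" for t
 proof -
  have "dirichlet_energy u t=(\<Sum>j\<in>UNIV. JO x. (norm (\<Sum>\<^sub>\<infinity>m. c j m t * char_fun m x))^2)" unfolding dirichlet_energy_def d by (rule si_sum_swap) (intro set_integrable_Omega continuous_intros trig_series_cont cs)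
  also have "... = (\<Sum>j\<in>UNIV. (2 * pi) ^ CARD('d)*(\<Sum>\<^sub>\<infinity>m. (norm (c j m t))^2))" by (intro sum.cong refl trig_series_parseval cs cs2)
  also have "... = (2 * pi) ^ CARD('d)*(\<Sum>\<^sub>\<infinity>m. \<Sum>j\<in>UNIV. (norm (c j m t))^2)" using infsum_finite_sum[of "UNIV :: 'd set" "%j m. (norm (c j m t))^2" UNIV] cs2 by (simp add: sum_distrib_left)
  also have "(%m. \<Sum>j\<in>UNIV. (norm (c j m t))^2)=(%m. (nv m)^2*(norm (cF u m t))^2)"
  proof
   fix m :: "int^'d"
   have "(nv m)^2=(\<Sum>j\<in>UNIV. (rvec m $ j)^2)" unfolding norm_vec_def L2_set_def by (simp add: sum_nonneg)
   then show "(\<Sum>j\<in>UNIV. (norm (c j m t))^2)=(nv m)^2*(norm (cF u m t))^2" by (simp add: c_def norm_mult power_mult_distrib sum_distrib_left sum_distrib_right inner_axis mult.commute)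
  qed
  finally show ?thesis .
 qed
 note eq = this
 show "dirichlet_energy u t=(2 * pi) ^ CARD('d)*(\<Sum>\<^sub>\<infinity>m. (nv m)^2*(norm (cF u m t))^2)" by (rule eq)
 have cc: "cts (cF u m)" for m
 proof -
  have "cF u m\<in>H1" using u by (simp add: X_space_def)
  then show ?thesis by (metis H1E H1_deriv_cont)
 qed
 have "cts (%t. \<Sum>\<^sub>\<infinity>m. (nv m)^2*(norm (cF u m t))^2)" by (rule continuous_infsum[OF _ _ B]) (use energy_term_bound[OF u] in \<open>auto intro!: continuous_intros cc\<close>)
 then show "cts (dirichlet_energy u)" unfolding eq[abs_def] by (intro continuous_intros)
qed

section \<open>Vanishing of a continuous periodic function of time with zero Fourier
  coefficients\<close>

lemma si_const: "(JT t. ka)=2 * pi * ka" for ka :: real using set_integral_FTC[of 0 "2 * pi" "%t. ka * t" "%_. ka"] by (auto intro!: derivative_eq_intros)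

text \<open>The product formula for cosines moves the integer frequency by one in either direction
  and also changes the phase, so the induction has to cover all frequencies and phases at
  once.\<close>

lemma cos_power_orthogonal:
 fixes D :: "real => real"
 assumes D: "cts D" and z: "!!(l::int) c. (JT t. D t * cos (of_int l * t+c))=0"
 shows "(JT t. D t*(a+cos (t-t0)) ^ n * cos (of_int l * t+c))=0"
proof (induction n arbitrary: l c)
 case 0
 show ?case using z by simp
next
 case (Suc n)
 have si: "sil {0..2*pi} f" if "cts f" for f :: "real => real" by (rule sicb[OF that]) auto
 have e: "cos (of_int l * t+c) * cos (t-t0)=(1/2) * cos (of_int (l+1) * t+(c-t0))+(1/2) * cos (of_int (l-1) * t+(c+t0))" for t unfolding cos_times_cos by (simp add: algebra_simps)
 have "(JT t. D t*(a+cos (t-t0)) ^ Suc n * cos (of_int l * t+c))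
     = (JT t. a*(D t*(a+cos (t-t0)) ^ n * cos (of_int l * t+c)) +
         ((1/2)*(D t*(a+cos (t-t0)) ^ n * cos (of_int (l+1) * t+(c-t0)))+(1/2)*(D t*(a+cos (t-t0)) ^ n * cos (of_int (l-1) * t+(c+t0)))))"
 proof (intro arg_cong[where f = "set_lebesgue_integral lborel {0..2*pi}"] ext)
  fix t
  have "D t*(a+cos (t-t0)) ^ Suc n * cos (of_int l * t+c)=a*(D t*(a+cos (t-t0)) ^ n * cos (of_int l * t+c))+D t*(a+cos (t-t0)) ^ n*(cos (of_int l * t+c) * cos (t-t0))" by (simp add: algebra_simps)
  then show "D t*(a+cos (t-t0)) ^ Suc n * cos (of_int l * t+c)=a*(D t*(a+cos (t-t0)) ^ n * cos (of_int l * t+c)) +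
         ((1/2)*(D t*(a+cos (t-t0)) ^ n * cos (of_int (l+1) * t+(c-t0)))+(1/2)*(D t*(a+cos (t-t0)) ^ n * cos (of_int (l-1) * t+(c+t0))))" unfolding e by (simp only: ring_distribs mult_ac)
 qed
 also have "... = a*0+((1/2)*0+(1/2)*0)"
 proof -
  have c: "cts (%t. k*(D t*(a+cos (t-t0)) ^ n * cos (of_int j * t+e)))" for k j e by (intro continuous_intros D)
  show ?thesis by (subst set_integral_add(2)[OF si si], intro c, intro continuous_on_add c, subst set_integral_add(2)[OF si si], intro c, intro c)
     (simp only: set_integral_mult_right Suc.IH mult_zero_right)
 qed
 finally show ?case by simp
qed

text \<open>Rudin's peaking kernels: on a neighbourhood of \<open>t0\<close> the powers of
 \<open>1 - cos de + cos (t - t0)\<close> grow exponentially, away from it they stay bounded.\<close>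

lemma fourier_uniqueness_interior:
 fixes D :: "real => real"
 assumes D: "cts D" and z: "!!(l::int) c. (JT t. D t * cos (of_int l * t+c))=0"
  and t0: "0<t0" "t0<2 * pi"
 shows "D t0<=0"
proof (rule ccontr)
 assume "\<not> D t0<=0"
 then have pos: "D t0>0" by simp
 define e where "e=D t0/2"
 have e: "e>0" using pos by (simp add: e_def)
 have "isCont D t0" using D by (simp add: continuous_on_eq_continuous_at)
 then obtain d where d: "d>0" "!!t. dist t t0<d==>dist (D t) (D t0)<e" using e unfolding continuous_at_eps_delta by blast
 \<comment> \<open>Small enough for continuity of \<open>D\<close>, for staying inside one period,
   and for staying below \<open>pi\<close>, where the cosine decreases.\<close>
 define de where "de=min (d/2) (min t0 (2 * pi-t0)/2)"
 have de: "0<de" "de<d" "de<t0" "de<2 * pi-t0" "de<pi" using d(1) t0 by (auto simp: de_def min_def)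
 have near: "D t>=e" if "abs(t-t0)<=de" for t using d(2)[of t] that de unfolding dist_real_def e_def by (simp add: abs_if split: if_splits)
 have "compact (D ` {0..2*pi})" by (rule compact_continuous_image[OF continuous_on_subset[OF D subset_UNIV] compact_Icc])
 then obtain K where K: "!!t. t\<in>{0..2*pi}==>abs(D t)<=K" using compact_imp_bounded[of "D ` {0..2*pi}"] unfolding bounded_iff by (metis (no_types, lifting) imageI real_norm_def)
 \<comment> \<open>The minimum of the kernel on the neighbourhood of half the radius. It exceeds 1,
   whereas outside the full neighbourhood the kernel is at most 1 in absolute value.\<close>
 define q where "q=1-cos de+cos (de/2)"
 have q: "q>1" using cos_monotone_0_pi[of "de/2" de] de by (simp add: q_def)
 define Q where "Q t=1-cos de+cos (t-t0)" for t
 have zero: "(JT t. D t * Q t ^ n)=0" for n using cos_power_orthogonal[OF D z, of "1-cos de" t0 n 0 0] by (simp add: Q_def)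
 have K0: "K>=0" using K[of 0] by simp
 have pw: "(e * q ^ n) * indicator {t0-de/2..t0+de/2} t-K<=D t * Q t ^ n" if t: "t\<in>{0..2*pi}" for t n
 proof -
  consider "abs(t-t0)<=de/2" | "abs(t-t0)>de/2" "abs(t-t0)<=de" | "abs(t-t0)>de" by linarith
  then show ?thesis
  proof cases
   case 1
   have "cos (de/2)<=cos (abs(t-t0))" by (rule cos_monotone_0_pi_le) (use 1 de in auto)
   then have "q<=Q t" by (simp add: q_def Q_def)
   then have "e * q ^ n<=D t * Q t ^ n" using near[of t] 1 de q e by (intro mult_mono power_mono) auto
   moreover have "t\<in>{t0-de/2..t0+de/2}" using 1 unfolding atLeastAtMost_iff abs_le_iff by linarith
   ultimately show ?thesis using K0 by simp
  next
   case 2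
   have "cos de<=cos (abs(t-t0))" by (rule cos_monotone_0_pi_le) (use 2 de in auto)
   then have "0<=Q t" by (simp add: Q_def)
   then have "0<=D t * Q t ^ n" using near[of t] 2 e by (intro mult_nonneg_nonneg) auto
   moreover have "t \<notin> {t0-de/2..t0+de/2}" using 2(1) unfolding atLeastAtMost_iff not_le[symmetric] abs_le_iff by linarith
   ultimately show ?thesis using K0 by simp
  next
   case 3
   have far: "cos (t-t0)<=cos de"
   proof (cases "abs(t-t0)<=pi")
    case True
    then have "cos (abs(t-t0))<=cos de" by (intro cos_monotone_0_pi_le) (use 3 de in auto)
    then show ?thesis by simp
   next
    case False
    have "abs(t-t0)<=2 * pi-de" using t de t0 by (auto simp: abs_if)
    then have "cos (2 * pi-abs(t-t0))<=cos de" by (intro cos_monotone_0_pi_le) (use False de in auto)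
    then show ?thesis by (simp add: cos_diff)
   qed
   have "abs(Q t)<=1" using far cos_ge_minus_one[of "t-t0"] cos_le_one[of de] unfolding Q_def abs_le_iff by linarith
   then have "abs(Q t ^ n)<=1" unfolding power_abs by (intro power_le_one) auto
   then have "abs(D t * Q t ^ n)<=K*1" unfolding abs_mult using K[OF t] K0 by (intro mult_mono) auto
   moreover have "t \<notin> {t0-de/2..t0+de/2}" using 3 de(1) unfolding atLeastAtMost_iff not_le[symmetric] abs_le_iff by linarith
   ultimately show ?thesis by (simp add: abs_le_iff)
  qed
 qed
 have le: "e * q ^ n * de<=2 * pi * K" for n
 proof -
  have i0: "sil {0..2*pi} (%t. (e * q ^ n) * indicator {t0-de/2..t0+de/2} t :: real)"
  proof -
   have "(%t. indicator {0..2*pi} t *\<^sub>R ((e * q ^ n) * indicator {t0-de/2..t0+de/2} t))=(%t. (e * q ^ n)*(indicator {t0-de/2..t0+de/2} t :: real))" using de by (auto simp: indicator_def fun_eq_iff)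
   moreover have "emeasure lborel {t0-de/2..t0+de/2} < \<infinity>" by (rule emeasure_bounded_finite) simp
   ultimately show ?thesis unfolding sid by (auto intro!: integrable_mult_right integrable_real_indicator)
  qed
  have i1: "sil {0..2*pi} (%t. K)" by (rule sicb) auto
  have i2: "sil {0..2*pi} (%t. D t * Q t ^ n)" unfolding Q_def by (rule sicb) (auto intro!: continuous_intros D)
  have "(JT t. (e * q ^ n) * indicator {t0-de/2..t0+de/2} t-K)<=(JT t. D t * Q t ^ n)" by (rule set_integral_mono[OF set_integral_diff(1)[OF i0 i1] i2 pw])
  moreover have "(JT t. (e * q ^ n) * indicator {t0-de/2..t0+de/2} t-K)=e * q ^ n * de-2 * pi * K"
  proof -
   have "(JT t. (indicator {t0-de/2..t0+de/2} t :: real))=de"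
   proof -
    have "(%t. indicator {0..2*pi} t *\<^sub>R (indicator {t0-de/2..t0+de/2} t :: real))=indicator {t0-de/2..t0+de/2}" using de by (auto simp: indicator_def fun_eq_iff)
    then show ?thesis unfolding sli using de(1) by simp
   qed
   moreover have "(JT t. K)=2 * pi * K" by (rule si_const)
   ultimately show ?thesis unfolding set_integral_diff(2)[OF i0 i1] by simp
  qed
  ultimately show ?thesis using zero by simp
 qed
 obtain n where "2 * pi * K/(e * de)<q ^ n" using real_arch_pow[OF q] by blast
 then have "2 * pi * K<e * q ^ n * de" using e de(1) by (simp add: field_simps)
 with le[of n] show False by simp
qed

lemma fourier_uniqueness:
 fixes D :: "real => real"
 assumes D: "cts D" and p: "!!t. D (t+2 * pi)=D t"
  and z: "!!(l::int) c. (JT t. D t * cos (of_int l * t+c))=0"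
 shows "D t=0"
proof -
 have int: "D t=0" if "0<t" "t<2 * pi" for t
 proof -
  have "D t<=0" by (rule fourier_uniqueness_interior[OF D z that])
  moreover have "- D t<=0"
  proof (rule fourier_uniqueness_interior[where D = "%t. - D t", OF _ _ that])
   show "cts (%t. - D t)" by (intro continuous_intros D)
   show "(JT t. - D t * cos (of_int l * t+c))=0" for l c using z[of l c] by (simp add: sli)
  qed
  ultimately show ?thesis by simp
 qed
 have "D 0=0"
 proof -
  have "closed {t. D t=0}" using D by (intro closed_Collect_eq continuous_on_const)
  moreover have "{0<..<2*pi}\<subseteq>{t. D t=0}" using int by auto
  ultimately have "closure {0<..<2*pi}\<subseteq>{t. D t=0}" by (rule closure_minimal[rotated])
  then show ?thesis by (simp add: subset_iff)
 qed
 moreover obtain s where "s\<in>{0..<2*pi}" "D t=D s" using periodic_reduce[of D D t] p by blast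
 ultimately show ?thesis using int[of s] by (cases "s=0") auto
qed

section \<open>Distributional derivatives and Fourier modes\<close>

lemma cos_affine_derivative:
 "((%z. A * cos (k\<bullet>z+c)) has_derivative (%h. A*(k\<bullet>h) * cos (k\<bullet>z+(c+pi/2)))) (at z)"
proof -
 have e: "cos (k\<bullet>z+(c+pi/2)) = - sin (k\<bullet>z+c)" by (simp add: cos_add[of "k\<bullet>z+c" "pi/2", simplified add.assoc])
 show ?thesis unfolding e by (auto intro!: derivative_eq_intros)
qed

lemma dderiv_cos_affine:
 "dderiv b (%z. A * cos (k\<bullet>z+c))=(%z. (A*(k\<bullet>b)) * cos (k\<bullet>z+(c+pi/2)))" by (rule ext) (simp add: dderiv_def frechet_derivative_at[OF cos_affine_derivative, symmetric])

text \<open>Differentiation changes the amplitude and moves the phase by \<open>pi/2\<close> but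
  preserves the shape of the function; this shape is the invariant of the coinduction.\<close>

lemma smooth_cos_affine: "smooth (%z. A * cos (k\<bullet>z+c))"
proof (coinduction arbitrary: A c)
 case smooth
 show ?case by (rule exI[of _ "%z. A * cos (k\<bullet>z+c)"]) (auto simp: dderiv_cos_affine differentiable_def intro: cos_affine_derivative)
qed

text \<open>Real test functions; the free phase \<open>c\<close> covers cosines and sines
  together.\<close>

definition wave :: "int^'d => int => real => (real^'d)\<times>real => real" where
 "wave m l c z=cos (rvec m\<bullet>fst z + of_int l * snd z+c)"

lemma wave_eq: "wave m l c=(%z. 1 * cos ((rvec m,real_of_int l)\<bullet>z+c))" by (auto simp: wave_def inner_prod_def)

lemma cos_add_pi_halves: "cos (x+(c+pi/2+pi/2)) = - cos (x+c)" using cos_add[of "x+c" pi] by (simp add: add.assoc)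

lemma wave_derivatives:
 fixes m :: "int^'d"
 shows "dderiv (0,1) (dderiv (0,1) (wave m l c)) z = - ((of_int l)^2 * wave m l c z)"
  "(\<Sum>j\<in>UNIV. dderiv (axis j 1,0) (dderiv (axis j 1,0) (wave m l c)) z) = - ((nv m)^2 * wave m l c z)"
proof -
 have 2: "dderiv b (dderiv b (wave m l c)) z = - (((rvec m,real_of_int l)\<bullet>b)^2 * wave m l c z)" for b unfolding wave_eq dderiv_cos_affine cos_add_pi_halves by (simp add: power2_eq_square)
 show "dderiv (0,1) (dderiv (0,1) (wave m l c)) z = - ((of_int l)^2 * wave m l c z)" unfolding 2 by simp
 have n: "(nv m)^2=(\<Sum>j\<in>UNIV. (rvec m $ j)^2)" unfolding norm_vec_def L2_set_def by (simp add: sum_nonneg)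
 show "(\<Sum>j\<in>UNIV. dderiv (axis j 1,0) (dderiv (axis j 1,0) (wave m l c)) z) = - ((nv m)^2 * wave m l c z)" unfolding 2 n by (simp add: sum_negf sum_distrib_right inner_axis)
qed

lemma wave_test_fun: "test_fun (wave m l c)" unfolding test_fun_def
proof (intro conjI allI)
 show "smooth (wave m l c)" unfolding wave_eq by (rule smooth_cos_affine)
 fix x t n and k :: int
 define N where "N=(\<Sum>j\<in>UNIV. m $ j * n $ j)+l * k"
 have e: "rvec m\<bullet>(x+(2 * pi) *\<^sub>R rvec n) + of_int l*(t+2 * pi * of_int k)+c=rvec m\<bullet>x + of_int l * t+c+2 * pi * of_int N" unfolding N_def inner_add_right inner_scaleR_right inner_vec_def by (simp add: rvec_simps algebra_simps sum.distrib sum_distrib_left)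
 show "wave m l c (x+(2 * pi) *\<^sub>R rvec n,t+2 * pi * of_int k)=wave m l c (x,t)" unfolding wave_def fst_conv snd_conv e by (rule periodic_int_shift[of cos]) simp
qed

text \<open>A bound for the square integrals over the slices, uniform in time, is all the input:
  \<open>|U| <= 1 + |U|^2\<close> yields integrability over the cell, and Cauchy-Schwarz on each
  slice yields the size.\<close>

lemma cell_integral_Fubini:
 fixes U :: "real^'d => real => complex" and ph :: "(real^'d)\<times>real => complex"
 assumes U[measurable]: "(%z. U (fst z) (snd z))\<in>bM" and ph[measurable]: "ph\<in>bM"
  and A: "!!t. (\<integral>\<^sup>+x\<in>Omega. ennreal ((norm (U x t))^2) \<partial>lborel)<=ennreal A" "A>=0" and B: "!!z. norm (ph z)<=B"
 shows "sil cell (%z. U (fst z) (snd z) * ph z)"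
  "(JC z. U (fst z) (snd z) * ph z)=(LINT t:{0<..<2*pi}|lborel. JO x. U x t * ph (x,t))"
  "norm (JC z. U (fst z) (snd z) * ph z)<=2 * pi*(B * sqrt ((2 * pi) ^ CARD('d) * A))"
proof -
 let ?V = "(2 * pi) ^ CARD('d)"
 have B0: "B>=0" using norm_ge_zero B[of 0] by (rule order_trans)
 have pm: "(%x. (x,t))\<in>bM" for t :: real and x :: "real^'d" by (intro bmcI continuous_intros)
 have Ut[measurable]: "(%x. U x t)\<in>bM" for t using measurable_compose[OF pm U, of t] by simp
 have pht[measurable]: "(%x. ph (x,t))\<in>bM" for t using measurable_compose[OF pm ph, of t] by simp
 define f where "f z=indicator cell z *\<^sub>R (U (fst z) (snd z) * ph z)" for z
 have cs[measurable]: "cell\<in>sets (borel :: ((real^'d)\<times>real) measure)" unfolding cell_eq by simp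
 have fm[measurable]: "f\<in>bM" unfolding f_def[abs_def] by measurable
 have fe: "f (x,t)=indicator {0<..<2*pi} t *\<^sub>R (indicator Omega x *\<^sub>R (U x t * ph (x,t)))" for x t by (simp add: f_def cell_def indicator_times)
 have inner: "(\<integral>\<^sup>+x. ennreal (norm (f (x,t))) \<partial>lborel)<=ennreal (B * ?V+B * A) * indicator {0<..<2*pi} t" for t
 proof (cases "t\<in>{0<..<2*pi}")
  case True
  have "(\<integral>\<^sup>+x. ennreal (norm (f (x,t))) \<partial>lborel)<=(\<integral>\<^sup>+x. ennreal B * indicator Omega x+ennreal B*(ennreal ((norm (U x t))^2) * indicator Omega x) \<partial>lborel)"
  proof (rule nn_integral_mono)
   fix x
   have "norm (U x t) * norm (ph (x,t))<=(1+(norm (U x t))^2) * B"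
   proof (intro mult_mono B)
    show "norm (U x t)<=1+(norm (U x t))^2" 
    proof -
     have "2 * norm (U x t)<=(norm (U x t))^2+1" using zero_le_power2[of "norm (U x t)-1"] by (simp add: power2_diff)
     then show ?thesis using norm_ge_zero[of "U x t"] by linarith
    qed
   qed auto
   then have "ennreal (norm (U x t * ph (x,t)))<=ennreal (B+B*(norm (U x t))^2)" by (intro ennreal_leI) (simp add: norm_mult algebra_simps)
   then show "ennreal (norm (f (x,t)))<=ennreal B * indicator Omega x+ennreal B*(ennreal ((norm (U x t))^2) * indicator Omega x)" unfolding fe using B0 by (auto simp: indicator_def ennreal_plus ennreal_mult')
  qed
  also have "... = ennreal B * ennreal ?V+ennreal B*(\<integral>\<^sup>+x\<in>Omega. ennreal ((norm (U x t))^2) \<partial>lborel)" by (subst nn_integral_add) (auto simp: nn_integral_cmult Omega_props(2))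
  also have "... <= ennreal B * ennreal ?V+ennreal B * ennreal A" by (intro add_left_mono mult_left_mono A) auto
  also have "... = ennreal (B * ?V+B * A)" using B0 A(2) by (simp add: ennreal_plus ennreal_mult')
  finally show ?thesis using True by simp
 next
  case False
  then show ?thesis by (simp add: fe)
 qed
 have pl: "(lborel :: ((real^'d)\<times>real) measure)=lborel \<Otimes>\<^sub>M lborel" by (rule lborel_prod[symmetric])
 have fm2: "f\<in>borel_measurable ((lborel :: (real^'d) measure) \<Otimes>\<^sub>M (lborel :: real measure))" unfolding lborel_prod using fm by simp
 have fi: "integrable lborel f"
 proof (rule integrableI_bounded)
  show "f\<in>borel_measurable lborel" by simp
  have "(\<integral>\<^sup>+z. ennreal (norm (f z)) \<partial>lborel)=(\<integral>\<^sup>+t. \<integral>\<^sup>+x. ennreal (norm (f (x,t))) \<partial>lborel \<partial>lborel)" unfolding pl by (rule lborel_pair.nn_integral_snd[symmetric]) (use fm2 in measurable)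
  also have "... <= (\<integral>\<^sup>+t. ennreal (B * ?V+B * A) * indicator {0<..<2*pi} t \<partial>lborel)" by (intro nn_integral_mono inner)
  also have "... < \<infinity>" by (subst nn_integral_cmult_indicator) (auto simp: ennreal_mult_less_top)
  finally show "(\<integral>\<^sup>+z. ennreal (norm (f z)) \<partial>lborel) < \<infinity>" .
 qed
 then show "sil cell (%z. U (fst z) (snd z) * ph z)" by (simp add: sid f_def[abs_def])
 have fi2: "integrable ((lborel :: (real^'d) measure) \<Otimes>\<^sub>M (lborel :: real measure)) (case_prod (%x t. f (x,t)))" using fi unfolding pl by (simp add: case_prod_unfold)
 have "(JC z. U (fst z) (snd z) * ph z)=(\<integral>z. f z \<partial>(lborel \<Otimes>\<^sub>M lborel))" unfolding sli f_def pl ..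
 also have "... = (\<integral>t. \<integral>x. f (x,t) \<partial>lborel \<partial>lborel)" using lborel_pair.integral_snd[OF fi2] by (simp add: case_prod_unfold)
 also have "... = (LINT t:{0<..<2*pi}|lborel. JO x. U x t * ph (x,t))" unfolding fe sli integral_scaleR_right ..
 finally show eq: "(JC z. U (fst z) (snd z) * ph z)=(LINT t:{0<..<2*pi}|lborel. JO x. U x t * ph (x,t))" .
 define K where "K=B * sqrt (?V * A)"
 have K: "norm (JO x. U x t * ph (x,t))<=K" for t unfolding K_def by (rule L2_norm_pairing(2)[OF Ut pht B A])
 have "norm (LINT t:{0<..<2*pi}|lborel. JO x. U x t * ph (x,t))<=(\<integral>t. norm (indicator {0<..<2*pi} t *\<^sub>R (JO x. U x t * ph (x,t))) \<partial>lborel)" unfolding sli[of _ "{0<..<2*pi}"] by (rule integral_norm_bound)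
 also have "... <= (\<integral>t. indicator {0<..<2*pi} t *\<^sub>R K \<partial>lborel)"
 proof (rule integral_mono')
  show "norm (indicator {0<..<2*pi} t *\<^sub>R (JO x. U x t * ph (x,t)))<=indicator {0<..<2*pi} t *\<^sub>R K" for t using K[of t] by (auto simp: indicator_def)
  show "0<=indicator {0<..<2*pi} t *\<^sub>R K" for t using B0 A(2) by (simp add: K_def)
 qed simp
 also have "... = 2 * pi * K" by simp
 finally show "norm (JC z. U (fst z) (snd z) * ph z)<=2 * pi*(B * sqrt (?V * A))" unfolding eq K_def .
qed

context
 fixes u :: "real^'d => real => real" and sg s :: real
 assumes u: "u\<in>X_space sg s" and sg: "sg>=0" and s: "s>=0"
begin

abbreviation "tail F \<equiv> infsum (%m. (sup_bound u m)^2) (UNIV-F)"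

lemma Xcoeff_cont: "cts (cF u m)"
proof -
 have "cF u m\<in>H1" using u by (simp add: X_space_def)
 then show ?thesis by (metis H1E H1_deriv_cont)
qed

lemma Xcoeff_per: "cF u m (t+2 * pi)=cF u m t" using u by (simp add: X_space_def H1_def periodic2pi_def)

lemma coeff_char_cont: "cts (%z. cF u m (snd z) * char_fun m (fst z))" by (intro continuous_intros continuous_on_compose2[OF Xcoeff_cont] continuous_on_compose2[OF chf_props(5)]) auto

lemma X_space_joint_measurable: "(%z. cor (u (fst z) (snd z))-trig_sum (%m. cF u m (snd z)) F (fst z))\<in>bM"
proof -
 have 1: "(%z. u (fst z) (snd z))\<in>bM" using u by (simp add: X_space_def)
 have 2: "(%z. trig_sum (%m. cF u m (snd z)) F (fst z))\<in>bM" unfolding trig_sum_def by (intro bmcI continuous_on_sum coeff_char_cont)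
 show ?thesis using 1 2 by measurable
qed

lemma X_space_slice_tail:
 assumes "finite F"
 shows "(\<integral>\<^sup>+x\<in>Omega. ennreal ((norm (cor (u x t)-trig_sum (%m. cF u m t) F x))^2) \<partial>lborel)<=ennreal (2*((2 * pi) ^ CARD('d) * tail F))" by (rule L2_conv_tail_bound[OF X_space_L2_conv[OF u] sup_bound_summable[OF u sg s] _ assms])
   (intro power_mono coeff_fun_bound[OF u], simp)

lemma tail_nonneg: "2*((2 * pi) ^ CARD('d) * tail F)>=0" by (simp add: infsum_nonneg)

lemma X_space_cell_Fubini:
 fixes ph :: "(real^'d)\<times>real => complex"
 assumes "ph\<in>bM" "!!z. norm (ph z)<=B"
 shows "sil cell (%z. of_real (u (fst z) (snd z)) * ph z)"
  "(JC z. of_real (u (fst z) (snd z)) * ph z)=(LINT t:{0<..<2*pi}|lborel. JO x. of_real (u x t) * ph (x,t))"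
proof -
 have m: "(%z. cor (u (fst z) (snd z)))\<in>bM" using X_space_joint_measurable[of "{}"] by (simp add: trig_sum_def)
 have t: "(\<integral>\<^sup>+x\<in>Omega. ennreal ((norm (cor (u x t)))^2) \<partial>lborel)<=ennreal (2*((2 * pi) ^ CARD('d) * tail {}))" for t using X_space_slice_tail[of "{}" t] by (simp add: trig_sum_def)
 note F = cell_integral_Fubini[where U = "%x t. cor (u x t)", OF m assms(1) t tail_nonneg assms(2)]
 show "sil cell (%z. of_real (u (fst z) (snd z)) * ph z)" by (rule F(1))
 show "(JC z. of_real (u (fst z) (snd z)) * ph z)=(LINT t:{0<..<2*pi}|lborel. JO x. of_real (u x t) * ph (x,t))" by (rule F(2))
qed

text \<open>The tails over the slices are small uniformly in time, so a series that converges in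
  mean square only may still be integrated term by term against a continuous function on the
  cell.\<close>

lemma cell_pairing_limit:
 fixes ph :: "(real^'d)\<times>real => complex"
 assumes c: "cts ph"
 shows "((%F. \<Sum>m\<in>F. JC z. cF u m (snd z) * char_fun m (fst z) * ph z) \<longlongrightarrow> (JC z. of_real (u (fst z) (snd z)) * ph z)) (fsat)"
proof -
 let ?V = "(2 * pi) ^ CARD('d)"
 have cs[measurable]: "cell\<in>sets (borel :: ((real^'d)\<times>real) measure)" and bc: "bounded (cell :: ((real^'d)\<times>real) set)" unfolding cell_eq by auto
 have sub: "(cell :: ((real^'d)\<times>real) set)\<subseteq>torus_box" unfolding cell_eq by (rule box_subset_cbox)
 have "bounded (ph ` torus_box)" by (rule compact_imp_bounded, rule compact_continuous_image[OF continuous_on_subset[OF c subset_UNIV] compact_cbox])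
 then obtain B where B': "!!y. y\<in>ph ` torus_box==>norm y<=B" unfolding bounded_iff by auto
 have B: "norm (ph z)<=max B 0" if "z\<in>cell" for z using B'[OF imageI[OF subsetD[OF sub that]]] by (rule max.coboundedI1)
 \<comment> \<open>Cutting \<open>ph\<close> off outside the cell makes it globally bounded, as
   \<open>cell_integral_Fubini\<close> demands, without changing any integral over the cell.\<close>
 define ph' where "ph' z=indicator cell z *\<^sub>R ph z" for z
 have pm: "ph'\<in>bM" unfolding ph'_def[abs_def] using bmcI[OF c] by measurable
 have pb: "norm (ph' z)<=max B 0" for z using B by (auto simp: ph'_def indicator_def)
 have cong: "(JC z. h z * ph' z)=(JC z. h z * ph z)" for h unfolding sli by (intro Bochner_Integration.integral_cong refl) (simp add: ph'_def indicator_def)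
 note F = cell_integral_Fubini[where U = "%x t. cor (u x t)-trig_sum (%m. cF u m t) F x" for F,
   OF X_space_joint_measurable pm X_space_slice_tail tail_nonneg pb]
 have si: "sil cell (%z. cF u m (snd z) * char_fun m (fst z) * ph z)" for m by (rule sicb[OF _ cs bc]) (intro continuous_intros coeff_char_cont c)
 have ui: "sil cell (%z. of_real (u (fst z) (snd z)) * ph z)"
 proof -
  have "sil cell (%z. of_real (u (fst z) (snd z)) * ph' z)" by (rule X_space_cell_Fubini(1)[OF pm pb])
  then show ?thesis unfolding sid ph'_def by (rule Bochner_Integration.integrable_cong[THEN iffD1, rotated 2]) (auto simp: indicator_def)
 qed
 have diff: "(JC z. of_real (u (fst z) (snd z)) * ph z)-(\<Sum>m\<in>F. JC z. cF u m (snd z) * char_fun m (fst z) * ph z)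
      = (JC z. (of_real (u (fst z) (snd z))-trig_sum (%m. cF u m (snd z)) F (fst z)) * ph' z)" if "finite F" for F
 proof -
  have sF: "sil cell (%z. \<Sum>m\<in>F. cF u m (snd z) * char_fun m (fst z) * ph z)" by (rule sicb[OF _ cs bc]) (intro continuous_intros coeff_char_cont c)
  show ?thesis unfolding cong si_sum_swap[OF si, symmetric] set_integral_diff(2)[OF ui sF, symmetric] by (simp add: trig_sum_def left_diff_distrib sum_distrib_right)
 qed
 show ?thesis
 proof (rule LIM_zero_cancel, rule Lim_null_comparison)
  have "((%F. 2 * pi*(max B 0 * sqrt (?V*(2*(?V * tail F))))) \<longlongrightarrow> 2 * pi*(max B 0 * sqrt (?V*(2*(?V*0))))) (fsat)" by (intro tendsto_intros tail_infsum_tendsto sup_bound_summable[OF u sg s])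
  then show "((%F. 2 * pi*(max B 0 * sqrt (?V*(2*(?V * tail F))))) \<longlongrightarrow> 0) (fsat)" by simp
  show "\<forall>\<^sub>F F in fsat. norm ((\<Sum>m\<in>F. JC z. cF u m (snd z) * char_fun m (fst z) * ph z)-(JC z. of_real (u (fst z) (snd z)) * ph z))<=2 * pi*(max B 0 * sqrt (?V*(2*(?V * tail F))))" by (intro eventually_finite_subsets_at_top_weakI) (simp only: norm_minus_commute[of "sum _ _"] diff F(3))
 qed
qed

text \<open>The wave is the real part of the conjugate character times an exponential in time, so
  the space integral produces the coefficient of mode \<open>m\<close> and only a time integral is
  left.\<close>

lemma cell_wave_integral:
 "(JC z. u (fst z) (snd z) * wave m l c z)=(2 * pi) ^ CARD('d) *
     (JT t. Re (cF u m t) * cos (of_int l * t+c)+Im (cF u m t) * sin (of_int l * t+c))"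
proof -
 let ?V = "(2 * pi) ^ CARD('d)"
 define e where "e t=exp (- (\<i> * of_real (of_int l * t+c)))" for t
 define ph where "ph z=cnj (char_fun m (fst z)) * e (snd z)" for z
 have pc: "cts ph" unfolding ph_def[abs_def] e_def by (intro continuous_intros continuous_on_compose2[OF chf_props(5)]) auto
 have "norm (e t)=1" for t unfolding e_def using norm_exp_i_times[of "- (of_int l * t+c)"] by simp
 then have pb: "norm (ph z)<=1" for z by (simp add: ph_def norm_mult chf_props)
 note F = X_space_cell_Fubini[OF bmcI[OF pc] pb]
 have Reph: "Re (ph z)=wave m l c z" for z
 proof -
  have "cnj (char_fun m x)=exp (\<i> * of_real (- (rvec m\<bullet>x)))" for x by (simp add: char_fun_def exp_cnj)
  then have "ph z=exp (\<i> * of_real (- (rvec m\<bullet>fst z + of_int l * snd z+c)))" by (simp add: ph_def e_def exp_add[symmetric] algebra_simps)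
  moreover have "Re (exp (\<i> * of_real (- y)))=cos y" for y by (simp add: Re_exp)
  ultimately show ?thesis unfolding wave_def by (simp only:)
 qed
 have "(JC z. u (fst z) (snd z) * wave m l c z)=Re (JC z. of_real (u (fst z) (snd z)) * ph z)" using F(1) unfolding sli sid by (subst integral_Re[symmetric]) (auto simp: Reph)
 also have "(JC z. of_real (u (fst z) (snd z)) * ph z)=(LINT t:{0<..<2*pi}|lborel. of_real ?V*(cF u m t * e t))"
 proof -
  have "(JO x. of_real (u x t) * ph (x,t)) = of_real ?V*(cF u m t * e t)" for t by (simp add: ph_def mult.assoc[symmetric] coeff_fun_def)
  then show ?thesis unfolding F(2) by simp
 qed
 also have "... = (JT t. of_real ?V*(cF u m t * e t))" by (rule si_open_closed(2)) (auto simp: e_def intro!: bmcI continuous_intros Xcoeff_cont)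
 also have "Re ... = (JT t. Re (of_real ?V*(cF u m t * e t)))"
 proof -
  have "sil {0..2*pi} (%t. of_real ?V*(cF u m t * e t))" by (rule sicb) (auto simp: e_def intro!: continuous_intros Xcoeff_cont)
  then show ?thesis unfolding sli sid by (subst integral_Re[symmetric]) auto
 qed
 also have "... = (JT t. ?V*(Re (cF u m t) * cos (of_int l * t+c)+Im (cF u m t) * sin (of_int l * t+c)))"
 proof -
  have e2: "Re (e t)=cos (of_int l * t+c)" "Im (e t) = - sin (of_int l * t+c)" for t using cos_minus[of "of_int l * t+c"] sin_minus[of "of_int l * t+c"] by (simp_all add: e_def Re_exp Im_exp)
  have "Re (of_real r * w)=r * Re w" for r w by simp
  then show ?thesis by (simp only: e2 complex.sel times_complex.simps) simp
 qed
 finally show ?thesis by simp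
qed

end

text \<open>Passing from \<open>(l, c)\<close> to \<open>(- l, - c)\<close> keeps the cosine term
  and reverses the sine term; sum and difference separate the two, and a phase shift by
  \<open>pi/2\<close> turns the sine into a cosine.\<close>

lemma modes_vanish:
 fixes D1 D2 :: "int => real => real"
 assumes c: "!!l. cts (D1 l)" "!!l. cts (D2 l)" and e: "!!l. D1 (- l)=D1 l" "!!l. D2 (- l)=D2 l"
  and z: "!!l c. (JT t. D1 l t * cos (of_int l * t+c)+D2 l t * sin (of_int l * t+c))=0"
 shows "(JT t. D1 l t * cos (of_int l * t+c))=0" "(JT t. D2 l t * cos (of_int l * t+c))=0"
proof -
 have i: "sil {0..2*pi} f" if "cts f" for f :: "real => real" by (rule sicb[OF that]) auto
 define C where "C c=(JT t. D1 l t * cos (of_int l * t+c))" for c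
 define S where "S c=(JT t. D2 l t * sin (of_int l * t+c))" for c
 have i1: "sil {0..2*pi} (%t. D1 l t * cos (of_int l * t+c))" for c by (intro i continuous_intros assms)
 have i2: "sil {0..2*pi} (%t. D2 l t * sin (of_int l * t+c))" for c by (intro i continuous_intros assms)
 have p: "C c+S c=0" for c using z[of l c] unfolding C_def S_def set_integral_add(2)[OF i1 i2] .
 have m: "C c-S c=0" for c
 proof -
  have "cos (of_int (- l) * t + - c)=cos (of_int l * t+c)" "sin (of_int (- l) * t + - c) = - sin (of_int l * t+c)" for t using cos_minus[of "of_int l * t+c"] sin_minus[of "of_int l * t+c"] by (simp_all add: algebra_simps)
  then show ?thesis using z[of "- l" "- c"] unfolding C_def S_def e set_integral_diff(2)[OF i1 i2, symmetric] by simp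
 qed
 have CS: "C c=0" "S c=0" for c using p[of c] m[of c] by auto
 show "(JT t. D1 l t * cos (of_int l * t+c))=0" using CS(1) by (simp add: C_def)
 have "sin (x+(c+pi/2))=cos (x+c)" for x using sin_add[of "x+c" "pi/2"] by (simp add: add.assoc)
 then show "(JT t. D2 l t * cos (of_int l * t+c))=0" using CS(2)[of "c+pi/2"] by (simp add: S_def)
qed

lemma periodic_antiderivative:
 fixes y :: "real => real"
 assumes c: "cts y" and p: "!!t. y (t+2 * pi)=y t" and z: "(JT t. y t)=0"
 obtains W where "!!t. (W hrd y t) (at t)" "!!t. W (t+2 * pi)=W t" "(JT t. W t)=0" "cts W"
proof -
 have "\<exists>F. \<forall>x. (-\<infinity> :: ereal)<ereal x-->ereal x < \<infinity> --> (F hvd y x) (at x)" by (rule einterval_antiderivative) (use c in \<open>auto simp: continuous_on_eq_continuous_at\<close>)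
 then obtain F where F: "(F hrd y x) (at x)" for x by (auto simp: hrv)
 have Fc: "cts F" using F DERIV_isCont by (auto simp: continuous_on_eq_continuous_at)
 have dd: "\<forall>x. ((%t. F (t+2 * pi)-F t) hrd 0) (at x)"
 proof
  fix x
  have "((%t. F (t+2 * pi)) hrd y (x+2 * pi)) (at x)" using F[of "x+2 * pi"] by (simp add: DERIV_shift)
  from DERIV_diff[OF this F[of x]] show "((%t. F (t+2 * pi)-F t) hrd 0) (at x)" by (simp add: p)
 qed
 have "F (t+2 * pi)-F t=F (2 * pi)-F 0" for t using DERIV_isconst_all[OF dd, of t 0] by simp
 moreover have "F (2 * pi)-F 0=0" using set_integral_FTC[OF _ F c, of 0 "2*pi"] z by simp
 ultimately have Fp: "F (t+2 * pi)=F t" for t by (simp add: algebra_simps)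
 define ka where "ka=(JT t. F t)/(2 * pi)"
 show ?thesis
 proof (rule that[of "%t. F t-ka"])
  show "((%t. F t-ka) hrd y t) (at t)" for t using F by (auto intro!: derivative_eq_intros)
  have i: "sil {0..2*pi} F" "sil {0..2*pi} (%t. ka)" by (intro sicb Fc; simp)+
  have "(JT t. ka)=2 * pi * ka" by (rule si_const)
  then show "(JT t. F t-ka)=0" unfolding set_integral_diff(2)[OF i] by (simp add: ka_def)
  show "F (t+2 * pi)-ka=F t-ka" for t by (simp add: Fp)
  show "cts (%t. F t-ka)" by (intro continuous_intros Fc)
 qed
qed

lemma periodic_second_antiderivative:
 fixes y :: "real => real"
 assumes c: "cts y" and p: "!!t. y (t+2 * pi)=y t" and z: "(JT t. y t)=0"
 obtains W W' where "!!t. (W hrd W' t) (at t)" "!!t. (W' hrd y t) (at t)"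
  "!!t. W (t+2 * pi)=W t" "!!t. W' (t+2 * pi)=W' t" "(JT t. W t)=0" "cts W" "cts W'"
proof -
 obtain W' where W': "!!t. (W' hrd y t) (at t)" "!!t. W' (t+2 * pi)=W' t" "(JT t. W' t)=0" "cts W'" by (rule periodic_antiderivative[OF assms]) blast
 obtain W where W: "!!t. (W hrd W' t) (at t)" "!!t. W (t+2 * pi)=W t" "(JT t. W t)=0" "cts W" by (rule periodic_antiderivative[OF W'(4,2,3)]) blast
 show ?thesis by (rule that[OF W(1) W'(1) W(2) W'(2) W(3,4) W'(4)])
qed

text \<open>A periodic \<open>W\<close> with second derivative \<open>y\<close> is built beforehand.
  The difference of \<open>U\<close> and \<open>W\<close>, less a constant, is orthogonal to all
  cosines: for nonzero frequency by integration by parts, for frequency 0 by the choice of the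
  constant. Hence it vanishes and \<open>U\<close> inherits two classical derivatives.\<close>

lemma weak_second_derivative:
 fixes y U :: "real => real"
 assumes c: "cts y" "cts U" and p: "!!t. y (t+2 * pi)=y t" "!!t. U (t+2 * pi)=U t"
  and z: "!!(l::int) c. (JT t. (y t+(of_int l)^2 * U t) * cos (of_int l * t+c))=0"
 obtains w where "!!t. (U hrd w t) (at t)" "!!t. (w hrd y t) (at t)"
proof -
 have i: "sil {0..2*pi} f" if "cts f" for f :: "real => real" by (rule sicb[OF that]) auto
 have "(JT t. y t)=0" using z[of 0 0] by simp
 then obtain W W' where W: "!!t. (W hrd W' t) (at t)" "!!t. (W' hrd y t) (at t)"
  "!!t. W (t+2 * pi)=W t" "!!t. W' (t+2 * pi)=W' t" "cts W" "cts W'" by (rule periodic_second_antiderivative[OF c(1) p(1)]) blast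
 define ka where "ka=(JT t. U t-W t)/(2 * pi)"
 define D where "D t=U t-W t-ka" for t
 have kc: "sil {0..2*pi} (%t. ka)" by (rule i) simp
 have UW: "cts (%t. U t-W t)" by (intro continuous_intros c W)
 have D0: "(JT t. D t)=0"
 proof -
  have "(JT t. ka)=2 * pi * ka" by (rule si_const)
  then show ?thesis unfolding D_def set_integral_diff(2)[OF i[OF UW] kc] by (simp add: ka_def)
 qed
 have "D t=0" for t
 proof (rule fourier_uniqueness[of D])
  show "cts D" unfolding D_def[abs_def] by (intro continuous_intros c W)
  show "D (t+2 * pi)=D t" for t by (simp add: D_def p W)
  fix l :: int and e :: real
  show "(JT t. D t * cos (of_int l * t+e))=0"
  proof (cases "l=0")
   case True
   then show ?thesis using D0 by simp
  next
   case False
   have per: "cos (of_int l*(2 * pi)+e)=cos e" "sin (of_int l*(2 * pi)+e)=sin e" using periodic_int_shift[where w = cos, OF cos_periodic, of e l] periodic_int_shift[where w = sin, OF sin_periodic, of e l] by (simp_all add: mult_ac add.commute)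
   have FTC: "(JT t. y t * cos (of_int l * t+e)+(of_int l)^2*(W t+ka) * cos (of_int l * t+e))=0"
   proof -
    let ?H = "%t. W' t * cos (of_int l * t+e) + of_int l*(W t+ka) * sin (of_int l * t+e)"
    have "(JT t. y t * cos (of_int l * t+e)+(of_int l)^2*(W t+ka) * cos (of_int l * t+e)) = ?H (2 * pi) - ?H 0"
    proof (rule set_integral_FTC)
     show "(?H hrd y t * cos (of_int l * t+e)+(of_int l)^2*(W t+ka) * cos (of_int l * t+e)) (at t)" for t by (rule derivative_eq_intros W refl | simp add: algebra_simps power2_eq_square)+
     show "cts (%t. y t * cos (of_int l * t+e)+(of_int l)^2*(W t+ka) * cos (of_int l * t+e))" by (intro continuous_intros c W)
    qed simp
    also have "... = 0" using per W(3)[of 0] W(4)[of 0] by (simp add: mult.commute)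
    finally show ?thesis .
   qed
   have i1: "sil {0..2*pi} (%t. (y t+(of_int l)^2 * U t) * cos (of_int l * t+e))" by (intro i continuous_intros c W)
   have i2: "sil {0..2*pi} (%t. y t * cos (of_int l * t+e)+(of_int l)^2*(W t+ka) * cos (of_int l * t+e))" by (intro i continuous_intros c W)
   have "(JT t. (of_int l)^2*(D t * cos (of_int l * t+e)))=0" using set_integral_diff(2)[OF i1 i2] FTC z[of l e] by (simp add: D_def algebra_simps)
   then show ?thesis using False by simp
  qed
 qed
 then have U: "U=(%t. W t+ka)" by (auto simp: D_def algebra_simps)
 show ?thesis by (rule that[of W']) (auto simp: U intro!: derivative_eq_intros W)
qed

text \<open>Waves of one spatial frequency and all time frequencies test the difference of the two
  sides as a function of time, and \<open>fourier_uniqueness\<close> applies to its real and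
  imaginary parts.\<close>

lemma weak_laplacian_coeff:
 fixes u v :: "real^'d => real => real"
 assumes u: "u\<in>X_space sg s" and v: "v\<in>X_space sg s'" and sg: "sg>=0" and s: "s>=0" "s'>=0" and w: "weak_laplacian u v"
 shows "cF v m t = - of_real ((nv m)^2) * cF u m t"
proof -
 define D where "D t=cF v m t + of_real ((nv m)^2) * cF u m t" for t
 have cD: "cts D" unfolding D_def[abs_def] by (intro continuous_intros Xcoeff_cont[OF u sg s(1)] Xcoeff_cont[OF v sg s(2)])
 have pD: "D (t+2 * pi)=D t" for t by (simp add: D_def Xcoeff_per[OF u sg s(1)] Xcoeff_per[OF v sg s(2)])
 have i: "sil {0..2*pi} f" if "cts f" for f :: "real => real" by (rule sicb[OF that]) auto
 have z: "(JT t. Re (D t) * cos (of_int l * t+c)+Im (D t) * sin (of_int l * t+c))=0" for l c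
 proof -
  define T where "T h=(JT t. Re (h t) * cos (of_int l * t+c)+Im (h t) * sin (of_int l * t+c))" for h
  have "(JC z. v (fst z) (snd z) * wave m l c z)=(JC z. u (fst z) (snd z)*(- ((nv m)^2 * wave m l c z)))" using w wave_test_fun[of m l c] unfolding weak_laplacian_def by (simp add: wave_derivatives)
  also have "... = - (nv m)\<^sup>2*(JC z. u (fst z) (snd z) * wave m l c z)" unfolding set_integral_mult_right[symmetric] by (simp add: mult_ac)
  finally have "(2 * pi) ^ CARD('d)*(T (cF v m)+(nv m)^2 * T (cF u m))=0" unfolding cell_wave_integral[OF u sg s(1)] cell_wave_integral[OF v sg s(2)] T_def[symmetric] by (simp add: algebra_simps)
  then have e: "T (cF v m)+(nv m)^2 * T (cF u m)=0" by simp
  have "T D=(JT t. (Re (cF v m t) * cos (of_int l * t+c)+Im (cF v m t) * sin (of_int l * t+c))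
        + (nv m)^2*(Re (cF u m t) * cos (of_int l * t+c)+Im (cF u m t) * sin (of_int l * t+c)))" unfolding T_def by (intro arg_cong[where f = "set_lebesgue_integral lborel {0..2*pi}"] ext) (simp add: D_def algebra_simps)
  also have "... = T (cF v m)+(nv m)^2 * T (cF u m)" unfolding T_def set_integral_mult_right[symmetric] by (rule set_integral_add(2)) (intro i continuous_intros Xcoeff_cont[OF u sg s(1)] Xcoeff_cont[OF v sg s(2)])+
  finally have "T D=T (cF v m)+(nv m)^2 * T (cF u m)" .
  with e show ?thesis unfolding T_def by simp
 qed
 note M = modes_vanish[where ?D1.0 = "%_ t. Re (D t)" and ?D2.0 = "%_ t. Im (D t)", OF _ _ refl refl z]
 have "Re (D t)=0" by (rule fourier_uniqueness[of "%t. Re (D t)"]) (auto intro!: continuous_intros cD M simp: pD)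
 moreover have "Im (D t)=0" by (rule fourier_uniqueness[of "%t. Im (D t)"]) (auto intro!: continuous_intros cD M simp: pD)
 ultimately have "D t=0" by (simp add: complex_eq_iff)
 then show ?thesis by (simp add: D_def add_eq_0_iff2)
qed

text \<open>Gives classical derivatives for the modes of an arbitrary solution, so that in the
  uniqueness proof every competitor consists of genuine solutions of Hill's equation.\<close>

lemma weak_tt_coeff:
 fixes u v :: "real^'d => real => real"
 assumes u: "u\<in>X_space sg s" and v: "v\<in>X_space sg s'" and sg: "sg>=0" and s: "s>=0" "s'>=0" and w: "weak_tt u v"
 shows "\<exists>w. \<forall>t. ((%t. Re (cF u m t)) hrd w t) (at t)&(w hrd Re (cF v m t)) (at t)"
  "\<exists>w. \<forall>t. ((%t. Im (cF u m t)) hrd w t) (at t)&(w hrd Im (cF v m t)) (at t)"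
proof -
 note cont = Xcoeff_cont[OF u sg s(1)] Xcoeff_cont[OF v sg s(2)]
 note per = Xcoeff_per[OF u sg s(1)] Xcoeff_per[OF v sg s(2)]
 define D where "D l t=cF v m t + of_real ((of_int l)^2) * cF u m t" for l :: int and t
 have cD: "cts (D l)" for l unfolding D_def[abs_def] by (intro continuous_intros cont)
 have i: "sil {0..2*pi} f" if "cts f" for f :: "real => real" by (rule sicb[OF that]) auto
 have z: "(JT t. Re (D l t) * cos (of_int l * t+c)+Im (D l t) * sin (of_int l * t+c))=0" for l c
 proof -
  define T where "T h=(JT t. Re (h t) * cos (of_int l * t+c)+Im (h t) * sin (of_int l * t+c))" for h
  have "(JC z. v (fst z) (snd z) * wave m l c z)=(JC z. u (fst z) (snd z)*(- ((of_int l)^2 * wave m l c z)))" using w wave_test_fun[of m l c] unfolding weak_tt_def by (simp add: wave_derivatives)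
  also have "... = - (of_int l)\<^sup>2*(JC z. u (fst z) (snd z) * wave m l c z)" unfolding set_integral_mult_right[symmetric] by (simp add: mult_ac)
  finally have "(2 * pi) ^ CARD('d)*(T (cF v m)+(of_int l)^2 * T (cF u m))=0" unfolding cell_wave_integral[OF u sg s(1)] cell_wave_integral[OF v sg s(2)] T_def[symmetric] by (simp add: algebra_simps)
  then have e: "T (cF v m)+(of_int l)^2 * T (cF u m)=0" by simp
  have "T (D l)=(JT t. (Re (cF v m t) * cos (of_int l * t+c)+Im (cF v m t) * sin (of_int l * t+c))
        + (of_int l)^2*(Re (cF u m t) * cos (of_int l * t+c)+Im (cF u m t) * sin (of_int l * t+c)))" unfolding T_def by (intro arg_cong[where f = "set_lebesgue_integral lborel {0..2*pi}"] ext) (simp add: D_def algebra_simps)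
  also have "... = T (cF v m)+(of_int l)^2 * T (cF u m)" unfolding T_def set_integral_mult_right[symmetric] by (rule set_integral_add(2)) (intro i continuous_intros cont)+
  finally have "T (D l)=T (cF v m)+(of_int l)^2 * T (cF u m)" .
  with e show ?thesis unfolding T_def by simp
 qed
 have A: "cts (%t. Re (D l t))" "cts (%t. Im (D l t))" for l by (intro continuous_intros cD)+
 have E: "(%t. Re (D (- l) t))=(%t. Re (D l t))" "(%t. Im (D (- l) t))=(%t. Im (D l t))" for l by (simp_all add: D_def)
 note M = modes_vanish[where ?D1.0 = "%l t. Re (D l t)" and ?D2.0 = "%l t. Im (D l t)", OF A E z]
 show "\<exists>w. \<forall>t. ((%t. Re (cF u m t)) hrd w t) (at t)&(w hrd Re (cF v m t)) (at t)"
 proof (rule weak_second_derivative[of "%t. Re (cF v m t)" "%t. Re (cF u m t)"])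
  show "(JT t. (Re (cF v m t)+(of_int l)^2 * Re (cF u m t)) * cos (of_int l * t+c))=0" for l :: int and c using M(1)[of l c] by (simp add: D_def)
 qed (intro continuous_intros cont | simp only: per | blast)+
 show "\<exists>w. \<forall>t. ((%t. Im (cF u m t)) hrd w t) (at t)&(w hrd Im (cF v m t)) (at t)"
 proof (rule weak_second_derivative[of "%t. Im (cF v m t)" "%t. Im (cF u m t)"])
  show "(JT t. (Im (cF v m t)+(of_int l)^2 * Im (cF u m t)) * cos (of_int l * t+c))=0" for l :: int and c using M(2)[of l c] by (simp add: D_def)
 qed (intro continuous_intros cont | simp only: per | blast)+
qed

section \<open>Verification of weak derivatives mode by mode\<close>

lemma smoothD:
 assumes "smooth ph"
 shows "ph differentiable (at z)" "b\<in>Basis==>smooth (dderiv b ph)" "cts ph"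
proof -
 show d: "ph differentiable (at z)" for z using assms by (cases rule: smooth.cases) auto
 show "b\<in>Basis==>smooth (dderiv b ph)" using assms by (cases rule: smooth.cases) auto
 show "cts ph" using d differentiable_imp_continuous_within by (auto simp: continuous_on_eq_continuous_at)
qed

lemma smooth_line_derivative:
 assumes "smooth ph"
 shows "((%h. ph (z+h *\<^sub>R b)) hrd dderiv b ph z) (at 0)"
proof -
 have F: "(ph has_derivative frechet_derivative ph (at z)) (at (z+0 *\<^sub>R b))" using smoothD(1)[OF assms, of z] by (simp add: frechet_derivative_works[symmetric])
 have "((%h. ph (z+h *\<^sub>R b)) has_derivative (%h. frechet_derivative ph (at z) (h *\<^sub>R b))) (at 0)" by (rule has_derivative_compose[where f = "%h. z+h *\<^sub>R b" and g = ph, OF _ F]) (auto intro!: derivative_eq_intros)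
 moreover have "linear (frechet_derivative ph (at z))" using smoothD(1)[OF assms] by (rule linear_frechet_derivative)
 ultimately show ?thesis unfolding has_field_derivative_def dderiv_def by (simp add: linear_cmul mult_commute_abs)
qed

lemma dderiv_periodic:
 assumes s: "smooth ph" and p: "!!z. ph (z+p)=ph z"
 shows "dderiv b ph (z+p)=dderiv b ph z"
proof -
 have F: "(ph has_derivative frechet_derivative ph (at (z+p))) (at (z+p))" using smoothD(1)[OF s, of "z+p"] by (simp add: frechet_derivative_works[symmetric])
 have "((%y. ph (y+p)) has_derivative (%h. frechet_derivative ph (at (z+p)) h)) (at z)" by (rule has_derivative_compose[where f = "%y. y+p" and g = ph, OF _ F]) (auto intro!: derivative_eq_intros)
 then have "(ph has_derivative frechet_derivative ph (at (z+p))) (at z)" by (simp add: p)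
 from frechet_derivative_at[OF this] show ?thesis by (simp add: dderiv_def)
qed

text \<open>The difference of the integrands is the derivative in direction \<open>b\<close> of the
  periodic function \<open>e1 * ph - e * dderiv b ph\<close>, so both integrations by parts are done
  in one step.\<close>

lemma cell_integration_by_parts:
 fixes e e1 e2 :: "(real^'d)\<times>real => complex"
 assumes b: "b\<in>Basis" and s: "smooth ph" and p: "!!z. ph (z+(2 * pi) *\<^sub>R b)=ph z"
  and c: "cts e" "cts e2"
  and pe: "!!z. e (z+(2 * pi) *\<^sub>R b)=e z" "!!z. e1 (z+(2 * pi) *\<^sub>R b)=e1 z" "!!z. e2 (z+(2 * pi) *\<^sub>R b)=e2 z"
  and d: "!!z. ((%h. e (z+h *\<^sub>R b)) hvd e1 z) (at 0)" "!!z. ((%h. e1 (z+h *\<^sub>R b)) hvd e2 z) (at 0)"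
 shows "(JC z. e2 z * of_real (ph z))=(JC z. e z * of_real (dderiv b (dderiv b ph) z))"
proof -
 note s1 = smoothD(2)[OF s b]
 note s2 = smoothD(2)[OF s1 b]
 note p1 = dderiv_periodic[OF s p]
 note p2 = dderiv_periodic[OF s1 p1]
 have c2: "cts (%z. e2 z * of_real (ph z))" "cts (%z. e z * cor (dderiv b (dderiv b ph) z))" by (intro continuous_intros c smoothD(3) s s2)+
 have l: "((%h. cor (f (z+h *\<^sub>R b))) hvd of_real (dderiv b f z)) (at 0)" if "smooth f" for f z using smooth_line_derivative[OF that, of z b] by (intro has_vector_derivative_of_real) (simp add: hrv)
 have "(LINT z:torus_box|lborel. e2 z * of_real (ph z)-e z * of_real (dderiv b (dderiv b ph) z))=0"
 proof (rule torus_integral_derivative[OF b])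
  show "cts (%z. e2 z * of_real (ph z)-e z * of_real (dderiv b (dderiv b ph) z))" by (intro continuous_on_diff c2)
  show "e2 (z+(2 * pi) *\<^sub>R b) * of_real (ph (z+(2 * pi) *\<^sub>R b))-e (z+(2 * pi) *\<^sub>R b) * of_real (dderiv b (dderiv b ph) (z+(2 * pi) *\<^sub>R b))=e2 z * of_real (ph z)-e z * of_real (dderiv b (dderiv b ph) z)" for z by (simp only: p p2 pe)
  show "e1 (z+(2 * pi) *\<^sub>R b) * of_real (ph (z+(2 * pi) *\<^sub>R b))-e (z+(2 * pi) *\<^sub>R b) * of_real (dderiv b ph (z+(2 * pi) *\<^sub>R b))=e1 z * of_real (ph z)-e z * of_real (dderiv b ph z)" for z by (simp only: p p1 pe)
  show "((%h. e1 (z+h *\<^sub>R b) * of_real (ph (z+h *\<^sub>R b))-e (z+h *\<^sub>R b) * of_real (dderiv b ph (z+h *\<^sub>R b))) hvd e2 z * of_real (ph z)-e z * of_real (dderiv b (dderiv b ph) z)) (at 0)" for z using has_vector_derivative_diff[OF has_vector_derivative_mult[OF d(2)[of z] l[OF s, of z]] has_vector_derivative_mult[OF d(1)[of z] l[OF s1, of z]]] by (simp add: algebra_simps)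
 qed
 then have "(JC z. e2 z * of_real (ph z)-e z * of_real (dderiv b (dderiv b ph) z))=0" unfolding cell_eq by (subst set_integral_torus_box) (auto intro!: bmcI continuous_on_diff c2)
 moreover have i: "sil cell f" if "cts f" for f :: "(real^'d)\<times>real => complex" by (rule sicb[OF that]) (auto simp: cell_eq)
 ultimately show ?thesis using set_integral_diff(2)[OF i[OF c2(1)] i[OF c2(2)]] by simp
qed

text \<open>Two nets of partial sums that agree mode by mode have the same limit; the weak
  identities are thereby reduced to single characters.\<close>

lemma cell_pairing_eqI:
 fixes u v :: "real^'d => real => real" and ph ps :: "(real^'d)\<times>real => real"
 assumes u: "u\<in>X_space sg s" and v: "v\<in>X_space sg s'" and sg: "sg>=0" and s: "s>=0" "s'>=0"
  and c: "cts ph" "cts ps"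
  and eq: "!!m. (JC z. cF v m (snd z) * char_fun m (fst z) * of_real (ph z))=(JC z. cF u m (snd z) * char_fun m (fst z) * of_real (ps z))"
 shows "(JC z. v (fst z) (snd z) * ph z)=(JC z. u (fst z) (snd z) * ps z)"
proof -
 have c': "cts (%z. cor (ph z))" "cts (%z. cor (ps z))" by (intro continuous_intros c)+
 have "(JC z. cor (v (fst z) (snd z)) * of_real (ph z))=(JC z. cor (u (fst z) (snd z)) * of_real (ps z))" by (rule tendsto_unique[OF finite_subsets_at_top_neq_bot cell_pairing_limit[OF v sg s(2) c'(1)] cell_pairing_limit[OF u sg s(1) c'(2), folded eq]])
 then have "cor (JC z. v (fst z) (snd z) * ph z) = of_real (JC z. u (fst z) (snd z) * ps z)" unfolding sli integral_complex_of_real[symmetric] by (simp add: scaleR_conv_of_real)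
 then show ?thesis unfolding of_real_eq_iff .
qed

lemma test_funD:
 assumes "test_fun ph"
 shows "smooth ph" "ph (z+(2 * pi) *\<^sub>R (axis j 1,0))=ph z" "ph (z+(2 * pi) *\<^sub>R (0,1))=ph z"
proof -
 show "smooth ph" using assms by (simp add: test_fun_def)
 have p: "ph (x+(2 * pi) *\<^sub>R rvec m,t+2 * pi * of_int k)=ph (x,t)" for x t m k using assms by (simp add: test_fun_def)
 show "ph (z+(2 * pi) *\<^sub>R (axis j 1,0))=ph z" using p[of "fst z" "axis j 1" "snd z" 0] by (simp add: axis_rvec[symmetric] plus_prod_def)
 show "ph (z+(2 * pi) *\<^sub>R (0,1))=ph z" using p[of "fst z" 0 "snd z" 1] by (simp add: rvec_simps plus_prod_def)
qed

lemma weak_ttI: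
 fixes u v :: "real^'d => real => real"
 assumes u: "u\<in>X_space sg s" and v: "v\<in>X_space sg s'" and sg: "sg>=0" and s: "s>=0" "s'>=0"
  and d: "!!m t. (cF u m hvd w m t) (at t)" "!!m t. (w m hvd cF v m t) (at t)"
  and p: "!!m t. w m (t+2 * pi)=w m t"
 shows "weak_tt u v" unfolding weak_tt_def
proof (intro allI impI)
 fix ph :: "(real^'d)\<times>real => real" assume t: "test_fun ph"
 let ?b = "(0,1) :: (real^'d)\<times>real"
 have b: "?b\<in>Basis" by (simp add: Basis_prod_def)
 note sm = smoothD(2)[OF smoothD(2)[OF test_funD(1)[OF t] b] b]
 show "(JC z. v (fst z) (snd z) * ph z)=(JC z. u (fst z) (snd z) * dderiv (0,1) (dderiv (0,1) ph) z)"
 proof (rule cell_pairing_eqI[OF u v sg s smoothD(3)[OF test_funD(1)[OF t]] smoothD(3)[OF sm]])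
  fix m
  have shift: "(f hvd f') (at r)==>((%h. f (r+h)) hvd f') (at 0)" for f :: "real => complex" and f' r unfolding has_vector_derivative_def by (rule has_derivative_compose[where f = "%h. r+h" and f' = "%h. h" and g = f]) (auto intro!: derivative_eq_intros)
  have line: "((%h. f (snd (z+h *\<^sub>R ?b)) * char_fun m (fst (z+h *\<^sub>R ?b))) hvd f' (snd z) * char_fun m (fst z)) (at 0)"
   if "!!t. (f hvd f' t) (at t)" for f f' z using has_vector_derivative_mult_left[OF shift[OF that[of "snd z"]], of "char_fun m (fst z)"] by simp
  show "(JC z. cF v m (snd z) * char_fun m (fst z) * of_real (ph z))=(JC z. cF u m (snd z) * char_fun m (fst z) * of_real (dderiv ?b (dderiv ?b ph) z))" by (rule cell_integration_by_parts[where ?e1.0 = "%z. w m (snd z) * char_fun m (fst z)", OF b test_funD(1)[OF t] test_funD(3)[OF t] coeff_char_cont[OF u sg s(1)] coeff_char_cont[OF v sg s(2)] _ _ _ line[OF d(1)] line[OF d(2)]])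
     (simp_all add: p Xcoeff_per[OF u sg s(1)] Xcoeff_per[OF v sg s(2)])
 qed
qed

lemma weak_laplacianI:
 fixes u v :: "real^'d => real => real"
 assumes u: "u\<in>X_space sg s" and v: "v\<in>X_space sg s'" and sg: "sg>=0" and s: "s>=0" "s'>=0"
  and c: "!!m t. cF v m t = - of_real ((nv m)^2) * cF u m t"
 shows "weak_laplacian u v" unfolding weak_laplacian_def
proof (intro allI impI)
 fix ph :: "(real^'d)\<times>real => real" assume t: "test_fun ph"
 let ?b = "%j. (axis j 1,0) :: (real^'d)\<times>real"
 have b: "?b j\<in>Basis" for j by (auto simp: Basis_prod_def axis_in_Basis_iff)
 note sm = smoothD(2)[OF smoothD(2)[OF test_funD(1)[OF t] b] b]
 have cs: "cts (dderiv (?b j) (dderiv (?b j) ph))" for j by (rule smoothD(3)[OF sm])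
 show "(JC z. v (fst z) (snd z) * ph z)=(JC z. u (fst z) (snd z)*(\<Sum>j\<in>UNIV. dderiv (axis j 1,0) (dderiv (axis j 1,0) ph) z))"
 proof (rule cell_pairing_eqI[OF u v sg s smoothD(3)[OF test_funD(1)[OF t]]])
  show "cts (%z. \<Sum>j\<in>UNIV. dderiv (axis j 1,0) (dderiv (axis j 1,0) ph) z)" by (intro continuous_intros cs)
  fix m :: "int^'d"
  define e where "e z=cF u m (snd z) * char_fun m (fst z)" for z
  have ec: "cts e" unfolding e_def[abs_def] by (rule coeff_char_cont[OF u sg s(1)])
  have i: "sil cell f" if "cts f" for f :: "(real^'d)\<times>real => complex" by (rule sicb[OF that]) (auto simp: cell_eq)
  have ep: "e (z+(2 * pi) *\<^sub>R ?b j)=e z" for z j using char_fun_periodic[of m "fst z" "axis j 1"] by (simp add: e_def axis_rvec[symmetric])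
  have line: "((%h. k * e (z+h *\<^sub>R ?b j)) hvd (k*(\<i> * of_int (m $ j))) * e z) (at 0)" for k z j using has_vector_derivative_mult_right[OF char_fun_derivative[of m "fst z" j], of "k * cF u m (snd z)"] by (simp add: e_def mult_ac)
  have bp: "(JC z. (\<i> * of_int (m $ j)*(\<i> * of_int (m $ j))) * e z * of_real (ph z))=(JC z. e z * of_real (dderiv (?b j) (dderiv (?b j) ph) z))" for j
  proof (rule cell_integration_by_parts[where ?e1.0 = "%z. \<i> * of_int (m $ j) * e z", OF b test_funD(1)[OF t] test_funD(2)[OF t] ec])
   show "cts (%z. \<i> * of_int (m $ j)*(\<i> * of_int (m $ j)) * e z)" by (intro continuous_intros ec)
   show "e (z+(2 * pi) *\<^sub>R ?b j)=e z" for z by (rule ep)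
   show "\<i> * of_int (m $ j) * e (z+(2 * pi) *\<^sub>R ?b j) = \<i> * of_int (m $ j) * e z" for z by (simp only: ep)
   show "\<i> * of_int (m $ j)*(\<i> * of_int (m $ j)) * e (z+(2 * pi) *\<^sub>R ?b j) = \<i> * of_int (m $ j)*(\<i> * of_int (m $ j)) * e z" for z by (simp only: ep)
   show "((%h. e (z+h *\<^sub>R ?b j)) hvd \<i> * of_int (m $ j) * e z) (at 0)" for z using line[of 1 z j] by (simp only: mult_1)
   show "((%h. \<i> * of_int (m $ j) * e (z+h *\<^sub>R ?b j)) hvd \<i> * of_int (m $ j)*(\<i> * of_int (m $ j)) * e z) (at 0)" for z by (rule line)
  qed
  have n: "(nv m)^2=(\<Sum>j\<in>UNIV. (of_int (m $ j))^2)" unfolding norm_vec_def L2_set_def by (simp add: sum_nonneg rvec_simps)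
  have "(JC z. cF v m (snd z) * char_fun m (fst z) * of_real (ph z))=(JC z. (\<Sum>j\<in>UNIV. (\<i> * of_int (m $ j)*(\<i> * of_int (m $ j))) * e z * of_real (ph z)))" unfolding c n e_def by (intro arg_cong[where f = "set_lebesgue_integral lborel cell"] ext) (simp add: sum_distrib_left sum_distrib_right sum_negf[symmetric] power2_eq_square mult_ac)
  also have "... = (\<Sum>j\<in>UNIV. JC z. (\<i> * of_int (m $ j)*(\<i> * of_int (m $ j))) * e z * of_real (ph z))" by (rule si_sum_swap) (intro i continuous_intros ec smoothD(3)[OF test_funD(1)[OF t]])
  also have "... = (JC z. (\<Sum>j\<in>UNIV. e z * of_real (dderiv (?b j) (dderiv (?b j) ph) z)))" unfolding bp by (rule si_sum_swap[symmetric]) (intro i continuous_intros ec cs)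
  finally show "(JC z. cF v m (snd z) * char_fun m (fst z) * of_real (ph z))=(JC z. cF u m (snd z) * char_fun m (fst z) * of_real (\<Sum>j\<in>UNIV. dderiv (axis j 1,0) (dderiv (axis j 1,0) ph) z))" by (simp add: e_def sum_distrib_left)
 qed
qed

lemma forcing_mono: "forcing M f==>M<=N==>forcing N f" unfolding forcing_def by (meson order_trans)

text \<open>The imaginary part of \<open>v\<close> is the real part of \<open>- \<i> * v\<close>.
  The estimate \<open>H1_lin\<close> used for this product loses at most a factor 2, hence 8 in
  place of 4.\<close>

lemma H1_forcing_Im:
 assumes v: "v\<in>H1"
 shows "forcing (8 * H1_norm v) (%t. Im (v t))"
proof -
 have z: "(%t. 0)\<in>H1" "H1_norm (%t. 0)<=4*0" by (rule H1_of_C1[of "%_. 0" "%_. 0"]; auto intro!: derivative_eq_intros)+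
 then have z0: "H1_norm (%t. 0)=0" using H1_norm_nonneg[of "%t. 0"] by simp
 note L = H1_lin[OF v z(1), of "- \<i>"]
 have "(2 * H1_norm v)^2=4*(H1_norm v)^2" by (simp add: power_mult_distrib)
 moreover have "(H1_norm (%t. - \<i> * v t+0))^2<=2*(H1_norm v)^2" using L(2) by (simp add: z0)
 ultimately have "(H1_norm (%t. - \<i> * v t+0))^2<=(2 * H1_norm v)^2" using zero_le_power2[of "H1_norm v"] by linarith
 then have "H1_norm (%t. - \<i> * v t+0)<=2 * H1_norm v" by (rule power2_le_imp_le) (simp add: H1_norm_nonneg)
 then have "forcing (8 * H1_norm v) (%t. Re (- \<i> * v t+0))" by (intro forcing_mono[OF H1_forcing_Re[OF L(1)]]) simp
 then show ?thesis by simp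
qed

lemma summable_on_pairs:
 fixes F :: "'a\<times>bool => real"
 assumes "(%m. F (m,True)) summable_on S" "(%m. F (m,False)) summable_on S"
 shows "F summable_on {i. fst i\<in>S}" "infsum F {i. fst i\<in>S}=(\<Sum>\<^sub>\<infinity>m\<in>S. F (m,True)+F (m,False))"
proof -
 have e: "{i. fst i\<in>S}=(%m. (m,True)) ` S\<union>(%m. (m,False)) ` S" by (auto simp: image_iff)
 have i: "inj_on (%m. (m,c)) S" for c :: bool by (simp add: inj_on_def)
 have s: "F summable_on (%m. (m,True)) ` S" "F summable_on (%m. (m,False)) ` S" using assms unfolding summable_on_reindex[OF i] by (simp_all add: o_def)
 have d: "(%m. (m,True)) ` S\<inter>(%m. (m,False)) ` S={}" by auto
 show "F summable_on {i. fst i\<in>S}" unfolding e by (rule summable_on_Un_disjoint[OF s d])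
 have "infsum F {i. fst i\<in>S}=(\<Sum>\<^sub>\<infinity>m\<in>S. F (m,True))+(\<Sum>\<^sub>\<infinity>m\<in>S. F (m,False))" unfolding e infsum_Un_disjoint[OF s d] infsum_reindex[OF i] by (simp add: o_def)
 then show "infsum F {i. fst i\<in>S}=(\<Sum>\<^sub>\<infinity>m\<in>S. F (m,True)+F (m,False))" using infsum_add[OF assms] by simp
qed

lemma weight_scale:
 assumes "m~=0"
 shows "(nv m powr a)^2 * weight sg s m=weight sg (s+a) m" using assms by (simp add: weight_def power2_eq_square powr_add[symmetric] algebra_simps)

lemma weight_mono: "s<=s'==>weight sg s m<=weight sg s' m" using norm_rvec_ge_1[of m] by (auto simp: weight_def intro!: powr_mono)

lemma L2_conv_lincomb:
 fixes f h :: "real^'d => complex"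
 assumes f: "L2_conv f c" and h: "L2_conv h e"
 shows "L2_conv (%x. of_real ap * f x + of_real bt * h x) (%m. of_real ap * c m + of_real bt * e m)" unfolding L2_conv_def
proof
 have [measurable]: "f\<in>bM" "h\<in>bM" using f h by (simp_all add: L2_conv_def)
 show "(%x. of_real ap * f x + of_real bt * h x)\<in>bM" by measurable
 define Af where "Af F=(\<integral>\<^sup>+x\<in>Omega. ennreal ((norm (f x-trig_sum c F x))^2) \<partial>lborel)" for F
 define Ah where "Ah F=(\<integral>\<^sup>+x\<in>Omega. ennreal ((norm (h x-trig_sum e F x))^2) \<partial>lborel)" for F
 have "((%F. ennreal (2 * ap^2) * Af F+ennreal (2 * bt^2) * Ah F) \<longlongrightarrow> ennreal (2 * ap^2)*0+ennreal (2 * bt^2)*0) (fsat)" using f h unfolding L2_conv_def Af_def Ah_def by (intro tendsto_add ennreal_tendsto_cmult) auto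
 then have z: "((%F. ennreal (2 * ap^2) * Af F+ennreal (2 * bt^2) * Ah F) \<longlongrightarrow> 0) (fsat)" by simp
 show "((%F. \<integral>\<^sup>+x\<in>Omega. ennreal ((norm (of_real ap * f x + of_real bt * h x-trig_sum (%m. of_real ap * c m + of_real bt * e m) F x))^2) \<partial>lborel) \<longlongrightarrow> 0) (fsat)"
 proof (rule tendsto_sandwich[OF _ _ tendsto_const z])
  have "(\<integral>\<^sup>+x\<in>Omega. ennreal ((norm (of_real ap * f x + of_real bt * h x-trig_sum (%m. of_real ap * c m + of_real bt * e m) F x))^2) \<partial>lborel)<=ennreal (2 * ap^2) * Af F+ennreal (2 * bt^2) * Ah F" for F
  proof -
   define X where "X x=f x-trig_sum c F x" for x
   define Y where "Y x=h x-trig_sum e F x" for x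
   have [measurable]: "X\<in>bM" "Y\<in>bM" unfolding X_def[abs_def] Y_def[abs_def] by measurable
   have eq: "of_real ap * f x + of_real bt * h x-trig_sum (%m. of_real ap * c m + of_real bt * e m) F x = of_real ap * X x + of_real bt * Y x" for x by (simp add: X_def Y_def trig_sum_def algebra_simps sum.distrib sum_distrib_left)
   have pw: "ennreal ((norm (of_real ap * X x + of_real bt * Y x))^2) * indicator Omega x<=ennreal (2 * ap^2)*(ennreal ((norm (X x))^2) * indicator Omega x)+ennreal (2 * bt^2)*(ennreal ((norm (Y x))^2) * indicator Omega x)" for x
   proof -
    have "norm (of_real ap * X x + of_real bt * Y x)<=abs(ap) * norm (X x)+abs(bt) * norm (Y x)" using norm_triangle_ineq[of "of_real ap * X x" "of_real bt * Y x"] by (simp add: norm_mult)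
    then have "(norm (of_real ap * X x + of_real bt * Y x))^2<=(abs(ap) * norm (X x)+abs(bt) * norm (Y x))^2" by (intro power_mono) auto
    also have "... <= 2 * ap^2*(norm (X x))^2+2 * bt^2*(norm (Y x))^2" using zero_le_power2[of "abs(ap) * norm (X x)-abs(bt) * norm (Y x)"] by (simp add: power2_sum power2_diff power_mult_distrib)
    finally have "ennreal ((norm (of_real ap * X x + of_real bt * Y x))^2)<=ennreal (2 * ap^2*(norm (X x))^2+2 * bt^2*(norm (Y x))^2)" by (rule ennreal_leI)
    then show ?thesis by (auto simp: indicator_def ennreal_plus ennreal_mult')
   qed
   show ?thesis unfolding eq Af_def Ah_def X_def[symmetric] Y_def[symmetric] by (rule order_trans[OF nn_integral_mono[OF pw]]) (subst nn_integral_add, auto simp: nn_integral_cmult)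
  qed
  then show "\<forall>\<^sub>F F in fsat. (\<integral>\<^sup>+x\<in>Omega. ennreal ((norm (of_real ap * f x + of_real bt * h x-trig_sum (%m. of_real ap * c m + of_real bt * e m) F x))^2) \<partial>lborel)<=ennreal (2 * ap^2) * Af F+ennreal (2 * bt^2) * Ah F" by simp
 qed simp
qed

text \<open>The delicate point is the pointwise clause. The series of \<open>h\<close> always
  converges and \<open>ap\<close> has no zeros, so convergence of the combined series forces
  convergence of the series of \<open>f\<close>. This serves to define the second time derivative by
  the equation itself.\<close>

lemma X_space_combination:
 fixes f h :: "real^'d => real => real"
 assumes f: "f\<in>X_space sg s" and h: "h\<in>X_space sg s'" and sg: "sg>=0" and s': "real CARD('d)<2 * s'"
  and ap: "cts ap" "!!t. ap (t+2 * pi)=ap t" "!!t. ap t~=0"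
  and H: "!!m. (%t. of_real (ap t) * cF f m t + of_real bt * cF h m t)\<in>H1"
  and summ: "(%m. (H1_norm (%t. of_real (ap t) * cF f m t + of_real bt * cF h m t))^2 * weight sg s'' m) summable_on UNIV"
 defines "w \<equiv> %x t. ap t * f x t+bt * h x t"
 shows "w\<in>X_space sg s''" "cF w m t = of_real (ap t) * cF f m t + of_real bt * cF h m t"
proof -
 have L: "L2_conv (%x. of_real (w x t)) (%m. of_real (ap t) * cF f m t + of_real bt * cF h m t)" for t using L2_conv_lincomb[OF X_space_L2_conv[OF f, of t] X_space_L2_conv[OF h, of t], of "ap t" bt] by (simp add: w_def)
 show coeff: "cF w m t = of_real (ap t) * cF f m t + of_real bt * cF h m t" for m t unfolding coeff_fun_def[of w] L2_conv_coeff[OF L] by simp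
 then have coeff': "cF w m=(%t. of_real (ap t) * cF f m t + of_real bt * cF h m t)" for m by (rule ext)
 show "w\<in>X_space sg s''" unfolding X_space_def mem_Collect_eq
 proof (intro conjI allI)
  have [measurable]: "(%z. f (fst z) (snd z))\<in>bM" "(%z. h (fst z) (snd z))\<in>bM" using f h by (simp_all add: X_space_def)
  have [measurable]: "(%z. ap (snd z))\<in>borel_measurable (borel :: ((real^'d)\<times>real) measure)" by (intro bmcI continuous_on_compose2[OF ap(1)] continuous_intros) auto
  show "(%z. w (fst z) (snd z))\<in>bM" unfolding w_def by measurable
  show "w (x+(2 * pi) *\<^sub>R rvec n) (t+2 * pi * of_int k)=w x t" for x t n k
  proof -
   have "f (x+(2 * pi) *\<^sub>R rvec n) (t+2 * pi * of_int k)=f x t" "h (x+(2 * pi) *\<^sub>R rvec n) (t+2 * pi * of_int k)=h x t" using f h unfolding X_space_def by blast+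
   moreover have "ap (t+2 * pi * of_int k)=ap t" by (rule periodic_int_shift[where w = ap, OF ap(2)])
   ultimately show ?thesis by (simp only: w_def)
  qed
  show "cF w m\<in>H1" for m unfolding coeff' by (rule H)
  show "(%m. (H1_norm (cF w m))^2 * weight sg s'' m) summable_on UNIV" unfolding coeff' by (rule summ)
  show "fourier_sum w" unfolding fourier_sum_def coeff
  proof (intro conjI allI impI)
   show "((%F. \<integral>\<^sup>+x\<in>Omega. ennreal ((norm (of_real (w x t)-(\<Sum>m\<in>F. (of_real (ap t) * cF f m t + of_real bt * cF h m t) * char_fun m x)))^2) \<partial>lborel) \<longlongrightarrow> 0) (fsat)" for t using L[of t] unfolding L2_conv_def trig_sum_def by blast
   fix x t
   assume S: "(%m. (of_real (ap t) * cF f m t + of_real bt * cF h m t) * char_fun m x) summable_on UNIV"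
   note hs = X_space_infsum(2)[OF h sg s', of t x] X_space_infsum(3)[OF h sg s', of x t]
   have S2: "(%m. of_real bt*(cF h m t * char_fun m x)) summable_on UNIV" by (rule summable_on_cmult_right[OF hs(1)])
   have "(%m. (of_real (ap t) * cF f m t + of_real bt * cF h m t) * char_fun m x - of_real bt*(cF h m t * char_fun m x)) summable_on UNIV" by (rule so_diff(1)[OF S S2])
   then have S1: "(%m. of_real (ap t)*(cF f m t * char_fun m x)) summable_on UNIV" by (simp add: algebra_simps)
   then have "(%m. of_real (1/ap t)*(of_real (ap t)*(cF f m t * char_fun m x))) summable_on UNIV" by (rule summable_on_cmult_right)
   then have fs: "(%m. cF f m t * char_fun m x) summable_on UNIV" using ap(3)[of t] by (simp add: mult.assoc[symmetric] of_real_mult[symmetric] del: of_real_mult of_real_divide)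
   then have "of_real (f x t)=(\<Sum>\<^sub>\<infinity>m. cF f m t * char_fun m x)" using f unfolding X_space_def fourier_sum_def by blast
   then have "cor (w x t) = of_real (ap t)*(\<Sum>\<^sub>\<infinity>m. cF f m t * char_fun m x) + of_real bt*(\<Sum>\<^sub>\<infinity>m. cF h m t * char_fun m x)" unfolding w_def of_real_add of_real_mult hs(2)[symmetric] by simp
   also have "... = (\<Sum>\<^sub>\<infinity>m. of_real (ap t)*(cF f m t * char_fun m x) + of_real bt*(cF h m t * char_fun m x))" unfolding infsum_add[OF S1 S2] by (simp add: infsum_cmult_right[OF fs] infsum_cmult_right[OF hs(1)])
   finally show "of_real (w x t)=(\<Sum>\<^sub>\<infinity>m. (of_real (ap t) * cF f m t + of_real bt * cF h m t) * char_fun m x)" by (simp add: algebra_simps)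
  qed
 qed
qed

lemma mean_zero_iff:
 fixes u :: "real^'d => real => real"
 assumes "u\<in>X_space sg s" "sg>=0" "s>=0"
 shows "mean_zero u \<longleftrightarrow> (JT t. Re (cF u 0 t))=0" using cell_wave_integral[OF assms, of 0 0 0] by (simp add: mean_zero_def wave_def rvec_simps)

lemma coeff_fun_0_real: "Im (cF u 0 t)=0" using coeff_fun_cnj[of u 0 t] by (simp add: complex_eq_iff)

section \<open>The Kirchhoff equation\<close>

text \<open>\<open>sz\<close> and \<open>sy\<close> are the smoothness of \<open>g\<close> and of
  the solution. Of the conditions on \<open>ta\<close>, the lower bound makes the excluded measure
  summable, \<open>ta <= sz + 1 - sy\<close> pays for the loss \<open>|m|^(ta-1)\<close> of the
  modes, \<open>3 * ta <= 2 * sz\<close> is the summability in \<open>hill_family\<close>, and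
  \<open>ta <= 2 * sy - 3\<close> serves the uniqueness proof. \<open>W\<close> solves the equation
  of mode 0, where the potential drops out.\<close>

locale kirchhoff =
 fixes g :: "real^'d => real => real" and sg sz sy ta N :: real and W W' :: "real => real"
 assumes sg: "sg>=0" and g: "g\<in>X_space sg sz"
  and ta: "real CARD('d)<ta" "ta<=sz+1-sy" "3 * ta<=2 * sz" "ta<=2 * sy-3"
  and s1: "1+real CARD('d)<sy"
  and W: "!!t. (W hrd W' t) (at t)" "!!t. (W' hrd Re (cF g 0 t)) (at t)"
   "!!t. W (t+2 * pi)=W t" "!!t. W' (t+2 * pi)=W' t" "(JT t. W t)=0"
   "!!t. abs(W t)<=N" "!!t. abs(W' t)<=N"
begin

lemma card_ge_1: "real CARD('d)>=1" using zero_less_card_finite[where 'a = 'd] by simp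

lemma tau_ge_1: "ta>=1" using card_ge_1 ta(1) by (rule order_trans[OF _ less_imp_le])

lemma s0_ge: "sz>=0" "real CARD('d)<2 * sz" "sy-2<=sz" "sy-2>=0" "sy>=0" "real CARD('d)<2*(sy-1)" "real CARD('d)<2 * sy"
proof -
 have A: "d>=1==>1+d<sy==>d<2*(sy-1)" for d :: real by simp
 show "real CARD('d)<2*(sy-1)" by (rule A[OF card_ge_1 s1])
 then show "real CARD('d)<2 * sy" by (rule less_trans) simp
 show "sz>=0" "real CARD('d)<2 * sz" "sy-2<=sz" "sy-2>=0" "sy>=0" using card_ge_1 ta s1 by linarith+
qed

text \<open>Hill's equation is real, so each nonzero mode is split into its real part, marked
  \<open>True\<close>, and its imaginary part, marked \<open>False\<close>.\<close>

definition idx :: "((int^'d)\<times>bool) set" where "idx={i. fst i \<in> - {0}}"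
definition lamb :: "(int^'d)\<times>bool => real" where "lamb i=norm (rvec (fst i))"
definition frc :: "(int^'d)\<times>bool => real => real" where
 "frc i t=(if snd i then Re (cF g (fst i) t) else Im (cF g (fst i) t))"
definition bnd :: "(int^'d)\<times>bool => real" where "bnd i=8 * H1_norm (cF g (fst i))"

abbreviation "G2 m \<equiv> (H1_norm (cF g m))^2 * weight sg sz m"

lemma g_H1: "cF g m\<in>H1" and G2_summable: "G2 summable_on UNIV" using g by (auto simp: X_space_def)

sublocale hill_family idx lamb frc bnd ta
proof
 show "1<=lamb i" if "i\<in>idx" for i using that norm_rvec_ge_1[of "fst i"] by (simp add: idx_def lamb_def)
 show "forcing (bnd i) (frc i)" if "i\<in>idx" for i
 proof (cases "snd i")
  case True
  then have "frc i=(%t. Re (cF g (fst i) t))" by (simp add: frc_def fun_eq_iff)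
  then show ?thesis using forcing_mono[OF H1_forcing_Re[OF g_H1[of "fst i"]], of "bnd i"] H1_norm_nonneg[of "cF g (fst i)"] by (simp add: bnd_def)
 next
  case False
  then have "frc i=(%t. Im (cF g (fst i) t))" by (simp add: frc_def fun_eq_iff)
  then show ?thesis using H1_forcing_Im[OF g_H1[of "fst i"]] by (simp add: bnd_def)
 qed
 show "1<=ta" by (rule tau_ge_1)
 have s: "(%m. nv m powr (3 * ta)*(8 * H1_norm (cF g m))^2) summable_on - {0}"
 proof (rule sob(1))
  show "(%m. 64 * G2 m) summable_on - {0}" by (rule summable_on_subset_banach[OF summable_on_cmult_right[OF G2_summable]]) simp
  fix m :: "int^'d" assume m: "m \<in> - {0}"
  then have n: "nv m>=1" using norm_rvec_ge_1[of m] by simp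
  have "nv m powr (3 * ta)<=nv m powr (2 * sz)" using n ta(3) by (intro powr_mono) auto
  also have "... <= weight sg sz m" using jap_weight[OF sg, of m sz] m by (simp add: jap_nonzero)
  finally have "64*(H1_norm (cF g m))^2 * nv m powr (3 * ta)<=64*(H1_norm (cF g m))^2 * weight sg sz m" by (intro mult_left_mono) auto
  then show "norm (nv m powr (3 * ta)*(8 * H1_norm (cF g m))^2)<=64 * G2 m" by (simp add: power_mult_distrib mult_ac)
 qed
 show "(%i. lamb i powr (3 * ta)*(bnd i)^2) summable_on idx" unfolding idx_def lamb_def bnd_def by (rule summable_on_pairs(1)) (use s in simp_all)
 show "countable idx" by (rule countable_subset[OF subset_UNIV], subst UNIV_Times_UNIV[symmetric], rule countable_SIGMA) (auto intro: countable_lattice countable_finite)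
 have "(%m::int^'d. nv m powr (- ta)) summable_on - {0}" by (rule summable_on_subset_banach[OF lattice_powr_summable[OF ta(1)]]) simp
 then show "(%i. lamb i powr (- ta)) summable_on idx" unfolding idx_def lamb_def by (intro summable_on_pairs(1)) simp_all
qed

definition S :: real where "S=infsum G2 UNIV"
text \<open>Depends on \<open>g\<close> and on the bound \<open>N\<close> for mode 0 alone. The
  constants of a frequency window enter the solution only through \<open>K\<close>, which the
  assumption \<open>small\<close> trades for a multiple of \<open>1/ga\<close>.\<close>

definition C0 :: real where "C0=sqrt (3 * S+4096 * N^2)+1"

lemma S_nonneg: "S>=0" unfolding S_def by (rule infsum_nonneg) (simp add: weight_nonneg)

lemma C0_pos: "C0>0" using S_nonneg by (simp add: C0_def add_nonneg_pos)

lemma N_nonneg: "N>=0" using abs_ge_zero W(6)[of 0] by (rule order_trans)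

section \<open>The solution belonging to a fixed point at which the cut-off is inactive\<close>

context
 fixes b G ow mu ga ka K :: real and p q :: "real \<Rightarrow>\<^sub>C real"
 assumes b: "b>=1" and G: "0<G" "G<=1/2" and ow: "ow>0" and mu: "mu>0" and ga: "0<ga" "ga<1"
  and fp: "fixes_pot b G (1 / ow^2) ((2 * pi) ^ CARD('d) * mu^3*(1 / ow^2)^3) p q"
  and gap: "!!i. i\<in>idx==>gap (lamb i) p>=2 * threshold G i"
  and kappa: "ka=mu / ow^2" and K: "K=fcst b/G" and small: "1024 * b * K * ga<=1"
begin

lemma kappa_pos: "ka>0" using ow mu by (simp add: kappa)

lemma K_nonneg: "K>=0" using fcst_pos[OF b] G by (simp add: K)

lemma G_le_1: "G<=1" using G by simp

lemma pot: "potential b p q" using fp by (simp add: fixes_pot_def)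

lemma p_eq: "p t=1 / ow^2+(2 * pi) ^ CARD('d) * mu^3*(1 / ow^2)^3 * nonlin G p t" using fp by (simp add: fixes_pot_def)

text \<open>The mode before multiplication by \<open>ka = mu / ow^2\<close>, so that the forcing is
  the coefficient of \<open>g\<close> itself. For mode 0 Hill's equation reads
  \<open>v'' = g_0\<close>, and \<open>W\<close> is the periodic solution with mean zero.\<close>

definition vr :: "int^'d => real => real" where "vr m=(if m=0 then W else sol G p (m,True))"
definition vr' :: "int^'d => real => real" where "vr' m=(if m=0 then W' else sol' G p (m,True))"
definition vi :: "int^'d => real => real" where "vi m=(if m=0 then (%_. 0) else sol G p (m,False))"
definition vi' :: "int^'d => real => real" where "vi' m=(if m=0 then (%_. 0) else sol' G p (m,False))"

lemma sol_hill:
 assumes "i\<in>idx"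
 shows "hill_sol (lamb i) p (frc i) (sol G p i) (sol' G p i)" "sol G p i (t+2 * pi)=sol G p i t" "sol' G p i (t+2 * pi)=sol' G p i t"
proof -
 have l: "lamb i>0" using lam[OF assms] by simp
 note e = threshold_bounds[OF assms G(1) G_le_1]
 note P = cut_sol_props[OF b pot l conjunct1[OF e] conjunct2[OF e] forc[OF assms]]
 show "hill_sol (lamb i) p (frc i) (sol G p i) (sol' G p i)" unfolding sol_def sol'_def by (rule P(6)[OF gap[OF assms]])
 show "sol G p i (t+2 * pi)=sol G p i t" "sol' G p i (t+2 * pi)=sol' G p i t" unfolding sol_def sol'_def by (rule P)+
qed

lemma idx_iff: "(m,c)\<in>idx \<longleftrightarrow> m~=0" by (simp add: idx_def)

lemma v_hill: "hill_sol (nv m) p (%t. Re (cF g m t)) (vr m) (vr' m)"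
 "hill_sol (nv m) p (%t. Im (cF g m t)) (vi m) (vi' m)"
proof -
 have f: "frc (m,True)=(%t. Re (cF g m t))" "frc (m,False)=(%t. Im (cF g m t))" by (auto simp: frc_def)
 show "hill_sol (nv m) p (%t. Re (cF g m t)) (vr m) (vr' m)"
 proof (cases "m=0")
  case True
  then show ?thesis using W by (simp add: hill_sol_def vr_def vr'_def rvec_simps)
 next
  case False
  then show ?thesis using sol_hill(1)[of "(m,True)"] by (simp add: vr_def vr'_def f lamb_def idx_iff)
 qed
 show "hill_sol (nv m) p (%t. Im (cF g m t)) (vi m) (vi' m)"
 proof (cases "m=0")
  case True
  then show ?thesis by (simp add: hill_sol_def vi_def vi'_def rvec_simps coeff_fun_0_real)
 next
  case False
  then show ?thesis using sol_hill(1)[of "(m,False)"] by (simp add: vi_def vi'_def f lamb_def idx_iff)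
 qed
qed

lemma v_periodic: "vr m (t+2 * pi)=vr m t" "vi m (t+2 * pi)=vi m t" "vr' m (t+2 * pi)=vr' m t" "vi' m (t+2 * pi)=vi' m t" using sol_hill(2,3)[of "(m,True)" t] sol_hill(2,3)[of "(m,False)" t] W(3,4)[of t] by (auto simp: vr_def vr'_def vi_def vi'_def idx_iff)

definition amp :: "int^'d => real" where
 "amp m=(if m=0 then N else K*(8 * H1_norm (cF g m) * nv m powr (ta-1)))"

lemma v_bounds: "abs(vr m t)<=amp m" "abs(vi m t)<=amp m" "abs(vr' m t)<=amp m" "abs(vi' m t)<=amp m" using sol_bounds(2,3)[OF b G(1) G_le_1 pot, of "(m,True)" t, folded K] sol_bounds(2,3)[OF b G(1) G_le_1 pot, of "(m,False)" t, folded K] W(6,7)[of t] N_nonneg by (auto simp: vr_def vr'_def vi_def vi'_def amp_def idx_iff bnd_def lamb_def)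

lemma amp_nonneg: "amp m>=0" using abs_ge_zero v_bounds(1)[of m 0] by (rule order_trans)

definition mode :: "int^'d => real => complex" where "mode m t = of_real (ka * vr m t) + \<i> * of_real (ka * vi m t)"
definition mode' :: "int^'d => real => complex" where "mode' m t = of_real (ka * vr' m t) + \<i> * of_real (ka * vi' m t)"

lemma complex_derivative:
 assumes "(x hrd x') (at t)" "(y hrd y') (at t)"
 shows "((%t. cor (ka * x t) + \<i> * of_real (ka * y t)) hvd (of_real (ka * x') + \<i> * of_real (ka * y'))) (at t)" by (intro has_vector_derivative_add has_vector_derivative_mult_right has_vector_derivative_of_real)
   (use DERIV_cmult[OF assms(1), of ka] DERIV_cmult[OF assms(2), of ka] in \<open>simp_all add: hrv\<close>)

lemma mode_derivatives:
 "(mode m hvd mode' m t) (at t)"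
 "(mode' m hvd (of_real (p t)*(- of_real ((nv m)^2) * mode m t) + of_real ka * cF g m t)) (at t)"
proof -
 show "(mode m hvd mode' m t) (at t)" unfolding mode_def[abs_def] mode'_def by (rule complex_derivative[OF hill_solD(1)[OF v_hill(1)] hill_solD(1)[OF v_hill(2)]])
 have "(mode' m hvd (of_real (ka*(Re (cF g m t)-(nv m)^2 * p t * vr m t)) + \<i> * of_real (ka*(Im (cF g m t)-(nv m)^2 * p t * vi m t)))) (at t)" unfolding mode'_def[abs_def] by (rule complex_derivative[OF hill_solD(2)[OF v_hill(1)] hill_solD(2)[OF v_hill(2)]])
 moreover have "of_real (ka*(Re (cF g m t)-(nv m)^2 * p t * vr m t)) + \<i> * of_real (ka*(Im (cF g m t)-(nv m)^2 * p t * vi m t))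
      = of_real (p t)*(- of_real ((nv m)^2) * mode m t) + of_real ka * cF g m t" by (simp add: complex_eq_iff mode_def Re_power2 Im_power2 algebra_simps)
 ultimately show "(mode' m hvd (of_real (p t)*(- of_real ((nv m)^2) * mode m t) + of_real ka * cF g m t)) (at t)" by simp
qed

lemma mode_cont: "cts (mode m)" "cts (mode' m)" by (simp_all add: continuous_on_eq_continuous_at has_vector_derivative_continuous[OF mode_derivatives(1)] has_vector_derivative_continuous[OF mode_derivatives(2)])

lemma mode_periodic: "mode m (t+2 * pi)=mode m t" "mode' m (t+2 * pi)=mode' m t" by (simp_all add: mode_def mode'_def v_periodic)

lemma norm_mode: "norm (mode m t)<=2 * ka * amp m" "norm (mode' m t)<=2 * ka * amp m"
proof -
 have k: "norm (cor (ka * x) + \<i> * of_real (ka * y))<=2 * ka * amp m" if "abs(x)<=amp m" "abs(y)<=amp m" for x y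
 proof -
  have "norm (cor (ka * x) + \<i> * of_real (ka * y))<=norm (cor (ka * x))+norm (\<i> * cor (ka * y))" by (rule norm_triangle_ineq)
  also have "... = ka * abs(x)+ka * abs(y)" unfolding norm_mult norm_of_real abs_mult norm_ii using kappa_pos by simp
  also have "... <= ka * amp m+ka * amp m" using kappa_pos that by (intro add_mono mult_left_mono) auto
  finally show ?thesis by simp
 qed
 show "norm (mode m t)<=2 * ka * amp m" unfolding mode_def by (rule k[OF v_bounds(1,2)])
 show "norm (mode' m t)<=2 * ka * amp m" unfolding mode'_def by (rule k[OF v_bounds(3,4)])
qed

lemma mode_H1: "mode m\<in>H1" "H1_norm (mode m)<=8 * ka * amp m" using H1_of_C1[OF mode_derivatives(1) mode_cont(2) mode_periodic norm_mode] by (simp_all add: mult.assoc)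

lemma lap_H1: "(%t. - of_real ((nv m)^2) * mode m t)\<in>H1"
 "H1_norm (%t. - of_real ((nv m)^2) * mode m t)<=8 * ka*((nv m)^2 * amp m)"
proof -
 let ?k = "- cor ((nv m)^2)"
 have k: "norm ?k=(nv m)^2" by (simp add: norm_power)
 have d: "((%t. ?k * mode m t) hvd ?k * mode' m t) (at t)" for t by (intro has_vector_derivative_mult_right mode_derivatives)
 have n: "norm (?k * x)<=2 * ka*((nv m)^2 * amp m)" if "norm x<=2 * ka * amp m" for x unfolding norm_mult k using mult_left_mono[OF that, of "(nv m)^2"] by (simp add: mult_ac)
 have c: "cts (%t. ?k * mode' m t)" by (intro continuous_intros mode_cont)
 have per: "?k * mode m (t+2 * pi) = ?k * mode m t" "?k * mode' m (t+2 * pi) = ?k * mode' m t" for t by (simp_all only: mode_periodic)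
 note H = H1_of_C1[OF d c per n[OF norm_mode(1)] n[OF norm_mode(2)]]
 show "(%t. ?k * mode m t)\<in>H1" by (rule H(1))
 show "H1_norm (%t. ?k * mode m t)<=8 * ka*((nv m)^2 * amp m)" using H(2) by (simp add: mult_ac)
qed

lemma plap_H1: "(%t. of_real (p t)*(- of_real ((nv m)^2) * mode m t))\<in>H1"
 "H1_norm (%t. of_real (p t)*(- of_real ((nv m)^2) * mode m t))<=16 * b * ka*((nv m)^2 * amp m)"
proof -
 let ?k = "- cor ((nv m)^2)" and ?B = "2 * ka*((nv m)^2 * amp m)"
 have k: "norm ?k=(nv m)^2" by (simp add: norm_power)
 have n: "norm (?k * x) <= ?B" if "norm x<=2 * ka * amp m" for x unfolding norm_mult k using mult_left_mono[OF that, of "(nv m)^2"] by (simp add: mult_ac)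
 have pb: "abs(p t)<=b" "abs(q t)<=b" for t
 proof -
  have "0<=1/b" using b by simp
  then show "abs(p t)<=b" using potentialD(2,3)[OF pot, of t] by linarith
  show "abs(q t)<=b" by (rule potentialD(4)[OF pot])
 qed
 have d: "((%t. of_real (p t)*(?k * mode m t)) hvd (of_real (p t)*(?k * mode' m t) + of_real (q t)*(?k * mode m t))) (at t)" for t by (intro has_vector_derivative_mult has_vector_derivative_of_real has_vector_derivative_mult_right mode_derivatives)
    (use potentialD(1)[OF pot] in \<open>simp add: hrv\<close>)
 have c: "cts (%t. of_real (p t)*(?k * mode' m t) + of_real (q t)*(?k * mode m t))" by (intro continuous_intros mode_cont potential_cont[OF pot] potentialD(6)[OF pot])
 have m: "norm (of_real x * y)<=b * ?B" if "abs(x)<=b" "norm y <= ?B" for x and y :: complex unfolding norm_mult norm_of_real by (rule mult_mono) (use that b in auto)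
 have B0: "?B>=0" using kappa_pos amp_nonneg[of m] by simp
 have pp: "p (t+2 * pi)=p t" for t by (rule potentialD(5)[OF pot])
 have qp: "q (t+2 * pi)=q t" for t
 proof -
  have "((%s. p (s+2 * pi)) hrd q (t+2 * pi)) (at t)" using potentialD(1)[OF pot, of "t+2 * pi"] by (simp add: DERIV_shift)
  then have "(p hrd q (t+2 * pi)) (at t)" by (simp add: pp)
  then show ?thesis using potentialD(1)[OF pot, of t] by (rule DERIV_unique)
 qed
 have A: "norm (of_real (p t)*(?k * mode m t))<=2 * b * ?B" "norm (of_real (p t)*(?k * mode' m t) + of_real (q t)*(?k * mode m t))<=2 * b * ?B" for t
 proof -
  have 0: "0<=b * ?B" using b B0 by simp
  show "norm (of_real (p t)*(?k * mode m t))<=2 * b * ?B" using m[OF pb(1)[of t] n[OF norm_mode(1)[of m t]]] 0 by linarith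
  show "norm (of_real (p t)*(?k * mode' m t) + of_real (q t)*(?k * mode m t))<=2 * b * ?B"
  proof -
   have "norm (of_real (p t)*(?k * mode' m t) + of_real (q t)*(?k * mode m t))<=b * ?B+b * ?B" by (rule norm_triangle_le[OF add_mono[OF m[OF pb(1)[of t] n[OF norm_mode(2)[of m t]]] m[OF pb(2)[of t] n[OF norm_mode(1)[of m t]]]]])
   also have "b * ?B+b * ?B=2 * b * ?B" by simp
   finally show ?thesis .
  qed
 qed
 have per: "of_real (p (t+2 * pi))*(?k * mode m (t+2 * pi)) = of_real (p t)*(?k * mode m t)"
  "of_real (p (t+2 * pi))*(?k * mode' m (t+2 * pi)) + of_real (q (t+2 * pi))*(?k * mode m (t+2 * pi)) = of_real (p t)*(?k * mode' m t) + of_real (q t)*(?k * mode m t)" for t by (simp_all only: pp qp mode_periodic)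
 note H = H1_of_C1[OF d c per A]
 show "(%t. of_real (p t)*(?k * mode m t))\<in>H1" by (rule H(1))
 show "H1_norm (%t. of_real (p t)*(?k * mode m t))<=16 * b * ka*((nv m)^2 * amp m)" using H(2) by (simp add: mult_ac)
qed

text \<open>The squared loss \<open>|m|^(2 (ta - 1))\<close> raises the smoothness index of the
  weight from \<open>sy\<close> to \<open>sy + ta - 1\<close>, which is at most
  \<open>sz\<close>.\<close>

lemma amp_weight:
 assumes "m~=0"
 shows "(amp m)^2 * weight sg sy m<=64 * K^2 * G2 m" "((nv m)^2 * amp m)^2 * weight sg (sy-2) m<=64 * K^2 * G2 m"
proof -
 have "(amp m)^2 * weight sg sy m=64 * K^2*((H1_norm (cF g m))^2*((nv m powr (ta-1))^2 * weight sg sy m))" using assms by (simp add: amp_def power_mult_distrib mult_ac)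
 also have "... <= 64 * K^2 * G2 m" unfolding weight_scale[OF assms] using ta by (intro mult_left_mono weight_mono) auto
 finally show 1: "(amp m)^2 * weight sg sy m<=64 * K^2 * G2 m" .
 have n2: "nv m powr 2=(nv m)^2" by simp
 have "((nv m)^2 * amp m)^2 * weight sg (sy-2) m=(amp m)^2 * weight sg sy m" using weight_scale[OF assms, of 2 sg "sy-2"] unfolding n2 by (simp add: power_mult_distrib mult_ac)
 then show "((nv m)^2 * amp m)^2 * weight sg (sy-2) m<=64 * K^2 * G2 m" using 1 by simp
qed

lemma G2_nonneg: "G2 m>=0" by (simp add: weight_nonneg)

lemma mode_weight: "(H1_norm (mode m))^2 * weight sg sy m<=4096*(K * ka)^2 * G2 m+(if m=0 then 4096*(ka * N)^2 else 0)"
proof -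
 have "(H1_norm (mode m))^2 * weight sg sy m<=(8 * ka * amp m)^2 * weight sg sy m" by (intro mult_right_mono power_mono mode_H1 H1_norm_nonneg weight_nonneg)
 also have "... = 64 * ka^2*((amp m)^2 * weight sg sy m)" by (simp only: power_mult_distrib mult_ac, simp?)
 also have "... <= 4096*(K * ka)^2 * G2 m+(if m=0 then 4096*(ka * N)^2 else 0)"
 proof (cases "m=0")
  case True
  have a: "64 * ka^2*(N^2*1)<=4096*(ka * N)^2" unfolding power_mult_distrib by simp
  have "0<=4096*(K * ka)^2 * G2 m" by (intro mult_nonneg_nonneg G2_nonneg) auto
  with a have "64 * ka^2*(N^2*1)<=4096*(K * ka)^2 * G2 m+4096*(ka * N)^2" by linarith
  moreover have "amp m=N" "weight sg sy m=1" using True by (simp_all add: amp_def weight_def)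
  ultimately show ?thesis by (simp only: True if_True simp_thms)
 next
  case False
  have "64 * ka^2*((amp m)^2 * weight sg sy m)<=64 * ka^2*(64 * K^2 * G2 m)" by (intro mult_left_mono amp_weight[OF False]) auto
  then show ?thesis using False by (simp add: power_mult_distrib mult_ac)
 qed
 finally show ?thesis .
qed

lemma lap_amp_weight: "((nv m)^2 * amp m)^2 * weight sg (sy-2) m<=64 * K^2 * G2 m"
proof (cases "m=0")
 case True
 then show ?thesis using mult_nonneg_nonneg[OF _ G2_nonneg, of "64 * K^2" m] by (simp add: rvec_simps)
qed (rule amp_weight(2))

lemma lap_weight: "(H1_norm (%t. - of_real ((nv m)^2) * mode m t))^2 * weight sg (sy-2) m<=4096*(K * ka)^2 * G2 m"
proof -
 have "(H1_norm (%t. - of_real ((nv m)^2) * mode m t))^2 * weight sg (sy-2) m<=(8 * ka*((nv m)^2 * amp m))^2 * weight sg (sy-2) m" by (intro mult_right_mono power_mono lap_H1 H1_norm_nonneg weight_nonneg)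
 also have "... = 64 * ka^2*(((nv m)^2 * amp m)^2 * weight sg (sy-2) m)" by (simp only: power_mult_distrib mult_ac, simp?)
 also have "... <= 64 * ka^2*(64 * K^2 * G2 m)" by (intro mult_left_mono lap_amp_weight) auto
 finally show ?thesis by (simp add: power_mult_distrib mult_ac)
qed

definition utt_mode :: "int^'d => real => complex" where
 "utt_mode m t = of_real (p t)*(- of_real ((nv m)^2) * mode m t) + of_real ka * cF g m t"

lemma utt_H1: "utt_mode m\<in>H1"
 "(H1_norm (utt_mode m))^2 * weight sg (sy-2) m<=(2 * ka^2+32768 * b^2*(K * ka)^2) * G2 m"
proof -
 have e: "utt_mode m=(%t. of_real ka * cF g m t + of_real (p t)*(- of_real ((nv m)^2) * mode m t))" by (simp add: utt_mode_def fun_eq_iff add.commute)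
 note L = H1_lin[OF g_H1 plap_H1(1), of "of_real ka" m m, folded e]
 show "utt_mode m\<in>H1" by (rule L(1))
 have "(H1_norm (utt_mode m))^2<=2 * ka^2*(H1_norm (cF g m))^2+2*(16 * b * ka*((nv m)^2 * amp m))^2"
 proof -
  have "(H1_norm (%t. of_real (p t)*(- of_real ((nv m)^2) * mode m t)))^2<=(16 * b * ka*((nv m)^2 * amp m))^2" by (intro power_mono plap_H1 H1_norm_nonneg)
  moreover have "(norm (cor ka))^2=ka^2" unfolding norm_of_real by (rule power2_abs)
  ultimately show ?thesis using L(2) by simp
 qed
 then have "(H1_norm (utt_mode m))^2 * weight sg (sy-2) m<=(2 * ka^2*(H1_norm (cF g m))^2+2*(16 * b * ka*((nv m)^2 * amp m))^2) * weight sg (sy-2) m" by (intro mult_right_mono weight_nonneg)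
 also have "... = 2 * ka^2*((H1_norm (cF g m))^2 * weight sg (sy-2) m)+512 * b^2 * ka^2*(((nv m)^2 * amp m)^2 * weight sg (sy-2) m)" by (simp only: power_mult_distrib ring_distribs mult_ac, simp?)
 also have "... <= 2 * ka^2 * G2 m+512 * b^2 * ka^2*(64 * K^2 * G2 m)" by (intro add_mono mult_left_mono lap_amp_weight weight_mono s0_ge) auto
 also have "... = (2 * ka^2+32768 * b^2*(K * ka)^2) * G2 m" by (simp only: power_mult_distrib ring_distribs mult_ac, simp?)
 finally show "(H1_norm (utt_mode m))^2 * weight sg (sy-2) m<=(2 * ka^2+32768 * b^2*(K * ka)^2) * G2 m" .
qed

lemma gap_v: "m~=0==>gap (nv m) p>=2*(G * nv m powr (- ta))" for m :: "int^'d" using gap[of "(m,True)"] by (simp add: idx_iff lamb_def threshold_def)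

lemma gap_level: "m~=0==>0<2*(G * nv m powr (- ta))&2*(G * nv m powr (- ta))<=1" for m :: "int^'d"
proof -
 assume m: "m~=0"
 then have n: "nv m>=1" by (rule norm_rvec_ge_1)
 have "nv m powr (- ta)<=nv m powr 0" using n tau_ge_1 by (intro powr_mono) auto
 then have "nv m powr (- ta)<=1" using n by (simp add: powr_def split: if_splits)
 then have "G * nv m powr (- ta)<=(1/2)*1" using G by (intro mult_mono) auto
 moreover have "rvec m~=0" using n by auto
 ultimately show ?thesis using G by simp
qed

lemma homogeneous_zero:
 fixes m :: "int^'d"
 assumes m: "m~=0" and v: "hill_sol (nv m) p (%_. 0) v v'" and per: "!!t. v (t+2 * pi)=v t" "!!t. v' (t+2 * pi)=v' t"
 shows "v t=0"
proof -
 have l: "nv m>0" using norm_rvec_ge_1[OF m] by linarith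
 obtain s where s: "s\<in>{0..<2*pi}" "v t=v s" using periodic_reduce[of v v t] per(1) by blast
 have "pnorm (nv m) v v' s<=2*(ecst b)^2*0/(2*(G * nv m powr (- ta)))" by (rule periodic_sol_bound_C0[OF b pot l gap_v[OF m] _ _ v per]) (use gap_level[OF m] s in auto)
 then have "nv m * abs(v s)+abs(v' s)<=0" by (simp add: pnorm_def)
 then have "nv m * abs(v s)=0" using mult_nonneg_nonneg[OF norm_ge_zero[of "rvec m"] abs_ge_zero[of "v s"]] abs_ge_zero[of "v' s"] by linarith
 then show ?thesis using l s by simp
qed

text \<open>The solutions for \<open>m\<close> and \<open>- m\<close> are chosen independently of
  each other. Their difference, or sum for the imaginary parts, is a periodic homogeneous solution
  and vanishes because the gap is positive.\<close>

lemma mode_symmetric: "mode (- m) t=cnj (mode m t)"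
proof (cases "m=0")
 case True
 then show ?thesis by (simp add: mode_def vi_def complex_eq_iff)
next
 case False
 have gm: "cF g (- m) t=cnj (cF g m t)" for t by (rule coeff_fun_cnj)
 have nm: "norm (rvec (- m))=nv m" by (simp add: rvec_simps)
 have r: "hill_sol (nv m) p (%_. 0) (%t. vr (- m) t-vr m t) (%t. vr' (- m) t-vr' m t)" using hill_sol_diff[OF v_hill(1)[of "- m", unfolded nm] v_hill(1)[of m]] by (simp add: gm)
 have i: "hill_sol (nv m) p (%_. 0) (%t. vi (- m) t+vi m t) (%t. vi' (- m) t+vi' m t)" using hill_sol_add[OF v_hill(2)[of "- m", unfolded nm] v_hill(2)[of m]] by (simp add: gm)
 have "vr (- m) t-vr m t=0" by (rule homogeneous_zero[OF False r]) (simp_all add: v_periodic)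
 moreover have "vi (- m) t+vi m t=0" by (rule homogeneous_zero[OF False i]) (simp_all add: v_periodic)
 ultimately have "vr (- m) t=vr m t" "vi (- m) t = - vi m t" by auto
 then show ?thesis by (simp add: mode_def complex_eq_iff)
qed

lemma mode_weight_summable: "(%m. (H1_norm (mode m))^2 * weight sg sy m) summable_on UNIV"
 "(\<Sum>\<^sub>\<infinity>m. (H1_norm (mode m))^2 * weight sg sy m)<=4096*(K * ka)^2 * S+4096*(ka * N)^2"
proof -
 have 1: "(%m. 4096*(K * ka)^2 * G2 m) summable_on UNIV" by (rule summable_on_cmult_right[OF G2_summable])
 have 2: "(%m::int^'d. if m=0 then 4096*(ka * N)^2 else 0) summable_on UNIV" by (rule finite_nonzero_values_imp_summable_on) (rule finite_subset[of _ "{0}"]; auto)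
 have nn: "0<=(H1_norm (mode m))^2 * weight sg sy m" for m by (simp add: weight_nonneg)
 show s: "(%m. (H1_norm (mode m))^2 * weight sg sy m) summable_on UNIV" by (rule sob(1)[OF summable_on_add[OF 1 2]]) (use mode_weight nn in \<open>simp only: real_norm_def abs_of_nonneg\<close>)
 have "(\<Sum>\<^sub>\<infinity>m. (H1_norm (mode m))^2 * weight sg sy m)<=(\<Sum>\<^sub>\<infinity>m. 4096*(K * ka)^2 * G2 m+(if m=0 then 4096*(ka * N)^2 else 0))" by (rule infsum_mono[OF s summable_on_add[OF 1 2] mode_weight])
 also have "... = (\<Sum>\<^sub>\<infinity>m. 4096*(K * ka)^2 * G2 m)+(\<Sum>\<^sub>\<infinity>m::int^'d. if m=0 then 4096*(ka * N)^2 else 0)" by (rule infsum_add[OF 1 2])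
 also have "(\<Sum>\<^sub>\<infinity>m::int^'d. if m=0 then 4096*(ka * N)^2 else 0)=(\<Sum>\<^sub>\<infinity>m\<in>{0::int^'d}. 4096*(ka * N)^2)" by (rule infsum_cong_neutral) auto
 also have "(\<Sum>\<^sub>\<infinity>m. 4096*(K * ka)^2 * G2 m)=4096*(K * ka)^2 * S" unfolding S_def by (rule infsum_cmult_right) (rule G2_summable)
 finally show "(\<Sum>\<^sub>\<infinity>m. (H1_norm (mode m))^2 * weight sg sy m)<=4096*(K * ka)^2 * S+4096*(ka * N)^2" by simp
qed

text \<open>\<open>small\<close> bounds \<open>1024 * b * K\<close> by \<open>1/ga\<close>; this
  converts the loss from small divisors into the \<open>1/gamma\<close> of the final estimates, with
  a constant common to all windows.\<close>

lemma small_squares: "1048576 * b^2 * K^2<=(1/ga)^2" "1048576 * K^2<=(1/ga)^2" "1<=(1/ga)^2"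
proof -
 have "1024 * b * K<=1/ga" using small ga by (simp add: pos_le_divide_eq)
 then have "(1024 * b * K)^2<=(1/ga)^2" using b K_nonneg by (intro power_mono) auto
 then show 1: "1048576 * b^2 * K^2<=(1/ga)^2" unfolding power_mult_distrib by simp
 have "1 * K^2<=b^2 * K^2" using b by (intro mult_right_mono) auto
 then show "1048576 * K^2<=(1/ga)^2" using 1 by linarith
 have "1<=1/ga" using ga by simp
 then show "1<=(1/ga)^2" by (rule one_le_power)
qed

text \<open>\<open>u\<close> and its Laplacian are synthesized from the modes, whereas the second
  time derivative is defined as \<open>p * lap + ka * g\<close>. The equation then holds at every
  point, once the fixed point equation has identified \<open>p\<close> with
  \<open>(1 + mu * energy) / ow^2\<close>.\<close>

theorem solution_exists:
 obtains u utt where "classical_solution g sg sy ow mu u" "mean_zero u" "X_norm sg sy u<=ka/ga * C0"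
  "utt\<in>X_space sg (sy-2)" "weak_tt u utt" "X_norm sg (sy-2) utt<=ka/ga * C0"
  "!!m t. cF u m t=mode m t" "!!t. p t=(1+mu * dirichlet_energy u t) / ow^2"
proof -
 let ?V = "(2 * pi) ^ CARD('d)"
 obtain u where u: "u\<in>X_space sg sy" "!!m. cF u m=mode m" by (rule synthesis[OF sg s0_ge(5) mode_H1(1) mode_symmetric mode_weight_summable(1)]) blast
 define lap_mode where "lap_mode m t = - of_real ((nv m)^2) * mode m t" for m t
 have lw: "(%m. (H1_norm (lap_mode m))^2 * weight sg (sy-2) m) summable_on UNIV"
 proof (rule sob(1)[OF summable_on_cmult_right[OF G2_summable]])
  show "norm ((H1_norm (lap_mode m))^2 * weight sg (sy-2) m)<=4096*(K * ka)^2 * G2 m" for m using lap_weight[of m] unfolding lap_mode_def[abs_def] by (simp add: weight_nonneg abs_mult)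
 qed
 have ls: "lap_mode (- m) t=cnj (lap_mode m t)" for m t by (simp add: lap_mode_def mode_symmetric rvec_simps)
 have lH: "lap_mode m\<in>H1" for m unfolding lap_mode_def[abs_def] by (rule lap_H1)
 obtain lap where lap: "lap\<in>X_space sg (sy-2)" "!!m. cF lap m=lap_mode m" by (rule synthesis[OF sg s0_ge(4) lH ls lw]) blast
 have ue: "utt_mode m=(%t. of_real (p t) * cF lap m t + of_real ka * cF g m t)" for m by (simp add: utt_mode_def fun_eq_iff lap lap_mode_def)
 have nn: "0<=(H1_norm (utt_mode m))^2 * weight sg (sy-2) m" for m by (simp add: weight_nonneg)
 have us: "(%m. (H1_norm (utt_mode m))^2 * weight sg (sy-2) m) summable_on UNIV" by (rule sob(1)[OF summable_on_cmult_right[OF G2_summable]]) (use utt_H1(2) nn in \<open>simp only: real_norm_def abs_of_nonneg\<close>)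
 define utt where "utt x t=p t * lap x t+ka * g x t" for x t
 have pp: "p (t+2 * pi)=p t" for t by (rule potentialD(5)[OF pot])
 have pnz: "p t~=0" for t
 proof -
  have "0<1/b" using b by simp
  then show ?thesis using potentialD(2)[OF pot, of t] by linarith
 qed
 note X = X_space_combination[OF lap(1) g sg s0_ge(2) potential_cont[OF pot] pp pnz utt_H1(1)[unfolded ue] us[unfolded ue], folded utt_def[abs_def]]
 have uttc: "cF utt m=utt_mode m" for m using X(2) by (simp add: fun_eq_iff ue)
 have wtt: "weak_tt u utt" by (rule weak_ttI[OF u(1) X(1) sg s0_ge(5,4), where w = mode'])
    (use mode_derivatives mode_periodic in \<open>simp_all only: u uttc utt_mode_def\<close>)
 have wl: "weak_laplacian u lap" by (rule weak_laplacianI[OF u(1) lap(1) sg s0_ge(5,4)]) (simp add: u lap lap_mode_def)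
 have energy: "dirichlet_energy u t=(2 * pi) ^ CARD('d)*(ka^2 * nonlin G p t)" for t
 proof -
  have n: "(norm (mode m t))^2=ka^2*((vr m t)^2+(vi m t)^2)" for m unfolding mode_def cmod_power2 by (simp add: power_mult_distrib power_divide algebra_simps)
  note ns = nonlin_summable(1)[OF b G(1) G_le_1 pot, of t]
  have inj: "inj_on (%m. (m,c)) (- {0 :: int^'d})" for c :: bool by (simp add: inj_on_def)
  have sub: "(%m. (m,c)) ` (- {0})\<subseteq>idx" for c by (auto simp: idx_iff)
  have sc: "(%m. (lamb (m,c))^2*(sol G p (m,c) t)^2) summable_on - {0}" for c using summable_on_subset_banach[OF ns sub[of c]] unfolding summable_on_reindex[OF inj] by (simp add: o_def)
  have "nonlin G p t=(\<Sum>\<^sub>\<infinity>m\<in>- {0}. (lamb (m,True))^2*(sol G p (m,True) t)^2+(lamb (m,False))^2*(sol G p (m,False) t)^2)" unfolding nonlin_def by (rule summable_on_pairs(2)[where F = "%i. (lamb i)^2*(sol G p i t)^2" and S = "- {0}", OF sc sc, folded idx_def])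
  also have "... = (\<Sum>\<^sub>\<infinity>m. (nv m)^2*((vr m t)^2+(vi m t)^2))" by (rule infsum_cong_neutral) (auto simp: vr_def vi_def lamb_def rvec_simps algebra_simps)
  finally have nl: "nonlin G p t=(\<Sum>\<^sub>\<infinity>m. (nv m)^2*((vr m t)^2+(vi m t)^2))" .
  have "(\<Sum>\<^sub>\<infinity>m. (nv m)^2*(norm (mode m t))^2)=(\<Sum>\<^sub>\<infinity>m. ka^2*((nv m)^2*((vr m t)^2+(vi m t)^2)))" unfolding n by (simp only: mult_ac)
  also have "... = ka^2 * nonlin G p t" unfolding nl by (rule infsum_cmult_right')
  finally show ?thesis unfolding dirichlet_energy_series(2)[OF u(1) sg s0_ge(6)] u by simp
 qed
 \<comment> \<open>The energy carries \<open>ka^2 = mu^2 / ow^4\<close>, so the product with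
   \<open>mu / ow^2\<close> has the coefficient \<open>mu^3 / ow^6\<close> of the fixed point
   equation.\<close>
 have peq: "p t=(1+mu * dirichlet_energy u t) / ow^2" for t
 proof -
  have A: "a+V * m^3 * a^3 * n=(1+m*(V*((m * a)^2 * n))) * a" for a n V m :: real by (simp only: power2_eq_square power3_eq_cube ring_distribs mult_1_left mult_ac)
  show ?thesis unfolding energy kappa p_eq[of t] using A[of "1 / ow^2" ?V mu "nonlin G p t"] by (simp only: times_divide_eq_right mult_1_right)
 qed
 have cls: "classical_solution g sg sy ow mu u" unfolding classical_solution_def
 proof (intro conjI bexI allI AE_I2)
  show "u\<in>X_space sg sy" "utt\<in>X_space sg (sy-2)" "lap\<in>X_space sg (sy-2)" "weak_tt u utt" "weak_laplacian u lap" by (fact u(1) X(1) lap(1) wtt wl)+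
  fix t x
  have "ow^2 * utt x t=(ow^2 * p t) * lap x t+(ow^2 * ka) * g x t" by (simp add: utt_def algebra_simps)
  moreover have "ow^2 * p t=1+mu * dirichlet_energy u t" "ow^2 * ka=mu" using ow by (simp_all add: peq kappa)
  ultimately show "ow^2 * utt x t-lap x t=mu*(lap x t * dirichlet_energy u t+g x t)" by (simp only:) (simp add: algebra_simps)
 qed
 have mz: "mean_zero u" unfolding mean_zero_iff[OF u(1) sg s0_ge(5)] u using W(5) by (simp add: mode_def vr_def)
 have kg: "0<=ka/ga" using kappa_pos ga by simp
 have fin: "sqrt y<=ka/ga * C0" if "y<=(ka/ga)^2*(3 * S+4096 * N^2)" for y
 proof -
  have "sqrt y<=sqrt ((ka/ga)^2*(3 * S+4096 * N^2))" using that by (rule real_sqrt_le_mono)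
  also have "... = ka/ga * sqrt (3 * S+4096 * N^2)" unfolding real_sqrt_mult real_sqrt_abs using kg by (simp only: abs_of_nonneg)
  also have "... <= ka/ga * C0" using kg by (intro mult_left_mono) (simp_all add: C0_def)
  finally show ?thesis .
 qed
 have kg2: "(ka/ga)^2=ka^2*(1/ga)^2" by (simp add: power_divide)
 have nu: "X_norm sg sy u<=ka/ga * C0" unfolding X_norm_def u
 proof (rule fin)
  have "ka^2*(1048576 * K^2)<=ka^2*(1/ga)^2" by (intro mult_left_mono small_squares) simp
  moreover have "(K * ka)^2*4096=ka^2*(1048576 * K^2)/256" by (simp add: power_mult_distrib)
  moreover have "0<=ka^2*(1048576 * K^2)" by simp
  ultimately have "(K * ka)^2*4096<=ka^2*(1/ga)^2" by linarith
  then have A1: "(K * ka)^2*4096 * S<=ka^2*(1/ga)^2 * S" using S_nonneg by (rule mult_right_mono)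
  have A2: "ka^2 * N^2*1<=ka^2 * N^2*(1/ga)^2" by (intro mult_left_mono small_squares) auto
  have A3: "0<=ka^2*(1/ga)^2 * S" by (intro mult_nonneg_nonneg S_nonneg) auto
  have B1: "4096*(ka * N)^2=4096*(ka^2 * N^2*1)" by (simp add: power_mult_distrib)
  have B2: "4096*(K * ka)^2 * S=(K * ka)^2*4096 * S" by simp
  have B3: "(ka/ga)^2*(3 * S+4096 * N^2)=3*(ka^2*(1/ga)^2 * S)+4096*(ka^2 * N^2*(1/ga)^2)" unfolding kg2 by (simp only: ring_distribs mult_ac)
  show "(\<Sum>\<^sub>\<infinity>m. (H1_norm (mode m))^2 * weight sg sy m)<=(ka/ga)^2*(3 * S+4096 * N^2)" unfolding B3 using mode_weight_summable(2) A1 A2 A3 unfolding B1 B2 by linarith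
 qed
 have nt: "X_norm sg (sy-2) utt<=ka/ga * C0" unfolding X_norm_def uttc
 proof (rule fin)
  have "(\<Sum>\<^sub>\<infinity>m. (H1_norm (utt_mode m))^2 * weight sg (sy-2) m)<=(\<Sum>\<^sub>\<infinity>m. (2 * ka^2+32768 * b^2*(K * ka)^2) * G2 m)" by (rule infsum_mono[OF us summable_on_cmult_right[OF G2_summable] utt_H1(2)])
  also have "... = (2 * ka^2+32768 * b^2*(K * ka)^2) * S" unfolding S_def by (rule infsum_cmult_right) (rule G2_summable)
  also have "... <= (3*(ka^2*(1/ga)^2)) * S"
  proof (rule mult_right_mono[OF _ S_nonneg])
   have "ka^2*(1048576 * b^2 * K^2)<=ka^2*(1/ga)^2" "ka^2*1<=ka^2*(1/ga)^2" by (intro mult_left_mono small_squares; simp)+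
   moreover have "0<=b^2*(K * ka)^2" by simp
   moreover have "ka^2*(1048576 * b^2 * K^2)=1048576*(b^2*(K * ka)^2)" by (simp only: power_mult_distrib mult_ac)
   ultimately show "2 * ka^2+32768 * b^2*(K * ka)^2<=3*(ka^2*(1/ga)^2)" by (simp only: mult.assoc)
  qed
  also have "... <= (ka/ga)^2*(3 * S+4096 * N^2)" unfolding kg2 by (simp add: ring_distribs mult_ac)
  finally show "(\<Sum>\<^sub>\<infinity>m. (H1_norm (utt_mode m))^2 * weight sg (sy-2) m)<=(ka/ga)^2*(3 * S+4096 * N^2)" .
 qed
 show ?thesis by (rule that[OF cls mz nu X(1) wtt nt _ peq]) (simp add: u)
qed

text \<open>Compares a mode of a competitor, which obeys its own potential \<open>Q\<close>, with
  the constructed mode. The difference is treated as a solution for \<open>p\<close>, so the divisor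
  is the gap of \<open>p\<close>, whatever the resonances of \<open>Q\<close> may be.\<close>

lemma hill_difference_bound:
 fixes m :: "int^'d"
 assumes m: "m~=0" and y: "hill_sol (nv m) Q (%t. ka * r t) y y'" and V: "hill_sol (nv m) p r V V'"
  and per: "!!t. y (t+2 * pi)=y t" "!!t. V (t+2 * pi)=V t" "!!t. V' (t+2 * pi)=V' t"
  and Q: "cts Q" and D: "!!t. abs(p t-Q t)<=D" and B: "!!t. abs(y t)<=B"
 shows "nv m * abs(y t-ka * V t)<=(ecst b)^2/G * nv m powr (2+ta) * D * B"
proof -
 let ?l = "nv m"
 have l: "?l>0" using norm_rvec_ge_1[OF m] by linarith
 have y'p: "y' (t+2 * pi)=y' t" for t
 proof -
  have "((%s. y (s+2 * pi)) hrd y' (t+2 * pi)) (at t)" using hill_solD(1)[OF y, of "t+2 * pi"] by (simp add: DERIV_shift)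
  then have "(y hrd y' (t+2 * pi)) (at t)" by (simp add: per)
  then show ?thesis using hill_solD(1)[OF y, of t] by (rule DERIV_unique)
 qed
 have h: "hill_sol ?l p (%t. ?l^2*(p t-Q t) * y t) (%t. y t-ka * V t) (%t. y' t-ka * V' t)" using hill_sol_diff[OF hill_sol_change_potential[OF y, of p] hill_sol_scale[OF V, of ka]] by simp
 obtain s where s: "s\<in>{0..<2*pi}" "y t-ka * V t=y s-ka * V s" using periodic_reduce[of "%t. y t-ka * V t" "%t. y t-ka * V t" t] per by auto
 have fb: "abs(?l^2*(p t-Q t) * y t) <= ?l^2 * D * B" for t unfolding abs_mult using D[of t] B[of t] by (intro mult_mono) auto
 have cy: "cts y" by (rule hill_sol_cont[OF y])
 have "pnorm ?l (%t. y t-ka * V t) (%t. y' t-ka * V' t) s<=2*(ecst b)^2*(?l^2 * D * B)/(2*(G * ?l powr (- ta)))" by (rule periodic_sol_bound_C0[OF b pot l gap_v[OF m] _ _ h _ _ _ fb])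
    (use gap_level[OF m] s in \<open>auto simp: per y'p intro!: continuous_intros potential_cont[OF pot] Q cy\<close>)
 also have "... = (ecst b)^2/G * ?l powr (2+ta) * D * B"
 proof -
  have "?l powr (2+ta) = ?l^2 / ?l powr (- ta)" using l by (simp add: powr_add powr_minus divide_inverse)
  then show ?thesis by simp
 qed
 finally show ?thesis unfolding pnorm_def s(2) using abs_ge_zero[of "y' s-ka * V' s"] by linarith
qed

text \<open>In the factorization of the difference of squares one \<open>|m|\<close> goes with the
  small difference and one remains. The total power \<open>|m|^(3 + ta)\<close> is below the weight
  of index \<open>sy\<close> because \<open>ta <= 2 * sy - 3\<close>.\<close>

lemma energy_term_difference:
 fixes m :: "int^'d" and a c :: complex
 assumes le: "nv m * norm (a-c)<=2*((ecst b)^2/G * nv m powr (2+ta) * D*(4 * k))"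
  and a: "norm a<=4 * k" and c: "norm c<=4 * h" and k: "k>=0" "h>=0" and D: "D>=0" and m: "m~=0"
 shows "abs((nv m)^2*(norm c)^2-(nv m)^2*(norm a)^2)<=2*((ecst b)^2/G) * D*32*(h^2 * weight sg sy m+k^2 * weight sg sy m)"
proof -
 let ?l = "nv m" and ?E = "(ecst b)^2/G"
 have E0: "?E>=0" using G by simp
 have l: "?l>=1" by (rule norm_rvec_ge_1[OF m])
 have "abs(?l^2*(norm c)^2 - ?l^2*(norm a)^2) = ?l*(?l * abs(norm c-norm a))*(norm c+norm a)"
 proof -
  have "?l^2*(norm c)^2 - ?l^2*(norm a)^2 = ?l*(?l*(norm c-norm a))*(norm c+norm a)" by (simp add: power2_eq_square algebra_simps)
  then show ?thesis by (simp add: abs_mult)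
 qed
 also have "... <= ?l*(2*(?E * ?l powr (2+ta) * D*(4 * k)))*(4 * h+4 * k)"
 proof -
  have "?l * abs(norm c-norm a) <= ?l * norm (a-c)" using norm_triangle_ineq3[of c a] by (intro mult_left_mono) (auto simp: norm_minus_commute)
  then have X: "?l * abs(norm c-norm a)<=2*(?E * ?l powr (2+ta) * D*(4 * k))" using le by linarith
  have Y: "0 <= ?l*(2*(?E * ?l powr (2+ta) * D*(4 * k)))" using k D E0 by (intro mult_nonneg_nonneg) auto
  show ?thesis by (rule mult_mono[OF mult_left_mono[OF X norm_ge_zero] add_mono[OF c a] Y]) simp
 qed
 also have "... = 2 * ?E * D*16*(?l powr (3+ta)*(k*(h+k)))"
 proof -
  have "?l powr (3+ta) = ?l * ?l powr (2+ta)"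
  proof -
   have "?l powr (1+(2+ta)) = ?l powr 1 * ?l powr (2+ta)" by (rule powr_add)
   then show ?thesis by simp
  qed
  moreover have "l*(2*(e * x * D*(4 * k)))*(4 * h+4 * k)=2 * e * D*16*(l * x*(k*(h+k)))" for l e x by (simp add: algebra_simps)
  ultimately show ?thesis by (simp only:)
 qed
 also have "... <= 2 * ?E * D*16*(weight sg sy m*(2*(h^2+k^2)))"
 proof -
  have "?l powr (3+ta) <= ?l powr (2 * sy)" using l ta(4) by (intro powr_mono) auto
  also have "... <= weight sg sy m" using jap_weight[OF sg, of m sy] m by (simp add: jap_nonzero)
  finally have X: "?l powr (3+ta)<=weight sg sy m" .
  have "2*(k * h)<=k^2+h^2" using zero_le_power2[of "k-h"] by (simp add: power2_diff)
  then have "k * h+k * h<=k^2+h^2" unfolding mult_2 .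
  moreover have "k*(h+k)=k * h+k^2" by (simp add: power2_eq_square algebra_simps)
  moreover have "0<=k * h" using k by simp
  moreover have "0<=k^2" "0<=h^2" by simp_all
  ultimately have "k*(h+k)<=h^2+k^2+(h^2+k^2)" by linarith
  then have Y: "k*(h+k)<=2*(h^2+k^2)" unfolding mult_2 .
  have Z: "0<=2 * ?E * D*16" using E0 D by (intro mult_nonneg_nonneg) auto
  have "0<=k*(h+k)" using k by simp
  then show ?thesis by (rule mult_left_mono[OF mult_mono[OF X Y weight_nonneg] Z])
 qed
 finally show ?thesis by (simp add: algebra_simps)
qed

text \<open>\<open>D\<close> is the largest distance between \<open>p\<close> and the potential of
  the competitor. The modes differ by a multiple of \<open>D\<close>, hence so do the energies, and
  the energies in turn determine the potentials: \<open>D\<close> is at most a factor below 1 times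
  \<open>D\<close>, by \<open>small2\<close>, and so vanishes. The unit ball bounds the competitor's
  share in that factor.\<close>

theorem solution_unique:
 assumes u: "u\<in>X_space sg sy" "!!m t. cF u m t=mode m t" "!!t. p t=(1+mu * dirichlet_energy u t) / ow^2"
  and v: "classical_solution g sg sy ow mu v" "mean_zero v" "X_norm sg sy v<1"
  and small2: "ka*(2 * pi) ^ CARD('d)*(2*((ecst b)^2/G)*32*((X_norm sg sy u)^2+1))<1"
 shows "v=u"
proof -
 let ?V = "(2 * pi) ^ CARD('d)"
 obtain vtt lap where vX: "v\<in>X_space sg sy" and vtt: "vtt\<in>X_space sg (sy-2)" and lap: "lap\<in>X_space sg (sy-2)"
  and wtt: "weak_tt v vtt" and wl: "weak_laplacian v lap"
  and eq: "!!t. AE x in lborel. ow^2 * vtt x t-lap x t=mu*(lap x t * dirichlet_energy v t+g x t)" using v(1) unfolding classical_solution_def by blast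
 define E where "E=dirichlet_energy v"
 define Q where "Q t=(1+mu * E t) / ow^2" for t
 note ev = dirichlet_energy_series[OF vX sg s0_ge(6)] and eu = dirichlet_energy_series[OF u(1) sg s0_ge(6)]
 have Ec: "cts E" unfolding E_def by (rule ev(3))
 have Ep: "E (t+2 * pi)=E t" for t unfolding E_def ev(2) Xcoeff_per[OF vX sg s0_ge(5)] ..
 have Qc: "cts Q" unfolding Q_def[abs_def] by (intro continuous_intros Ec) (use ow in simp)
 have lapc: "cF lap m t = - of_real ((nv m)^2) * cF v m t" for m t by (rule weak_laplacian_coeff[OF vX lap sg s0_ge(5,4) wl])
 \<comment> \<open>The equation holds almost everywhere in \<open>x\<close> at each time, which
   suffices for taking Fourier coefficients; solving for the second derivative gives Hill's equation
   with potential \<open>Q\<close>.\<close>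
 have vttc: "cF vtt m t = of_real ka * cF g m t - of_real ((nv m)^2 * Q t) * cF v m t" for m t
 proof -
  note L1 = L2_conv_lincomb[OF X_space_L2_conv[OF vtt, of t] X_space_L2_conv[OF lap, of t], of "ow^2" "-1"]
  note L2 = L2_conv_lincomb[OF X_space_L2_conv[OF lap, of t] X_space_L2_conv[OF g, of t], of "mu * E t" mu]
  have ae: "AE x in lborel. cor (ow^2) * of_real (vtt x t) + of_real (-1) * of_real (lap x t) = of_real (mu * E t) * of_real (lap x t) + of_real mu * of_real (g x t)" using eq[of t]
  proof eventually_elim
   case (elim x)
   have "ow^2 * vtt x t+(-1) * lap x t=(mu * E t) * lap x t+mu * g x t" using elim by (simp add: E_def algebra_simps)
   then show ?case unfolding of_real_mult[symmetric] of_real_add[symmetric] by (rule arg_cong)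
  qed
  have m1: "(%x. cor (ow^2) * of_real (vtt x t) + of_real (-1) * of_real (lap x t))\<in>bM"
   "(%x. cor (mu * E t) * of_real (lap x t) + of_real mu * of_real (g x t))\<in>bM" using L1 L2 by (simp_all only: L2_conv_def)
  have cm: "(%x. cnj (char_fun m x))\<in>bM" by (intro bmcI continuous_intros chf_props)
  have "(JO x. (cor (ow^2) * of_real (vtt x t) + of_real (-1) * of_real (lap x t)) * cnj (char_fun m x))
        = (JO x. (cor (mu * E t) * of_real (lap x t) + of_real mu * of_real (g x t)) * cnj (char_fun m x))" unfolding sli
  proof (rule integral_cong_AE)
   show "AE x in lborel. indicat_real Omega x *\<^sub>R ((cor (ow^2) * of_real (vtt x t) + of_real (-1) * of_real (lap x t)) * cnj (char_fun m x))=indicat_real Omega x *\<^sub>R ((cor (mu * E t) * of_real (lap x t) + of_real mu * of_real (g x t)) * cnj (char_fun m x))" using ae by eventually_elim (simp only:)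
  qed (use m1 cm in measurable)
  then have c: "of_real (ow^2) * cF vtt m t + of_real (-1) * cF lap m t = of_real (mu * E t) * cF lap m t + of_real mu * cF g m t" unfolding L2_conv_coeff[OF L1] L2_conv_coeff[OF L2] by simp
  define n where "n=(nv m)^2"
  have "of_real (ow^2) * cF vtt m t = of_real (ow^2)*(of_real ka * cF g m t - of_real (n * Q t) * cF v m t)"
  proof -
   have "ow^2 * ka=mu" "ow^2 * Q t=1+mu * E t" using ow by (simp_all add: kappa Q_def)
   then have e1: "of_real (ow^2)*(of_real ka * cF g m t - of_real (n * Q t) * cF v m t) = of_real mu * cF g m t - of_real (n*(1+mu * E t)) * cF v m t" by (simp only: right_diff_distrib mult.assoc[symmetric] of_real_mult[symmetric] mult.commute[of n] mult.left_commute[of _ n])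
   have "of_real (ow^2) * cF vtt m t = of_real mu * cF g m t - of_real (n*(1+mu * E t)) * cF v m t" using c unfolding lapc n_def[symmetric] by (simp add: algebra_simps)
   then show ?thesis unfolding e1 .
  qed
  then show ?thesis using ow by (simp add: n_def)
 qed
 have pQ: "p t-Q t=ka*(dirichlet_energy u t-E t)" for t unfolding u(3) Q_def kappa by (simp add: diff_divide_distrib[symmetric] algebra_simps)
 have dc: "cts (%t. abs(p t-Q t))" by (intro continuous_intros potential_cont[OF pot] Qc)
 have "\<exists>tm\<in>{0..2*pi}. \<forall>t\<in>{0..2*pi}. abs(p t-Q t)<=abs(p tm-Q tm)" by (rule continuous_attains_sup[OF compact_Icc _ continuous_on_subset[OF dc subset_UNIV]]) simp
 then obtain tm where tm': "\<forall>t\<in>{0..2*pi}. abs(p t-Q t)<=abs(p tm-Q tm)" by blast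
 note tm = bspec[OF tm']
 define D where "D=abs(p tm-Q tm)"
 have D0: "D>=0" by (simp add: D_def)
 have D: "abs(p t-Q t)<=D" for t
 proof -
  obtain s where s: "s\<in>{0..<2*pi}" "p t=p s" "Q t=Q s" using periodic_reduce[of p Q t] potentialD(5)[OF pot] Ep by (auto simp: Q_def)
  then show ?thesis using tm[of s] by (simp add: D_def)
 qed
 define hu where "hu m=H1_norm (cF u m)" for m
 define hv where "hv m=H1_norm (cF v m)" for m
 have hb: "norm (cF u m t)<=4 * hu m" "norm (cF v m t)<=4 * hv m" for m t using coeff_fun_bound[OF u(1)] coeff_fun_bound[OF vX] by (simp_all add: sup_bound_def hu_def hv_def)
 have h0: "hu m>=0" "hv m>=0" for m by (simp_all add: hu_def hv_def H1_norm_nonneg)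
 have parts: "nv m * abs(Re (cF v m t)-ka * vr m t)<=(ecst b)^2/G * nv m powr (2+ta) * D*(4 * hv m)"
  "nv m * abs(Im (cF v m t)-ka * vi m t)<=(ecst b)^2/G * nv m powr (2+ta) * D*(4 * hv m)" if m: "m~=0" for m t
 proof -
  obtain w1 where w1: "!!t. ((%t. Re (cF v m t)) hrd w1 t) (at t)" "!!t. (w1 hrd Re (cF vtt m t)) (at t)" using weak_tt_coeff(1)[OF vX vtt sg s0_ge(5,4) wtt, of m] by blast
  obtain w2 where w2: "!!t. ((%t. Im (cF v m t)) hrd w2 t) (at t)" "!!t. (w2 hrd Im (cF vtt m t)) (at t)" using weak_tt_coeff(2)[OF vX vtt sg s0_ge(5,4) wtt, of m] by blast
  have r: "Re (cF vtt m t)=ka * Re (cF g m t)-(nv m)^2 * Q t * Re (cF v m t)"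
   "Im (cF vtt m t)=ka * Im (cF g m t)-(nv m)^2 * Q t * Im (cF v m t)" for t unfolding vttc of_real_mult[symmetric] by (simp_all del: of_real_mult of_real_power)
  have h1: "hill_sol (nv m) Q (%t. ka * Re (cF g m t)) (%t. Re (cF v m t)) w1" using w1 unfolding hill_sol_def r by blast
  have h2: "hill_sol (nv m) Q (%t. ka * Im (cF g m t)) (%t. Im (cF v m t)) w2" using w2 unfolding hill_sol_def r by blast
  show "nv m * abs(Re (cF v m t)-ka * vr m t)<=(ecst b)^2/G * nv m powr (2+ta) * D*(4 * hv m)" by (rule hill_difference_bound[OF m h1 v_hill(1) _ v_periodic(1,3) Qc D])
     (simp_all add: Xcoeff_per[OF vX sg s0_ge(5)] order_trans[OF abs_Re_le_cmod hb(2)])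
  show "nv m * abs(Im (cF v m t)-ka * vi m t)<=(ecst b)^2/G * nv m powr (2+ta) * D*(4 * hv m)" by (rule hill_difference_bound[OF m h2 v_hill(2) _ v_periodic(2,4) Qc D])
     (simp_all add: Xcoeff_per[OF vX sg s0_ge(5)] order_trans[OF abs_Im_le_cmod hb(2)])
 qed
 have close: "nv m * norm (cF v m t-cF u m t)<=2*((ecst b)^2/G * nv m powr (2+ta) * D*(4 * hv m))" if m: "m~=0" for m t
 proof -
  have "norm (cF v m t-cF u m t)<=abs(Re (cF v m t)-ka * vr m t)+abs(Im (cF v m t)-ka * vi m t)" using cmod_le[of "cF v m t-cF u m t"] by (simp add: u(2) mode_def)
  from mult_left_mono[OF this norm_ge_zero]
  have "nv m * norm (cF v m t-cF u m t)<=nv m*(abs(Re (cF v m t)-ka * vr m t)+abs(Im (cF v m t)-ka * vi m t))" .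
  also have "... <= (ecst b)^2/G * nv m powr (2+ta) * D*(4 * hv m)+(ecst b)^2/G * nv m powr (2+ta) * D*(4 * hv m)" unfolding distrib_left by (intro add_mono parts m)
  finally show ?thesis unfolding mult_2 .
 qed
 have us: "(%m. (hu m)^2 * weight sg sy m) summable_on UNIV" "(%m. (hv m)^2 * weight sg sy m) summable_on UNIV" using u(1) vX unfolding X_space_def hu_def hv_def by blast+
 have nn: "(\<Sum>\<^sub>\<infinity>m. (hu m)^2 * weight sg sy m)>=0" "(\<Sum>\<^sub>\<infinity>m. (hv m)^2 * weight sg sy m)>=0" by (intro infsum_nonneg mult_nonneg_nonneg weight_nonneg; simp)+
 have nu: "(\<Sum>\<^sub>\<infinity>m. (hu m)^2 * weight sg sy m)=(X_norm sg sy u)^2" "(\<Sum>\<^sub>\<infinity>m. (hv m)^2 * weight sg sy m)=(X_norm sg sy v)^2" using nn by (simp_all add: X_norm_def hu_def hv_def)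
 have "(X_norm sg sy v)^2<=1" using v(3) nn(2) by (intro power_le_one) (simp_all add: X_norm_def hv_def)
 define Th where "Th=2*((ecst b)^2/G) * D*32"
 have Th0: "Th>=0" unfolding Th_def using D0 G by (intro mult_nonneg_nonneg) auto
 have tb: "norm ((nv m)^2*(norm (cF u m tm))^2-(nv m)^2*(norm (cF v m tm))^2)<=Th*((hu m)^2 * weight sg sy m+(hv m)^2 * weight sg sy m)" for m
 proof (cases "m=0")
  case True
  have "0<=Th*((hu m)^2 * weight sg sy m+(hv m)^2 * weight sg sy m)" by (intro mult_nonneg_nonneg add_nonneg_nonneg Th0 weight_nonneg) auto
  then show ?thesis by (simp add: True rvec_simps)
 next
  case False
  show ?thesis unfolding real_norm_def Th_def by (rule energy_term_difference[OF close[OF False] hb(2) hb(1) h0(2) h0(1) D0 False])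
 qed
 have "abs(dirichlet_energy u tm-E tm) <= ?V*(Th*((X_norm sg sy u)^2+1))"
 proof -
  have "dirichlet_energy u tm-E tm = ?V*(\<Sum>\<^sub>\<infinity>m. (nv m)^2*(norm (cF u m tm))^2-(nv m)^2*(norm (cF v m tm))^2)" unfolding E_def eu(2) ev(2) so_diff(2)[OF eu(1) ev(1)] by (simp add: right_diff_distrib)
  moreover have "norm (\<Sum>\<^sub>\<infinity>m. (nv m)^2*(norm (cF u m tm))^2-(nv m)^2*(norm (cF v m tm))^2)<=(\<Sum>\<^sub>\<infinity>m. Th*((hu m)^2 * weight sg sy m+(hv m)^2 * weight sg sy m))" by (rule sob(3)[OF summable_on_cmult_right[OF summable_on_add[OF us]] tb])
  moreover have "(\<Sum>\<^sub>\<infinity>m. Th*((hu m)^2 * weight sg sy m+(hv m)^2 * weight sg sy m))=Th*((X_norm sg sy u)^2+(X_norm sg sy v)^2)" unfolding nu[symmetric] infsum_add[OF us, symmetric] by (rule infsum_cmult_right) (rule summable_on_add[OF us])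
  moreover have "Th*((X_norm sg sy u)^2+(X_norm sg sy v)^2)<=Th*((X_norm sg sy u)^2+1)" using \<open>(X_norm sg sy v)\<^sup>2 \<le> 1\<close> by (intro mult_left_mono Th0) simp
  ultimately have "norm (\<Sum>\<^sub>\<infinity>m. (nv m)^2*(norm (cF u m tm))^2-(nv m)^2*(norm (cF v m tm))^2)<=Th*((X_norm sg sy u)^2+1)" by linarith
  then have "?V * norm (\<Sum>\<^sub>\<infinity>m. (nv m)^2*(norm (cF u m tm))^2-(nv m)^2*(norm (cF v m tm))^2) <= ?V*(Th*((X_norm sg sy u)^2+1))" by (rule mult_left_mono) simp
  then show ?thesis unfolding \<open>dirichlet_energy u tm - E tm = _\<close> abs_mult real_norm_def by simp
 qed
 then have "ka * abs(dirichlet_energy u tm-E tm)<=ka*(?V*(Th*((X_norm sg sy u)^2+1)))" using kappa_pos by (intro mult_left_mono) auto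
 moreover have "D=ka * abs(dirichlet_energy u tm-E tm)" unfolding D_def pQ abs_mult using kappa_pos by simp
 moreover have "ka*(?V*(Th*((X_norm sg sy u)^2+1)))=(ka * ?V*(2*((ecst b)^2/G)*32*((X_norm sg sy u)^2+1))) * D" unfolding Th_def by (simp only: mult_ac)
 ultimately have Dle: "D<=(ka * ?V*(2*((ecst b)^2/G)*32*((X_norm sg sy u)^2+1))) * D" by linarith
 have "D=0"
 proof (rule ccontr)
  assume "D~=0"
  then have "D>0" using D0 by simp
  then have "(ka * ?V*(2*((ecst b)^2/G)*32*((X_norm sg sy u)^2+1))) * D<1 * D" by (rule mult_strict_right_mono[OF small2])
  then show False using Dle by simp
 qed
 have nz: "cF v m t=cF u m t" if m: "m~=0" for m t
 proof -
  have "nv m * norm (cF v m t-cF u m t)<=0" using close[OF m, of t] \<open>D = 0\<close> by simp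
  moreover have "rvec m~=0" using norm_rvec_ge_1[OF m] by auto
  ultimately have "norm (cF v m t-cF u m t)<=0" by (simp add: mult_le_0_iff)
  then show ?thesis by simp
 qed
 \<comment> \<open>The energy does not see mode 0. The difference of the two zero modes has
   vanishing second derivative, so it is affine; periodicity makes it constant and the zero mean
   makes it 0.\<close>
 have z: "cF v 0 t=cF u 0 t" for t
 proof -
  obtain w where w: "!!t. ((%t. Re (cF v 0 t)) hrd w t) (at t)" "!!t. (w hrd Re (cF vtt 0 t)) (at t)" using weak_tt_coeff(1)[OF vX vtt sg s0_ge(5,4) wtt, of 0] by blast
  define d where "d t=Re (cF v 0 t)-ka * W t" for t
  have d1: "(d hrd w t-ka * W' t) (at t)" for t unfolding d_def[abs_def] by (intro DERIV_diff DERIV_cmult w W)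
  have "((%t. w t-ka * W' t) hrd 0) (at t)" for t using DERIV_diff[OF w(2)[of t] DERIV_cmult[OF W(2)[of t], of ka]] by (simp add: vttc rvec_simps)
  then have wc: "w t-ka * W' t=w 0-ka * W' 0" for t using DERIV_isconst_all[of "%t. w t-ka * W' t" t 0] by simp
  define k where "k=w 0-ka * W' 0"
  have "((%t. d t-k * t) hrd 0) (at t)" for t using DERIV_diff[OF d1[of t] DERIV_cmult[OF DERIV_ident, of k]] wc[of t] by (simp add: k_def)
  then have dl: "d t-k * t=d 0" for t using DERIV_isconst_all[of "%t. d t-k * t" t 0] by simp
  have "d (2 * pi)=d 0" using Xcoeff_per[OF vX sg s0_ge(5), of 0 0] W(3)[of 0] by (simp add: d_def)
  then have "k=0" using dl[of "2 * pi"] by simp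
  then have dconst: "d t=d 0" for t using dl[of t] by simp
  have i: "sil {0..2*pi} f" if "cts f" for f :: "real => real" by (rule sicb[OF that]) auto
  have Wc: "cts W" using W(1) DERIV_isCont by (auto simp: continuous_on_eq_continuous_at)
  have "(JT t. d t)=(JT t. Re (cF v 0 t))-(JT t. ka * W t)" unfolding d_def by (rule set_integral_diff(2)) (intro i continuous_intros Xcoeff_cont[OF vX sg s0_ge(5)] Wc)+
  also have "... = 0" using v(2) W(5) unfolding mean_zero_iff[OF vX sg s0_ge(5)] by simp
  finally have "(JT t. d t)=0" .
  moreover have "(JT t. d t)=(JT t. d 0)" by (rule arg_cong[where f = "set_lebesgue_integral lborel {0..2*pi}"]) (rule ext, rule dconst)
  ultimately have "(JT t. d 0)=0" by simp
  then have "d 0=0" unfolding si_const by simp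
  then have "Re (cF v 0 t)=ka * W t" using dconst[of t] by (simp add: d_def)
  then show ?thesis by (simp add: complex_eq_iff u(2) mode_def vr_def vi_def coeff_fun_0_real)
 qed
 show "v=u"
 proof (rule X_space_eqI[OF vX u(1) sg s0_ge(7)])
  show "cF v m t=cF u m t" for m t by (cases "m=0") (simp_all add: z nz)
 qed
qed

end



section \<open>Assembling the parameter sets\<close>

definition good :: "real => real => real => bool" where
 "good ga ow mu \<longleftrightarrow> (\<exists>u. classical_solution g sg sy ow mu u&mean_zero u &
     X_norm sg sy u<=mu/ga*(1+1 / ow^2) * C0 &
     (\<exists>utt\<in>X_space sg (sy-2). weak_tt u utt&X_norm sg (sy-2) utt<=mu/(ga * ow^2) * C0) &
     (\<forall>v. classical_solution g sg sy ow mu v&mean_zero v&X_norm sg sy v<1-->v=u))"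

text \<open>The cut-off level is tied to \<open>ga\<close> by \<open>ga = et * G\<close>. Then
  \<open>K * ga = fcst b * et\<close>, so a small \<open>et\<close> satisfies the assumption
  \<open>small\<close> for every \<open>ga\<close> at once, and it also makes the factor in the
  uniqueness proof less than 1.\<close>

lemma local_parameters:
 assumes r: "0<r" "r<=R"
 shows "\<exists>et C. 0<et&0<=C&(\<forall>ga. 0<ga-->ga<1-->ga<=et -->
    (\<exists>A. A\<in>sets borel&A\<subseteq>{r..R}\<times>{0<..<ga}&(\<forall>z\<in>A. good ga (fst z) (snd z)) &
      emeasure lborel ({r..R}\<times>{0<..<ga}-A)<=ennreal (C * ga * ga)))"
proof -
 define V where "V=(2 * pi) ^ CARD('d)"
 have V0: "V>=0" by (simp add: V_def)
 obtain b et0 C1 where b: "b>=1" and et0: "et0>0" and C1: "C1>=0" and fam: "!!et G. 0<et==>et<=et0==>0<G==>G<=1/2 ==>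
    (\<exists>A. \<exists>p q :: real\<times>real => real \<Rightarrow>\<^sub>C real. A\<in>sets borel&A\<subseteq>{r..R}\<times>{0<..<et * G} &
       (\<forall>z\<in>A. fixes_pot b G (1/(fst z)^2) (V*(snd z)^3*(1/(fst z)^2)^3) (p z) (q z) &
         (\<forall>i\<in>idx. gap (lamb i) (p z)>=2 * threshold G i)) &
       emeasure lborel ({r..R}\<times>{0<..<et * G}-A)<=ennreal (C1 * G*(et * G)))" using local_family[OF r V0] by blast
 define fc where "fc=fcst b"
 define ke where "ke=(ecst b)^2"
 have fc: "fc>=1" unfolding fc_def by (rule fcst_pos[OF b])
 have ke: "ke>=0" by (simp add: ke_def)
 \<comment> \<open>\<open>et * U\<close> bounds the factor in \<open>solution_unique\<close>:
   \<open>1/G\<close> equals \<open>et / ga\<close>, the quotient \<open>ka / ga\<close> is at most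
   \<open>1/r^2\<close>, and so the norm of \<open>u\<close> is at most
   \<open>C0 / r^2\<close>.\<close>
 define U where "U=V*(2 * ke*32*((C0/r^2)^2+1))/r^2"
 have U: "U>=0" unfolding U_def using V0 ke by simp
 define et where "et=min et0 (min (1/(1024 * b * fc)) (1/(U+1)))"
 have bf: "1024 * b * fc>0" using b fc by simp
 have et: "0<et" "et<=et0" "et<=1/(1024 * b * fc)" "et<=1/(U+1)" using et0 bf U by (auto simp: et_def)
 have etb: "1024 * b * fc * et<=1"
 proof -
  have "1024 * b * fc * et<=1024 * b * fc*(1/(1024 * b * fc))" using bf by (intro mult_left_mono et) simp
  also have "... = 1" using b fc by simp
  finally show ?thesis .
 qed
 have etU: "et * U<1"
 proof -
  have "et*(U+1)<=1" using mult_right_mono[OF et(4), of "U+1"] U by simp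
  then show ?thesis using et(1) by (simp add: distrib_left)
 qed
 have "\<exists>A. A\<in>sets borel&A\<subseteq>{r..R}\<times>{0<..<ga}&(\<forall>z\<in>A. good ga (fst z) (snd z)) &
      emeasure lborel ({r..R}\<times>{0<..<ga}-A)<=ennreal (C1/et * ga * ga)" if ga: "0<ga" "ga<1" "ga<=et/2" for ga
 proof -
  define G where "G=ga/et"
  have G: "0<G" "G<=1/2" using ga et(1) by (simp_all add: G_def field_simps)
  have etG: "et * G=ga" using et(1) by (simp add: G_def)
  obtain A and p q :: "real\<times>real => real \<Rightarrow>\<^sub>C real" where A: "A\<in>sets borel" "A\<subseteq>{r..R}\<times>{0<..<ga}"
   and pq: "!!z. z\<in>A==>fixes_pot b G (1/(fst z)^2) (V*(snd z)^3*(1/(fst z)^2)^3) (p z) (q z)"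
    "!!z i. z\<in>A==>i\<in>idx==>gap (lamb i) (p z)>=2 * threshold G i"
   and em: "emeasure lborel ({r..R}\<times>{0<..<ga}-A)<=ennreal (C1 * G * ga)" using fam[OF et(1,2) G] unfolding etG by blast
  have "good ga (fst z) (snd z)" if z: "z\<in>A" for z
  proof -
   define ow where "ow=fst z"
   define mu where "mu=snd z"
   define ka where "ka=mu / ow^2"
   have w: "r <= ow" "ow<=R" "0<mu" "mu<ga" using A(2) z by (auto simp: ow_def mu_def)
   have ow: "ow>0" using w r by simp
   have sm: "1024 * b*(fcst b/G) * ga<=1" using etb ga(1) by (simp add: G_def fc_def[symmetric])
   note ctx = b G ow w(3) ga(1,2) pq(1)[OF z, unfolded V_def, folded ow_def mu_def] pq(2)[OF z] ka_def refl sm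
   obtain u utt where u: "classical_solution g sg sy ow mu u" "mean_zero u" "X_norm sg sy u<=ka/ga * C0"
    "utt\<in>X_space sg (sy-2)" "weak_tt u utt" "X_norm sg (sy-2) utt<=ka/ga * C0"
    "!!m t. cF u m t=mode G ka (p z) m t" "!!t. p z t=(1+mu * dirichlet_energy u t) / ow^2" by (rule solution_exists[OF ctx], assumption) (rule that; assumption)
   have uX: "u\<in>X_space sg sy" using u(1) by (simp add: classical_solution_def)
   have r2: "r^2 <= ow^2" "0<r^2" using w(1) r by (auto intro: power_mono)
   have kg: "ka/ga<=1/r^2"
   proof -
    have "ka/ga=(mu/ga)*(1 / ow^2)" by (simp add: ka_def)
    also have "... <= 1*(1/r^2)" using w(3,4) ga(1) r2 by (intro mult_mono) (auto simp: frac_le)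
    finally show ?thesis by simp
   qed
   have Xu: "(X_norm sg sy u)^2<=(C0/r^2)^2"
   proof (rule power_mono)
    have "X_norm sg sy u<=1/r^2 * C0" using mult_right_mono[OF kg, of C0] C0_pos u(3) by simp
    then show "X_norm sg sy u<=C0/r^2" by simp
    show "0<=X_norm sg sy u" unfolding X_norm_def by (intro real_sqrt_ge_zero infsum_nonneg mult_nonneg_nonneg weight_nonneg) auto
   qed
   have small2: "ka*(2 * pi) ^ CARD('d)*(2*((ecst b)^2/G)*32*((X_norm sg sy u)^2+1))<1"
   proof -
    have "ka*(2 * pi) ^ CARD('d)*(2*((ecst b)^2/G)*32*((X_norm sg sy u)^2+1))
          = et*((ka/ga)*(V*(2 * ke*32*((X_norm sg sy u)^2+1))))" unfolding V_def[symmetric] ke_def[symmetric] G_def using et(1) ga(1) by simp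
    also have "... <= et*((1/r^2)*(V*(2 * ke*32*((C0/r^2)^2+1))))" by (rule mult_left_mono[OF mult_mono[OF kg mult_left_mono[OF mult_left_mono[OF add_right_mono[OF Xu]]]]])
       (use V0 ke r2 et(1) in auto)
    also have "... = et * U" by (simp add: U_def)
    finally show ?thesis using etU by simp
   qed
   have uniq: "v=u" if "classical_solution g sg sy ow mu v" "mean_zero v" "X_norm sg sy v<1" for v by (rule solution_unique[OF ctx uX u(7,8) that small2])
   have k1: "ka/ga * C0<=mu/ga*(1+1 / ow^2) * C0"
   proof (rule mult_right_mono)
    have "ka/ga=mu/ga*(1 / ow^2)" by (simp add: ka_def)
    also have "... <= mu/ga*(1+1 / ow^2)" using w(3) ga(1) by (intro mult_left_mono) auto
    finally show "ka/ga<=mu/ga*(1+1 / ow^2)" .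
   qed (use C0_pos in simp)
   have k2: "ka/ga=mu/(ga * ow^2)" by (simp add: ka_def mult.commute)
   show ?thesis unfolding good_def ow_def[symmetric] mu_def[symmetric] by (intro exI[of _ u] conjI bexI[of _ utt] allI impI u(1,2,4,5) order_trans[OF u(3) k1] u(6)[unfolded k2]) (use uniq in blast)
  qed
  moreover have "C1 * G * ga=C1/et * ga * ga" by (simp add: G_def)
  ultimately show ?thesis using A em by auto
 qed
 moreover have "0<et/2" "0<=C1/et" using et(1) C1 by simp_all
 ultimately show ?thesis by blast
qed

lemma rectangle_measure:
 fixes a b c d :: real
 assumes "a<=b" "c<=d"
 shows "emeasure lborel ({a<..<b}\<times>{c<..<d})=ennreal ((b-a)*(d-c))"
proof -
 have "emeasure lborel ({a<..<b}\<times>{c<..<d})=emeasure lborel {a<..<b} * emeasure lborel {c<..<d}" unfolding lborel_prod[symmetric] by (rule lborel.emeasure_pair_measure_Times) auto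
 then show ?thesis using assms by (simp add: ennreal_mult)
qed

text \<open>The windows \<open>{1/(k+1)..k+1}\<close> exhaust the positive frequencies, and the sets
  found in them are united. A window whose threshold \<open>et k\<close> lies below
  \<open>ga\<close> contributes the empty set.\<close>

theorem parameter_sets:
 "\<exists>A :: real => (real\<times>real) set.
    (\<forall>ga\<in>{0<..<1}. A ga\<in>sets lebesgue&A ga\<subseteq>{0<..}\<times>{0<..<ga}&(\<forall>z\<in>A ga. good ga (fst z) (snd z))) &
    (\<forall>ow\<^sub>1 ow\<^sub>2. 0 < ow\<^sub>1 & ow\<^sub>1 < ow\<^sub>2-->(\<exists>C'. \<forall>ga\<in>{0<..<1}.
       measure lebesgue (({ow\<^sub>1<..<ow\<^sub>2}\<times>{0<..<ga})\<inter>A ga)/measure lebesgue ({ow\<^sub>1<..<ow\<^sub>2}\<times>{0<..<ga})>1-C' * ga))"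
proof -
 define r where "r k=1/(real k+1)" for k
 have r: "0<r k" "r k<=real k+1" for k
 proof -
  show "0<r k" by (simp add: r_def)
  have "1/(real k+1)<=1/1" by (intro divide_left_mono) auto
  then have "r k<=1" by (simp add: r_def)
  then show "r k<=real k+1" by linarith
 qed
 define P where "P k C ga A \<longleftrightarrow> A\<in>sets borel&A\<subseteq>{r k..real k+1}\<times>{0<..<ga}&(\<forall>z\<in>A. good ga (fst z) (snd z)) &
      emeasure lborel ({r k..real k+1}\<times>{0<..<ga}-A)<=ennreal (C * ga * ga)" for k C ga A
 have "\<exists>et C. 0<et&0<=C&(\<forall>ga. 0<ga-->ga<1-->ga<=et-->(\<exists>A. P k C ga A))" for k using local_parameters[OF r, of k] unfolding P_def .
 then obtain et C where etC: "!!k. 0<et k" "!!k. 0<=C k" "!!k ga. 0<ga==>ga<1==>ga<=et k ==> \<exists>A. P k (C k) ga A" by metis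
 define B where "B k ga=(if 0<ga&ga<1&ga<=et k then SOME A. P k (C k) ga A else {})" for k ga
 have BP: "P k (C k) ga (B k ga)" if "0<ga" "ga<1" "ga<=et k" for k ga using someI_ex[OF etC(3)[OF that]] that by (simp add: B_def)
 have B: "B k ga\<in>sets borel" "B k ga\<subseteq>{r k..real k+1}\<times>{0<..<ga}" "z\<in>B k ga==>good ga (fst z) (snd z)" for k ga z
 proof -
  have "P k (C k) ga (B k ga) \<or> B k ga={}"
  proof (cases "0<ga&ga<1&ga<=et k")
   case False
   then show ?thesis by (simp only: B_def if_False simp_thms)
  qed (use BP in blast)
  then consider "P k (C k) ga (B k ga)" | "B k ga={}" by blast
  then show "B k ga\<in>sets borel" "B k ga\<subseteq>{r k..real k+1}\<times>{0<..<ga}" "z\<in>B k ga==>good ga (fst z) (snd z)" by (cases; auto simp: P_def)+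
 qed
 define A where "A ga=(\<Union>k. B k ga)" for ga
 have Ab: "A ga\<in>sets borel" for ga unfolding A_def using B(1) by auto
 have m_eq: "measure lebesgue X=measure lborel X" if "X\<in>sets borel" for X :: "(real\<times>real) set" using that by (simp add: measure_completion)
 show ?thesis
 proof (intro exI[of _ A] conjI ballI allI impI)
  fix ga :: real
  show "A ga\<in>sets lebesgue" using Ab[of ga] by (simp add: sets_completionI_sets)
  show "A ga\<subseteq>{0<..}\<times>{0<..<ga}"
  proof
   fix z assume "z\<in>A ga"
   then obtain k where "z\<in>B k ga" by (auto simp: A_def)
   then have "z\<in>{r k..real k+1}\<times>{0<..<ga}" using B(2) by blast
   then show "z\<in>{0<..}\<times>{0<..<ga}" using r(1)[of k] by (auto intro: less_le_trans)
  qed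
  show "good ga (fst z) (snd z)" if "z\<in>A ga" for z using that B(3) by (auto simp: A_def)
 next
  fix w1 w2 :: real
  assume w: "0<w1&w1<w2"
  obtain k1 :: nat where k1: "1/w1<real k1" using reals_Archimedean2 by blast
  obtain k2 :: nat where k2: "w2<real k2" using reals_Archimedean2 by blast
  define k where "k=max k1 k2"
  have kw: "r k<=w1" "w2<=real k+1"
  proof -
   have "1/w1<real k+1" using k1 by (simp add: k_def)
   then have "1<w1*(real k+1)" using w by (simp add: pos_divide_less_eq mult.commute)
   then show "r k<=w1" by (simp add: r_def pos_divide_le_eq mult.commute)
   show "w2<=real k+1" using k2 by (simp add: k_def)
  qed
  \<comment> \<open>The first summand is the measure estimate in the window, \<open>1 / et k\<close>
    makes the right-hand side negative when \<open>ga\<close> exceeds the threshold, and the final 1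
    makes the inequality strict.\<close>
  define C' where "C'=C k/(w2-w1)+1/et k+1"
  have C'0: "C k/(w2-w1)>=0" "1/et k>0" using w etC by simp_all
  show "\<exists>C'. \<forall>ga\<in>{0<..<1}. measure lebesgue (({w1<..<w2}\<times>{0<..<ga})\<inter>A ga)/measure lebesgue ({w1<..<w2}\<times>{0<..<ga})>1-C' * ga"
  proof (intro exI[of _ C'] ballI)
   fix ga :: real
   assume "ga\<in>{0<..<1}"
   then have ga: "0<ga" "ga<1" by auto
   let ?R = "{w1<..<w2}\<times>{0<..<ga}"
   show "measure lebesgue (?R\<inter>A ga)/measure lebesgue ?R>1-C' * ga"
   proof (cases "ga<=et k")
    case False
    have "1/et k * ga>1" using False etC(1)[of k] by simp
    moreover have "C' * ga=C k/(w2-w1) * ga+1/et k * ga+ga" by (simp add: C'_def distrib_right)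
    moreover have "C k/(w2-w1) * ga>=0" by (rule mult_nonneg_nonneg[OF C'0(1)]) (use ga in simp)
    ultimately have "1-C' * ga<0" using ga(1) by linarith
    also have "0<=measure lebesgue (?R\<inter>A ga)/measure lebesgue ?R" by simp
    finally show ?thesis .
   next
    case True
    have Pk: "P k (C k) ga (B k ga)" by (rule BP[OF ga True])
    have Rb: "?R\<in>sets borel" by (intro borel_open open_Times) auto
    have eR: "emeasure lborel ?R=ennreal ((w2-w1) * ga)" using rectangle_measure[of w1 w2 0 ga] w ga by simp
    have mR: "measure lborel ?R=(w2-w1) * ga" using w ga by (simp add: measure_def eR)
    have pos: "(w2-w1) * ga>0" using w ga by simp
    have sub: "?R-A ga\<subseteq>{r k..real k+1}\<times>{0<..<ga}-B k ga" using kw by (auto simp: A_def)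
    have mb: "{r k..real k+1}\<times>{0<..<ga}-B k ga\<in>sets lborel"
    proof -
     have "{r k..real k+1}\<times>{0<..<ga}\<in>sets borel" unfolding borel_prod[symmetric] by (intro pair_measureI) auto
     then show ?thesis using B(1)[of k ga] by (simp add: sets.Diff)
    qed
    have "emeasure lborel (?R-A ga)<=ennreal (C k * ga * ga)" by (rule order_trans[OF emeasure_mono[OF sub mb]]) (use Pk in \<open>simp add: P_def\<close>)
    then have le: "measure lborel (?R-A ga)<=C k * ga * ga" unfolding measure_def using etC(2)[of k] ga by (intro enn2real_leI) auto
    have "measure lborel (?R-A ga)=measure lborel ?R-measure lborel (?R\<inter>A ga)"
    proof -
     have "?R-A ga = ?R-(?R\<inter>A ga)" by auto
     moreover have "measure lborel (?R-(?R\<inter>A ga))=measure lborel ?R-measure lborel (?R\<inter>A ga)" by (rule measure_Diff) (use Rb Ab[of ga] eR in auto)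
     ultimately show ?thesis by (simp only:)
    qed
    then have "measure lborel (?R\<inter>A ga)>=(w2-w1) * ga-C k * ga * ga" using le mR by simp
    then have "((w2-w1) * ga-C k * ga * ga)/((w2-w1) * ga)<=measure lborel (?R\<inter>A ga)/((w2-w1) * ga)" using pos by (intro divide_right_mono) auto
    moreover have "((w2-w1) * ga-C k * ga * ga)/((w2-w1) * ga)=1-C k/(w2-w1) * ga" using w ga by (simp add: diff_divide_distrib)
    moreover have "C k/(w2-w1) * ga<C' * ga" unfolding C'_def using C'0 ga by (intro mult_strict_right_mono) linarith+
    moreover have "measure lebesgue (?R\<inter>A ga)=measure lborel (?R\<inter>A ga)" "measure lebesgue ?R=(w2-w1) * ga" using m_eq[of "?R\<inter>A ga"] m_eq[OF Rb] Rb Ab[of ga] mR by auto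
    ultimately show ?thesis by simp
   qed
  qed
 qed
qed

end

lemma continuous_periodic_bounded:
 fixes W :: "real => real"
 assumes "cts W" "!!t. W (t+2 * pi)=W t"
 obtains B where "!!t. abs(W t)<=B"
proof -
 have "bounded (W ` {0..2*pi})" by (rule compact_imp_bounded, rule compact_continuous_image[OF continuous_on_subset[OF assms(1) subset_UNIV] compact_Icc])
 then obtain B where B: "!!y. y\<in>W ` {0..2*pi}==>norm y<=B" unfolding bounded_iff by auto
 have "abs(W t)<=B" for t
 proof -
  obtain s where s: "s\<in>{0..<2*pi}" "W t=W s" using periodic_reduce[of W W t] assms(2) by blast
  then have "W s\<in>W ` {0..2*pi}" by auto
  then show ?thesis using B s(2) by simp
 qed
 then show ?thesis by (rule that)
qed

theorem theorem2:
  fixes g :: "real^'d \<Rightarrow> real \<Rightarrow> real" and \<sigma> s\<^sub>0 s\<^sub>1 :: real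
  assumes "\<sigma> \<ge> 0" and "s\<^sub>0 > 2 * real CARD('d)"
    and "g \<in> X_space \<sigma> s\<^sub>0" and "mean_zero g"
    and "1 + real CARD('d) < s\<^sub>1" and "s\<^sub>1 < 1 + s\<^sub>0 / 2"
  shows "\<exists>\<delta> C :: real. \<delta> > 0 \<and> C > 0 \<and>
    (\<exists>A :: real \<Rightarrow> (real \<times> real) set.
      (\<forall>\<gamma>\<in>{0<..<1}.
         A \<gamma> \<in> sets lebesgue \<and> A \<gamma> \<subseteq> {0<..} \<times> {0<..<\<delta> * \<gamma>} \<and>
         (\<forall>(\<omega>, \<mu>) \<in> A \<gamma>. \<exists>u :: real^'d \<Rightarrow> real \<Rightarrow> real.
            classical_solution g \<sigma> s\<^sub>1 \<omega> \<mu> u \<and> mean_zero u \<and>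
            X_norm \<sigma> s\<^sub>1 u \<le> \<mu> / \<gamma> * (1 + 1 / \<omega>\<^sup>2) * C \<and>
            (\<exists>utt \<in> X_space \<sigma> (s\<^sub>1 - 2). weak_tt u utt \<and>
               X_norm \<sigma> (s\<^sub>1 - 2) utt \<le> \<mu> / (\<gamma> * \<omega>\<^sup>2) * C) \<and>
            (\<forall>v. classical_solution g \<sigma> s\<^sub>1 \<omega> \<mu> v \<and> mean_zero v \<and> X_norm \<sigma> s\<^sub>1 v < 1
                 \<longrightarrow> v = u))) \<and>
      (\<forall>\<omega>\<^sub>1 \<omega>\<^sub>2 :: real. 0 < \<omega>\<^sub>1 \<and> \<omega>\<^sub>1 < \<omega>\<^sub>2 \<longrightarrow>
         (\<exists>C' :: real. \<forall>\<gamma>\<in>{0<..<1}.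
            measure lebesgue (({\<omega>\<^sub>1<..<\<omega>\<^sub>2} \<times> {0<..<\<delta> * \<gamma>}) \<inter> A \<gamma>)
              / measure lebesgue ({\<omega>\<^sub>1<..<\<omega>\<^sub>2} \<times> {0<..<\<delta> * \<gamma>}) > 1 - C' * \<gamma>)))"
proof -
 have "(1::nat)<=CARD('d)" using zero_less_card_finite[where 'a = 'd] by linarith
 then have card: "1<=real CARD('d)" by simp
 \<comment> \<open>The conditions on the two smoothness indices place the dimension below each of
   the three upper bounds for the exponent; their minimum is taken as \<open>ta\<close>. The last
   bound uses that the dimension is at least 1.\<close>
 have arith: "d<min (s\<^sub>0+1-s\<^sub>1) (min (2 * s\<^sub>0/3) (2 * s\<^sub>1-3))&s\<^sub>0>=0" if "1<=d" "2 * d<s\<^sub>0" "1+d<s\<^sub>1" "s\<^sub>1<1+s\<^sub>0/2" for d using that by (simp add: min_def)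
 note \<tau> = arith[OF card assms(2,5,6)]
 define y where "y t=Re (cF g 0 t)" for t
 have s0: "s\<^sub>0>=0" using \<tau> by simp
 have yc: "cts y" unfolding y_def[abs_def] by (intro continuous_intros Xcoeff_cont[OF assms(3,1) s0])
 have yp: "y (t+2 * pi)=y t" for t by (simp add: y_def Xcoeff_per[OF assms(3,1) s0])
 have yz: "(JT t. y t)=0" using assms(4) unfolding mean_zero_iff[OF assms(3,1) s0] y_def .
 obtain W W' where W: "!!t. (W hrd W' t) (at t)" "!!t. (W' hrd y t) (at t)"
  "!!t. W (t+2 * pi)=W t" "!!t. W' (t+2 * pi)=W' t" "(JT t. W t)=0" "cts W" "cts W'" by (rule periodic_second_antiderivative[OF yc yp yz]) blast
 obtain N1 where N1: "!!t. abs(W t)<=N1" by (rule continuous_periodic_bounded[OF W(6,3)]) blast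
 obtain N2 where N2: "!!t. abs(W' t)<=N2" by (rule continuous_periodic_bounded[OF W(7,4)]) blast
 interpret kirchhoff g \<sigma> s\<^sub>0 s\<^sub>1 "min (s\<^sub>0+1-s\<^sub>1) (min (2 * s\<^sub>0/3) (2 * s\<^sub>1-3))" "max N1 N2" W W'
 proof
  show "abs(W t)<=max N1 N2" "abs(W' t)<=max N1 N2" for t using N1[of t] N2[of t] by auto
 qed (use assms \<tau> W in \<open>auto simp: y_def min_def\<close>)
 obtain A :: "real => (real\<times>real) set" where A:
  "\<forall>\<gamma>\<in>{0<..<1}. A \<gamma>\<in>sets lebesgue&A \<gamma>\<subseteq>{0<..}\<times>{0<..<\<gamma>}&(\<forall>z\<in>A \<gamma>. good \<gamma> (fst z) (snd z))"
  "\<forall>\<omega>\<^sub>1 \<omega>\<^sub>2. 0 < \<omega>\<^sub>1 & \<omega>\<^sub>1 < \<omega>\<^sub>2-->(\<exists>C'. \<forall>\<gamma>\<in>{0<..<1}.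
       measure lebesgue (({\<omega>\<^sub>1<..<\<omega>\<^sub>2}\<times>{0<..<\<gamma>})\<inter>A \<gamma>)/measure lebesgue ({\<omega>\<^sub>1<..<\<omega>\<^sub>2}\<times>{0<..<\<gamma>})>1-C' * \<gamma>)" using parameter_sets by blast
 show ?thesis
 \<comment> \<open>\<open>delta\<close> is 1: the smallness that depends on the frequency is already
   built into the sets \<open>A\<close>.\<close>
 proof (rule exI[of _ 1], rule exI[of _ C0], unfold mult_1_left, intro conjI exI[of _ A] A(2))
  show "0<C0" by (rule C0_pos)
  show "\<forall>\<gamma>\<in>{0<..<1}. A \<gamma>\<in>sets lebesgue&A \<gamma>\<subseteq>{0<..}\<times>{0<..<\<gamma>}&(\<forall>(\<omega>, \<mu>)\<in>A \<gamma>. \<exists>u.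
            classical_solution g \<sigma> s\<^sub>1 \<omega> \<mu> u&mean_zero u &
            X_norm \<sigma> s\<^sub>1 u <= \<mu> / \<gamma> * (1+1 / \<omega>^2) * C0 &
            (\<exists>utt\<in>X_space \<sigma> (s\<^sub>1-2). weak_tt u utt&X_norm \<sigma> (s\<^sub>1-2) utt <= \<mu> / (\<gamma> * \<omega>^2) * C0) &
            (\<forall>v. classical_solution g \<sigma> s\<^sub>1 \<omega> \<mu> v&mean_zero v&X_norm \<sigma> s\<^sub>1 v<1-->v=u))" using A(1) unfolding good_def case_prod_unfold .
 qed simp
qed


end
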